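(* Let $(M,\mathcal{V},P,\mathcal{F})$ be a flat Poisson foliation with $\mathcal{V}$ orientable, and let $\Pi$ be a strongly compatible $\mathcal{V}$-coupling Poisson structure on it. If $\Pi$ is unimodular, then $$\operatorname{Mod}(\mathcal{F})=0\qquad\text{and}\qquad\operatorname{Mod}(M,\mathcal{V},P)=0.\tag{$*$}$$ Conversely, if $$\partial_{\mathcal{F}}(\operatorname{Casim}(M,P))=\partial_{\mathcal{F}}(C^{\infty}(M))\cap\mathcal{C}^{1},$$ then the unimodularity of $(M,\Pi)$ is equivalent to $( * )$.
   Context: Everything is smooth. For a Poisson bivector field $\Pi$ on $M$, $\Pi^\sharp:T^*M\to TM$ is given by $\langle\beta,\Pi^\sharp\alpha\rangle=\Pi(\alpha,\beta)$. $\operatorname{Poiss}(M,\Pi)=\{X: L_X\Pi=0\}$, $\operatorname{Ham}(M,\Pi)=\{\Pi^\sharp df: f\in C^\infty(M)\}$, $H^1_\Pi(M)=\operatorname{Poiss}(M,\Pi)/\operatorname{Ham}(M,\Pi)$, $\operatorname{Casim}(M,\Pi)=\{f\in C^\infty(M):\Pi^\sharp df=0\}$. For a volume form $\Omega$ on $M$, the modular vector field $Z_\Pi^\Omega$ is defined by $Z_\Pi^\Omega(f)=\operatorname{div}^\Omega(\Pi^\sharp df)$; its class $\operatorname{Mod}(M,\Pi)=[Z_\Pi^\Omega]\in H^1_\Pi(M)$ does not depend on $\Omega$; $\Pi$ is unimodular if $\operatorname{Mod}(M,\Pi)=0$. For a regular foliation $\mathcal{V}$: $\mathbb{V}=T\mathcal{V}$,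 $\mathbb{V}^0\subset T^*M$ its annihilator, $d_{\mathcal V}$ the foliated exterior derivative on $\Gamma(\wedge^\bullet\mathbb{V}^* )$, $\mathfrak{X}_{\mathrm{pr}}(M,\mathcal{V})=\{X\in\mathfrak{X}(M):[X,\Gamma(\mathbb{V})]\subset\Gamma(\mathbb{V})\}$. $\mathcal{V}$ is orientable if there is a nowhere vanishing $\tau\in\Gamma(\wedge^{\operatorname{top}}\mathbb{V}^* )$ (a leaf-wise volume form). Flat Poisson foliation $(M,\mathcal{V},P,\mathcal{F})$: $\mathcal{V}$ is a regular foliation, $P\in\Gamma(\wedge^2\mathbb{V})$ a Poisson bivector, and $\mathcal{F}$ a regular foliation with $\mathbb{F}=T\mathcal{F}$ such that $TM=\mathbb{F}\oplus\mathbb{V}$ and $L_ZP=0$ for every $Z\in\Gamma(\mathbb{F})\cap\mathfrak{X}_{\mathrm{pr}}(M,\mathcal{V})$. $\gamma_0:TM\to\mathbb{V}$ is the projection along $\mathbb{F}$. With forms bigraded by $\wedge^p\mathbb{V}^0\otimes\wedge^q\mathbb{F}^0$, $\partial_{\mathcal{F}}$ is the bidegree $(1,0)$ component of $d$ (so $d=\partial_{\mathcal{F}}+\partial_{\mathcal{V}}$). $\mathcal{C}^p=\{\beta\in\Gamma(\wedge^p\mathbb{V}^0):\mathbf{i}_{X_1}\cdots\mathbf{i}_{X_p}\beta\in\operatorname{Casim}(M,P)\ \forall X_i\in\mathfrak{X}_{\mathrm{pr}}(M,\mathcal{V})\}$. A Poisson bivector $\Pi$ on $M$ is $\mathcal{V}$-coupling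 if $\mathbb{H}:=\Pi^\sharp(\mathbb{V}^0)$ satisfies $TM=\mathbb{H}\oplus\mathbb{V}$; then $\Pi=\Pi_{2,0}+\Pi_{0,2}$ with $\Pi_{2,0}\in\Gamma(\wedge^2\mathbb{H})$, $\Pi_{0,2}\in\Gamma(\wedge^2\mathbb{V})$, and $\gamma:TM\to\mathbb{V}$ denotes the projection along $\mathbb{H}$. (If $\mathcal{V}$ is orientable then so is $M$, since $\mathbb{H}$ carries a nondegenerate 2-form.) A $\mathcal{V}$-coupling $\Pi$ is compatible with $(M,\mathcal{V},P,\mathcal{F})$ if $\Pi_{0,2}=P$ and $\gamma_0(X)-\gamma(X)$ takes values in $P^\sharp(T^*M)$ for all $X\in\Gamma(TM)$. It is strongly compatible if $\Pi_{0,2}=P$ and there is $\mu\in\Gamma(\mathbb{V}^0)$ with $\gamma_0(X)-\gamma(X)=P^\sharp d[\mu(X)]$ for all $X\in\mathfrak{X}_{\mathrm{pr}}(M,\mathcal{V})$. Foliated modular class: for a leaf-wise volume form $\tau$, $Z_P^\tau\in\Gamma(\mathbb{V})$ is defined by $\mathbf{i}_{Z_P^\tau}\tau=-d_{\mathcal V}\mathbf{i}_P\tau$, where $\mathbf{i}_{X_1\wedge\dots\wedge X_k}=\mathbf{i}_{X_1}\circ\dots\circ\mathbf{i}_{X_k}$, and $\operatorname{Mod}(M,\mathcal{V},P):=[Z_P^\tau]\in(\Gamma(\mathbb{V})\cap\operatorname{Poiss}(M,P))/\operatorname{Ham}(M,P)$, independent of $\tau$. Reeb class of $\mathcal{F}$: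 $\mathcal{F}$ is transversally orientable (because $\mathcal{V}$ is orientable), i.e. there is a nowhere vanishing $\varsigma\in\Gamma(\wedge^{\operatorname{top}}\mathbb{F}^0)$, where $\mathbb{F}^0\subset T^*M$ is the annihilator of $\mathbb{F}$. Define $\lambda_\varsigma\in\Gamma(\mathbb{F}^* )$ by $L_X\varsigma=\lambda_\varsigma(X)\varsigma$ for $X\in\Gamma(\mathbb{F})$; it is closed for the foliated differential of $\mathcal{F}$ and $\operatorname{Mod}(\mathcal{F}):=[\lambda_\varsigma]\in H^1_{\operatorname{dR}}(\mathcal{F})$ (foliated de Rham cohomology) is independent of $\varsigma$.
   Formalization: The conditions on projectable fields (flatness, strong compatibility, C^1) are imposed on those over every open subset of M, not only global ones; with global fields only, the first claim fails on the mapping torus of a hyperbolic element of SL(2,Z). *)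

theory Defs
  imports "HOL-Analysis.Analysis" "HOL-Library.Function_Algebras"
begin

text \<open>
  Pointwise real vector space structure on function types. It is used for functions, tangent
  vectors (which are functionals on functions), vector fields and one-forms.
\<close>

instantiation "fun" :: (type, real_vector) real_vector
begin
definition scaleR_fun :: "real \<Rightarrow> ('a \<Rightarrow> 'b) \<Rightarrow> 'a \<Rightarrow> 'b"
  where "scaleR_fun c f = (\<lambda>x. c *\<^sub>R f x)"
instance
  by standard (simp_all add: scaleR_fun_def fun_eq_iff scaleR_add_right scaleR_add_left)
end


section \<open>Smooth manifolds\<close>

text \<open>\<open>S\<close> is meant to be an open set.\<close>

primrec Ck_on :: "nat \<Rightarrow> 'e::real_normed_vector set \<Rightarrow> ('e \<Rightarrow> 'f::real_normed_vector) \<Rightarrow> bool" where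
  "Ck_on 0 S f \<longleftrightarrow> continuous_on S f"
| "Ck_on (Suc k) S f \<longleftrightarrow>
     (\<forall>x\<in>S. f differentiable (at x)) \<and> (\<forall>v. Ck_on k S (\<lambda>x. frechet_derivative f (at x) v))"

definition smooth_on :: "'e::real_normed_vector set \<Rightarrow> ('e \<Rightarrow> 'f::real_normed_vector) \<Rightarrow> bool"
  where "smooth_on S f \<longleftrightarrow> (\<forall>k. Ck_on k S f)"

type_synonym ('m, 'e) chart = "'m set \<times> ('m \<Rightarrow> 'e)"

definition is_chart :: "('m::topological_space, 'e::euclidean_space) chart \<Rightarrow> bool" where
  "is_chart c \<longleftrightarrow> (case c of (U, \<phi>) \<Rightarrow>
     open U \<and> open (\<phi> ` U) \<and> homeomorphism U (\<phi> ` U) \<phi> (inv_into U \<phi>))"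

definition smooth_transition ::
    "('m::topological_space, 'e::euclidean_space) chart \<Rightarrow> ('m, 'e) chart \<Rightarrow> bool" where
  "smooth_transition c d \<longleftrightarrow> (case c of (U, \<phi>) \<Rightarrow> case d of (V, \<psi>) \<Rightarrow>
     smooth_on (\<phi> ` (U \<inter> V)) (\<psi> \<circ> inv_into U \<phi>))"

text \<open>
  The underlying set of the manifold \<open>M\<close> is the whole type \<open>'m\<close>; the Hausdorff and
  second countability axioms are type class constraints on \<open>'m\<close>. The dimension is \<open>DIM('e)\<close>.
\<close>

definition smooth_atlas :: "('m::topological_space, 'e::euclidean_space) chart set \<Rightarrow> bool" where
  "smooth_atlas A \<longleftrightarrow>
     (\<forall>c\<in>A. is_chart c) \<and> (\<forall>c\<in>A. \<forall>d\<in>A. smooth_transition c d) \<and> (\<Union>c\<in>A. fst c) = UNIV"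

definition maximal_atlas ::
    "('m::topological_space, 'e::euclidean_space) chart set \<Rightarrow> ('m, 'e) chart set" where
  "maximal_atlas A =
     {c. is_chart c \<and> (\<forall>d\<in>A. smooth_transition c d \<and> smooth_transition d c)}"

definition Cinf ::
    "('m::topological_space, 'e::euclidean_space) chart set \<Rightarrow> 'm set \<Rightarrow> ('m \<Rightarrow> real) set" where
  "Cinf A U = {f. \<forall>(D, \<phi>)\<in>A. smooth_on (\<phi> ` (D \<inter> U)) (f \<circ> inv_into D \<phi>)}"

definition smooth_at ::
    "('m::topological_space, 'e::euclidean_space) chart set \<Rightarrow> 'm \<Rightarrow> ('m \<Rightarrow> real) \<Rightarrow> bool" where
  "smooth_at A p f \<longleftrightarrow> (\<exists>U. open U \<and> p \<in> U \<and> f \<in> Cinf A U)"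

text \<open>
  A tangent vector at \<open>p\<close> is a derivation at \<open>p\<close> of the functions that are smooth near \<open>p\<close>
  (by the Leibniz rule it only depends on germs). On all other functions it is set to \<open>0\<close>, so that
  equality of tangent vectors is equality of functions.
\<close>

type_synonym 'm tangent = "('m \<Rightarrow> real) \<Rightarrow> real"
type_synonym 'm vfield = "'m \<Rightarrow> 'm tangent"
type_synonym 'm covector = "'m tangent \<Rightarrow> real"
type_synonym 'm oneform = "'m \<Rightarrow> 'm covector"
type_synonym 'm kform = "'m \<Rightarrow> 'm tangent list \<Rightarrow> real"
type_synonym 'm bivector = "'m \<Rightarrow> 'm covector \<Rightarrow> 'm covector \<Rightarrow> real"
type_synonym 'm distribution = "'m \<Rightarrow> 'm tangent set"

definition tangent_space ::
    "('m::topological_space, 'e::euclidean_space) chart set \<Rightarrow> 'm distribution" where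
  "tangent_space A p = {v.
     (\<forall>f. \<not> smooth_at A p f \<longrightarrow> v f = 0) \<and>
     (\<forall>f g. smooth_at A p f \<longrightarrow> smooth_at A p g \<longrightarrow>
        v (\<lambda>q. f q + g q) = v f + v g \<and>
        v (\<lambda>q. f q * g q) = f p * v g + g p * v f) \<and>
     (\<forall>c f. smooth_at A p f \<longrightarrow> v (\<lambda>q. c * f q) = c * v f)}"

definition linear_functional_on :: "'v::real_vector set \<Rightarrow> ('v \<Rightarrow> real) \<Rightarrow> bool" where
  "linear_functional_on S \<alpha> \<longleftrightarrow>
     (\<forall>u\<in>S. \<forall>v\<in>S. \<forall>a b. \<alpha> (a *\<^sub>R u + b *\<^sub>R v) = a * \<alpha> u + b * \<alpha> v)"

definition cotangent_space ::
    "('m::topological_space, 'e::euclidean_space) chart set \<Rightarrow> 'm \<Rightarrow> 'm covector set" where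
  "cotangent_space A p = {\<alpha>. linear_functional_on (tangent_space A p) \<alpha>}"

text \<open>The differential of \<open>f\<close>, at any point near which \<open>f\<close> is smooth.\<close>

definition differential :: "('m \<Rightarrow> real) \<Rightarrow> 'm covector" where
  "differential f = (\<lambda>v. v f)"

definition vector_fields ::
    "('m::topological_space, 'e::euclidean_space) chart set \<Rightarrow> 'm set \<Rightarrow> 'm vfield set" where
  "vector_fields A U = {X. (\<forall>p\<in>U. X p \<in> tangent_space A p) \<and>
     (\<forall>W f. open W \<longrightarrow> W \<subseteq> U \<longrightarrow> f \<in> Cinf A W \<longrightarrow> (\<lambda>p. X p f) \<in> Cinf A W)}"

text \<open>Smooth sections over the open set \<open>U\<close> of a distribution \<open>D\<close>.\<close>

definition sections ::
    "('m::topological_space, 'e::euclidean_space) chart set \<Rightarrow> 'm set \<Rightarrow> 'm distribution \<Rightarrow>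
      'm vfield set" where
  "sections A U D = {X \<in> vector_fields A U. \<forall>p\<in>U. X p \<in> D p}"

text \<open>The case distinction keeps \<open>[X, Y]\<^sub>p\<close> in the tangent space (zero on non-smooth functions).\<close>

definition lie_bracket ::
    "('m::topological_space, 'e::euclidean_space) chart set \<Rightarrow> 'm vfield \<Rightarrow> 'm vfield \<Rightarrow> 'm vfield"
  where
  "lie_bracket A X Y = (\<lambda>p f. if smooth_at A p f
     then X p (\<lambda>q. Y q f) - Y p (\<lambda>q. X q f) else 0)"


section \<open>Differential forms\<close>

text \<open>
  A \<open>k\<close>-form takes a list of \<open>k\<close> tangent vectors. The forms below are sections of
  \<open>\<Lambda>\<^sup>k D\<^sup>*\<close> for a distribution \<open>D\<close>; ordinary forms are the case \<open>D = TM\<close>.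
\<close>

definition alternating_on :: "'v::real_vector set \<Rightarrow> nat \<Rightarrow> ('v list \<Rightarrow> real) \<Rightarrow> bool" where
  "alternating_on S k w \<longleftrightarrow> (\<forall>xs. length xs = k \<longrightarrow> set xs \<subseteq> S \<longrightarrow>
     (\<forall>i<k. \<forall>u\<in>S. \<forall>v\<in>S. \<forall>a b.
        w (xs[i := a *\<^sub>R u + b *\<^sub>R v]) = a * w (xs[i := u]) + b * w (xs[i := v])) \<and>
     (\<forall>i<k. \<forall>j<k. i \<noteq> j \<longrightarrow> xs ! i = xs ! j \<longrightarrow> w xs = 0))"

definition at_point :: "'m vfield list \<Rightarrow> 'm \<Rightarrow> 'm tangent list" where
  "at_point Xs p = map (\<lambda>X. X p) Xs"

definition kforms ::
    "('m::topological_space, 'e::euclidean_space) chart set \<Rightarrow> 'm distribution \<Rightarrow> nat \<Rightarrow>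
      'm kform set" where
  "kforms A D k = {\<omega>. (\<forall>p. alternating_on (D p) k (\<omega> p)) \<and>
     (\<forall>W Xs. open W \<longrightarrow> length Xs = k \<longrightarrow> set Xs \<subseteq> sections A W D \<longrightarrow>
        (\<lambda>p. \<omega> p (at_point Xs p)) \<in> Cinf A W)}"

definition nowhere_vanishing :: "'m distribution \<Rightarrow> nat \<Rightarrow> 'm kform \<Rightarrow> bool" where
  "nowhere_vanishing D k \<omega> \<longleftrightarrow> (\<forall>p. \<exists>vs. length vs = k \<and> set vs \<subseteq> D p \<and> \<omega> p vs \<noteq> 0)"

text \<open>
  One-forms on a distribution are extended by \<open>0\<close> outside of the distribution, so that equality of
  one-forms is equality of functions.
\<close>

definition oneforms ::
    "('m::topological_space, 'e::euclidean_space) chart set \<Rightarrow> 'm distribution \<Rightarrow>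
      'm oneform set" where
  "oneforms A D = {\<eta>.
     (\<forall>p. linear_functional_on (D p) (\<eta> p) \<and> (\<forall>v. v \<notin> D p \<longrightarrow> \<eta> p v = 0)) \<and>
     (\<forall>W X. open W \<longrightarrow> X \<in> sections A W D \<longrightarrow> (\<lambda>p. \<eta> p (X p)) \<in> Cinf A W)}"

text \<open>The sections of the annihilator of \<open>D\<close> in the cotangent bundle.\<close>

definition annihilating_oneforms ::
    "('m::topological_space, 'e::euclidean_space) chart set \<Rightarrow> 'm distribution \<Rightarrow>
      'm oneform set" where
  "annihilating_oneforms A D = {\<eta> \<in> oneforms A (tangent_space A). \<forall>p. \<forall>v\<in>D p. \<eta> p v = 0}"

text \<open>\<open>(L\<^sub>X \<omega>)(Y\<^sub>1, \<dots>, Y\<^sub>k) = X(\<omega>(Y\<^sub>1, \<dots>, Y\<^sub>k)) - \<Sum>\<^sub>i \<omega>(Y\<^sub>1, \<dots>, [X, Y\<^sub>i], \<dots>, Y\<^sub>k)\<close>\<close>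

definition lie_form ::
    "('m::topological_space, 'e::euclidean_space) chart set \<Rightarrow> 'm vfield \<Rightarrow> 'm kform \<Rightarrow>
      'm vfield list \<Rightarrow> 'm \<Rightarrow> real" where
  "lie_form A X \<omega> Ys p =
     X p (\<lambda>q. \<omega> q (at_point Ys q)) -
     (\<Sum>i<length Ys. \<omega> p ((at_point Ys p)[i := lie_bracket A X (Ys ! i) p]))"

definition remove_nth :: "nat \<Rightarrow> 'a list \<Rightarrow> 'a list" where
  "remove_nth i xs = take i xs @ drop (Suc i) xs"

text \<open>
  The exterior derivative, evaluated by the Koszul formula on vector fields \<open>X\<^sub>0, \<dots>, X\<^sub>k\<close>.
  For sections of \<open>\<Lambda>\<^sup>k \<V>\<^sup>*\<close> and vector fields tangent to the foliation
  it is the foliated exterior derivative. It is \<open>0\<close> on the empty list, as it should be for forms of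
  negative degree.
\<close>

definition ext_deriv ::
    "('m::topological_space, 'e::euclidean_space) chart set \<Rightarrow> 'm kform \<Rightarrow>
      'm vfield list \<Rightarrow> 'm \<Rightarrow> real" where
  "ext_deriv A \<omega> Xs p =
     (\<Sum>i<length Xs. (-1) ^ i * (Xs ! i) p (\<lambda>q. \<omega> q (at_point (remove_nth i Xs) q))) +
     (\<Sum>j<length Xs. \<Sum>i<j. (-1) ^ (i + j) *
        \<omega> p (lie_bracket A (Xs ! i) (Xs ! j) p # at_point (remove_nth i (remove_nth j Xs)) p))"


section \<open>Bivector fields\<close>

text \<open>
  \<open>wedge2 A p S\<close> is \<open>\<Lambda>\<^sup>2 S\<close> for a subspace \<open>S\<close> of the tangent space at \<open>p\<close>: sums of
  \<open>v \<and> w\<close> with \<open>v, w \<in> S\<close>, where \<open>(v \<and> w)(\<alpha>, \<beta>) = \<alpha>(v) \<beta>(w) - \<alpha>(w) \<beta>(v)\<close>.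
\<close>

definition wedge_sum ::
    "('m tangent \<times> 'm tangent) list \<Rightarrow> 'm covector \<Rightarrow> 'm covector \<Rightarrow> real" where
  "wedge_sum ps \<alpha> \<beta> = (\<Sum>(v, w)\<leftarrow>ps. \<alpha> v * \<beta> w - \<alpha> w * \<beta> v)"

definition decomposes ::
    "('m::topological_space, 'e::euclidean_space) chart set \<Rightarrow> 'm \<Rightarrow> 'm tangent set \<Rightarrow>
      ('m covector \<Rightarrow> 'm covector \<Rightarrow> real) \<Rightarrow> ('m tangent \<times> 'm tangent) list \<Rightarrow> bool" where
  "decomposes A p S B ps \<longleftrightarrow> set ps \<subseteq> S \<times> S \<and>
     (\<forall>\<alpha>\<in>cotangent_space A p. \<forall>\<beta>\<in>cotangent_space A p. B \<alpha> \<beta> = wedge_sum ps \<alpha> \<beta>)"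

definition wedge2 ::
    "('m::topological_space, 'e::euclidean_space) chart set \<Rightarrow> 'm \<Rightarrow> 'm tangent set \<Rightarrow>
      ('m covector \<Rightarrow> 'm covector \<Rightarrow> real) set" where
  "wedge2 A p S = {B. \<exists>ps. decomposes A p S B ps}"

definition pbracket :: "'m bivector \<Rightarrow> ('m \<Rightarrow> real) \<Rightarrow> ('m \<Rightarrow> real) \<Rightarrow> 'm \<Rightarrow> real" where
  "pbracket B f g = (\<lambda>p. B p (differential f) (differential g))"

definition bivector_fields ::
    "('m::topological_space, 'e::euclidean_space) chart set \<Rightarrow> 'm distribution \<Rightarrow>
      'm bivector set" where
  "bivector_fields A D = {B. (\<forall>p. B p \<in> wedge2 A p (D p)) \<and>
     (\<forall>W f g. open W \<longrightarrow> f \<in> Cinf A W \<longrightarrow> g \<in> Cinf A W \<longrightarrow> pbracket B f g \<in> Cinf A W)}"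

definition poisson_bivector ::
    "('m::topological_space, 'e::euclidean_space) chart set \<Rightarrow> 'm bivector \<Rightarrow> bool" where
  "poisson_bivector A B \<longleftrightarrow> B \<in> bivector_fields A (tangent_space A) \<and>
     (\<forall>W f g h. open W \<longrightarrow> f \<in> Cinf A W \<longrightarrow> g \<in> Cinf A W \<longrightarrow> h \<in> Cinf A W \<longrightarrow>
        (\<forall>p\<in>W. pbracket B f (pbracket B g h) p + pbracket B g (pbracket B h f) p +
               pbracket B h (pbracket B f g) p = 0))"

text \<open>
  \<open>\<langle>\<beta>, B\<^sup>\<sharp>\<alpha>\<rangle> = B(\<alpha>, \<beta>)\<close>; as tangent vectors are derivations, it is enough to say this for
  \<open>\<beta> = df\<close>.
\<close>

definition sharp ::
    "('m::topological_space, 'e::euclidean_space) chart set \<Rightarrow> 'm bivector \<Rightarrow>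
      'm \<Rightarrow> 'm covector \<Rightarrow> 'm tangent" where
  "sharp A B p \<alpha> = (\<lambda>f. if smooth_at A p f then B p \<alpha> (differential f) else 0)"

definition ham_field ::
    "('m::topological_space, 'e::euclidean_space) chart set \<Rightarrow> 'm bivector \<Rightarrow> ('m \<Rightarrow> real) \<Rightarrow>
      'm vfield" where
  "ham_field A B f = (\<lambda>p. sharp A B p (differential f))"

text \<open>\<open>(L\<^sub>X B)(df, dg)\<close>, by the Leibniz rule and \<open>L\<^sub>X df = d(X f)\<close>.\<close>

definition lie_bivector ::
    "'m vfield \<Rightarrow> 'm bivector \<Rightarrow> ('m \<Rightarrow> real) \<Rightarrow> ('m \<Rightarrow> real) \<Rightarrow> 'm \<Rightarrow> real" where
  "lie_bivector X B f g p = X p (pbracket B f g)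
     - pbracket B (\<lambda>q. X q f) g p - pbracket B f (\<lambda>q. X q g) p"

definition preserves_bivector ::
    "('m::topological_space, 'e::euclidean_space) chart set \<Rightarrow> 'm set \<Rightarrow> 'm vfield \<Rightarrow>
      'm bivector \<Rightarrow> bool" where
  "preserves_bivector A U X B \<longleftrightarrow> (\<forall>W f g. open W \<longrightarrow> W \<subseteq> U \<longrightarrow>
     f \<in> Cinf A W \<longrightarrow> g \<in> Cinf A W \<longrightarrow> (\<forall>p\<in>W. lie_bivector X B f g p = 0))"

definition poisson_fields ::
    "('m::topological_space, 'e::euclidean_space) chart set \<Rightarrow> 'm bivector \<Rightarrow> 'm vfield set" where
  "poisson_fields A B = {X \<in> vector_fields A UNIV. preserves_bivector A UNIV X B}"

definition hamiltonian_fields ::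
    "('m::topological_space, 'e::euclidean_space) chart set \<Rightarrow> 'm bivector \<Rightarrow> 'm vfield set" where
  "hamiltonian_fields A B = ham_field A B ` Cinf A UNIV"

definition casimirs ::
    "('m::topological_space, 'e::euclidean_space) chart set \<Rightarrow> 'm set \<Rightarrow> 'm bivector \<Rightarrow>
      ('m \<Rightarrow> real) set" where
  "casimirs A U B = {f \<in> Cinf A U. \<forall>p\<in>U. ham_field A B f p = 0}"

text \<open>The class of \<open>x\<close> in the quotient of \<open>Z\<close> by its subspace \<open>B\<close>.\<close>

definition quot_class :: "'v::real_vector set \<Rightarrow> 'v set \<Rightarrow> 'v \<Rightarrow> 'v set" where
  "quot_class Z B x = {y \<in> Z. y - x \<in> B}"


section \<open>The modular class of a Poisson manifold\<close>

definition volume_form ::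
    "('m::topological_space, 'e::euclidean_space) chart set \<Rightarrow> 'm kform \<Rightarrow> bool" where
  "volume_form A \<Omega> \<longleftrightarrow> \<Omega> \<in> kforms A (tangent_space A) DIM('e) \<and>
     nowhere_vanishing (tangent_space A) DIM('e) \<Omega>"

text \<open>\<open>L\<^sub>X \<Omega> = div(X) \<Omega>\<close> at \<open>p\<close>; \<open>X\<close> only needs to be smooth near \<open>p\<close>.\<close>

definition divergence ::
    "('m::topological_space, 'e::euclidean_space) chart set \<Rightarrow> 'm kform \<Rightarrow> 'm vfield \<Rightarrow>
      'm \<Rightarrow> real" where
  "divergence A \<Omega> X p = (THE c. \<forall>U Ys. open U \<longrightarrow> p \<in> U \<longrightarrow>
     length Ys = DIM('e) \<longrightarrow> set Ys \<subseteq> vector_fields A U \<longrightarrow>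
     lie_form A X \<Omega> Ys p = c * \<Omega> p (at_point Ys p))"

definition modular_field ::
    "('m::topological_space, 'e::euclidean_space) chart set \<Rightarrow> 'm bivector \<Rightarrow> 'm kform \<Rightarrow>
      'm vfield" where
  "modular_field A B \<Omega> = (\<lambda>p f. if smooth_at A p f
     then divergence A \<Omega> (ham_field A B f) p else 0)"

definition poisson_class ::
    "('m::topological_space, 'e::euclidean_space) chart set \<Rightarrow> 'm bivector \<Rightarrow> 'm vfield \<Rightarrow>
      'm vfield set" where
  "poisson_class A B = quot_class (poisson_fields A B) (hamiltonian_fields A B)"

text \<open>The class does not depend on the choice of the volume form.\<close>

definition modular_class ::
    "('m::topological_space, 'e::euclidean_space) chart set \<Rightarrow> 'm bivector \<Rightarrow> 'm vfield set" where
  "modular_class A B = poisson_class A B (modular_field A B (SOME \<Omega>. volume_form A \<Omega>))"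

definition unimodular ::
    "('m::topological_space, 'e::euclidean_space) chart set \<Rightarrow> 'm bivector \<Rightarrow> bool" where
  "unimodular A B \<longleftrightarrow> modular_class A B = poisson_class A B 0"


section \<open>Foliations\<close>

text \<open>The differential of a chart map \<open>\<phi>\<close> of the maximal atlas.\<close>

definition push_forward :: "('m \<Rightarrow> 'e::euclidean_space) \<Rightarrow> 'm tangent \<Rightarrow> 'e" where
  "push_forward \<phi> v = (\<Sum>b\<in>Basis. v (\<lambda>q. \<phi> q \<bullet> b) *\<^sub>R b)"

text \<open>
  A regular foliation is given by its tangent distribution \<open>D\<close>: it has constant rank, and near every
  point there is a foliated chart, in which the leaves are open pieces of the parallels to a fixed
  linear subspace \<open>E\<close> of the model space.
\<close>

definition regular_foliation ::
    "('m::topological_space, 'e::euclidean_space) chart set \<Rightarrow> 'm distribution \<Rightarrow> bool" where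
  "regular_foliation A D \<longleftrightarrow> (\<exists>r. \<forall>p. dim (D p) = r) \<and>
     (\<forall>p. \<exists>U \<phi> E. (U, \<phi>) \<in> maximal_atlas A \<and> p \<in> U \<and> subspace E \<and>
        (\<forall>q\<in>U. D q = {v \<in> tangent_space A q. push_forward \<phi> v \<in> E}))"

definition fol_rank :: "'m distribution \<Rightarrow> nat" where
  "fol_rank D = (THE r. \<forall>p. dim (D p) = r)"

definition splits_tangent ::
    "('m::topological_space, 'e::euclidean_space) chart set \<Rightarrow> 'm distribution \<Rightarrow>
      'm distribution \<Rightarrow> bool" where
  "splits_tangent A H D \<longleftrightarrow> (\<forall>p. H p \<inter> D p = {0} \<and>
     tangent_space A p = {u + v |u v. u \<in> H p \<and> v \<in> D p})"

text \<open>The projection onto \<open>D\<close> along \<open>H\<close>.\<close>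

definition proj_along ::
    "'m distribution \<Rightarrow> 'm distribution \<Rightarrow> 'm \<Rightarrow> 'm tangent \<Rightarrow> 'm tangent" where
  "proj_along H D p v = (THE w. w \<in> D p \<and> v - w \<in> H p)"

text \<open>
  Projectable vector fields over an open set \<open>U\<close>. Conditions on projectable vector fields are always
  imposed on those defined over arbitrary open sets: a general foliation has very few globally
  defined projectable vector fields, and such conditions are meant to be local.
\<close>

definition projectable_fields ::
    "('m::topological_space, 'e::euclidean_space) chart set \<Rightarrow> 'm set \<Rightarrow> 'm distribution \<Rightarrow>
      'm vfield set" where
  "projectable_fields A U D = {X \<in> vector_fields A U.
     \<forall>Y\<in>sections A U D. lie_bracket A X Y \<in> sections A U D}"

definition leafwise_volume_form ::
    "('m::topological_space, 'e::euclidean_space) chart set \<Rightarrow> 'm distribution \<Rightarrow>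
      'm kform \<Rightarrow> bool" where
  "leafwise_volume_form A D \<tau> \<longleftrightarrow>
     \<tau> \<in> kforms A D (fol_rank D) \<and> nowhere_vanishing D (fol_rank D) \<tau>"

definition orientable_foliation ::
    "('m::topological_space, 'e::euclidean_space) chart set \<Rightarrow> 'm distribution \<Rightarrow> bool" where
  "orientable_foliation A D \<longleftrightarrow> (\<exists>\<tau>. leafwise_volume_form A D \<tau>)"


subsection \<open>Flat Poisson foliations and coupling structures\<close>

definition flat_poisson_foliation ::
    "('m::topological_space, 'e::euclidean_space) chart set \<Rightarrow> 'm distribution \<Rightarrow> 'm bivector \<Rightarrow>
      'm distribution \<Rightarrow> bool" where
  "flat_poisson_foliation A V P F \<longleftrightarrow>
     regular_foliation A V \<and> P \<in> bivector_fields A V \<and> poisson_bivector A P \<and>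
     regular_foliation A F \<and> splits_tangent A F V \<and>
     (\<forall>U. open U \<longrightarrow>
        (\<forall>Z \<in> sections A U F \<inter> projectable_fields A U V. preserves_bivector A U Z P))"

definition horizontal ::
    "('m::topological_space, 'e::euclidean_space) chart set \<Rightarrow> 'm distribution \<Rightarrow> 'm bivector \<Rightarrow>
      'm distribution" where
  "horizontal A V B p = {sharp A B p \<alpha> |\<alpha>. \<alpha> \<in> cotangent_space A p \<and> (\<forall>v\<in>V p. \<alpha> v = 0)}"

definition coupling ::
    "('m::topological_space, 'e::euclidean_space) chart set \<Rightarrow> 'm distribution \<Rightarrow> 'm bivector \<Rightarrow>
      bool" where
  "coupling A V B \<longleftrightarrow> splits_tangent A (horizontal A V B) V"

text \<open>
  \<open>P\<close> is the component \<open>B\<^sub>0\<^sub>,\<^sub>2\<close> in the decomposition of \<open>B\<close> into sections of \<open>\<Lambda>\<^sup>2 H\<close> and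
  \<open>\<Lambda>\<^sup>2 V\<close>, where \<open>H = B\<^sup>\<sharp>(V\<^sup>0)\<close>.
\<close>

definition vertical_part ::
    "('m::topological_space, 'e::euclidean_space) chart set \<Rightarrow> 'm distribution \<Rightarrow> 'm bivector \<Rightarrow>
      'm bivector \<Rightarrow> bool" where
  "vertical_part A V B P \<longleftrightarrow> (\<forall>p. P p \<in> wedge2 A p (V p) \<and>
     (\<lambda>\<alpha> \<beta>. B p \<alpha> \<beta> - P p \<alpha> \<beta>) \<in> wedge2 A p (horizontal A V B p))"

definition strongly_compatible ::
    "('m::topological_space, 'e::euclidean_space) chart set \<Rightarrow> 'm distribution \<Rightarrow> 'm bivector \<Rightarrow>
      'm distribution \<Rightarrow> 'm bivector \<Rightarrow> bool" where
  "strongly_compatible A V P F B \<longleftrightarrow> vertical_part A V B P \<and>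
     (\<exists>\<mu>\<in>annihilating_oneforms A V. \<forall>U. open U \<longrightarrow>
        (\<forall>X\<in>projectable_fields A U V. \<forall>p\<in>U.
           proj_along F V p (X p) - proj_along (horizontal A V B) V p (X p) =
             sharp A P p (differential (\<lambda>q. \<mu> q (X q)))))"

text \<open>
  On functions, \<open>\<partial>\<^sub>F f\<close> is the component of \<open>df\<close> in \<open>V\<^sup>0\<close> with respect to
  \<open>T\<^sup>*M = V\<^sup>0 \<oplus> F\<^sup>0\<close>.
\<close>

definition partial_F ::
    "('m::topological_space, 'e::euclidean_space) chart set \<Rightarrow> 'm distribution \<Rightarrow>
      'm distribution \<Rightarrow> ('m \<Rightarrow> real) \<Rightarrow> 'm oneform" where
  "partial_F A V F f = (\<lambda>p v. if v \<in> tangent_space A p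
     then differential f (v - proj_along F V p v) else 0)"

text \<open>The space \<open>\<C>\<^sup>p\<close> for \<open>p = 1\<close>.\<close>

definition casimir_oneforms ::
    "('m::topological_space, 'e::euclidean_space) chart set \<Rightarrow> 'm distribution \<Rightarrow> 'm bivector \<Rightarrow>
      'm oneform set" where
  "casimir_oneforms A V P = {\<beta> \<in> annihilating_oneforms A V. \<forall>U. open U \<longrightarrow>
     (\<forall>X\<in>projectable_fields A U V. (\<lambda>q. \<beta> q (X q)) \<in> casimirs A U P)}"


subsection \<open>The modular class of a Poisson foliation\<close>

text \<open>
  \<open>\<i>\<^sub>P \<tau>\<close> at \<open>p\<close>, for \<open>P\<^sub>p = \<Sum> v \<and> w\<close> with \<open>v, w\<close> tangent to the foliation:
  \<open>\<i>\<^bsub>v \<and> w\<^esub> \<tau> = \<i>\<^sub>v \<i>\<^sub>w \<tau> = \<tau>(w, v, \<dots>)\<close>. This does not depend on the chosen decomposition.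
\<close>

definition interior_bivector ::
    "('m::topological_space, 'e::euclidean_space) chart set \<Rightarrow> 'm distribution \<Rightarrow> 'm bivector \<Rightarrow>
      'm kform \<Rightarrow> 'm kform" where
  "interior_bivector A D P \<tau> = (\<lambda>p vs.
     \<Sum>(v, w)\<leftarrow>(SOME ps. decomposes A p (D p) (P p) ps). \<tau> p (w # v # vs))"

definition foliated_modular_field ::
    "('m::topological_space, 'e::euclidean_space) chart set \<Rightarrow> 'm distribution \<Rightarrow> 'm bivector \<Rightarrow>
      'm kform \<Rightarrow> 'm vfield" where
  "foliated_modular_field A V P \<tau> = (THE Z. Z \<in> sections A UNIV V \<and>
     (\<forall>U Xs. open U \<longrightarrow> length Xs + 1 = fol_rank V \<longrightarrow> set Xs \<subseteq> sections A U V \<longrightarrow>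
        (\<forall>p\<in>U. \<tau> p (Z p # at_point Xs p) = - ext_deriv A (interior_bivector A V P \<tau>) Xs p)))"

definition foliated_poisson_class ::
    "('m::topological_space, 'e::euclidean_space) chart set \<Rightarrow> 'm distribution \<Rightarrow> 'm bivector \<Rightarrow>
      'm vfield \<Rightarrow> 'm vfield set" where
  "foliated_poisson_class A V P =
     quot_class (sections A UNIV V \<inter> poisson_fields A P) (hamiltonian_fields A P)"

text \<open>The class does not depend on the choice of the leaf-wise volume form.\<close>

definition foliated_modular_class ::
    "('m::topological_space, 'e::euclidean_space) chart set \<Rightarrow> 'm distribution \<Rightarrow> 'm bivector \<Rightarrow>
      'm vfield set" where
  "foliated_modular_class A V P = foliated_poisson_class A V P
     (foliated_modular_field A V P (SOME \<tau>. leafwise_volume_form A V \<tau>))"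


subsection \<open>The Reeb class of a foliation\<close>

definition transverse_volume_form ::
    "('m::topological_space, 'e::euclidean_space) chart set \<Rightarrow> 'm distribution \<Rightarrow>
      'm kform \<Rightarrow> bool" where
  "transverse_volume_form A F \<sigma> \<longleftrightarrow> (let k = DIM('e) - fol_rank F in
     \<sigma> \<in> kforms A (tangent_space A) k \<and>
     (\<forall>p vs. length vs = k \<longrightarrow> set vs \<subseteq> tangent_space A p \<longrightarrow> set vs \<inter> F p \<noteq> {} \<longrightarrow> \<sigma> p vs = 0) \<and>
     nowhere_vanishing (tangent_space A) k \<sigma>)"

definition reeb_form ::
    "('m::topological_space, 'e::euclidean_space) chart set \<Rightarrow> 'm distribution \<Rightarrow>
      'm kform \<Rightarrow> 'm oneform" where
  "reeb_form A F \<sigma> = (THE \<eta>. \<eta> \<in> oneforms A F \<and>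
     (\<forall>U X Ys. open U \<longrightarrow> X \<in> sections A U F \<longrightarrow> length Ys = DIM('e) - fol_rank F \<longrightarrow>
        set Ys \<subseteq> vector_fields A U \<longrightarrow>
        (\<forall>p\<in>U. lie_form A X \<sigma> Ys p = \<eta> p (X p) * \<sigma> p (at_point Ys p))))"

definition closed_foliated_oneforms ::
    "('m::topological_space, 'e::euclidean_space) chart set \<Rightarrow> 'm distribution \<Rightarrow>
      'm oneform set" where
  "closed_foliated_oneforms A F = {\<eta> \<in> oneforms A F.
     \<forall>U. open U \<longrightarrow> (\<forall>X\<in>sections A U F. \<forall>Y\<in>sections A U F. \<forall>p\<in>U.
        ext_deriv A (\<lambda>q vs. \<eta> q (hd vs)) [X, Y] p = 0)}"

definition exact_foliated_oneforms ::
    "('m::topological_space, 'e::euclidean_space) chart set \<Rightarrow> 'm distribution \<Rightarrow>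
      'm oneform set" where
  "exact_foliated_oneforms A F =
     (\<lambda>f p v. if v \<in> F p then differential f v else 0) ` Cinf A UNIV"

definition foliated_deRham_class ::
    "('m::topological_space, 'e::euclidean_space) chart set \<Rightarrow> 'm distribution \<Rightarrow> 'm oneform \<Rightarrow>
      'm oneform set" where
  "foliated_deRham_class A F =
     quot_class (closed_foliated_oneforms A F) (exact_foliated_oneforms A F)"

text \<open>The class does not depend on the choice of the transverse volume form.\<close>

definition reeb_class ::
    "('m::topological_space, 'e::euclidean_space) chart set \<Rightarrow> 'm distribution \<Rightarrow>
      'm oneform set" where
  "reeb_class A F =
     foliated_deRham_class A F (reeb_form A F (SOME \<sigma>. transverse_volume_form A F \<sigma>))"

end

(*
  Write d for the leafwise divergence with respect to tau, x_j for transverse coordinates of V, Z_j for the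
  lift of the j-th coordinate field to F and h_j = Z_j + P# d mu_j for its lift to H. Contracting a volume form
  Omega with the maximal power of Pi that survives transversally leaves a form that vanishes on H and equals
  kappa tau on the leaves. It is rescaled by div(X_f) along X_f = Pi# df, and evaluating this on a leafwise frame gives
    div(X_f) = X_f(ln kappa) + sum_j X_f(x_j) (d(Z_j) + Z_P(mu_j)) + Z_P(f),
  where the d(Z_j) represent the Reeb form. Comparing components along H and V, Z_Pi = Pi# dh holds
  iff d(Z_j) = Z_j(h') and Z_P = - P# dh' for h' = - h - ln kappa: one function h' has to trivialise both classes.
  If they are trivialised by g and -k instead, then d[Z_j, P# df] = Z_j d(P# df) - (P# df) d(Z_j) shows that
  Z_j(g + k) is a Casimir function, so the hypothesis yields a Casimir function c with Z_j(c) = Z_j(g + k),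
  and h' = c - k works.
*)
theory Submission
  imports Defs
begin

section \<open>Smooth functions on Euclidean spaces\<close>

text \<open>The obstacle is the horizontal part of \<open>B\<close>: \<open>H\<close> need not be
  integrable and \<open>B - P\<close> has no explicit components, so a computation in a frame of
  \<open>H\<close> would involve its curvature and the inverse of a transverse 2-form. Contracting
  with the whole of \<open>B\<close> circumvents this. A Hamiltonian field preserves
  \<open>B\<close>, hence every contraction hands the eigenvalue of the Lie derivative down
  unchanged, and counting entries replaces formulas: a form vanishes on a list with more vertical or
  more horizontal vectors than the respective dimension. The exponent is half the codimension
  because this spends every horizontal direction exactly once. The same contraction, normalised to
  equal \<tau> on the leaves, singles out a volume form and so orients the manifold. A second
  difficulty is that projectable fields are mostly local, and that the classes rest on choices and
  definite descriptions. All identities are therefore proved in foliated charts, where the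
  descriptions have unique solutions that glue. Changing a leafwise form by a factor
  \<open>a\<close> shifts potentials by ln |a|.\<close>

lemma Ck_on_cong:
 assumes "open S" "\<And>x. x \<in> S \<Longrightarrow> f x = g x"
 shows "Ck_on k S f \<longleftrightarrow> Ck_on k S g" using assms(2)
proof (induction k arbitrary: f g)
 case 0
 then show ?case by (auto intro!: continuous_on_cong)
next
 case (Suc k)
 have *: "(f has_derivative D) (at x) \<longleftrightarrow> (g has_derivative D) (at x)" if "x \<in> S" for x D
  using has_derivative_transform_within_open[OF _ assms(1) that, of f D UNIV g]
   has_derivative_transform_within_open[OF _ assms(1) that, of g D UNIV f] Suc.prems by auto
 have "frechet_derivative f (at x) = frechet_derivative g (at x)" if "x \<in> S" for x
  unfolding frechet_derivative_def using *[OF that] by simp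
 then have "Ck_on k S (\<lambda>x. frechet_derivative f (at x) v)
   \<longleftrightarrow> Ck_on k S (\<lambda>x. frechet_derivative g (at x) v)" for v
  by (intro Suc.IH) simp
 then show ?case using * by (simp add: differentiable_def)
qed

text \<open>The derivative on an open set is unique, so any convenient formula for it may take the
  place of \<open>frechet_derivative\<close> in the inductions on \<open>k\<close> below.\<close>

lemma Ck_on_SucI:
 assumes "open S" "\<And>x. x \<in> S \<Longrightarrow> (f has_derivative f' x) (at x)"
  "\<And>v. Ck_on k S (\<lambda>x. f' x v)"
 shows "Ck_on (Suc k) S f"
proof -
 have "frechet_derivative f (at x) = f' x" if "x \<in> S" for x
  using frechet_derivative_at[OF assms(2)[OF that]] by simp
 then have "Ck_on k S (\<lambda>x. frechet_derivative f (at x) v)" for v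
  using assms(3) Ck_on_cong[OF assms(1), of "\<lambda>x. frechet_derivative f (at x) v" "\<lambda>x. f' x v"]
  by simp
 then show ?thesis using assms(2) by (auto simp: differentiable_def)
qed

lemma Ck_on_SucD:
 assumes "Ck_on (Suc k) S f"
 shows "x \<in> S \<Longrightarrow> (f has_derivative frechet_derivative f (at x)) (at x)"
  "Ck_on k S (\<lambda>x. frechet_derivative f (at x) v)"
 using assms by (auto simp: frechet_derivative_works)

lemma Ck_on_lower: "Ck_on (Suc k) S f \<Longrightarrow> Ck_on k S f"
proof (induction k arbitrary: f)
 case 0
 then show ?case by (auto intro!: continuous_at_imp_continuous_on differentiable_imp_continuous_within)
qed auto

lemma Ck_on_imp_continuous_on: "Ck_on k S f \<Longrightarrow> continuous_on S f"
 by (induction k) (use Ck_on_lower in \<open>auto simp del: Ck_on.simps(2)\<close>)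

lemma Ck_on_subset: "Ck_on k S f \<Longrightarrow> T \<subseteq> S \<Longrightarrow> Ck_on k T f"
 by (induction k arbitrary: f) (auto intro: continuous_on_subset)

lemma Ck_on_local:
 assumes "open S" "\<And>x. x \<in> S \<Longrightarrow> \<exists>T. open T \<and> x \<in> T \<and> Ck_on k T f"
 shows "Ck_on k S f" using assms(2)
proof (induction k arbitrary: f)
 case 0
 have "isCont f x" if "x \<in> S" for x
  using 0[OF that] continuous_on_eq_continuous_at Ck_on.simps(1) by blast
 then show ?case by (auto intro: continuous_at_imp_continuous_on)
next
 case (Suc k)
 have "Ck_on k S (\<lambda>x. frechet_derivative f (at x) v)" for v
 proof (rule Suc.IH)
  fix x assume "x \<in> S"
  then obtain T where "open T" "x \<in> T" "Ck_on (Suc k) T f" using Suc.prems by blast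
  then show "\<exists>T. open T \<and> x \<in> T \<and> Ck_on k T (\<lambda>x. frechet_derivative f (at x) v)"
   using Ck_on_SucD(2) by blast
 qed
 moreover have "f differentiable at x" if "x \<in> S" for x using Suc.prems[OF that] by auto
 ultimately show ?case by simp
qed

lemma Ck_on_const: "Ck_on k S (\<lambda>x. c)"
 by (induction k arbitrary: c) (auto simp: frechet_derivative_const)

lemma Ck_on_add:
 assumes "open S" "Ck_on k S f" "Ck_on k S g"
 shows "Ck_on k S (\<lambda>x. f x + g x)" using assms(2,3)
proof (induction k arbitrary: f g)
 case 0
 then show ?case by (auto intro!: continuous_on_add)
next
 case (Suc k)
 then show ?case by (intro Ck_on_SucI[OF assms(1) has_derivative_add]) (auto simp: frechet_derivative_works)
qed

lemma Ck_on_sum: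
 assumes "open S" "\<And>i. i \<in> I \<Longrightarrow> Ck_on k S (f i)"
 shows "Ck_on k S (\<lambda>x. \<Sum>i\<in>I. f i x)" using assms(2)
 by (induction I rule: infinite_finite_induct) (auto simp: Ck_on_const intro!: Ck_on_add[OF assms(1)])

lemma Ck_on_mult:
 fixes f g :: "'e::real_normed_vector \<Rightarrow> real"
 assumes "open S" "Ck_on k S f" "Ck_on k S g"
 shows "Ck_on k S (\<lambda>x. f x * g x)" using assms(2,3)
proof (induction k arbitrary: f g)
 case 0
 then show ?case by (auto intro!: continuous_on_mult)
next
 case (Suc k)
 have "Ck_on k S (\<lambda>x. f x * frechet_derivative g (at x) v + frechet_derivative f (at x) v * g x)" for v
  by (intro Ck_on_add assms(1) Suc.IH Ck_on_lower[OF Suc.prems(1)] Ck_on_lower[OF Suc.prems(2)]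
    Ck_on_SucD(2)[OF Suc.prems(1)] Ck_on_SucD(2)[OF Suc.prems(2)])
 from Ck_on_SucI[OF assms(1) has_derivative_mult[OF Ck_on_SucD(1)[OF Suc.prems(1)]
    Ck_on_SucD(1)[OF Suc.prems(2)]] this]
 show ?case by simp
qed

lemma Ck_on_bounded_linear:
 assumes "bounded_linear L" "open S" "Ck_on k S f"
 shows "Ck_on k S (\<lambda>x. L (f x))" using assms(3)
proof (induction k arbitrary: f)
 case 0
 then show ?case using bounded_linear.continuous_on[OF assms(1)] by auto
next
 case (Suc k)
 show ?case by (rule Ck_on_SucI[OF assms(2) bounded_linear.has_derivative[OF assms(1)]])
   (use Suc.prems Ck_on_SucD in \<open>auto intro!: Suc.IH\<close>)
qed

lemma Ck_on_id: "open S \<Longrightarrow> Ck_on k S (\<lambda>x. x)"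
 by (cases k) (auto intro!: Ck_on_SucI has_derivative_ident Ck_on_const simp del: Ck_on.simps(2))

lemma linear_functional_expand:
 fixes L :: "'e::euclidean_space \<Rightarrow> real"
 assumes "linear L"
 shows "L w = (\<Sum>b\<in>Basis. (w \<bullet> b) * L b)"
proof -
 have "L w = L (\<Sum>b\<in>Basis. (w \<bullet> b) *\<^sub>R b)" by (simp add: euclidean_representation)
 then show ?thesis by (simp add: linear_sum[OF assms] linear_cmul[OF assms])
qed

text \<open>The chain rule differentiates \<open>g\<close> in the moving direction
  \<open>?D x v\<close>, whereas \<open>Ck_on\<close> speaks of fixed directions. Expanding that
  direction in \<open>Basis\<close> gives products to which the induction hypothesis
  applies.\<close>

lemma Ck_on_compose:
 fixes f :: "'e::real_normed_vector \<Rightarrow> 'g::euclidean_space" and g :: "'g \<Rightarrow> real"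
 assumes "open S" "open T" "f ` S \<subseteq> T" "Ck_on k S f" "Ck_on k T g"
 shows "Ck_on k S (\<lambda>x. g (f x))" using assms(4,5)
proof (induction k arbitrary: g)
 case 0
 then show ?case using assms(3) by (auto intro: continuous_on_compose2)
next
 case (Suc k)
 let ?D = "\<lambda>x. frechet_derivative f (at x)" and ?E = "\<lambda>y. frechet_derivative g (at y)"
 have E: "(g has_derivative ?E (f x)) (at (f x))" if "x \<in> S" for x
  by (rule Ck_on_SucD(1)[OF Suc.prems(2)]) (use that assms(3) in auto)
 have 1: "((\<lambda>x. g (f x)) has_derivative
   (\<lambda>v. \<Sum>b\<in>Basis. (?D x v \<bullet> b) * ?E (f x) b)) (at x)" if "x \<in> S" for x
 proof -
  have "?E (f x) w = (\<Sum>b\<in>Basis. (w \<bullet> b) * ?E (f x) b)" for w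
   by (rule linear_functional_expand[OF has_derivative_linear[OF E[OF that]]])
  then have "(\<lambda>v. ?E (f x) (?D x v)) = (\<lambda>v. \<Sum>b\<in>Basis. (?D x v \<bullet> b) * ?E (f x) b)"
   by (intro ext)
  then show ?thesis using has_derivative_compose[OF Ck_on_SucD(1)[OF Suc.prems(1) that] E[OF that]] by metis
 qed
 have 2: "Ck_on k S (\<lambda>x. \<Sum>b\<in>Basis. (?D x v \<bullet> b) * ?E (f x) b)" for v
 proof (intro Ck_on_sum Ck_on_mult assms(1))
  fix b :: 'g
  show "Ck_on k S (\<lambda>x. ?D x v \<bullet> b)"
   using Ck_on_bounded_linear[OF bounded_linear_inner_left assms(1) Ck_on_SucD(2)[OF Suc.prems(1)]] .
  show "Ck_on k S (\<lambda>x. ?E (f x) b)"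
   by (rule Suc.IH[OF Ck_on_lower[OF Suc.prems(1)] Ck_on_SucD(2)[OF Suc.prems(2)]])
 qed
 show ?case by (rule Ck_on_SucI[OF assms(1) 1 2])
qed

lemma Ck_on_inverse:
 fixes f :: "'e::real_normed_vector \<Rightarrow> real"
 assumes "open S" "Ck_on k S f" "\<And>x. x \<in> S \<Longrightarrow> f x \<noteq> 0"
 shows "Ck_on k S (\<lambda>x. inverse (f x))" using assms(2)
proof (induction k)
 case 0
 then show ?case using assms(3) by (auto intro!: Limits.continuous_on_inverse)
next
 case (Suc k)
 have "Ck_on k S (\<lambda>x. inverse (f x))" by (rule Suc.IH[OF Ck_on_lower[OF Suc.prems]])
 then have 1: "Ck_on k S (\<lambda>x. (-1) * (inverse (f x) * frechet_derivative f (at x) v * inverse (f x)))" for v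
  by (intro Ck_on_mult assms(1) Ck_on_const Ck_on_SucD(2)[OF Suc.prems])
 have 2: "((\<lambda>x. inverse (f x)) has_derivative
   (\<lambda>v. (-1) * (inverse (f x) * frechet_derivative f (at x) v * inverse (f x)))) (at x)"
  if "x \<in> S" for x
  using Deriv.has_derivative_inverse[OF assms(3)[OF that] Ck_on_SucD(1)[OF Suc.prems that]] by simp
 show ?case by (rule Ck_on_SucI[OF assms(1) 2 1])
qed

text \<open>\<open>ln_minus\<close> makes \<open>ln\<close> on the reals an even function, i.e. the
  logarithm of the absolute value. Coefficients and quotients of volume forms can therefore be put
  under \<open>ln\<close> whatever their sign.\<close>

lemma DERIV_ln_nonzero:
 assumes "x \<noteq> 0"
 shows "DERIV ln x :> inverse (x::real)"
proof (cases "x > 0")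
 case False
 then have "DERIV ln (- x) :> inverse (- x)" using assms by (intro DERIV_ln) simp
 then have "DERIV (\<lambda>x. ln (- x)) x :> inverse (- x) * (- 1)"
  by (intro DERIV_chain2[where f = ln and g = uminus]) (auto intro!: derivative_eq_intros)
 then show ?thesis by (simp add: ln_minus)
qed (rule DERIV_ln)

lemma Ck_on_ln:
 fixes f :: "'e::real_normed_vector \<Rightarrow> real"
 assumes "open S" "Ck_on k S f" "\<And>x. x \<in> S \<Longrightarrow> f x \<noteq> 0"
 shows "Ck_on k S (\<lambda>x. ln (f x))"
proof (cases k)
 case 0
 then show ?thesis using assms by (auto intro!: continuous_on_ln)
next
 case (Suc j)
 note f = assms(2)[unfolded Suc]
 have "((\<lambda>x. ln (f x)) has_derivative (\<lambda>v. frechet_derivative f (at x) v * inverse (f x))) (at x)"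
  if "x \<in> S" for x
  by (rule DERIV_compose_FDERIV[OF DERIV_ln_nonzero[OF assms(3)[OF that]] Ck_on_SucD(1)[OF f that]])
 note 1 = this
 have 2: "Ck_on j S (\<lambda>x. frechet_derivative f (at x) v * inverse (f x))" for v
  by (intro Ck_on_mult assms(1) Ck_on_SucD(2)[OF f] Ck_on_inverse Ck_on_lower[OF f] assms(3))
 show ?thesis unfolding Suc by (rule Ck_on_SucI[OF assms(1) 1 2])
qed

section \<open>Hadamard's lemma with smooth remainder functions\<close>

text \<open>Differentiation under the integral sign brings out one factor \<open>t\<close> each
  time, hence the power \<open>t ^ j\<close> in the statement and its generalisation in the
  induction.\<close>

lemma Ck_on_line_integral:
 fixes g :: "'e::euclidean_space \<Rightarrow> real"
 assumes "Ck_on k (ball x0 r) g"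
 shows "Ck_on k (ball x0 r) (\<lambda>x. integral {0..1} (\<lambda>t. t ^ j * g (x0 + t *\<^sub>R (x - x0))))"
 using assms
proof (induction k arbitrary: g j)
 have seg: "x0 + t *\<^sub>R (x - x0) \<in> ball x0 r" if "x \<in> ball x0 r" "t \<in> {0..1}" for x t
 proof -
  have "norm (t *\<^sub>R (x - x0)) \<le> 1 * norm (x - x0)"
   unfolding norm_scaleR using that by (intro mult_right_mono) auto
  then show ?thesis using that by (simp add: dist_norm norm_minus_commute)
 qed
 have cont: "continuous_on (ball x0 r \<times> cbox 0 1) (\<lambda>(x, t). t ^ j * g (x0 + t *\<^sub>R (x - x0)))"
  if "continuous_on (ball x0 r) g" for g :: "'e \<Rightarrow> real" and j unfolding split_beta using seg
  by (auto intro!: continuous_intros continuous_on_compose2[OF that])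
 {
  case 0
  then show ?case using integral_continuous_on_param[OF cont] by simp
 next
  case (Suc k)
  let ?D = "\<lambda>y. frechet_derivative g (at y)"
  let ?f = "\<lambda>x t. t ^ j * g (x0 + t *\<^sub>R (x - x0))"
  let ?fx = "\<lambda>x t. Blinfun (\<lambda>v. t ^ Suc j * ?D (x0 + t *\<^sub>R (x - x0)) v)"
  have D: "(g has_derivative ?D y) (at y)" if "y \<in> ball x0 r" for y
   using Ck_on_SucD(1)[OF Suc.prems that] .
  have bl: "bounded_linear (\<lambda>v. t ^ Suc j * ?D (x0 + t *\<^sub>R (x - x0)) v)"
   if "x \<in> ball x0 r" "t \<in> {0..1}" for x t
   using has_derivative_bounded_linear[OF D[OF seg[OF that]]] by (intro bounded_linear_const_mult)
  have cg: "continuous_on (ball x0 r) g" using Ck_on_SucD(1)[OF Suc.prems]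
   by (auto intro!: continuous_at_imp_continuous_on has_derivative_continuous)
  have cD: "continuous_on (ball x0 r) (\<lambda>x. ?D x v)" for v
   by (rule Ck_on_imp_continuous_on[OF Ck_on_SucD(2)[OF Suc.prems]])
  have fd: "((\<lambda>x. ?f x t) has_derivative blinfun_apply (?fx x t)) (at x within ball x0 r)"
   if "x \<in> ball x0 r" "t \<in> cbox 0 1" for x t
  proof -
   have "((\<lambda>x. g (x0 + t *\<^sub>R (x - x0))) has_derivative
     (\<lambda>v. ?D (x0 + t *\<^sub>R (x - x0)) (t *\<^sub>R v))) (at x)" using that
    by (intro has_derivative_compose[OF _ D] seg) (auto intro!: derivative_eq_intros)
   then have "((\<lambda>x. ?f x t) has_derivative
     (\<lambda>v. t ^ j * ?D (x0 + t *\<^sub>R (x - x0)) (t *\<^sub>R v))) (at x)"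
    by (intro has_derivative_mult_right)
   moreover have "?D (x0 + t *\<^sub>R (x - x0)) (t *\<^sub>R v) = t * ?D (x0 + t *\<^sub>R (x - x0)) v" for v
    using that linear_cmul[OF has_derivative_linear[OF D[OF seg]]] by simp
   ultimately have "((\<lambda>x. ?f x t) has_derivative
     (\<lambda>v. t ^ Suc j * ?D (x0 + t *\<^sub>R (x - x0)) v)) (at x)" by (simp add: mult_ac)
   then show ?thesis
    using that by (subst bounded_linear_Blinfun_apply[OF bl]) (auto intro: has_derivative_at_withinI)
  qed
  \<comment> \<open>\<open>leibniz_rule\<close> asks for a derivative with values in
    \<open>blinfun\<close> that is jointly continuous in \<open>x\<close> and \<open>t\<close>;
    continuity is tested on basis vectors, where it reduces to that of the partial
    derivatives.\<close>
  have cfx: "continuous_on (ball x0 r \<times> cbox 0 1) (\<lambda>(x, t). ?fx x t)"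
  proof (rule continuous_on_blinfun_componentwise)
   fix b :: 'e
   have "continuous_on (ball x0 r \<times> cbox 0 1)
     (\<lambda>(x, t). t ^ Suc j * ?D (x0 + t *\<^sub>R (x - x0)) b)" by (rule cont[OF cD])
   then show "continuous_on (ball x0 r \<times> cbox 0 1) (\<lambda>z. blinfun_apply (case z of (x, t) \<Rightarrow> ?fx x t) b)"
    by (rule continuous_on_cong[THEN iffD1, rotated 2])
     (auto simp: bounded_linear_Blinfun_apply[OF bl] simp del: power_Suc)
  qed
  have int: "?f x integrable_on cbox 0 1" if "x \<in> ball x0 r" for x
   using that seg by (intro integrable_continuous) (auto intro!: continuous_intros continuous_on_compose2[OF cg])
  have intx: "?fx x integrable_on cbox 0 1" if "x \<in> ball x0 r" for x using that
   by (intro integrable_continuous continuous_on_compose2[OF cfx, where f="\<lambda>t. (x, t)", simplified split_conv])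
    (auto intro!: continuous_intros)
  have "((\<lambda>x. integral (cbox 0 1) (?f x)) has_derivative
    (\<lambda>v. integral (cbox 0 1) (\<lambda>t. t ^ Suc j * ?D (x0 + t *\<^sub>R (x - x0)) v))) (at x)"
   if x: "x \<in> ball x0 r" for x
  proof -
   have "((\<lambda>x. integral (cbox 0 1) (?f x)) has_derivative
     blinfun_apply (integral (cbox 0 1) (?fx x))) (at x)" (is ?d)
    using leibniz_rule[OF fd int cfx x convex_ball] at_within_open[OF x open_ball] by simp
   have "blinfun_apply (integral (cbox 0 1) (?fx x)) v
     = integral (cbox 0 1) (\<lambda>t. t ^ Suc j * ?D (x0 + t *\<^sub>R (x - x0)) v)" for v
   proof -
    have "blinfun_apply (integral (cbox 0 1) (?fx x)) v
      = integral (cbox 0 1) (\<lambda>t. blinfun_apply (?fx x t) v)"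
     using integral_linear[OF intx[OF x] blinfun.bounded_linear_left[of v]] by (simp add: o_def)
    also have "\<dots> = integral (cbox 0 1) (\<lambda>t. t ^ Suc j * ?D (x0 + t *\<^sub>R (x - x0)) v)"
     by (rule integral_cong) (use x in \<open>auto simp: bounded_linear_Blinfun_apply[OF bl] simp del: power_Suc\<close>)
    finally show ?thesis .
   qed
   then have "blinfun_apply (integral (cbox 0 1) (?fx x))
     = (\<lambda>v. integral (cbox 0 1) (\<lambda>t. t ^ Suc j * ?D (x0 + t *\<^sub>R (x - x0)) v))" by blast
   with \<open>?d\<close> show ?thesis by (simp only:)
  qed
  from Ck_on_SucI[OF open_ball this[unfolded cbox_interval] Suc.IH[OF Ck_on_SucD(2)[OF Suc.prems], of "Suc j"]]
  show ?case .
 }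
qed

text \<open>Integrating the derivative of \<open>g\<close> along the segment from \<open>x0\<close>
  to \<open>x\<close> gives the remainder functions. Their smoothness is the point: a derivation can
  then be applied to the products.\<close>

lemma hadamard:
 fixes g :: "'e::euclidean_space \<Rightarrow> real"
 assumes "smooth_on (ball x0 r) g"
 obtains G where "\<And>b. smooth_on (ball x0 r) (G b)"
  "\<And>x. x \<in> ball x0 r \<Longrightarrow> g x = g x0 + (\<Sum>b\<in>Basis. ((x - x0) \<bullet> b) * G b x)"
  "\<And>b. r > 0 \<Longrightarrow> G b x0 = frechet_derivative g (at x0) b"
proof -
 let ?D = "\<lambda>y. frechet_derivative g (at y)"
 let ?G = "\<lambda>b x. integral {0..1} (\<lambda>t. ?D (x0 + t *\<^sub>R (x - x0)) b)"
 have D: "(g has_derivative ?D y) (at y)" if "y \<in> ball x0 r" for y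
  using assms that Ck_on_SucD(1) unfolding smooth_on_def by blast
 have Db: "Ck_on k (ball x0 r) (\<lambda>x. ?D x b)" for k and b :: 'e
  using assms Ck_on_SucD(2) unfolding smooth_on_def by blast
 have "smooth_on (ball x0 r) (?G b)" for b :: 'e
  unfolding smooth_on_def using Ck_on_line_integral[OF Db, where j = 0] by simp
 moreover have "g x = g x0 + (\<Sum>b\<in>Basis. ((x - x0) \<bullet> b) * ?G b x)" if x: "x \<in> ball x0 r" for x :: 'e
 proof -
  have seg: "x0 + t *\<^sub>R (x - x0) \<in> ball x0 r" if "t \<in> {0..1}" for t
  proof -
   have "norm (t *\<^sub>R (x - x0)) \<le> 1 * norm (x - x0)"
    unfolding norm_scaleR using that by (intro mult_right_mono) auto
   then show ?thesis using x by (simp add: dist_norm norm_minus_commute)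
  qed
  have "((\<lambda>t. g (x0 + t *\<^sub>R (x - x0))) has_vector_derivative
    ?D (x0 + t *\<^sub>R (x - x0)) (x - x0)) (at t within {0..1})" if "t \<in> {0..1}" for t
  proof -
   have "((\<lambda>t. g (x0 + t *\<^sub>R (x - x0))) has_derivative
     (\<lambda>s. ?D (x0 + t *\<^sub>R (x - x0)) (s *\<^sub>R (x - x0)))) (at t within {0..1})"
    by (rule has_derivative_compose[where g = g and f = "\<lambda>t. x0 + t *\<^sub>R (x - x0)", OF _ D[OF seg[OF that]]])
     (auto intro!: derivative_eq_intros)
   then show ?thesis unfolding has_vector_derivative_def
    using linear_cmul[OF has_derivative_linear[OF D[OF seg[OF that]]]] by simp
  qed
  then have "((\<lambda>t. ?D (x0 + t *\<^sub>R (x - x0)) (x - x0)) has_integral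
    g (x0 + 1 *\<^sub>R (x - x0)) - g (x0 + 0 *\<^sub>R (x - x0))) {0..1}"
   by (intro fundamental_theorem_of_calculus) auto
  then have "g x - g x0 = integral {0..1} (\<lambda>t. ?D (x0 + t *\<^sub>R (x - x0)) (x - x0))"
   by (simp add: integral_unique)
  also have "\<dots> = integral {0..1} (\<lambda>t. \<Sum>b\<in>Basis. ((x - x0) \<bullet> b) * ?D (x0 + t *\<^sub>R (x - x0)) b)"
   by (rule integral_cong) (rule linear_functional_expand[OF has_derivative_linear[OF D[OF seg]]])
  also have "\<dots> = (\<Sum>b\<in>Basis. integral {0..1} (\<lambda>t. ((x - x0) \<bullet> b) * ?D (x0 + t *\<^sub>R (x - x0)) b))"
  proof (rule integral_sum)
   fix b :: 'e
   have "continuous_on {0..1} (\<lambda>t. ?D (x0 + t *\<^sub>R (x - x0)) b)"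
    using Db[of 0 b] seg by (auto intro!: continuous_intros intro: continuous_on_compose2)
   then show "(\<lambda>t. ((x - x0) \<bullet> b) * ?D (x0 + t *\<^sub>R (x - x0)) b) integrable_on {0..1}"
    by (intro integrable_continuous_real continuous_intros)
  qed simp
  finally show ?thesis by simp
 qed
 moreover have "?G b x0 = ?D x0 b" for b :: 'e by simp
 ultimately show ?thesis by (rule that)
qed

section \<open>A flat smooth function on the line\<close>

text \<open>\<open>flat 1\<close> is the classical exp(-1/t), extended by zero. Polynomials in 1/t
  are included so that the family is closed under differentiation: with s = 1/t the factor P(s)
  turns into s^2 (P(s) - P'(s)), which is \<open>[:0, 0, 1:] * (P - pderiv P)\<close>.\<close>

definition flat :: "real poly \<Rightarrow> real \<Rightarrow> real" where
 "flat P t = (if t \<le> 0 then 0 else poly P (1 / t) * exp (- 1 / t))"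

lemma tendsto_poly_div_exp_0:
 "((\<lambda>s::real. s ^ k * poly P s / exp s) \<longlongrightarrow> 0) at_top"
proof (induction P arbitrary: k)
 case (pCons a P)
 have "((\<lambda>s::real. a * (s ^ k / exp s) + s ^ Suc k * poly P s / exp s) \<longlongrightarrow> a * 0 + 0) at_top"
  by (intro tendsto_intros tendsto_power_div_exp_0 pCons.IH)
 then show ?case by (simp add: field_simps)
qed simp

lemma DERIV_flat: "DERIV (flat P) t :> flat ([:0, 0, 1:] * (P - pderiv P)) t"
proof -
 consider "t < 0" | "t = 0" | "t > 0" by linarith
 then show ?thesis
 proof cases
  case 1
  have "((\<lambda>_. 0) has_field_derivative 0) (at t)" by simp
  then have "DERIV (flat P) t :> 0"
   by (rule has_field_derivative_transform_within_open[of _ _ _ "{..<0}"]) (use 1 in \<open>auto simp: flat_def\<close>)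
  then show ?thesis using 1 by (simp add: flat_def)
 next
  case 2
  \<comment> \<open>Substituting s = 1/h turns the difference quotient into s P(s) / exp s with s
    tending to infinity.\<close>
  have "((\<lambda>h. (flat P (0 + h) - flat P 0) / h) \<longlongrightarrow> 0) (at_right 0)"
  proof -
   have "((\<lambda>h. inverse h * poly P (inverse h) / exp (inverse h)) \<longlongrightarrow> 0) (at_right (0::real))"
    by (rule filterlim_compose[OF tendsto_poly_div_exp_0[of 1 P, simplified] filterlim_inverse_at_top_right])
   moreover have "\<forall>\<^sub>F h in at_right (0::real). inverse h * poly P (inverse h) / exp (inverse h)
     = (flat P (0 + h) - flat P 0) / h"
    by (auto simp: eventually_at_filter flat_def field_simps exp_minus)
   ultimately show ?thesis by (rule Lim_transform_eventually)
  qed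
  moreover have "((\<lambda>h. (flat P (0 + h) - flat P 0) / h) \<longlongrightarrow> 0) (at_left 0)"
  proof -
   have "\<forall>\<^sub>F h in at_left (0::real). 0 = (flat P (0 + h) - flat P 0) / h"
    by (auto simp: eventually_at_filter flat_def)
   then show ?thesis by (rule Lim_transform_eventually[OF tendsto_const])
  qed
  ultimately show ?thesis unfolding 2 DERIV_def by (simp add: flat_def filterlim_split_at)
 next
  case 3
  have "((\<lambda>t. poly P (1 / t) * exp (- 1 / t)) has_field_derivative
    flat ([:0, 0, 1:] * (P - pderiv P)) t) (at t)"
   using 3 by (auto intro!: derivative_eq_intros DERIV_chain2[OF poly_DERIV]
     simp: flat_def field_simps power2_eq_square)
  then show ?thesis
   by (rule has_field_derivative_transform_within_open[of _ _ _ "{0<..}"]) (use 3 in \<open>auto simp: flat_def\<close>)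
 qed
qed

lemma smooth_on_flat: "smooth_on UNIV (flat P)"
proof -
 have "Ck_on k UNIV (flat P)" for k
 proof (induction k arbitrary: P)
  case 0
  then show ?case using DERIV_isCont[OF DERIV_flat] by (auto intro: continuous_at_imp_continuous_on)
 next
  case (Suc k)
  have "(flat P has_derivative (\<lambda>v. flat ([:0, 0, 1:] * (P - pderiv P)) x * v)) (at x)" for x
   using DERIV_flat by (simp add: has_field_derivative_def)
  from Ck_on_SucI[OF open_UNIV this Ck_on_mult[OF open_UNIV Suc.IH Ck_on_const]]
  show ?case .
 qed
 then show ?thesis by (simp add: smooth_on_def)
qed

lemma smooth_on_cong: "open S \<Longrightarrow> (\<And>x. x \<in> S \<Longrightarrow> f x = g x) \<Longrightarrow> smooth_on S f \<longleftrightarrow> smooth_on S g"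
 unfolding smooth_on_def using Ck_on_cong by blast

lemma smooth_on_subset: "smooth_on S f \<Longrightarrow> T \<subseteq> S \<Longrightarrow> smooth_on T f"
 unfolding smooth_on_def using Ck_on_subset by blast

lemma smooth_on_local:
 "open S \<Longrightarrow> (\<And>x. x \<in> S \<Longrightarrow> \<exists>T. open T \<and> x \<in> T \<and> smooth_on T f) \<Longrightarrow> smooth_on S f"
 unfolding smooth_on_def by (intro allI Ck_on_local) auto

lemma smooth_on_const: "smooth_on S (\<lambda>x. c)"
 by (simp add: smooth_on_def Ck_on_const)

lemma smooth_on_id: "open S \<Longrightarrow> smooth_on S (\<lambda>x. x)"
 by (simp add: smooth_on_def Ck_on_id)

lemma smooth_on_add: "open S \<Longrightarrow> smooth_on S f \<Longrightarrow> smooth_on S g \<Longrightarrow> smooth_on S (\<lambda>x. f x + g x)"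
 by (simp add: smooth_on_def Ck_on_add)

lemma smooth_on_mult:
 "open S \<Longrightarrow> smooth_on S f \<Longrightarrow> smooth_on S g \<Longrightarrow> smooth_on S (\<lambda>x. f x * g x)" for f :: "_ \<Rightarrow> real"
 by (simp add: smooth_on_def Ck_on_mult)

lemma smooth_on_inverse:
 "open S \<Longrightarrow> smooth_on S f \<Longrightarrow> (\<And>x. x \<in> S \<Longrightarrow> f x \<noteq> 0) \<Longrightarrow> smooth_on S (\<lambda>x. inverse (f x))" for f :: "_ \<Rightarrow> real"
 by (simp add: smooth_on_def Ck_on_inverse)

lemma smooth_on_ln:
 "open S \<Longrightarrow> smooth_on S f \<Longrightarrow> (\<And>x. x \<in> S \<Longrightarrow> f x \<noteq> 0) \<Longrightarrow> smooth_on S (\<lambda>x. ln (f x))" for f :: "_ \<Rightarrow> real"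
 by (simp add: smooth_on_def Ck_on_ln)

lemma smooth_on_compose:
 fixes f :: "'e::real_normed_vector \<Rightarrow> 'g::euclidean_space" and g :: "'g \<Rightarrow> real"
 shows "open S \<Longrightarrow> open T \<Longrightarrow> f ` S \<subseteq> T \<Longrightarrow> smooth_on S f \<Longrightarrow> smooth_on T g \<Longrightarrow> smooth_on S (\<lambda>x. g (f x))"
 unfolding smooth_on_def using Ck_on_compose[of S T f _ g] by blast

lemma smooth_on_bounded_linear:
 "bounded_linear L \<Longrightarrow> open S \<Longrightarrow> smooth_on S f \<Longrightarrow> smooth_on S (\<lambda>x. L (f x))"
 by (simp add: smooth_on_def Ck_on_bounded_linear)

lemma smooth_on_derivative:
 "smooth_on S f \<Longrightarrow> smooth_on S (\<lambda>x. frechet_derivative f (at x) v)"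
 unfolding smooth_on_def using Ck_on_SucD(2) by blast

lemma smooth_on_has_derivative:
 "smooth_on S f \<Longrightarrow> x \<in> S \<Longrightarrow> (f has_derivative frechet_derivative f (at x)) (at x)"
 unfolding smooth_on_def using Ck_on_SucD(1) by blast

section \<open>Smooth functions, tangent vectors and vector fields on a manifold\<close>

lemma scaleR_fun_apply [simp]: "(c *\<^sub>R f) x = c *\<^sub>R f x"
 by (simp add: scaleR_fun_def)

lemma sum_fun_apply: "(\<Sum>i\<in>I. f i) x = (\<Sum>i\<in>I. f i x)"
 by (induction I rule: infinite_finite_induct) auto

lemma smooth_on_transform:
 "smooth_on S f \<Longrightarrow> open S \<Longrightarrow> (\<And>x. x \<in> S \<Longrightarrow> f x = g x) \<Longrightarrow> smooth_on S g"
 using smooth_on_cong by blast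

abbreviation "coord \<phi> b \<equiv> \<lambda>q. \<phi> q \<bullet> b"

locale manifold =
 fixes A :: "('m::t2_space, 'e::euclidean_space) chart set"
 assumes atlas: "smooth_atlas A"
begin

abbreviation TM :: "'m distribution" where "TM \<equiv> tangent_space A"

abbreviation "\<XX> \<equiv> vector_fields A"

abbreviation "bracket \<equiv> lie_bracket A"

abbreviation "ham \<equiv> ham_field A"

lemma chartD:
 assumes "(U, \<phi>) \<in> maximal_atlas A"
 shows "open U" "inj_on \<phi> U" "\<And>q. q \<in> U \<Longrightarrow> inv_into U \<phi> (\<phi> q) = q"
  "\<And>W. open W \<Longrightarrow> W \<subseteq> U \<Longrightarrow> open (\<phi> ` W)"
  "\<And>B. open B \<Longrightarrow> B \<subseteq> \<phi> ` U \<Longrightarrow> open (inv_into U \<phi> ` B)"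
  "continuous_on U \<phi>"
proof -
 have c: "open U" "open (\<phi> ` U)" and h: "homeomorphism U (\<phi> ` U) \<phi> (inv_into U \<phi>)"
  using assms by (auto simp: maximal_atlas_def is_chart_def)
 show "open U" by fact
 show "continuous_on U \<phi>" using h by (auto simp: homeomorphism_def)
 show *: "\<And>q. q \<in> U \<Longrightarrow> inv_into U \<phi> (\<phi> q) = q" using h by (auto simp: homeomorphism_def)
 then show "inj_on \<phi> U" by (rule inj_on_inverseI)
 show "open (\<phi> ` W)" if "open W" "W \<subseteq> U" for W
  using homeomorphism_imp_open_map[OF h, of W] that c by (simp add: openin_open_eq)
 show "open (inv_into U \<phi> ` B)" if "open B" "B \<subseteq> \<phi> ` U" for B
  using homeomorphism_imp_open_map[OF h[THEN homeomorphism_symD], of B] that c by (simp add: openin_open_eq)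
qed

lemma atlas_subset: "A \<subseteq> maximal_atlas A"
 using atlas unfolding smooth_atlas_def maximal_atlas_def by auto

lemma chart_exists: obtains U \<phi> where "(U, \<phi>) \<in> A" "p \<in> U"
 using atlas unfolding smooth_atlas_def by (metis UNIV_I UN_E prod.collapse)

lemma Cinf_mono: "f \<in> Cinf A W \<Longrightarrow> W' \<subseteq> W \<Longrightarrow> f \<in> Cinf A W'"
 unfolding Cinf_def by (fastforce intro: smooth_on_subset)

lemma chart_transition:
 assumes "(U, \<phi>) \<in> maximal_atlas A" "(D, \<psi>) \<in> A"
 shows "smooth_on (\<phi> ` (U \<inter> D)) (\<lambda>x. \<psi> (inv_into U \<phi> x))"
  "smooth_on (\<psi> ` (D \<inter> U)) (\<lambda>x. \<phi> (inv_into D \<psi> x))"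
 using assms unfolding maximal_atlas_def smooth_transition_def o_def by fastforce+

text \<open>Smoothness is defined through the charts of \<open>A\<close>. Smooth transition maps in
  both directions let any single chart of the maximal atlas, for instance a foliated one, decide
  it.\<close>

lemma Cinf_chart:
 assumes c: "(U, \<phi>) \<in> maximal_atlas A" and W: "open W" "W \<subseteq> U"
 shows "f \<in> Cinf A W \<longleftrightarrow> smooth_on (\<phi> ` W) (\<lambda>x. f (inv_into U \<phi> x))"
proof
 assume f: "f \<in> Cinf A W"
 show "smooth_on (\<phi> ` W) (\<lambda>x. f (inv_into U \<phi> x))"
 proof (rule smooth_on_local)
  show "open (\<phi> ` W)" using chartD(4)[OF c] W by blast
  fix x assume "x \<in> \<phi> ` W"
  then obtain q where q: "q \<in> W" "x = \<phi> q" by auto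
  obtain D \<psi> where d: "(D, \<psi>) \<in> A" "q \<in> D" by (rule chart_exists)
  have d': "(D, \<psi>) \<in> maximal_atlas A" using d atlas_subset by auto
  let ?T = "\<phi> ` (W \<inter> D)"
  have T: "open ?T" using chartD(4)[OF c] chartD(1)[OF d'] W by (metis Int_lower1 dual_order.trans open_Int)
  have t: "smooth_on ?T (\<lambda>x. \<psi> (inv_into U \<phi> x))"
   by (rule smooth_on_subset[OF chart_transition(1)[OF c d(1)]]) (use W(2) in auto)
  have "smooth_on (\<psi> ` (D \<inter> W)) (\<lambda>x. f (inv_into D \<psi> x))"
   using f d(1) unfolding Cinf_def by (auto simp: o_def)
  moreover have "open (\<psi> ` (D \<inter> W))" using chartD(4)[OF d'] chartD(1)[OF d'] W by blast
  moreover have "(\<lambda>x. \<psi> (inv_into U \<phi> x)) ` ?T \<subseteq> \<psi> ` (D \<inter> W)"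
   using W chartD(3)[OF c] by auto
  ultimately have "smooth_on ?T (\<lambda>x. f (inv_into D \<psi> (\<psi> (inv_into U \<phi> x))))"
   using smooth_on_compose[OF T _ _ t] by blast
  moreover have "f (inv_into D \<psi> (\<psi> (inv_into U \<phi> x))) = f (inv_into U \<phi> x)" if "x \<in> ?T" for x
   using that W chartD(3)[OF c] chartD(3)[OF d'] by auto
  ultimately have "smooth_on ?T (\<lambda>x. f (inv_into U \<phi> x))" by (rule smooth_on_transform[OF _ T])
  then show "\<exists>T. open T \<and> x \<in> T \<and> smooth_on T (\<lambda>x. f (inv_into U \<phi> x))"
   using T q d by blast
 qed
next
 assume f: "smooth_on (\<phi> ` W) (\<lambda>x. f (inv_into U \<phi> x))"
 have "smooth_on (\<psi> ` (D \<inter> W)) (\<lambda>x. f (inv_into D \<psi> x))" if d: "(D, \<psi>) \<in> A" for D \<psi>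
 proof -
  have d': "(D, \<psi>) \<in> maximal_atlas A" using d atlas_subset by auto
  let ?T = "\<psi> ` (D \<inter> W)"
  have T: "open ?T" using chartD(4)[OF d'] chartD(1)[OF d'] W by blast
  have t: "smooth_on ?T (\<lambda>x. \<phi> (inv_into D \<psi> x))"
   by (rule smooth_on_subset[OF chart_transition(2)[OF c d]]) (use W(2) in auto)
  have "(\<lambda>x. \<phi> (inv_into D \<psi> x)) ` ?T \<subseteq> \<phi> ` W"
   using chartD(3)[OF d'] by auto
  then have "smooth_on ?T (\<lambda>x. f (inv_into U \<phi> (\<phi> (inv_into D \<psi> x))))"
   using smooth_on_compose[OF T chartD(4)[OF c W] _ t f] by blast
  moreover have "f (inv_into U \<phi> (\<phi> (inv_into D \<psi> x))) = f (inv_into D \<psi> x)" if "x \<in> ?T" for x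
  proof -
   obtain q where "q \<in> D" "q \<in> W" "x = \<psi> q" using \<open>x \<in> ?T\<close> by auto
   then show ?thesis using W(2) chartD(3)[OF c] chartD(3)[OF d'] by auto
  qed
  ultimately show ?thesis by (rule smooth_on_transform[OF _ T])
 qed
 then show "f \<in> Cinf A W" unfolding Cinf_def by (auto simp: o_def)
qed

lemma open_atlas_image:
 assumes "(D, \<psi>) \<in> A" "open W"
 shows "open (\<psi> ` (D \<inter> W))"
 using chartD(4)[of D \<psi>] chartD(1)[of D \<psi>] atlas_subset assms by blast

lemma Cinf_local:
 assumes "open W" "\<And>p. p \<in> W \<Longrightarrow> \<exists>V. open V \<and> p \<in> V \<and> f \<in> Cinf A V"
 shows "f \<in> Cinf A W"
proof -
 have "smooth_on (\<psi> ` (D \<inter> W)) (\<lambda>x. f (inv_into D \<psi> x))" if d: "(D, \<psi>) \<in> A" for D \<psi>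
 proof (rule smooth_on_local[OF open_atlas_image[OF d assms(1)]])
  fix x assume "x \<in> \<psi> ` (D \<inter> W)"
  then obtain q where q: "q \<in> D" "q \<in> W" "x = \<psi> q" by auto
  with assms(2) obtain V where V: "open V" "q \<in> V" "f \<in> Cinf A V" by blast
  then show "\<exists>T. open T \<and> x \<in> T \<and> smooth_on T (\<lambda>x. f (inv_into D \<psi> x))"
   using q d open_atlas_image[OF d V(1)] unfolding Cinf_def o_def by blast
 qed
 then show ?thesis unfolding Cinf_def by (auto simp: o_def)
qed

lemma Cinf_cong:
 assumes "open W" "\<And>p. p \<in> W \<Longrightarrow> f p = g p"
 shows "f \<in> Cinf A W \<longleftrightarrow> g \<in> Cinf A W"
proof -
 have "smooth_on (\<psi> ` (D \<inter> W)) (\<lambda>x. f (inv_into D \<psi> x)) = smooth_on (\<psi> ` (D \<inter> W)) (\<lambda>x. g (inv_into D \<psi> x))"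
  if d: "(D, \<psi>) \<in> A" for D \<psi> using assms(2) chartD(3)[of D \<psi>] atlas_subset d
  by (intro smooth_on_cong[OF open_atlas_image[OF d assms(1)]]) auto
 then show ?thesis unfolding Cinf_def by (auto simp: o_def)
qed

lemma Cinf_const: "(\<lambda>p. c) \<in> Cinf A W"
 unfolding Cinf_def by (auto simp: o_def smooth_on_const)

lemma Cinf_add:
 assumes "open W" "f \<in> Cinf A W" "g \<in> Cinf A W"
 shows "(\<lambda>p. f p + g p) \<in> Cinf A W" using assms smooth_on_add[OF open_atlas_image[OF _ assms(1)]]
 unfolding Cinf_def by (fastforce simp: o_def)

lemma Cinf_mult:
 assumes "open W" "f \<in> Cinf A W" "g \<in> Cinf A W"
 shows "(\<lambda>p. f p * g p) \<in> Cinf A W"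
 using assms smooth_on_mult[OF open_atlas_image[OF _ assms(1)]] unfolding Cinf_def by (fastforce simp: o_def)

lemma Cinf_minus: "open W \<Longrightarrow> f \<in> Cinf A W \<Longrightarrow> (\<lambda>p. - f p) \<in> Cinf A W"
 using Cinf_mult[of W "\<lambda>_. -1" f] by (simp add: Cinf_const)

lemma Cinf_diff: "open W \<Longrightarrow> f \<in> Cinf A W \<Longrightarrow> g \<in> Cinf A W \<Longrightarrow> (\<lambda>p. f p - g p) \<in> Cinf A W"
 using Cinf_add[of W f "\<lambda>p. - g p"] by (simp add: Cinf_minus)

lemma Cinf_sum:
 assumes "open W" "\<And>i. i \<in> I \<Longrightarrow> f i \<in> Cinf A W"
 shows "(\<lambda>p. \<Sum>i\<in>I. f i p) \<in> Cinf A W" using assms(2)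
 by (induction I rule: infinite_finite_induct) (auto simp: Cinf_const intro!: Cinf_add[OF assms(1)])

lemma Cinf_on_image:
 assumes "(D, \<psi>) \<in> A" "\<And>p. p \<in> W \<Longrightarrow> f p \<noteq> (0::real)" "x \<in> \<psi> ` (D \<inter> W)"
 shows "f (inv_into D \<psi> x) \<noteq> 0" using assms chartD(3)[of D \<psi>] atlas_subset by auto

lemma Cinf_inverse:
 assumes "open W" "f \<in> Cinf A W" "\<And>p. p \<in> W \<Longrightarrow> f p \<noteq> 0"
 shows "(\<lambda>p. inverse (f p)) \<in> Cinf A W"
proof -
 have "smooth_on (\<psi> ` (D \<inter> W)) (\<lambda>x. inverse (f (inv_into D \<psi> x)))" if d: "(D, \<psi>) \<in> A" for D \<psi>
  using assms(2) d Cinf_on_image[OF d, of W f] assms(3)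
  by (intro smooth_on_inverse[OF open_atlas_image[OF d assms(1)]]) (auto simp: Cinf_def o_def)
 then show ?thesis unfolding Cinf_def by (auto simp: o_def)
qed

lemma Cinf_divide:
 assumes "open W" "f \<in> Cinf A W" "g \<in> Cinf A W" "\<And>p. p \<in> W \<Longrightarrow> g p \<noteq> 0"
 shows "(\<lambda>p. f p / g p) \<in> Cinf A W"
 using Cinf_mult[OF assms(1,2) Cinf_inverse[OF assms(1,3,4)]] by (simp add: divide_inverse)

lemma Cinf_ln:
 assumes "open W" "f \<in> Cinf A W" "\<And>p. p \<in> W \<Longrightarrow> f p \<noteq> 0"
 shows "(\<lambda>p. ln (f p)) \<in> Cinf A W"
proof -
 have "smooth_on (\<psi> ` (D \<inter> W)) (\<lambda>x. ln (f (inv_into D \<psi> x)))" if d: "(D, \<psi>) \<in> A" for D \<psi>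
  using assms(2) d Cinf_on_image[OF d, of W f] assms(3)
  by (intro smooth_on_ln[OF open_atlas_image[OF d assms(1)]]) (auto simp: Cinf_def o_def)
 then show ?thesis unfolding Cinf_def by (auto simp: o_def)
qed

lemma Cinf_coordinate:
 assumes "(U, \<phi>) \<in> maximal_atlas A"
 shows "(coord \<phi> b) \<in> Cinf A U"
proof -
 have o: "open (\<phi> ` U)" using chartD(1,4)[OF assms] by blast
 have "smooth_on (\<phi> ` U) (\<lambda>x. x \<bullet> b)"
  by (rule smooth_on_bounded_linear[OF bounded_linear_inner_left o smooth_on_id[OF o]])
 then have "smooth_on (\<phi> ` U) (\<lambda>x. \<phi> (inv_into U \<phi> x) \<bullet> b)"
  using chartD(3)[OF assms] by (subst smooth_on_cong[OF o, of _ "\<lambda>x. x \<bullet> b"]) auto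
 then show ?thesis using Cinf_chart[OF assms chartD(1)[OF assms] order.refl] by simp
qed

lemma smooth_atI: "open U \<Longrightarrow> p \<in> U \<Longrightarrow> f \<in> Cinf A U \<Longrightarrow> smooth_at A p f"
 unfolding smooth_at_def by blast

lemma smooth_atE2:
 assumes "smooth_at A p f" "smooth_at A p g" "open V" "p \<in> V"
 obtains U where "open U" "p \<in> U" "U \<subseteq> V" "f \<in> Cinf A U" "g \<in> Cinf A U"
proof -
 obtain W W' where "open W" "p \<in> W" "f \<in> Cinf A W" "open W'" "p \<in> W'" "g \<in> Cinf A W'"
  using assms unfolding smooth_at_def by blast
 then show ?thesis using assms by (intro that[of "W \<inter> W' \<inter> V"]) (auto intro: Cinf_mono)
qed

lemma smooth_atE:
 assumes "smooth_at A p f" "open V" "p \<in> V"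
 obtains U where "open U" "p \<in> U" "U \<subseteq> V" "f \<in> Cinf A U"
proof -
 obtain U where "open U" "p \<in> U" "U \<subseteq> V" "f \<in> Cinf A U" "f \<in> Cinf A U"
  using smooth_atE2[OF assms(1,1) assms(2,3)] .
 then show ?thesis by (intro that)
qed

lemma smooth_at_cong:
 assumes "smooth_at A p f" "open W" "p \<in> W" "\<And>q. q \<in> W \<Longrightarrow> f q = g q"
 shows "smooth_at A p g"
proof -
 obtain U where U: "open U" "p \<in> U" "U \<subseteq> W" "f \<in> Cinf A U"
  using smooth_atE[OF assms(1-3)] .
 then have "g \<in> Cinf A U" using Cinf_cong[of U f g] assms(4) by auto
 then show ?thesis using U by (intro smooth_atI)
qed

lemma smooth_at_const: "smooth_at A p (\<lambda>_. c)"
 by (rule smooth_atI[of UNIV]) (auto simp: Cinf_const)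

lemma smooth_at_binary:
 assumes "smooth_at A p f" "smooth_at A p g"
  "\<And>U. open U \<Longrightarrow> f \<in> Cinf A U \<Longrightarrow> g \<in> Cinf A U \<Longrightarrow> h \<in> Cinf A U"
 shows "smooth_at A p h"
proof -
 obtain U where "open U" "p \<in> U" "U \<subseteq> UNIV" "f \<in> Cinf A U" "g \<in> Cinf A U"
  using smooth_atE2[OF assms(1,2) open_UNIV UNIV_I] .
 then show ?thesis using assms(3) by (intro smooth_atI)
qed

lemma smooth_at_add: "smooth_at A p f \<Longrightarrow> smooth_at A p g \<Longrightarrow> smooth_at A p (\<lambda>q. f q + g q)"
 by (rule smooth_at_binary[of p f g], assumption+) (rule Cinf_add)

lemma smooth_at_mult: "smooth_at A p f \<Longrightarrow> smooth_at A p g \<Longrightarrow> smooth_at A p (\<lambda>q. f q * g q)"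
 by (rule smooth_at_binary[of p f g], assumption+) (rule Cinf_mult)

lemma smooth_at_diff: "smooth_at A p f \<Longrightarrow> smooth_at A p g \<Longrightarrow> smooth_at A p (\<lambda>q. f q - g q)"
 by (rule smooth_at_binary[of p f g], assumption+) (rule Cinf_diff)

lemma smooth_at_sum:
 "(\<And>i. i \<in> I \<Longrightarrow> smooth_at A p (f i)) \<Longrightarrow> smooth_at A p (\<lambda>q. \<Sum>i\<in>I. f i q)"
 by (induction I rule: infinite_finite_induct) (auto intro: smooth_at_const smooth_at_add)

section \<open>Tangent vectors as derivations; coordinate fields\<close>

lemma tangentD:
 assumes "v \<in> TM p"
 shows tangent_nonsmooth: "\<not> smooth_at A p f \<Longrightarrow> v f = 0"
  and tangent_add: "smooth_at A p f \<Longrightarrow> smooth_at A p g \<Longrightarrow> v (\<lambda>q. f q + g q) = v f + v g"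
  and tangent_mult: "smooth_at A p f \<Longrightarrow> smooth_at A p g \<Longrightarrow> v (\<lambda>q. f q * g q) = f p * v g + g p * v f"
  and tangent_cmult: "smooth_at A p f \<Longrightarrow> v (\<lambda>q. c * f q) = c * v f"
 using assms unfolding tangent_space_def by blast+

lemma tangent_const:
 assumes "v \<in> TM p"
 shows "v (\<lambda>q. c) = 0"
proof -
 have "v (\<lambda>q. 1 * 1) = 1 * v (\<lambda>q. 1) + 1 * v (\<lambda>q. 1)"
  by (rule tangent_mult[OF assms smooth_at_const smooth_at_const])
 then have "v (\<lambda>q. 1) = 0" by simp
 then show ?thesis using tangent_cmult[OF assms smooth_at_const, of c 1] by simp
qed

lemma tangent_minus:
 assumes "v \<in> TM p" "smooth_at A p f"
 shows "v (\<lambda>q. - f q) = - v f" using tangent_cmult[OF assms, of "-1"] by simp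

lemma tangent_diff:
 assumes "v \<in> TM p" "smooth_at A p f" "smooth_at A p g"
 shows "v (\<lambda>q. f q - g q) = v f - v g"
proof -
 have "smooth_at A p (\<lambda>q. - g q)" using smooth_at_mult[OF smooth_at_const assms(3), of "-1"] by simp
 from tangent_add[OF assms(1,2) this] show ?thesis using tangent_minus[OF assms(1,3)] by simp
qed

lemma tangent_sum:
 assumes "v \<in> TM p" "\<And>i. i \<in> I \<Longrightarrow> smooth_at A p (f i)"
 shows "v (\<lambda>q. \<Sum>i\<in>I. f i q) = (\<Sum>i\<in>I. v (f i))" using assms(2)
proof (induction I rule: infinite_finite_induct)
 case (insert i I)
 then show ?case
  using tangent_add[OF assms(1), of "f i" "\<lambda>q. \<Sum>i\<in>I. f i q"] by (simp add: smooth_at_sum)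
qed (use tangent_const[OF assms(1)] in auto)

lemma tangent_cong:
 assumes v: "v \<in> TM p" and W: "open W" "p \<in> W" "\<And>q. q \<in> W \<Longrightarrow> f q = g q"
 shows "v f = v g"
proof (cases "smooth_at A p f")
 case True
 then have g: "smooth_at A p g" using smooth_at_cong W by blast
 \<comment> \<open>Tangent vectors act on functions that are smooth near \<open>p\<close> only, so
   this discontinuous cut-off is admissible. It vanishes near \<open>p\<close> and is 1 wherever
   \<open>f\<close> and \<open>g\<close> may differ, so multiplying \<open>f - g\<close> by it
   changes nothing, and both terms of the Leibniz rule are zero.\<close>
 let ?\<chi> = "\<lambda>q. if q \<in> W then 0 else (1::real)"
 have h: "smooth_at A p (\<lambda>q. f q - g q)" using True g by (rule smooth_at_diff)
 have \<chi>: "smooth_at A p ?\<chi>" by (rule smooth_at_cong[OF smooth_at_const[of p 0] W(1,2)]) auto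
 have "v (\<lambda>q. f q - g q) = v (\<lambda>q. ?\<chi> q * (f q - g q))"
  by (rule arg_cong[of _ _ v]) (use W(3) in auto)
 also have "\<dots> = 0" using tangent_mult[OF v \<chi> h] W by simp
 finally show ?thesis using tangent_diff[OF v True g] by simp
next
 case False
 then have "\<not> smooth_at A p g" using smooth_at_cong[of p g W f] W by auto
 then show ?thesis using False tangent_nonsmooth[OF v] by simp
qed

lemma subspace_tangent_space: "subspace (TM p)"
 unfolding subspace_def tangent_space_def by (auto simp: algebra_simps)

text \<open>The direction \<open>e\<close> ranges over all vectors of the model space, because
  foliated charts later use an orthonormal basis adapted to the leaves instead of
  \<open>Basis\<close>. The default value 0 follows the convention for tangent vectors.\<close>

definition coord_field :: "'m set \<Rightarrow> ('m \<Rightarrow> 'e) \<Rightarrow> 'e \<Rightarrow> 'm vfield" where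
 "coord_field U \<phi> e q f = (if smooth_at A q f
   then frechet_derivative (\<lambda>x. f (inv_into U \<phi> x)) (at (\<phi> q)) e else 0)"

abbreviation "frame_at U \<phi> es q \<equiv> at_point (map (coord_field U \<phi>) es) q"

lemma chart_has_derivative:
 assumes c: "(U, \<phi>) \<in> maximal_atlas A" and q: "q \<in> U" and f: "smooth_at A q f"
 shows "((\<lambda>x. f (inv_into U \<phi> x)) has_derivative
  (\<lambda>e. coord_field U \<phi> e q f)) (at (\<phi> q))"
proof -
 obtain W where W: "open W" "q \<in> W" "W \<subseteq> U" "f \<in> Cinf A W" using smooth_atE[OF f chartD(1)[OF c] q] .
 then have "smooth_on (\<phi> ` W) (\<lambda>x. f (inv_into U \<phi> x))" using Cinf_chart[OF c] by blast
 from smooth_on_has_derivative[OF this, of "\<phi> q"] W(2) f show ?thesis by (simp add: coord_field_def)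
qed

lemma coord_field_eqI:
 assumes "(U, \<phi>) \<in> maximal_atlas A" "q \<in> U" "smooth_at A q f"
  "((\<lambda>x. f (inv_into U \<phi> x)) has_derivative D) (at (\<phi> q))"
 shows "coord_field U \<phi> e q f = D e"
 using has_derivative_unique[OF chart_has_derivative[OF assms(1-3)] assms(4)] by metis

lemma coord_field_tangent:
 assumes c: "(U, \<phi>) \<in> maximal_atlas A" and q: "q \<in> U"
 shows "coord_field U \<phi> e q \<in> TM q"
proof -
 note D = chart_has_derivative[OF c q]
 have [simp]: "inv_into U \<phi> (\<phi> q) = q" using chartD(3)[OF c q] .
 show ?thesis unfolding tangent_space_def
 proof (intro CollectI conjI allI impI)
  fix f g and k :: real
  assume f: "smooth_at A q f"
  show "coord_field U \<phi> e q (\<lambda>p. k * f p) = k * coord_field U \<phi> e q f"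
   using coord_field_eqI[OF c q smooth_at_mult[OF smooth_at_const f] has_derivative_mult_right[OF D[OF f]]] .
  assume g: "smooth_at A q g"
  show "coord_field U \<phi> e q (\<lambda>p. f p + g p) = coord_field U \<phi> e q f + coord_field U \<phi> e q g"
   using coord_field_eqI[OF c q smooth_at_add[OF f g] has_derivative_add[OF D[OF f] D[OF g]]] .
  show "coord_field U \<phi> e q (\<lambda>p. f p * g p) = f q * coord_field U \<phi> e q g + g q * coord_field U \<phi> e q f"
   using coord_field_eqI[OF c q smooth_at_mult[OF f g] has_derivative_mult[OF D[OF f] D[OF g]], of e] by simp
 qed (auto simp: coord_field_def)
qed

lemma coord_field_coordinate:
 assumes c: "(U, \<phi>) \<in> maximal_atlas A" and q: "q \<in> U"
 shows "coord_field U \<phi> e q (coord \<phi> b) = e \<bullet> b"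
proof (rule coord_field_eqI[OF c q])
 show "smooth_at A q (coord \<phi> b)" using smooth_atI[OF chartD(1)[OF c] q Cinf_coordinate[OF c]] .
 have "((\<lambda>x. x \<bullet> b) has_derivative (\<lambda>e. e \<bullet> b)) (at (\<phi> q))"
  by (rule bounded_linear.has_derivative[OF bounded_linear_inner_left has_derivative_ident])
 then show "((\<lambda>x. \<phi> (inv_into U \<phi> x) \<bullet> b) has_derivative (\<lambda>e. e \<bullet> b)) (at (\<phi> q))"
  by (rule has_derivative_transform_within_open[where s = "\<phi> ` U"]) (use chartD[OF c] q in auto)
qed

lemma coord_field_linear:
 assumes c: "(U, \<phi>) \<in> maximal_atlas A" and q: "q \<in> U"
 shows "coord_field U \<phi> (a *\<^sub>R d + b *\<^sub>R e) q = a *\<^sub>R coord_field U \<phi> d q + b *\<^sub>R coord_field U \<phi> e q"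
proof
 fix f
 show "coord_field U \<phi> (a *\<^sub>R d + b *\<^sub>R e) q f = (a *\<^sub>R coord_field U \<phi> d q + b *\<^sub>R coord_field U \<phi> e q) f"
 proof (cases "smooth_at A q f")
  case True
  note l = has_derivative_linear[OF chart_has_derivative[OF c q True]]
  from linear_add[OF l, of "a *\<^sub>R d" "b *\<^sub>R e"] show ?thesis
   using linear_cmul[OF l, of a d] linear_cmul[OF l, of b e] by simp
 qed (simp add: coord_field_def)
qed

text \<open>Hadamard's lemma writes \<open>f\<close> near \<open>q\<close> as its value at
  \<open>q\<close> plus products of coordinate increments, which vanish at \<open>q\<close>, with
  smooth functions. By the Leibniz rule a derivation sees only the coordinates of \<open>v\<close>
  and the first derivatives of \<open>f\<close>.\<close>

lemma tangent_expand_chart: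
 assumes c: "(U, \<phi>) \<in> maximal_atlas A" and q: "q \<in> U" and v: "v \<in> TM q"
 shows "v = coord_field U \<phi> (push_forward \<phi> v) q"
proof
 fix f
 show "v f = coord_field U \<phi> (push_forward \<phi> v) q f"
 proof (cases "smooth_at A q f")
  case False
  then show ?thesis using tangent_nonsmooth[OF v] by (simp add: coord_field_def)
 next
  case True
  obtain W where W: "open W" "q \<in> W" "W \<subseteq> U" "f \<in> Cinf A W"
   using smooth_atE[OF True chartD(1)[OF c] q] .
  have oW: "open (\<phi> ` W)" using chartD(4)[OF c W(1,3)] .
  then obtain r where r: "r > 0" "ball (\<phi> q) r \<subseteq> \<phi> ` W" using W(2) by (meson imageI open_contains_ball)
  let ?B = "ball (\<phi> q) r" and ?g = "\<lambda>x. f (inv_into U \<phi> x)"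
  have gs: "smooth_on ?B ?g" by (rule smooth_on_subset[OF iffD1[OF Cinf_chart[OF c W(1,3)] W(4)] r(2)])
  obtain G where G: "\<And>b. smooth_on ?B (G b)"
   "\<And>x. x \<in> ?B \<Longrightarrow> ?g x = ?g (\<phi> q) + (\<Sum>b\<in>Basis. ((x - \<phi> q) \<bullet> b) * G b x)"
   "\<And>b. r > 0 \<Longrightarrow> G b (\<phi> q) = frechet_derivative ?g (at (\<phi> q)) b"
   by (rule hadamard[OF gs]) blast
  let ?N = "inv_into U \<phi> ` ?B"
  have BU: "?B \<subseteq> \<phi> ` U" using r(2) W(3) by blast
  have N1: "open ?N" by (rule chartD(5)[OF c open_ball BU])
  have N2: "?N \<subseteq> U" using BU by (intro image_subsetI inv_into_into) (rule subsetD)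
  have N3: "q \<in> ?N" by (rule image_eqI[of _ _ "\<phi> q"]) (use r(1) chartD(3)[OF c q] in auto)
  note N = N1 N2 N3
  have \<phi>N: "\<phi> p \<in> ?B" "inv_into U \<phi> (\<phi> p) = p" if "p \<in> ?N" for p
  proof -
   obtain x where x: "x \<in> ?B" "p = inv_into U \<phi> x" using \<open>p \<in> ?N\<close> by blast
   then have "\<phi> p = x" using BU f_inv_into_f[of x \<phi> U] by auto
   then show "\<phi> p \<in> ?B" "inv_into U \<phi> (\<phi> p) = p" using x by auto
  qed
  have "\<phi> ` ?N \<subseteq> ?B" by (intro image_subsetI \<phi>N(1))
  then have 1: "smooth_on (\<phi> ` ?N) (G b)" for b by (rule smooth_on_subset[OF G(1)])
  have 2: "G b x = G b (\<phi> (inv_into U \<phi> x))" if "x \<in> \<phi> ` ?N" for x b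
  proof -
   obtain p where p: "p \<in> ?N" "x = \<phi> p" using \<open>x \<in> \<phi> ` ?N\<close> by blast
   show ?thesis unfolding p(2) \<phi>N(2)[OF p(1)] ..
  qed
  have "smooth_on (\<phi> ` ?N) (\<lambda>x. G b (\<phi> (inv_into U \<phi> x)))" for b
   by (rule smooth_on_transform[OF 1 chartD(4)[OF c N(1,2)] 2])
  then have "(\<lambda>p. G b (\<phi> p)) \<in> Cinf A ?N" for b using Cinf_chart[OF c N(1,2)] by simp
  then have sG: "smooth_at A q (\<lambda>p. G b (\<phi> p))" for b using smooth_atI[OF N(1,3)] by blast
  have s\<phi>: "smooth_at A q (coord \<phi> b)" for b
   using smooth_atI[OF chartD(1)[OF c] q Cinf_coordinate[OF c]] .
  have s: "smooth_at A q (\<lambda>p. (\<phi> p \<bullet> b - \<phi> q \<bullet> b))" for b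
   by (rule smooth_at_diff[OF s\<phi> smooth_at_const])
  have "v f = v (\<lambda>p. f q + (\<Sum>b\<in>Basis. (\<phi> p \<bullet> b - \<phi> q \<bullet> b) * G b (\<phi> p)))"
  proof (rule tangent_cong[OF v N(1,3)])
   fix p assume "p \<in> ?N"
   from G(2)[OF \<phi>N(1)[OF this]] \<phi>N(2)[OF this] chartD(3)[OF c q]
   show "f p = f q + (\<Sum>b\<in>Basis. (\<phi> p \<bullet> b - \<phi> q \<bullet> b) * G b (\<phi> p))"
    by (simp add: inner_diff_left)
  qed
  also have "\<dots> = (\<Sum>b\<in>Basis. v (\<lambda>p. (\<phi> p \<bullet> b - \<phi> q \<bullet> b) * G b (\<phi> p)))"
  proof -
   let ?h = "\<lambda>b p. (\<phi> p \<bullet> b - \<phi> q \<bullet> b) * G b (\<phi> p)"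
   have m: "smooth_at A q (?h b)" for b by (rule smooth_at_mult[OF s sG])
   have "smooth_at A q (\<lambda>p. \<Sum>b\<in>Basis. ?h b p)" by (rule smooth_at_sum[OF m])
   then show ?thesis
    using tangent_add[OF v smooth_at_const, of "\<lambda>p. \<Sum>b\<in>Basis. ?h b p" "f q"]
     tangent_const[OF v] tangent_sum[where f = ?h and I = Basis, OF v m] by simp
  qed
  also have "\<dots> = (\<Sum>b\<in>Basis. v (coord \<phi> b) * coord_field U \<phi> b q f)"
  proof (rule sum.cong[OF refl])
   fix b :: 'e
   have "v (\<lambda>p. (\<phi> p \<bullet> b - \<phi> q \<bullet> b) * G b (\<phi> p)) = G b (\<phi> q) * v (\<lambda>p. \<phi> p \<bullet> b - \<phi> q \<bullet> b)"
    using tangent_mult[OF v s sG] by simp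
   also have "\<dots> = v (coord \<phi> b) * coord_field U \<phi> b q f"
    using tangent_diff[OF v s\<phi> smooth_at_const] tangent_const[OF v] True
    by (simp add: G(3)[OF r(1)] coord_field_def)
   finally show "v (\<lambda>p. (\<phi> p \<bullet> b - \<phi> q \<bullet> b) * G b (\<phi> p)) = v (coord \<phi> b) * coord_field U \<phi> b q f" .
  qed
  also have "\<dots> = coord_field U \<phi> (push_forward \<phi> v) q f"
  proof -
   note l = has_derivative_linear[OF chart_has_derivative[OF c q True]]
   show ?thesis unfolding push_forward_def
    using linear_sum[OF l, of "\<lambda>b. v (coord \<phi> b) *\<^sub>R b" Basis] linear_cmul[OF l] by simp
  qed
  finally show ?thesis .
 qed
qed

section \<open>Vector fields and their brackets\<close>

lemma vector_fieldsD:
 assumes "X \<in> \<XX> U"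
 shows vector_field_tangent: "p \<in> U \<Longrightarrow> X p \<in> TM p"
  and vector_field_smooth: "open W \<Longrightarrow> W \<subseteq> U \<Longrightarrow> f \<in> Cinf A W \<Longrightarrow> (\<lambda>p. X p f) \<in> Cinf A W"
 using assms unfolding vector_fields_def by blast+

lemma vector_fields_mono: "X \<in> \<XX> U \<Longrightarrow> U' \<subseteq> U \<Longrightarrow> X \<in> \<XX> U'"
 unfolding vector_fields_def by (auto dest: subset_trans)

lemma sections_mono: "X \<in> sections A U D \<Longrightarrow> U' \<subseteq> U \<Longrightarrow> X \<in> sections A U' D"
 unfolding sections_def using vector_fields_mono[of X U U'] by auto

lemma smooth_at_vector_field:
 assumes "X \<in> \<XX> U" "open U" "p \<in> U" "smooth_at A p f"
 shows "smooth_at A p (\<lambda>q. X q f)"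
proof -
 obtain W where "open W" "p \<in> W" "W \<subseteq> U" "f \<in> Cinf A W" using smooth_atE[OF assms(4,2,3)] .
 then show ?thesis using vector_field_smooth[OF assms(1)] by (intro smooth_atI)
qed

lemma coord_field_vector_field:
 assumes c: "(U, \<phi>) \<in> maximal_atlas A"
 shows "coord_field U \<phi> e \<in> \<XX> U"
proof -
 have "(\<lambda>p. coord_field U \<phi> e p f) \<in> Cinf A W" if W: "open W" "W \<subseteq> U" "f \<in> Cinf A W" for W f
 proof -
  have o: "open (\<phi> ` W)" using chartD(4)[OF c W(1,2)] .
  have 1: "smooth_on (\<phi> ` W) (\<lambda>x. frechet_derivative (\<lambda>x. f (inv_into U \<phi> x)) (at x) e)"
   using W Cinf_chart[OF c W(1,2)] smooth_on_derivative by blast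
  have 2: "coord_field U \<phi> e (inv_into U \<phi> x) f
    = frechet_derivative (\<lambda>x. f (inv_into U \<phi> x)) (at x) e" if x: "x \<in> \<phi> ` W" for x
  proof -
   obtain q where q: "q \<in> W" "x = \<phi> q" using x by auto
   then have "smooth_at A q f" using smooth_atI W by blast
   then show ?thesis using q W chartD(3)[OF c] by (auto simp: coord_field_def)
  qed
  have "smooth_on (\<phi> ` W) (\<lambda>x. coord_field U \<phi> e (inv_into U \<phi> x) f)"
   by (rule smooth_on_transform[OF 1 o 2[symmetric]])
  then show ?thesis using Cinf_chart[OF c W(1,2)] by simp
 qed
 then show ?thesis using coord_field_tangent[OF c] by (simp add: vector_fields_def)
qed

lemma vector_fields_sum:
 assumes "open U" "\<And>i. i \<in> I \<Longrightarrow> X i \<in> \<XX> U" "\<And>i. i \<in> I \<Longrightarrow> c i \<in> Cinf A U"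
 shows "(\<lambda>p. \<Sum>i\<in>I. c i p *\<^sub>R X i p) \<in> \<XX> U" unfolding vector_fields_def
proof (intro CollectI conjI ballI allI impI)
 fix p assume "p \<in> U"
 then show "(\<Sum>i\<in>I. c i p *\<^sub>R X i p) \<in> TM p" using assms(2) vector_field_tangent
  by (intro subspace_sum subspace_scale subspace_tangent_space) blast
next
 fix W f assume W: "open W" "W \<subseteq> U" "f \<in> Cinf A W"
 show "(\<lambda>p. (\<Sum>i\<in>I. c i p *\<^sub>R X i p) f) \<in> Cinf A W"
  unfolding sum_fun_apply scaleR_fun_apply real_scaleR_def
  by (intro Cinf_sum[OF W(1)] Cinf_mult[OF W(1)] Cinf_mono[OF assms(3) W(2)]
    vector_field_smooth[OF assms(2) W])
qed

lemma vector_fields_add: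
 assumes "open U" "X \<in> \<XX> U" "Y \<in> \<XX> U"
 shows "(\<lambda>p. X p + Y p) \<in> \<XX> U" using assms subspace_add[OF subspace_tangent_space]
 unfolding vector_fields_def by (auto intro!: Cinf_add)

lemma vector_fields_scale:
 assumes "open U" "X \<in> \<XX> U" "c \<in> Cinf A U"
 shows "(\<lambda>p. c p *\<^sub>R X p) \<in> \<XX> U"
 using vector_fields_sum[of U "{()}" "\<lambda>_. X" "\<lambda>_. c"] assms by simp

lemma vector_fields_diff:
 assumes "open U" "X \<in> \<XX> U" "Y \<in> \<XX> U"
 shows "(\<lambda>p. X p - Y p) \<in> \<XX> U"
 using vector_fields_add[OF assms(1,2) vector_fields_scale[OF assms(1,3), of "\<lambda>_. -1"]]
 by (simp add: Cinf_const)

lemma lie_bracket_apply: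
 "smooth_at A p f \<Longrightarrow> bracket X Y p f = X p (\<lambda>q. Y q f) - Y p (\<lambda>q. X q f)"
 by (simp add: lie_bracket_def)

text \<open>The mixed products of first derivatives cancel in the commutator. The rules for the
  inner derivation are used on a whole neighbourhood of \<open>p\<close> through
  \<open>tangent_cong\<close>, since the outer one differentiates the result.\<close>

lemma lie_bracket_tangent:
 assumes X: "X \<in> \<XX> U" and Y: "Y \<in> \<XX> U" and U: "open U" "p \<in> U"
 shows "bracket X Y p \<in> TM p"
proof -
 have Xt: "\<And>q. q \<in> U \<Longrightarrow> X q \<in> TM q" and Yt: "\<And>q. q \<in> U \<Longrightarrow> Y q \<in> TM q"
  using vector_field_tangent X Y by auto
 note Xp = Xt[OF U(2)] and Yp = Yt[OF U(2)]
 have sX: "smooth_at A p (\<lambda>q. X q f)" and sY: "smooth_at A p (\<lambda>q. Y q f)" if "smooth_at A p f" for f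
  using smooth_at_vector_field[OF _ U that] X Y by auto
 note simps = tangent_add[OF Xp] tangent_add[OF Yp] tangent_mult[OF Xp] tangent_mult[OF Yp]
  tangent_cmult[OF Xp] tangent_cmult[OF Yp] smooth_at_add smooth_at_mult smooth_at_const sX sY lie_bracket_apply
 show ?thesis unfolding tangent_space_def
 proof (intro CollectI conjI allI impI)
  fix f g and k :: real
  assume f: "smooth_at A p f"
  have "X p (\<lambda>q. Y q (\<lambda>p. k * f p)) = X p (\<lambda>q. k * Y q f)"
   "Y p (\<lambda>q. X q (\<lambda>p. k * f p)) = Y p (\<lambda>q. k * X q f)"
  proof -
   obtain W where W: "open W" "p \<in> W" "W \<subseteq> U" "f \<in> Cinf A W" using smooth_atE[OF f U] .
   have sq: "smooth_at A q f" if "q \<in> W" for q using that W smooth_atI by blast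
   show "X p (\<lambda>q. Y q (\<lambda>p. k * f p)) = X p (\<lambda>q. k * Y q f)"
    by (rule tangent_cong[OF Xp W(1,2)]) (use W(3) Yt tangent_cmult sq in blast)
   show "Y p (\<lambda>q. X q (\<lambda>p. k * f p)) = Y p (\<lambda>q. k * X q f)"
    by (rule tangent_cong[OF Yp W(1,2)]) (use W(3) Xt tangent_cmult sq in blast)
  qed
  then show "bracket X Y p (\<lambda>q. k * f q) = k * bracket X Y p f"
   using f by (simp add: simps right_diff_distrib tangent_const[OF Xp] tangent_const[OF Yp])
  assume g: "smooth_at A p g"
  obtain W where W: "open W" "p \<in> W" "W \<subseteq> U" "f \<in> Cinf A W" "g \<in> Cinf A W" using smooth_atE2[OF f g U] .
  have sq: "smooth_at A q f" "smooth_at A q g" if "q \<in> W" for q using that W smooth_atI by blast+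
  have "X p (\<lambda>q. Y q (\<lambda>p. f p + g p)) = X p (\<lambda>q. Y q f + Y q g)"
   by (rule tangent_cong[OF Xp W(1,2)]) (use W(3) Yt tangent_add sq in blast)
  moreover have "Y p (\<lambda>q. X q (\<lambda>p. f p + g p)) = Y p (\<lambda>q. X q f + X q g)"
   by (rule tangent_cong[OF Yp W(1,2)]) (use W(3) Xt tangent_add sq in blast)
  ultimately show "bracket X Y p (\<lambda>q. f q + g q) = bracket X Y p f + bracket X Y p g"
   using f g by (simp add: simps)
  have "X p (\<lambda>q. Y q (\<lambda>p. f p * g p)) = X p (\<lambda>q. f q * Y q g + g q * Y q f)"
   by (rule tangent_cong[OF Xp W(1,2)]) (use W(3) Yt tangent_mult sq in blast)
  moreover have "Y p (\<lambda>q. X q (\<lambda>p. f p * g p)) = Y p (\<lambda>q. f q * X q g + g q * X q f)"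
   by (rule tangent_cong[OF Yp W(1,2)]) (use W(3) Xt tangent_mult sq in blast)
  ultimately show "bracket X Y p (\<lambda>q. f q * g q) = f p * bracket X Y p g + g p * bracket X Y p f"
   using f g by (simp add: simps algebra_simps)
 qed (simp add: lie_bracket_def)
qed

lemma lie_bracket_vector_field:
 assumes "X \<in> \<XX> U" "Y \<in> \<XX> U" "open U"
 shows "bracket X Y \<in> \<XX> U"
proof -
 have "(\<lambda>p. bracket X Y p f) \<in> Cinf A W" if W: "open W" "W \<subseteq> U" "f \<in> Cinf A W" for W f
 proof -
  have "(\<lambda>p. X p (\<lambda>q. Y q f) - Y p (\<lambda>q. X q f)) \<in> Cinf A W"
   by (intro Cinf_diff[OF W(1)] vector_field_smooth[OF assms(1) W(1,2)]
     vector_field_smooth[OF assms(2) W(1,2)] W(3))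
  moreover have "bracket X Y p f = X p (\<lambda>q. Y q f) - Y p (\<lambda>q. X q f)" if "p \<in> W" for p
   by (rule lie_bracket_apply[OF smooth_atI[OF W(1) that W(3)]])
  ultimately show ?thesis by (subst Cinf_cong[OF W(1)])
 qed
 then show ?thesis using lie_bracket_tangent[OF assms] by (simp add: vector_fields_def)
qed

end

section \<open>Alternating forms\<close>

lemma alternatingI:
 assumes "\<And>xs i u v a b. length xs = k \<Longrightarrow> set xs \<subseteq> S \<Longrightarrow> i < k \<Longrightarrow> u \<in> S \<Longrightarrow> v \<in> S \<Longrightarrow>
   w (xs[i := a *\<^sub>R u + b *\<^sub>R v]) = a * w (xs[i := u]) + b * w (xs[i := v])"
  and "\<And>xs i j. length xs = k \<Longrightarrow> set xs \<subseteq> S \<Longrightarrow> i < j \<Longrightarrow> j < k \<Longrightarrow> xs ! i = xs ! j \<Longrightarrow> w xs = 0"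
 shows "alternating_on S k w"
proof -
 have "w xs = 0" if "length xs = k" "set xs \<subseteq> S" "i < k" "j < k" "i \<noteq> j" "xs ! i = xs ! j" for xs i j
  using assms(2)[of xs i j] assms(2)[of xs j i] that by (cases "i < j") auto
 then show ?thesis using assms(1) unfolding alternating_on_def by blast
qed

lemma alternatingD:
 assumes "alternating_on S k w" "length xs = k" "set xs \<subseteq> S"
 shows alternating_linear: "i < k \<Longrightarrow> u \<in> S \<Longrightarrow> v \<in> S \<Longrightarrow>
   w (xs[i := a *\<^sub>R u + b *\<^sub>R v]) = a * w (xs[i := u]) + b * w (xs[i := v])"
  and alternating_eq: "i < k \<Longrightarrow> j < k \<Longrightarrow> i \<noteq> j \<Longrightarrow> xs ! i = xs ! j \<Longrightarrow> w xs = 0"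
 using assms unfolding alternating_on_def by blast+

lemma alternating_subset: "alternating_on S k w \<Longrightarrow> T \<subseteq> S \<Longrightarrow> alternating_on T k w"
proof (rule alternatingI)
 assume *: "alternating_on S k w" "T \<subseteq> S"
 {
  fix xs i u v and a b :: real
  assume "length xs = k" "set xs \<subseteq> T" "i < k" "u \<in> T" "v \<in> T"
  then show "w (xs[i := a *\<^sub>R u + b *\<^sub>R v]) = a * w (xs[i := u]) + b * w (xs[i := v])"
   using * by (intro alternating_linear[OF *(1)]) auto
 next
  fix xs i j
  assume "length xs = k" "set xs \<subseteq> T" "i < j" "j < k" "xs ! i = xs ! j"
  then show "w xs = 0" using * alternating_eq[OF *(1), of xs i j] by auto
 }
qed

lemma alternating_cong:
 assumes "alternating_on S k w" "subspace S" "\<And>xs. length xs = k \<Longrightarrow> set xs \<subseteq> S \<Longrightarrow> w' xs = w xs"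
 shows "alternating_on S k w'"
proof (rule alternatingI)
 fix xs i u v and a b :: real
 assume *: "length xs = k" "set xs \<subseteq> S" "i < k" "u \<in> S" "v \<in> S"
 then have "a *\<^sub>R u + b *\<^sub>R v \<in> S" using assms(2) by (simp add: subspace_add subspace_scale)
 then have "set (xs[i := x]) \<subseteq> S" if "x \<in> {u, v, a *\<^sub>R u + b *\<^sub>R v}" for x
  using * that by (auto dest!: set_update_subset_insert[THEN subsetD])
 then show "w' (xs[i := a *\<^sub>R u + b *\<^sub>R v]) = a * w' (xs[i := u]) + b * w' (xs[i := v])"
  using * by (simp add: assms(3) alternating_linear[OF assms(1)])
next
 fix xs i j
 assume *: "length xs = k" "set xs \<subseteq> S" "i < j" "j < k" "xs ! i = xs ! j"
 then show "w' xs = 0" using alternating_eq[OF assms(1) *(1,2), of i j] assms(3)[OF *(1,2)] by simp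
qed

lemma alternating_lincomb:
 assumes "alternating_on S k w1" "alternating_on S k w2"
 shows "alternating_on S k (\<lambda>xs. c * w1 xs + d * w2 xs)"
proof (rule alternatingI)
 fix xs i j
 assume *: "length xs = k" "set xs \<subseteq> S" "i < j" "j < k" "xs ! i = xs ! j"
 then show "c * w1 xs + d * w2 xs = 0"
  using alternating_eq[OF assms(1) *(1,2), of i j] alternating_eq[OF assms(2) *(1,2), of i j] by simp
qed (simp add: alternating_linear[OF assms(1)] alternating_linear[OF assms(2)] algebra_simps)

lemma alternating_zero: "alternating_on S k (\<lambda>_. 0)"
 by (rule alternatingI) auto

lemma alternating_sum_list:
 assumes "\<And>x. x \<in> set l \<Longrightarrow> alternating_on S k (f x)"
 shows "alternating_on S k (\<lambda>xs. \<Sum>x\<leftarrow>l. f x xs)" using assms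
proof (induction l)
 case (Cons x l)
 then show ?case using alternating_lincomb[of S k "f x" "\<lambda>xs. \<Sum>x\<leftarrow>l. f x xs" 1 1] by simp
qed (simp add: alternating_zero)

lemma set_update_subset: "set xs \<subseteq> S \<Longrightarrow> x \<in> S \<Longrightarrow> set (xs[i := x]) \<subseteq> S"
 using set_update_subset_insert by fastforce

lemma alternating_sum:
 assumes "alternating_on S k w" "subspace S" "length xs = k" "set xs \<subseteq> S" "i < k" "\<And>j. j \<in> J \<Longrightarrow> u j \<in> S"
 shows "w (xs[i := \<Sum>j\<in>J. c j *\<^sub>R u j]) = (\<Sum>j\<in>J. c j * w (xs[i := u j]))"
 using assms(6)
proof (induction J rule: infinite_finite_induct)
 case (insert j J)
 have "(\<Sum>j\<in>J. c j *\<^sub>R u j) \<in> S"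
  using insert assms(2) by (intro subspace_sum subspace_scale) auto
 then show ?case
  using insert alternating_linear[OF assms(1,3,4,5), of "u j" "\<Sum>j\<in>J. c j *\<^sub>R u j" "c j" 1] by simp
qed (use alternating_linear[OF assms(1,3,4,5), of 0 0 0 0] subspace_0[OF assms(2)] in auto)

lemma alternating_swap:
 assumes w: "alternating_on S k w" and S: "subspace S" and xs: "length xs = k" "set xs \<subseteq> S"
  and ij: "i < k" "j < k" "i \<noteq> j" and xy: "x \<in> S" "y \<in> S"
 shows "w (xs[i := x, j := y]) = - w (xs[i := y, j := x])"
proof -
 have lin_j: "w (xs[i := z, j := x + y]) = w (xs[i := z, j := x]) + w (xs[i := z, j := y])" if "z \<in> S" for z
  using alternating_linear[OF w, of "xs[i := z]" j x y 1 1] xs ij xy that by (simp add: set_update_subset)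
 have lin_i: "w (xs[i := x + y, j := z]) = w (xs[i := x, j := z]) + w (xs[i := y, j := z])" if "z \<in> S" for z
  using alternating_linear[OF w, of "xs[j := z]" i x y 1 1] xs ij xy that
  by (simp add: set_update_subset list_update_swap[of j i])
 have z: "w (xs[i := z, j := z]) = 0" if "z \<in> S" for z
  by (rule alternating_eq[OF w, of _ i j]) (use xs ij that in \<open>auto simp: set_update_subset nth_list_update\<close>)
 have "x + y \<in> S" using S xy by (rule subspace_add)
 then show ?thesis using z[of "x + y"] z[of x] z[of y] lin_i[of x] lin_i[of y] lin_j[of "x + y"] xy by simp
qed

lemma alternating_move:
 assumes w: "alternating_on S k w" and S: "subspace S" and l: "Suc (length l) = k" "set l \<subseteq> S" "x \<in> S" "i \<le> length l"
 shows "w (take i l @ x # drop i l) = (- 1) ^ i * w (x # l)" using l(4)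
proof (induction i)
 case (Suc i)
 let ?xs = "take i l @ x # drop i l"
 have d: "drop i l = l ! i # drop (Suc i) l" using Suc.prems by (simp add: Cons_nth_drop_Suc)
 have "take (Suc i) l @ x # drop (Suc i) l = ?xs[i := l ! i, Suc i := x]"
  using Suc.prems by (simp add: take_Suc_conv_app_nth list_update_append d)
 moreover have "?xs = ?xs[i := x, Suc i := l ! i]" using Suc.prems by (simp add: list_update_append d)
 moreover have "set ?xs \<subseteq> S" using l by (auto dest: in_set_takeD in_set_dropD)
 moreover have "l ! i \<in> S" using l Suc.prems by auto
 ultimately have "w (take (Suc i) l @ x # drop (Suc i) l) = - w ?xs"
  using alternating_swap[OF w S, of ?xs i "Suc i" "l ! i" x] Suc.prems l by auto
 then show ?case using Suc by simp
qed simp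

lemma alternating_span_zero:
 assumes w: "alternating_on S k w" and S: "subspace S" and xs: "length xs = k" "set xs \<subseteq> S"
  and i: "i < k" "xs ! i \<in> span ((!) xs ` ({..<k} - {i}))"
 shows "w xs = 0"
proof -
 let ?T = "(!) xs ` ({..<k} - {i})"
 obtain c where c: "xs ! i = (\<Sum>v\<in>?T. c v *\<^sub>R v)"
  using i(2) unfolding span_finite[OF finite_imageI[OF finite_Diff[OF finite_lessThan]]] by auto
 have S': "xs ! j \<in> S" if "j < k" for j using xs that nth_mem by blast
 have "w xs = w (xs[i := \<Sum>v\<in>?T. c v *\<^sub>R v])" by (metis c list_update_id)
 also have "\<dots> = (\<Sum>v\<in>?T. c v * w (xs[i := v]))"
  by (rule alternating_sum[OF w S xs i(1)]) (use S' in auto)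
 also have "\<dots> = 0"
 proof (rule sum.neutral, intro ballI)
  fix v assume "v \<in> ?T"
  then obtain j where j: "j < k" "j \<noteq> i" "v = xs ! j" by auto
  have "w (xs[i := v]) = 0"
   by (rule alternating_eq[OF w, of _ i j]) (use j xs i set_update_subset[OF xs(2) S'[of j], of i] in auto)
  then show "c v * w (xs[i := v]) = 0" by simp
 qed
 finally show ?thesis .
qed

text \<open>The dimension count behind the later vanishing statements: too many entries lie in a
  small span, so they repeat or are linearly dependent. \<open>P\<close> selects the entries to be
  counted, for instance the vertical or the horizontal ones of a mixed list.\<close>

lemma alternating_dependent_zero:
 assumes w: "alternating_on S (length xs) w" and S: "subspace S" and xs: "set xs \<subseteq> S"
  and bs: "finite bs" "\<And>x. x \<in> set xs \<Longrightarrow> P x \<Longrightarrow> x \<in> span bs" "card bs < length (filter P xs)"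
 shows "w xs = 0"
proof -
 let ?I = "{i. i < length xs \<and> P (xs ! i)}"
 have card: "card bs < card ?I" using bs(3) by (simp add: length_filter_conv_card)
 show ?thesis
 proof (cases "inj_on ((!) xs) ?I")
  case False
  then obtain i j where "i \<in> ?I" "j \<in> ?I" "i \<noteq> j" "xs ! i = xs ! j" by (auto simp: inj_on_def)
  then show ?thesis using alternating_eq[OF w refl xs, of i j] by auto
 next
  case True
  let ?T = "(!) xs ` ?I"
  have "?T \<subseteq> span bs" using bs(2) by auto
  moreover have "card ?T = card ?I" using True by (rule card_image)
  ultimately have "dependent ?T" using independent_span_bound[OF bs(1), of ?T] card by auto
  then obtain i where i: "i \<in> ?I" "xs ! i \<in> span (?T - {xs ! i})" unfolding dependent_def by auto
  have "?T - {xs ! i} \<subseteq> (!) xs ` ({..<length xs} - {i})" by auto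
  then have "xs ! i \<in> span ((!) xs ` ({..<length xs} - {i}))" using i(2) span_mono by blast
  then show ?thesis using alternating_span_zero[OF w S refl xs, of i] i(1) by auto
 qed
qed

text \<open>Entries are exchanged one slot at a time, and each exchange costs a term with an entry
  in \<open>N\<close>. Taking for \<open>N\<close> a fibre of \<open>F\<close> makes a transverse
  form insensitive to projection along \<open>F\<close>.\<close>

lemma alternating_replace:
 assumes w: "alternating_on S k w" and S: "subspace S" and xs: "length xs = k" "set xs \<subseteq> S"
  and ys: "length ys = k" "set ys \<subseteq> S"
  and N: "\<And>zs. length zs = k \<Longrightarrow> set zs \<subseteq> S \<Longrightarrow> set zs \<inter> N \<noteq> {} \<Longrightarrow> w zs = 0"
  and d: "\<And>i. i < k \<Longrightarrow> xs ! i - ys ! i \<in> N"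
 shows "w xs = w ys"
proof -
 have "w (take m ys @ drop m xs) = w xs" if "m \<le> k" for m using that
 proof (induction m)
  case (Suc m)
  let ?z = "take m ys @ drop m xs"
  have z: "length ?z = k" "set ?z \<subseteq> S" using Suc.prems xs ys by (auto dest: in_set_takeD in_set_dropD)
  have m: "xs ! m \<in> S" "ys ! m \<in> S" "xs ! m - ys ! m \<in> S"
   using Suc.prems xs ys subspace_diff[OF S] by (auto simp: subset_iff)
  have "drop m xs = xs ! m # drop (Suc m) xs" using Suc.prems xs by (simp add: Cons_nth_drop_Suc)
  then have zs: "take (Suc m) ys @ drop (Suc m) xs = ?z[m := ys ! m]" and zm: "?z ! m = xs ! m"
   using Suc.prems xs ys by (auto simp: take_Suc_conv_app_nth list_update_append nth_append min_def)
  note zs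
  also have "ys ! m = 1 *\<^sub>R (xs ! m) + (- 1) *\<^sub>R (xs ! m - ys ! m)" by simp
  also have "w (?z[m := \<dots>]) = 1 * w (?z[m := xs ! m]) + (- 1) * w (?z[m := xs ! m - ys ! m])"
   by (rule alternating_linear[OF w z]) (use m Suc.prems in auto)
  also have "w (?z[m := xs ! m - ys ! m]) = 0"
  proof (rule N)
   have "xs ! m - ys ! m \<in> set (?z[m := xs ! m - ys ! m])"
    using Suc.prems z by (intro set_update_memI) auto
   then show "set (?z[m := xs ! m - ys ! m]) \<inter> N \<noteq> {}" using d[of m] Suc.prems by auto
  qed (use z set_update_subset[OF z(2) m(3), of m] in auto)
  also have "?z[m := xs ! m] = ?z" using zm by (metis list_update_id)
  finally show ?case using Suc by simp
 qed simp
 from this[of k] show ?thesis using xs ys by simp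
qed

lemma alternating_Cons:
 assumes "alternating_on S (Suc k) w" "v \<in> S"
 shows "alternating_on S k (\<lambda>l. w (v # l))"
proof (rule alternatingI)
 fix xs i u u' and a b :: real
 assume "length xs = k" "set xs \<subseteq> S" "i < k" "u \<in> S" "u' \<in> S"
 then show "w (v # xs[i := a *\<^sub>R u + b *\<^sub>R u']) = a * w (v # xs[i := u]) + b * w (v # xs[i := u'])"
  using alternating_linear[OF assms(1), of "v # xs" "Suc i" u u' a b] assms(2) by simp
next
 fix xs i j
 assume "length xs = k" "set xs \<subseteq> S" "i < j" "j < k" "xs ! i = xs ! j"
 then show "w (v # xs) = 0" using alternating_eq[OF assms(1), of "v # xs" "Suc i" "Suc j"] assms(2) by simp
qed

lemma alternating_scaled_entry:
 assumes w: "alternating_on S k w" and xs: "length xs = k" "set xs \<subseteq> S" "i < k" "e \<in> S" "xs ! i = c *\<^sub>R e"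
 shows "w xs = c * w (xs[i := e])"
proof -
 have "w xs = w (xs[i := c *\<^sub>R e + 0 *\<^sub>R e])" using xs by (metis add.right_neutral list_update_id scale_zero_left)
 then show ?thesis using alternating_linear[OF w xs(1-3,4,4), of c 0] by simp
qed

text \<open>Induction on the spanning list, which is allowed to be dependent. By the induction
  hypothesis \<open>w (e # l)\<close> vanishes for \<open>l\<close> in the span of the remaining
  generators; multiples of \<open>e\<close> in the other slots do not matter, since \<open>e\<close>
  then occurs twice. Discarding the \<open>e\<close>-components of all entries finally leaves
  \<open>k\<close> vectors in the span of \<open>k - 1\<close> generators.\<close>

lemma alternating_top_zero:
 assumes "alternating_on S k w" "subspace S" "S = span (set es)" "length es = k" "w es = 0"
  "length vs = k" "set vs \<subseteq> S"
 shows "w vs = 0" using assms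
proof (induction es arbitrary: S k w vs)
 case (Cons e es)
 note w = Cons.prems(1) and S = Cons.prems(2)
 obtain k' where k: "k = Suc k'" "length es = k'" using Cons.prems(4) by auto
 let ?S' = "span (set es)"
 have S': "?S' \<subseteq> S" unfolding Cons.prems(3) by (rule span_mono) auto
 have e: "e \<in> S" unfolding Cons.prems(3) by (auto intro: span_base)
 have we: "alternating_on S k' (\<lambda>l. w (e # l))" using alternating_Cons w e k by blast
 have we': "alternating_on ?S' k' (\<lambda>l. w (e # l))" using alternating_subset[OF we S'] .
 have 1: "w (e # l) = 0" if "length l = k'" "set l \<subseteq> ?S'" for l
  by (rule Cons.IH[OF we' subspace_span refl k(2) Cons.prems(5) that])
 have split: "\<exists>c. x - c *\<^sub>R e \<in> ?S'" if "x \<in> S" for x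
  using span_breakdown[of e "set (e # es)" x] that Cons.prems(3)
  by (metis Diff_insert_absorb insert_Diff_single list.simps(15) span_breakdown_eq)
 then obtain c where c: "\<And>x. x \<in> S \<Longrightarrow> x - c x *\<^sub>R e \<in> ?S'" by metis
 let ?p = "\<lambda>x. x - c x *\<^sub>R e"
 have we0: "w (e # zs) = 0" if zs: "length zs = k'" "set zs \<subseteq> S" "set zs \<inter> range (\<lambda>c. c *\<^sub>R e) \<noteq> {}" for zs
 proof -
  obtain i a where i: "i < k'" "zs ! i = a *\<^sub>R e" using zs by (auto simp: in_set_conv_nth)
  have "w (e # zs) = a * w (e # zs[i := e])" using alternating_scaled_entry[OF we zs(1,2) i(1) e i(2)] .
  also have "w (e # zs[i := e]) = 0"
   by (rule alternating_eq[OF w, of _ 0 "Suc i"]) (use zs i e k set_update_subset[OF zs(2) e] in auto)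
  finally show ?thesis by simp
 qed
 have 2: "w (e # l) = 0" if l: "length l = k'" "set l \<subseteq> S" for l
 proof -
  have pS: "set (map ?p l) \<subseteq> ?S'" using l c by auto
  have "w (e # l) = w (e # map ?p l)"
   by (rule alternating_replace[OF we S l(1,2), where N = "range (\<lambda>c. c *\<^sub>R e)"])
    (use l pS S' we0 in \<open>auto simp: subset_iff\<close>)
  also have "\<dots> = 0" using 1[OF _ pS] l by simp
  finally show ?thesis .
 qed
 have 3: "w zs = 0" if zs: "length zs = k" "set zs \<subseteq> S" "set zs \<inter> range (\<lambda>c. c *\<^sub>R e) \<noteq> {}" for zs
 proof -
  obtain i a where i: "i < k" "zs ! i = a *\<^sub>R e" using zs by (auto simp: in_set_conv_nth)
  let ?l = "take i zs @ drop (Suc i) zs"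
  have "zs[i := e] = take i ?l @ e # drop i ?l" using i zs by (simp add: upd_conv_take_nth_drop)
  moreover have l: "length ?l = k'" "set ?l \<subseteq> S" using zs i k by (auto dest: in_set_takeD in_set_dropD)
  ultimately have "w (zs[i := e]) = (- 1) ^ i * w (e # ?l)"
   using alternating_move[OF w S, of ?l e i] e i k by simp
  then show ?thesis using alternating_scaled_entry[OF w zs(1,2) i(1) e i(2)] 2[OF l] by simp
 qed
 have pS: "set (map ?p vs) \<subseteq> ?S'" using Cons.prems c by auto
 have pS': "set (map ?p vs) \<subseteq> S" using pS S' by (rule subset_trans)
 have "w vs = w (map ?p vs)"
  by (rule alternating_replace[OF w S Cons.prems(6,7), where N = "range (\<lambda>c. c *\<^sub>R e)"])
   (use Cons.prems(6) pS' 3 in auto)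
 also have "\<dots> = 0"
 proof (rule alternating_dependent_zero[of S _ w "set es" "\<lambda>_. True"])
  show "x \<in> ?S'" if "x \<in> set (map ?p vs)" for x using that pS by blast
  show "card (set es) < length (filter (\<lambda>_. True) (map ?p vs))"
   using card_length[of es] Cons.prems(6) k by simp
 qed (use w S pS' Cons.prems(6) in auto)
 finally show ?case .
qed auto

text \<open>The combination of \<open>w1\<close> and \<open>w2\<close> that vanishes on
  \<open>es\<close> vanishes everywhere. All proportionality factors between volume forms and their
  Lie derivatives come from here.\<close>

lemma alternating_top_ratio:
 assumes "alternating_on S k w1" "alternating_on S k w2" "subspace S" "S = span (set es)" "length es = k"
  "length vs = k" "set vs \<subseteq> S"
 shows "w1 vs * w2 es = w1 es * w2 vs"
 using alternating_top_zero[OF alternating_lincomb[OF assms(1,2), of "w2 es" "- w1 es"] assms(3-5) _ assms(6,7)]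
 by (simp add: mult.commute)

lemma alternating_top_nonzero:
 assumes "alternating_on S k w" "subspace S" "S = span (set es)" "length es = k"
  "length vs = k" "set vs \<subseteq> S" "w vs \<noteq> 0"
 shows "w es \<noteq> 0" using alternating_top_zero[OF assms(1-4) _ assms(5,6)] assms(7) by blast

subsection \<open>Antisymmetrisation\<close>

lemma length_remove_nth: "i < length xs \<Longrightarrow> length (remove_nth i xs) = length xs - 1"
 by (auto simp: remove_nth_def)

lemma set_remove_nth: "set (remove_nth i xs) \<subseteq> set xs"
 by (auto simp: remove_nth_def dest: in_set_takeD in_set_dropD)

lemma nth_remove_nth:
 "i < length xs \<Longrightarrow> j < length xs - 1 \<Longrightarrow> remove_nth i xs ! j = (if j < i then xs ! j else xs ! Suc j)"
 by (auto simp: remove_nth_def nth_append min_def)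

lemma remove_nth_update_eq: "remove_nth i (xs[i := x]) = remove_nth i xs"
 by (simp add: remove_nth_def)

lemma remove_nth_update_neq:
 assumes "i < length xs" "j < length xs" "i \<noteq> j"
 shows "remove_nth i (xs[j := x]) = (remove_nth i xs)[(if j < i then j else j - 1) := x]"
 by (rule nth_equalityI)
  (use assms in \<open>auto simp: length_remove_nth nth_remove_nth nth_list_update\<close>)

lemma remove_nth_Cons_0: "remove_nth 0 (x # xs) = xs"
 and remove_nth_Cons_Suc: "remove_nth (Suc i) (x # xs) = x # remove_nth i xs"
 by (simp_all add: remove_nth_def)

lemma remove_nth_insert:
 "i < length xs \<Longrightarrow> take i (remove_nth i xs) @ (xs ! i) # drop i (remove_nth i xs) = xs"
 by (simp add: remove_nth_def id_take_nth_drop[symmetric])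

lemma at_point_remove_nth: "at_point (remove_nth i Xs) p = remove_nth i (at_point Xs p)"
 by (simp add: at_point_def remove_nth_def take_map drop_map)

text \<open>Swaps the two removals, so that both sides of the cancellation below see the same list.\<close>

lemma remove_nth_remove_nth:
 "i < j \<Longrightarrow> j < length xs \<Longrightarrow> remove_nth (j - 1) (remove_nth i xs) = remove_nth i (remove_nth j xs)"
 by (rule nth_equalityI) (auto simp: length_remove_nth nth_remove_nth)

text \<open>The alternating sum over the position of the distinguished argument. If
  \<open>\<Psi> u l\<close> is \<open>\<alpha> u * w l\<close>, it is the wedge product of the
  one-form \<alpha> with \<open>w\<close>.\<close>

definition alt_lift :: "('v \<Rightarrow> 'v list \<Rightarrow> real) \<Rightarrow> 'v list \<Rightarrow> real" where
 "alt_lift \<Psi> us = (\<Sum>i<length us. (- 1) ^ i * \<Psi> (us ! i) (remove_nth i us))"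

lemma alternating_remove_nth:
 assumes "alternating_on S k w" "subspace S" "length xs = k" "set xs \<subseteq> S" "i < k"
 shows "w xs = (- 1) ^ i * w (xs ! i # remove_nth i xs)"
proof -
 have "w (take i (remove_nth i xs) @ (xs ! i) # drop i (remove_nth i xs)) = (- 1) ^ i * w (xs ! i # remove_nth i xs)"
  by (rule alternating_move[OF assms(1,2)])
   (use assms set_remove_nth[of i xs] in \<open>auto simp: length_remove_nth\<close>)
 then show ?thesis using remove_nth_insert assms by metis
qed

lemma alternating_alt_lift:
 assumes S: "subspace S" and alt: "\<And>u. u \<in> S \<Longrightarrow> alternating_on S k (\<Psi> u)"
  and lin: "\<And>u v a b l. u \<in> S \<Longrightarrow> v \<in> S \<Longrightarrow> length l = k \<Longrightarrow> set l \<subseteq> S \<Longrightarrow>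
   \<Psi> (a *\<^sub>R u + b *\<^sub>R v) l = a * \<Psi> u l + b * \<Psi> v l"
 shows "alternating_on S (Suc k) (alt_lift \<Psi>)"
proof (rule alternatingI)
 fix xs i u v and a b :: real
 assume xs: "length xs = Suc k" "set xs \<subseteq> S" and i: "i < Suc k" and uv: "u \<in> S" "v \<in> S"
 have r: "length (remove_nth j xs) = k" "set (remove_nth j xs) \<subseteq> S" if "j < Suc k" for j
  using that xs set_remove_nth[of j xs] by (auto simp: length_remove_nth)
 have "\<Psi> (xs[i := a *\<^sub>R u + b *\<^sub>R v] ! j) (remove_nth j (xs[i := a *\<^sub>R u + b *\<^sub>R v]))
   = a * \<Psi> (xs[i := u] ! j) (remove_nth j (xs[i := u])) + b * \<Psi> (xs[i := v] ! j) (remove_nth j (xs[i := v]))"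
  if j: "j < Suc k" for j
 proof (cases "j = i")
  case True
  then show ?thesis using xs i uv lin r by (simp add: remove_nth_update_eq)
 next
  case False
  then have "xs ! j \<in> S" using xs j by auto
  then show ?thesis
   using False xs i j uv alternating_linear[OF alt r, of "xs ! j" j "if i < j then i else i - 1" u v a b]
   by (auto simp: remove_nth_update_neq)
 qed
 then show "alt_lift \<Psi> (xs[i := a *\<^sub>R u + b *\<^sub>R v]) = a * alt_lift \<Psi> (xs[i := u]) + b * alt_lift \<Psi> (xs[i := v])"
  using xs by (simp add: alt_lift_def sum_distrib_left sum.distrib[symmetric] algebra_simps)
next
 fix xs i j
 assume xs: "length xs = Suc k" "set xs \<subseteq> S" and ij: "i < j" "j < Suc k" "xs ! i = xs ! j"
 let ?t = "\<lambda>l. (- 1) ^ l * \<Psi> (xs ! l) (remove_nth l xs)"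
 have r: "length (remove_nth l xs) = k" "set (remove_nth l xs) \<subseteq> S" "xs ! l \<in> S" if "l < Suc k" for l
  using that xs set_remove_nth[of l xs] by (auto simp: length_remove_nth)
 have zero: "?t l = 0" if l: "l < Suc k" "l \<noteq> i" "l \<noteq> j" for l
 proof -
  have "\<Psi> (xs ! l) (remove_nth l xs) = 0"
   by (rule alternating_eq[OF alt[OF r(3)[OF l(1)]] r(1,2)[OF l(1)], of "if i < l then i else i - 1" "if j < l then j else j - 1"])
    (use l ij xs in \<open>auto simp: nth_remove_nth\<close>)
  then show ?thesis by simp
 qed
 have ni: "remove_nth i xs ! (j - 1) = xs ! j" "remove_nth j xs ! i = xs ! i"
  using ij xs by (auto simp: nth_remove_nth)
 have i: "i < Suc k" "j - 1 < k" "i < k" using ij by auto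
 \<comment> \<open>Only the two terms whose distinguished argument is one of the equal entries are
   left. With the other copy moved to the front they agree up to sign, and the total exponents i +
   (j - 1) and j + i have opposite parity.\<close>
 have "\<Psi> (xs ! i) (remove_nth i xs)
   = (- 1) ^ (j - 1) * \<Psi> (xs ! i) (xs ! j # remove_nth (j - 1) (remove_nth i xs))"
  using alternating_remove_nth[OF alt[OF r(3)[OF i(1)]] S r(1,2)[OF i(1)] i(2)] ni by simp
 moreover have "\<Psi> (xs ! j) (remove_nth j xs)
   = (- 1) ^ i * \<Psi> (xs ! j) (xs ! i # remove_nth i (remove_nth j xs))"
  using alternating_remove_nth[OF alt[OF r(3)[OF ij(2)]] S r(1,2)[OF ij(2)] i(3)] ni by simp
 moreover have "remove_nth (j - 1) (remove_nth i xs) = remove_nth i (remove_nth j xs)"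
  using ij xs by (intro remove_nth_remove_nth) auto
 moreover have "(- 1) ^ j = - ((- 1) ^ (j - 1) :: real)" using ij(1) by (cases j) auto
 ultimately have "?t i + ?t j = 0" using ij(3) by simp
 moreover have "alt_lift \<Psi> xs = (\<Sum>l\<in>{i, j}. ?t l)"
  unfolding alt_lift_def xs(1) by (rule sum.mono_neutral_right) (use ij zero in auto)
 ultimately show "alt_lift \<Psi> xs = 0" using ij(1) by simp
qed

subsection \<open>Contraction with a bivector\<close>

text \<open>Contraction with the bivector that \<open>ps\<close> represents. \<open>w\<close> comes
  before \<open>v\<close> because the contraction with v wedge w is i_v after i_w, and i_w fills the
  first slot.\<close>

definition contract :: "('v \<times> 'v) list \<Rightarrow> ('v list \<Rightarrow> real) \<Rightarrow> 'v list \<Rightarrow> real" where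
 "contract ps \<Phi> l = (\<Sum>(v, w)\<leftarrow>ps. \<Phi> (w # v # l))"

lemma contract_Cons: "contract ((v, w) # ps) \<Phi> l = \<Phi> (w # v # l) + contract ps \<Phi> l"
 by (simp add: contract_def)

lemma contract_Nil [simp]: "contract [] \<Phi> l = 0"
 by (simp add: contract_def)

lemma contract_zero: "(\<And>v w. (v, w) \<in> set ps \<Longrightarrow> \<Phi> (w # v # l) = 0) \<Longrightarrow> contract ps \<Phi> l = 0"
 by (induction ps) (auto simp: contract_Cons)

lemma contract_cong: "(\<And>v w. (v, w) \<in> set ps \<Longrightarrow> \<Phi> (w # v # l) = \<Psi> (w # v # l)) \<Longrightarrow> contract ps \<Phi> l = contract ps \<Psi> l"
 by (induction ps) (auto simp: contract_Cons)

lemma contract_add: "contract ps (\<lambda>l. \<Phi> l + \<Psi> l) l = contract ps \<Phi> l + contract ps \<Psi> l"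
 by (induction ps) (auto simp: contract_Cons)

lemma contract_pow_add: "(contract ps ^^ j) (\<lambda>l. \<Phi> l + \<Psi> l) l = (contract ps ^^ j) \<Phi> l + (contract ps ^^ j) \<Psi> l"
proof (induction j arbitrary: l)
 case (Suc j)
 have "(contract ps ^^ j) (\<lambda>l. \<Phi> l + \<Psi> l) = (\<lambda>l. (contract ps ^^ j) \<Phi> l + (contract ps ^^ j) \<Psi> l)"
  using Suc by blast
 then show ?case by (simp add: contract_add)
qed simp

lemma contract_pow_cong:
 assumes "set ps \<subseteq> S \<times> S" "\<And>l. length l = k + 2 * j \<Longrightarrow> set l \<subseteq> S \<Longrightarrow> \<Phi> l = \<Psi> l" "length l = k" "set l \<subseteq> S"
 shows "(contract ps ^^ j) \<Phi> l = (contract ps ^^ j) \<Psi> l" using assms(2-4)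
proof (induction j arbitrary: l k)
 case (Suc j)
 have "(contract ps ^^ j) \<Phi> (w # v # l) = (contract ps ^^ j) \<Psi> (w # v # l)" if "(v, w) \<in> set ps" for v w
  by (rule Suc.IH[of "Suc (Suc k)"]) (use Suc.prems that assms(1) in auto)
 then have "contract ps ((contract ps ^^ j) \<Phi>) l = contract ps ((contract ps ^^ j) \<Psi>) l"
  unfolding contract_def by (intro arg_cong[of _ _ sum_list] map_cong) auto
 then show ?case by simp
qed simp

lemma alternating_contract:
 assumes "alternating_on S (Suc (Suc k)) \<Phi>" "set ps \<subseteq> S \<times> S"
 shows "alternating_on S k (contract ps \<Phi>)" unfolding contract_def
 by (rule alternating_sum_list) (use assms in \<open>auto intro!: alternating_Cons\<close>)

lemma alternating_contract_pow:
 assumes "alternating_on S (k + 2 * j) \<Phi>" "set ps \<subseteq> S \<times> S"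
 shows "alternating_on S k ((contract ps ^^ j) \<Phi>)" using assms(1)
proof (induction j arbitrary: k)
 case (Suc j)
 then have "alternating_on S (Suc (Suc k)) ((contract ps ^^ j) \<Phi>)" by simp
 then show ?case using alternating_contract assms(2) by simp
qed simp

text \<open>Two transpositions form an even permutation; this is why contractions with two bivectors
  commute.\<close>

lemma alternating_swap_pairs:
 assumes w: "alternating_on S (length l + 4) \<Phi>" and S: "subspace S" and l: "set l \<subseteq> S"
  and abcd: "a \<in> S" "b \<in> S" "c \<in> S" "d \<in> S"
 shows "\<Phi> (a # b # c # d # l) = \<Phi> (c # d # a # b # l)"
proof -
 have "\<Phi> (a # b # c # d # l) = - \<Phi> (c # b # a # d # l)"
  using alternating_swap[OF w S, of "a # b # c # d # l" 0 2 a c] l abcd by (simp add: numeral_2_eq_2)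
 also have "\<dots> = \<Phi> (c # d # a # b # l)"
  using alternating_swap[OF w S, of "c # b # a # d # l" 1 3 b d] l abcd by (simp add: numeral_3_eq_3)
 finally show ?thesis .
qed

text \<open>Contraction with a single v wedge w squares to zero, since entries repeat, and it
  commutes with the contraction by \<open>ps\<close>. The binomial expansion of the
  \<open>j\<close>-th power therefore stops after the linear term. At \<open>j = 0\<close> the
  truncated \<open>j - 1\<close> is multiplied by zero.\<close>

lemma contract_pow_Cons:
 assumes S: "subspace S" and \<Phi>: "alternating_on S (k + 2 * j) \<Phi>" and ps: "set ((v, w) # ps) \<subseteq> S \<times> S"
  and l: "length l = k" "set l \<subseteq> S"
 shows "(contract ((v, w) # ps) ^^ j) \<Phi> l
  = (contract ps ^^ j) \<Phi> l + j * (contract ps ^^ (j - 1)) (\<lambda>l. \<Phi> (w # v # l)) l"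
 using \<Phi>
proof (induction j arbitrary: \<Phi>)
 case (Suc j)
 let ?C = "contract ps" and ?C1 = "\<lambda>\<Phi> l. \<Phi> (w # v # l)"
 have vw: "v \<in> S" "w \<in> S" and ps': "set ps \<subseteq> S \<times> S" using ps by auto
 have a0: "alternating_on S (Suc (Suc (k + 2 * j))) \<Phi>" using Suc.prems by simp
 have a1: "alternating_on S (k + 2 * j) (?C1 \<Phi>)" using a0 vw by (intro alternating_Cons)
 have a2: "alternating_on S (k + 2 * j) (?C \<Phi>)" using a0 ps' by (intro alternating_contract)
 have "(contract ((v, w) # ps) ^^ Suc j) \<Phi> l = (contract ((v, w) # ps) ^^ j) (\<lambda>l. ?C1 \<Phi> l + ?C \<Phi> l) l"
  by (simp add: funpow_Suc_right contract_Cons[abs_def] del: funpow.simps)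
 also have "\<dots> = (contract ((v, w) # ps) ^^ j) (?C1 \<Phi>) l + (contract ((v, w) # ps) ^^ j) (?C \<Phi>) l"
  by (rule contract_pow_add)
 also have "(contract ((v, w) # ps) ^^ j) (?C1 \<Phi>) l = (?C ^^ j) (?C1 \<Phi>) l"
 proof -
  have "j * (?C ^^ (j - 1)) (?C1 (?C1 \<Phi>)) l = 0"
  proof (cases j)
   case (Suc i)
   have "(?C ^^ i) (?C1 (?C1 \<Phi>)) l = (?C ^^ i) (\<lambda>_. 0) l"
   proof (rule contract_pow_cong[OF ps' _ l])
    fix l' assume "length l' = k + 2 * i" "set l' \<subseteq> S"
    then show "\<Phi> (w # v # w # v # l') = 0"
     using vw Suc by (intro alternating_eq[OF a0, of _ 0 2]) auto
   qed
   also have "\<dots> = 0" by (induction i arbitrary: l) (auto simp: contract_def comp_def split_def)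
   finally show ?thesis using Suc by simp
  qed simp
  then show ?thesis using Suc.IH[OF a1] by simp
 qed
 also have "(contract ((v, w) # ps) ^^ j) (?C \<Phi>) l = (?C ^^ Suc j) \<Phi> l + j * (?C ^^ j) (?C1 \<Phi>) l"
 proof -
  have "j * (?C ^^ (j - 1)) (?C1 (?C \<Phi>)) l = j * (?C ^^ j) (?C1 \<Phi>) l"
  proof (cases j)
   case (Suc i)
   have "(?C ^^ i) (?C1 (?C \<Phi>)) l = (?C ^^ i) (?C (?C1 \<Phi>)) l"
   proof (rule contract_pow_cong[OF ps' _ l])
    fix l' assume l': "length l' = k + 2 * i" "set l' \<subseteq> S"
    show "?C \<Phi> (w # v # l') = ?C (?C1 \<Phi>) l'" unfolding contract_def
    proof (intro arg_cong[of _ _ sum_list] map_cong[OF refl])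
     fix x assume "x \<in> set ps"
     then obtain v' w' where "x = (v', w')" "v' \<in> S" "w' \<in> S" using ps' by auto
     then show "(case x of (v', w') \<Rightarrow> \<Phi> (w' # v' # w # v # l')) = (case x of (v', w') \<Rightarrow> \<Phi> (w # v # w' # v' # l'))"
      using alternating_swap_pairs[OF _ S l'(2), of \<Phi> w' v' w v] a0 Suc l' vw by (simp add: numeral_eq_Suc)
    qed
   qed
   then show ?thesis using Suc by (simp add: funpow_swap1)
  qed simp
  then show ?thesis using Suc.IH[OF a2] by (simp add: funpow_swap1)
 qed
 finally show ?case by (simp add: algebra_simps)
qed simp

definition flatten_pairs :: "('v \<times> 'v) list \<Rightarrow> 'v list" where
 "flatten_pairs ps = concat (map (\<lambda>(v, w). [w, v]) ps)"

lemma flatten_pairs_simps [simp]: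
 "flatten_pairs [] = []" "flatten_pairs ((v, w) # ps) = w # v # flatten_pairs ps"
 by (simp_all add: flatten_pairs_def)

lemma length_flatten_pairs [simp]: "length (flatten_pairs ps) = 2 * length ps"
 by (induction ps) auto

lemma set_flatten_pairs: "set (flatten_pairs ps) = fst ` set ps \<union> snd ` set ps"
 by (induction ps) (auto, (force simp: image_iff)+)

text \<open>By \<open>contract_pow_Cons\<close> each pair can be used at most once, so there are not
  enough pairs for \<open>j\<close> contractions.\<close>

lemma contract_pow_zero:
 assumes S: "subspace S" and ps: "set ps \<subseteq> S \<times> S" and "j > length ps"
  and \<Phi>: "alternating_on S (k + 2 * j) \<Phi>" and l: "length l = k" "set l \<subseteq> S"
 shows "(contract ps ^^ j) \<Phi> l = 0" using ps assms(3) \<Phi>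
proof (induction ps arbitrary: j \<Phi>)
 case Nil
 then show ?case by (cases j) auto
next
 case (Cons p ps)
 obtain v w where p: "p = (v, w)" by fastforce
 obtain i where j: "j = Suc i" using Cons.prems(2) by (cases j) auto
 have "(contract ps ^^ i) (\<lambda>l. \<Phi> (w # v # l)) l = 0"
  by (rule Cons.IH) (use Cons.prems j p in \<open>auto intro!: alternating_Cons\<close>)
 moreover have "(contract ps ^^ j) \<Phi> l = 0" by (rule Cons.IH) (use Cons.prems in auto)
 ultimately show ?case
  using contract_pow_Cons[OF S Cons.prems(3)[unfolded j], of v w ps l] Cons.prems(1) l p j by simp
qed

text \<open>Every pair must be used exactly once, and the \<open>fact (length ps)\<close> orders of
  doing so all contribute the same value.\<close>

lemma contract_pow_length:
 assumes S: "subspace S" and ps: "set ps \<subseteq> S \<times> S"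
  and \<Phi>: "alternating_on S (k + 2 * length ps) \<Phi>" and l: "length l = k" "set l \<subseteq> S"
 shows "(contract ps ^^ length ps) \<Phi> l = fact (length ps) * \<Phi> (flatten_pairs ps @ l)"
 using ps \<Phi>
proof (induction ps arbitrary: \<Phi>)
 case (Cons p ps)
 obtain v w where p: "p = (v, w)" by fastforce
 have "(contract ps ^^ length ps) (\<lambda>l. \<Phi> (w # v # l)) l = fact (length ps) * \<Phi> (w # v # flatten_pairs ps @ l)"
  by (rule Cons.IH) (use Cons.prems p in \<open>auto intro!: alternating_Cons\<close>)
 moreover have "(contract ps ^^ Suc (length ps)) \<Phi> l = 0"
  by (rule contract_pow_zero[OF S _ _ _ l]) (use Cons.prems in auto)
 ultimately show ?case
  using contract_pow_Cons[OF S, of k "Suc (length ps)" \<Phi> v w ps l] Cons.prems l p by simp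
qed simp

text \<open>
 In the next lemmas \<open>bad\<close> lists are those on which the form vanishes for dimension reasons; as
 contraction only adds entries, they stay bad.
\<close>

lemma contract_pow_bad:
 assumes "\<And>x l. bad l \<Longrightarrow> bad (x # l)" "\<And>l. length l = k + 2 * j \<Longrightarrow> set l \<subseteq> S \<Longrightarrow> bad l \<Longrightarrow> \<Phi> l = 0"
  "set ps \<subseteq> S \<times> S" "length l = k" "set l \<subseteq> S" "bad l"
 shows "(contract ps ^^ j) \<Phi> l = 0" using assms(2,4-6)
proof (induction j arbitrary: l k)
 case (Suc j)
 have "(contract ps ^^ j) \<Phi> (w # v # l) = 0" if "(v, w) \<in> set ps" for v w
  by (rule Suc.IH[of "Suc (Suc k)"]) (use Suc.prems that assms(1,3) in auto)
 then have "contract ps ((contract ps ^^ j) \<Phi>) l = 0" by (intro contract_zero)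
 then show ?case by simp
qed simp

text \<open>\<open>Q\<close> marks the lists that turn bad as soon as one pair of \<open>qs\<close>
  is put in front. It survives further entries, so a pair of \<open>qs\<close> contributes nothing
  at any stage of the iteration.\<close>

lemma contract_pow_append_bad:
 assumes bad: "\<And>x l. bad l \<Longrightarrow> bad (x # l)" "\<And>l. length l = k + 2 * j \<Longrightarrow> set l \<subseteq> S \<Longrightarrow> bad l \<Longrightarrow> \<Phi> l = 0"
  and ps: "set ps \<subseteq> S \<times> S" "set qs \<subseteq> S \<times> S"
  and l: "length l = k" "set l \<subseteq> S" "Q l" "\<And>x l. Q l \<Longrightarrow> Q (x # l)"
   "\<And>v w l. Q l \<Longrightarrow> (v, w) \<in> set qs \<Longrightarrow> bad (w # v # l)"
 shows "(contract (ps @ qs) ^^ j) \<Phi> l = (contract ps ^^ j) \<Phi> l" using bad(2) l(1-3)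
proof (induction j arbitrary: l k)
 case (Suc j)
 have 1: "(contract (ps @ qs) ^^ j) \<Phi> (w # v # l) = (contract ps ^^ j) \<Phi> (w # v # l)" if "(v, w) \<in> set ps" for v w
  by (rule Suc.IH[of "Suc (Suc k)"]) (use Suc.prems that ps l(4) in auto)
 have 2: "(contract (ps @ qs) ^^ j) \<Phi> (w # v # l) = 0" if "(v, w) \<in> set qs" for v w
  by (rule contract_pow_bad[of bad "Suc (Suc k)" j S]) (use Suc.prems that ps l bad(1) in auto)
 have "contract (ps @ qs) ((contract (ps @ qs) ^^ j) \<Phi>) l
   = contract ps ((contract (ps @ qs) ^^ j) \<Phi>) l + contract qs ((contract (ps @ qs) ^^ j) \<Phi>) l"
  by (simp add: contract_def)
 also have "contract qs ((contract (ps @ qs) ^^ j) \<Phi>) l = 0" using 2 by (intro contract_zero)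
 also have "contract ps ((contract (ps @ qs) ^^ j) \<Phi>) l = contract ps ((contract ps ^^ j) \<Phi>) l"
  by (rule contract_cong) (rule 1)
 finally show ?case by simp
qed simp

section \<open>Foliated charts and local frames\<close>

text \<open>\<open>es\<close> is a basis of \<open>E\<close> and \<open>fs\<close> one of its
  orthogonal complement, so that membership in \<open>E\<close> becomes the vanishing of
  coordinates. Lists are used because the resulting frames are fed to forms, which take
  lists.\<close>

lemma orthonormal_split:
 fixes E :: "'e::euclidean_space set"
 assumes E: "subspace E"
 obtains es fs :: "'e list" where "distinct (es @ fs)"
  "\<And>a b. a \<in> set (es @ fs) \<Longrightarrow> b \<in> set (es @ fs) \<Longrightarrow> a \<bullet> b = (if a = b then 1 else 0)"
  "\<And>x. x = (\<Sum>b\<in>set (es @ fs). (x \<bullet> b) *\<^sub>R b)" "length es = dim E"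
  "\<And>x. x \<in> E \<longleftrightarrow> (\<forall>f\<in>set fs. x \<bullet> f = 0)"
proof -
 obtain B1 where B1: "B1 \<subseteq> E" "pairwise orthogonal B1" "\<And>x. x \<in> B1 \<Longrightarrow> norm x = 1"
   "independent B1" "card B1 = dim E" "span B1 = E" using orthonormal_basis_subspace[OF E] by metis
 obtain B2 where B2: "B2 \<subseteq> E\<^sup>\<bottom>" "pairwise orthogonal B2" "\<And>x. x \<in> B2 \<Longrightarrow> norm x = 1"
   "independent B2" "span B2 = E\<^sup>\<bottom>"
  using orthonormal_basis_subspace[OF subspace_orthogonal_comp[of E]] by metis
 have fin: "finite B1" "finite B2" using B1(4) B2(4) by (auto intro: independent_imp_finite)
 obtain es fs where l: "set es = B1" "distinct es" "set fs = B2" "distinct fs"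
  using finite_distinct_list fin by metis
 have perp: "x \<bullet> y = 0" if "x \<in> E" "y \<in> E\<^sup>\<bottom>" for x y
  using that by (auto simp: orthogonal_comp_def orthogonal_def)
 have disj: "B1 \<inter> B2 = {}"
 proof (rule ccontr)
  assume "B1 \<inter> B2 \<noteq> {}"
  then obtain x where x: "x \<in> B1" "x \<in> B2" by blast
  then have "x \<bullet> x = 0" using perp[of x x] B1(1) B2(1) by auto
  then show False using B1(3)[OF x(1)] by simp
 qed
 have on: "a \<bullet> b = (if a = b then 1 else 0)" if "a \<in> B1 \<union> B2" "b \<in> B1 \<union> B2" for a b
 proof (cases "a = b")
  case True
  then have "norm a = 1" using that B1(3) B2(3) by auto
  then show ?thesis using True by (simp add: dot_square_norm)
 next
  case False
  then show ?thesis using that B1(1,2) B2(1,2) perp[of a b] perp[of b a]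
   by (auto simp: pairwise_def orthogonal_def inner_commute subset_iff)
 qed
 have decomp: "\<exists>u\<in>E. \<exists>w\<in>E\<^sup>\<bottom>. x = u + w" for x
  using subspace_sum_orthogonal_comp[OF E] by (metis UNIV_I set_plus_elim)
 have expand: "x = (\<Sum>b\<in>B1 \<union> B2. (x \<bullet> b) *\<^sub>R b)" for x
 proof -
  obtain u w where "u \<in> E" "w \<in> E\<^sup>\<bottom>" "x = u + w" using decomp by blast
  then have "x \<in> span (B1 \<union> B2)"
   using B1(6) B2(5) span_mono[of B1 "B1 \<union> B2"] span_mono[of B2 "B1 \<union> B2"] by (auto intro!: span_add)
  moreover have "(\<Sum>b\<in>B1 \<union> B2. (x \<bullet> b) *\<^sub>R b) \<in> span (B1 \<union> B2)"
   by (intro span_sum span_scale span_base)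
  ultimately have s: "x - (\<Sum>b\<in>B1 \<union> B2. (x \<bullet> b) *\<^sub>R b) \<in> span (B1 \<union> B2)" (is "?r \<in> _") by (rule span_diff)
  have "orthogonal ?r c" if c: "c \<in> B1 \<union> B2" for c
  proof -
   have "(\<Sum>b\<in>B1 \<union> B2. (x \<bullet> b) *\<^sub>R b) \<bullet> c = (\<Sum>b\<in>B1 \<union> B2. if b = c then x \<bullet> b else 0)"
    unfolding inner_sum_left by (rule sum.cong) (use on c in auto)
   then show ?thesis using c fin by (simp add: orthogonal_def inner_diff_left)
  qed
  then have "orthogonal ?r ?r" by (rule orthogonal_to_span[OF s])
  then show ?thesis by (simp add: orthogonal_def)
 qed
 show ?thesis
 proof (rule that[of es fs])
  show "distinct (es @ fs)" using l disj by auto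
  show "length es = dim E" using l B1(5) distinct_card by metis
  fix x
  show "x = (\<Sum>b\<in>set (es @ fs). (x \<bullet> b) *\<^sub>R b)" using expand l by simp
  show "x \<in> E \<longleftrightarrow> (\<forall>f\<in>set fs. x \<bullet> f = 0)"
  proof
   assume "x \<in> E"
   then show "\<forall>f\<in>set fs. x \<bullet> f = 0" using perp B2(1) l by auto
  next
   assume *: "\<forall>f\<in>set fs. x \<bullet> f = 0"
   obtain u w where uw: "u \<in> E" "w \<in> E\<^sup>\<bottom>" "x = u + w" using decomp by blast
   have "orthogonal w f" if "f \<in> B2" for f
   proof -
    have "x \<bullet> f = 0" "u \<bullet> f = 0" using * l(3) that perp[OF uw(1), of f] B2(1) by auto
    then show ?thesis using uw(3) by (simp add: orthogonal_def inner_add_left)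
   qed
   then have "orthogonal w w" using orthogonal_to_span[of w B2 w] uw B2(5) by auto
   then show "x \<in> E" using uw by (simp add: orthogonal_def)
  qed
 qed (use on l in auto)
qed

context manifold
begin

text \<open>A foliated chart together with an orthonormal basis of the model space: coordinates
  along \<open>es\<close> parametrise the leaves, those along \<open>fs\<close> are constant on
  them. The tangent bundle itself is the case \<open>fs = []\<close>, so that leafwise lemmas also
  serve ordinary forms.\<close>

definition adapted_chart :: "'m distribution \<Rightarrow> 'm set \<Rightarrow> ('m \<Rightarrow> 'e) \<Rightarrow> 'e list \<Rightarrow> 'e list \<Rightarrow> bool" where
 "adapted_chart D U \<phi> es fs \<longleftrightarrow> (U, \<phi>) \<in> maximal_atlas A \<and> distinct (es @ fs) \<and>
   (\<forall>a\<in>set (es @ fs). \<forall>b\<in>set (es @ fs). a \<bullet> b = (if a = b then 1 else 0)) \<and>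
   (\<forall>x. x = (\<Sum>b\<in>set (es @ fs). (x \<bullet> b) *\<^sub>R b)) \<and>
   (\<forall>q\<in>U. D q = {v \<in> TM q. \<forall>f\<in>set fs. v (coord \<phi> f) = 0})"

lemma push_forward_inner:
 assumes c: "(U, \<phi>) \<in> maximal_atlas A" and q: "q \<in> U" and v: "v \<in> TM q"
 shows "push_forward \<phi> v \<bullet> b = v (coord \<phi> b)"
proof -
 have s: "smooth_at A q (coord \<phi> c)" for c
  using smooth_atI[OF chartD(1)[OF c] q Cinf_coordinate[OF c]] .
 have "v (coord \<phi> b) = v (\<lambda>p. \<Sum>c\<in>Basis. (b \<bullet> c) * (\<phi> p \<bullet> c))"
  by (subst euclidean_inner) (simp add: mult.commute)
 also have "\<dots> = (\<Sum>c\<in>Basis. v (\<lambda>p. (b \<bullet> c) * (\<phi> p \<bullet> c)))"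
  by (rule tangent_sum[OF v]) (intro smooth_at_mult smooth_at_const s)
 also have "\<dots> = push_forward \<phi> v \<bullet> b"
  by (simp add: push_forward_def inner_sum_left inner_sum_right tangent_cmult[OF v s] mult.commute inner_commute[of _ b])
 finally show ?thesis by simp
qed

lemma adapted_chart_exists:
 assumes "regular_foliation A D"
 obtains U \<phi> es fs where "adapted_chart D U \<phi> es fs" "p \<in> U"
proof -
 obtain U \<phi> E where c: "(U, \<phi>) \<in> maximal_atlas A" "p \<in> U" and E: "subspace E"
  and D: "\<And>q. q \<in> U \<Longrightarrow> D q = {v \<in> TM q. push_forward \<phi> v \<in> E}"
  using assms unfolding regular_foliation_def by meson
 obtain es fs :: "'e list" where l: "distinct (es @ fs)"
  "\<And>a b. a \<in> set (es @ fs) \<Longrightarrow> b \<in> set (es @ fs) \<Longrightarrow> a \<bullet> b = (if a = b then 1 else 0)"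
  "\<And>x. x = (\<Sum>b\<in>set (es @ fs). (x \<bullet> b) *\<^sub>R b)" "length es = dim E"
  "\<And>x. x \<in> E \<longleftrightarrow> (\<forall>f\<in>set fs. x \<bullet> f = 0)"
  by (rule orthonormal_split[OF E]) blast
 have "D q = {v \<in> TM q. \<forall>f\<in>set fs. v (coord \<phi> f) = 0}" if "q \<in> U" for q
  unfolding D[OF that] using l(5) push_forward_inner[OF c(1) that] by auto
 then have "adapted_chart D U \<phi> es fs" unfolding adapted_chart_def using c l(1,2) l(3) by blast
 then show ?thesis using c(2) by (rule that)
qed

lemma adapted_chartD:
 assumes "adapted_chart D U \<phi> es fs"
 shows adapted_chart_atlas: "(U, \<phi>) \<in> maximal_atlas A"
  and adapted_chart_open: "open U"
  and adapted_chart_distinct: "distinct (es @ fs)"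
  and adapted_chart_inner: "a \<in> set (es @ fs) \<Longrightarrow> b \<in> set (es @ fs) \<Longrightarrow> a \<bullet> b = (if a = b then 1 else 0)"
  and adapted_chart_basis: "x = (\<Sum>b\<in>set (es @ fs). (x \<bullet> b) *\<^sub>R b)"
  and adapted_chart_mem: "q \<in> U \<Longrightarrow> v \<in> D q \<longleftrightarrow> v \<in> TM q \<and> (\<forall>f\<in>set fs. v (coord \<phi> f) = 0)"
 using assms chartD(1) unfolding adapted_chart_def by blast+

lemma adapted_chart_total:
 "adapted_chart D U \<phi> es fs \<Longrightarrow> adapted_chart TM U \<phi> (es @ fs) []"
 unfolding adapted_chart_def by simp

lemma adapted_chart_length:
 assumes "adapted_chart D U \<phi> es fs"
 shows "length es + length fs = DIM('e)"
proof -
 note c = adapted_chartD[OF assms]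
 have "independent (set (es @ fs))" by (rule pairwise_orthogonal_independent)
   (use c(4) in \<open>auto simp: pairwise_def orthogonal_def simp del: set_append, fastforce\<close>)
 moreover have "span (set (es @ fs)) = UNIV"
 proof (rule UNIV_eq_I[symmetric])
  fix x :: 'e
  have "(\<Sum>b\<in>set (es @ fs). (x \<bullet> b) *\<^sub>R b) \<in> span (set (es @ fs))"
   by (intro span_sum span_scale span_base)
  then show "x \<in> span (set (es @ fs))" using c(5)[of x] by (simp only:)
 qed
 ultimately have "card (set (es @ fs)) = dim (UNIV :: 'e set)" by (metis dim_eq_card dim_span)
 then show ?thesis using distinct_card[OF c(3)] by simp
qed

context
 fixes D U \<phi> es fs
 assumes ac: "adapted_chart D U \<phi> es fs"
begin

lemmas acD = adapted_chartD[OF ac]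

lemma coordinate_smooth: "(coord \<phi> b) \<in> Cinf A U"
 by (rule Cinf_coordinate[OF acD(1)])

lemma coordinate_smooth_at: "q \<in> U \<Longrightarrow> smooth_at A q (coord \<phi> b)"
 by (rule smooth_atI[OF acD(2) _ coordinate_smooth])

lemma frame_coordinate: "q \<in> U \<Longrightarrow> coord_field U \<phi> e q (coord \<phi> b) = e \<bullet> b"
 by (rule coord_field_coordinate[OF acD(1)])

lemma frame_tangent: "q \<in> U \<Longrightarrow> coord_field U \<phi> e q \<in> TM q"
 by (rule coord_field_tangent[OF acD(1)])

lemma frame_vector_field: "coord_field U \<phi> e \<in> \<XX> U"
 by (rule coord_field_vector_field[OF acD(1)])

lemma coord_field_sum:
 "q \<in> U \<Longrightarrow> coord_field U \<phi> (\<Sum>b\<in>I. c b *\<^sub>R b) q = (\<Sum>b\<in>I. c b *\<^sub>R coord_field U \<phi> b q)"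
proof (induction I rule: infinite_finite_induct)
 case (insert b I)
 then show ?case using coord_field_linear[OF acD(1), of q "c b" b 1 "\<Sum>b\<in>I. c b *\<^sub>R b"] by simp
qed (use coord_field_linear[OF acD(1), of q 0 0 0 0] in auto)

lemma tangent_expand:
 assumes "q \<in> U" "v \<in> TM q"
 shows "v = (\<Sum>b\<in>set (es @ fs). v (coord \<phi> b) *\<^sub>R coord_field U \<phi> b q)"
proof -
 have "v = coord_field U \<phi> (push_forward \<phi> v) q" by (rule tangent_expand_chart[OF acD(1) assms])
 also have "push_forward \<phi> v = (\<Sum>b\<in>set (es @ fs). v (coord \<phi> b) *\<^sub>R b)"
  by (subst acD(5)[of "push_forward \<phi> v"]) (simp add: push_forward_inner[OF acD(1) assms] del: set_append)
 finally show ?thesis unfolding coord_field_sum[OF assms(1)] .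
qed

lemma tangent_eqI:
 assumes "q \<in> U" "v \<in> TM q" "w \<in> TM q"
  "\<And>b. b \<in> set (es @ fs) \<Longrightarrow> v (coord \<phi> b) = w (coord \<phi> b)"
 shows "v = w"
 using tangent_expand[OF assms(1,2)] tangent_expand[OF assms(1,3)] assms(4) by (simp del: set_append)

lemma leaf_expand:
 assumes "q \<in> U" "v \<in> D q"
 shows "v = (\<Sum>e\<in>set es. v (coord \<phi> e) *\<^sub>R coord_field U \<phi> e q)"
proof -
 have v: "v \<in> TM q" and "\<forall>f\<in>set fs. v (coord \<phi> f) = 0" using assms acD(6) by auto
 then have "(\<Sum>b\<in>set (es @ fs). v (coord \<phi> b) *\<^sub>R coord_field U \<phi> b q)
   = (\<Sum>e\<in>set es. v (coord \<phi> e) *\<^sub>R coord_field U \<phi> e q)"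
  by (intro sum.mono_neutral_right) auto
 then show ?thesis using tangent_expand[OF assms(1) v] by simp
qed

lemma frame_in_leaf: "q \<in> U \<Longrightarrow> e \<in> set es \<Longrightarrow> coord_field U \<phi> e q \<in> D q"
 using acD(3) acD(4)[of e] frame_coordinate frame_tangent by (auto simp: acD(6))

lemma frame_section: "e \<in> set es \<Longrightarrow> coord_field U \<phi> e \<in> sections A U D"
 using frame_in_leaf frame_vector_field by (simp add: sections_def)

lemma subspace_leaf: "q \<in> U \<Longrightarrow> subspace (D q)"
 using subspace_tangent_space[of q] by (auto simp: subspace_def acD(6))

lemma leaf_span: "q \<in> U \<Longrightarrow> D q = span (set (map (\<lambda>e. coord_field U \<phi> e q) es))"
proof (intro equalityI subsetI)
 fix v assume q: "q \<in> U"
 {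
  assume "v \<in> D q"
  from leaf_expand[OF q this] show "v \<in> span (set (map (\<lambda>e. coord_field U \<phi> e q) es))"
   by (subst \<open>v = _\<close>) (intro span_sum span_scale span_base, auto)
 next
  assume "v \<in> span (set (map (\<lambda>e. coord_field U \<phi> e q) es))"
  moreover have "set (map (\<lambda>e. coord_field U \<phi> e q) es) \<subseteq> D q" using frame_in_leaf[OF q] by auto
  ultimately show "v \<in> D q" using span_minimal[OF _ subspace_leaf[OF q]] by blast
 }
qed

lemma frame_injective:
 assumes "q \<in> U"
 shows "inj_on (\<lambda>e. coord_field U \<phi> e q) (set (es @ fs))"
proof (rule inj_onI)
 fix a b assume *: "a \<in> set (es @ fs)" "b \<in> set (es @ fs)" "coord_field U \<phi> a q = coord_field U \<phi> b q"
 then have "a \<bullet> b = b \<bullet> b" using frame_coordinate[OF assms, of a b] frame_coordinate[OF assms, of b b] by simp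
 then show "a = b" using acD(4)[OF *(1,2)] acD(4)[OF *(2,2)] by (simp split: if_splits)
qed

lemma frame_independent:
 assumes "q \<in> U"
 shows "independent ((\<lambda>e. coord_field U \<phi> e q) ` set (es @ fs))"
 unfolding dependent_finite[OF finite_imageI[OF finite_set]]
proof (intro notI, elim exE conjE)
 fix u
 assume u: "\<exists>v\<in>(\<lambda>e. coord_field U \<phi> e q) ` set (es @ fs). u v \<noteq> 0"
  and s: "(\<Sum>v\<in>(\<lambda>e. coord_field U \<phi> e q) ` set (es @ fs). u v *\<^sub>R v) = 0"
 let ?c = "\<lambda>e. coord_field U \<phi> e q"
 have "0 = (\<Sum>e\<in>set (es @ fs). u (?c e) *\<^sub>R ?c e)"
  using s sum.reindex[OF frame_injective[OF assms], of "\<lambda>v. u v *\<^sub>R v"] by (simp del: set_append)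
 then have "0 = (\<Sum>e\<in>set (es @ fs). u (?c e) *\<^sub>R ?c e) (coord \<phi> b)" for b by (metis zero_fun_apply)
 then have "0 = (\<Sum>e\<in>set (es @ fs). u (?c e) * (e \<bullet> b))" for b
  by (simp add: sum_fun_apply frame_coordinate[OF assms] del: set_append)
 moreover have "(\<Sum>e\<in>set (es @ fs). u (?c e) * (e \<bullet> b)) = u (?c b)" if b: "b \<in> set (es @ fs)" for b
 proof -
  have "(\<Sum>e\<in>set (es @ fs). u (?c e) * (e \<bullet> b)) = (\<Sum>e\<in>set (es @ fs). if e = b then u (?c e) else 0)"
   by (rule sum.cong) (use acD(4) b in auto)
  then show ?thesis using b by (simp del: set_append)
 qed
 ultimately show False using u by auto
qed

lemma dim_leaf:
 assumes "q \<in> U"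
 shows "dim (D q) = length es"
proof -
 let ?c = "\<lambda>e. coord_field U \<phi> e q"
 have "independent (?c ` set es)" using independent_mono[OF frame_independent[OF assms]] by (simp add: image_Un)
 moreover have "inj_on ?c (set es)" using inj_on_subset[OF frame_injective[OF assms]] by simp
 ultimately have "dim (span (?c ` set es)) = card (set es)" by (simp add: dim_eq_card_independent card_image)
 then show ?thesis using leaf_span[OF assms] distinct_card[of es] acD(3) by simp
qed

lemma bracket_frame_zero:
 assumes "q \<in> U"
 shows "bracket (coord_field U \<phi> a) (coord_field U \<phi> b) q = 0"
proof (rule tangent_eqI[OF assms])
 show "bracket (coord_field U \<phi> a) (coord_field U \<phi> b) q \<in> TM q"
  by (rule lie_bracket_tangent[OF frame_vector_field frame_vector_field acD(2) assms])
 show "0 \<in> TM q" by (rule subspace_0[OF subspace_tangent_space])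
 fix c
 have "coord_field U \<phi> d q (\<lambda>q. coord_field U \<phi> e q (coord \<phi> c)) = 0" for d e
  using tangent_cong[OF frame_tangent[OF assms, of d] acD(2) assms frame_coordinate]
   tangent_const[OF frame_tangent[OF assms, of d]] by simp
 then show "bracket (coord_field U \<phi> a) (coord_field U \<phi> b) q (coord \<phi> c) = 0 (coord \<phi> c)"
  by (simp add: lie_bracket_apply[OF coordinate_smooth_at[OF assms]])
qed

end

lemma fol_rank_eq:
 assumes "regular_foliation A D"
 shows "dim (D p) = fol_rank D"
proof -
 obtain r where "\<And>p. dim (D p) = r" using assms unfolding regular_foliation_def by blast
 then have "(\<forall>p. dim (D p) = k) \<longleftrightarrow> k = r" for k by auto
 then show ?thesis using \<open>\<And>p. dim (D p) = r\<close> by (simp add: fol_rank_def)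
qed

lemma adapted_chart_rank:
 assumes "regular_foliation A D" "adapted_chart D U \<phi> es fs" "U \<noteq> {}"
 shows "length es = fol_rank D"
 using dim_leaf[OF assms(2)] fol_rank_eq[OF assms(1)] assms(3) by (metis ex_in_conv)

lemma regular_foliation_total: "regular_foliation A TM"
proof -
 have 1: "\<exists>U \<phi>. (U, \<phi>) \<in> maximal_atlas A \<and> p \<in> U" for p
  using chart_exists[of p] atlas_subset by (metis subsetD)
 obtain es fs :: "'e list" where l: "distinct (es @ fs)"
  "\<And>a b. a \<in> set (es @ fs) \<Longrightarrow> b \<in> set (es @ fs) \<Longrightarrow> a \<bullet> b = (if a = b then 1 else 0)"
  "\<And>x. x = (\<Sum>b\<in>set (es @ fs). (x \<bullet> b) *\<^sub>R b)" "length es = dim (UNIV :: 'e set)"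
  "\<And>x. x \<in> UNIV \<longleftrightarrow> (\<forall>f\<in>set fs. x \<bullet> f = 0)"
  by (rule orthonormal_split[OF subspace_UNIV]) blast
 have "dim (TM p) = DIM('e)" for p
 proof -
  obtain U \<phi> where c: "(U, \<phi>) \<in> maximal_atlas A" "p \<in> U" using 1 by blast
  then have ac: "adapted_chart TM U \<phi> (es @ fs) []"
   unfolding adapted_chart_def using l(1,2) l(3) by simp
  show ?thesis using dim_leaf[OF ac c(2)] adapted_chart_length[OF ac] by simp
 qed
 then show ?thesis
  unfolding regular_foliation_def using 1 by (metis (mono_tags, lifting) Collect_mem_eq Collect_cong UNIV_I subspace_UNIV)
qed

lemma regular_foliation_subspace: "regular_foliation A D \<Longrightarrow> subspace (D q)"
 using adapted_chart_exists[of D q] subspace_leaf by metis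

lemma regular_foliation_tangent: "regular_foliation A D \<Longrightarrow> v \<in> D q \<Longrightarrow> v \<in> TM q"
 using adapted_chart_exists[of D q] acD(6) by metis

lemma fol_rank_total: "fol_rank TM = DIM('e)"
proof -
 obtain U \<phi> es fs where ac: "adapted_chart TM U \<phi> es fs" "undefined \<in> U"
  using adapted_chart_exists[OF regular_foliation_total] by blast
 then have ac': "adapted_chart TM U \<phi> (es @ fs) []" using adapted_chart_total by blast
 have "U \<noteq> {}" using ac(2) by auto
 then show ?thesis
  using adapted_chart_rank[OF regular_foliation_total ac'] adapted_chart_length[OF ac'] by simp
qed

text \<open>The derivation axioms contain a product rule but no chain rule; the latter is obtained
  by writing \<open>v\<close> as a directional derivative in a chart.\<close>

lemma tangent_apply_ln:
 assumes v: "v \<in> TM p" and f: "smooth_at A p f" "f p \<noteq> 0"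
 shows "v (\<lambda>q. ln (f q)) = v f / f p"
proof -
 obtain U \<phi> where c: "(U, \<phi>) \<in> A" "p \<in> U" by (rule chart_exists)
 then have c': "(U, \<phi>) \<in> maximal_atlas A" using atlas_subset by auto
 obtain W where W: "open W" "p \<in> W" "W \<subseteq> U" "f \<in> Cinf A W" using smooth_atE[OF f(1) chartD(1)[OF c'] c(2)] .
 have cW: "continuous_on (\<phi> ` W) (\<lambda>x. f (inv_into U \<phi> x))"
  using Cinf_chart[OF c' W(1,3)] W(4) by (simp add: smooth_on_def Ck_on_imp_continuous_on)
 have "continuous_on W f"
 proof (rule continuous_on_eq)
  show "continuous_on W (\<lambda>q. f (inv_into U \<phi> (\<phi> q)))"
   by (rule continuous_on_compose2[OF cW continuous_on_subset[OF chartD(6)[OF c'] W(3)]]) auto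
 qed (use W(3) chartD(3)[OF c'] in auto)
 then have "open (W \<inter> f -` (- {0}))" using W(1) by (intro continuous_open_preimage) auto
 then have N: "open (W \<inter> f -` (- {0}))" "p \<in> W \<inter> f -` (- {0})" (is "p \<in> ?N") using W(2) f(2) by auto
 have "f \<in> Cinf A ?N" by (rule Cinf_mono[OF W(4)]) auto
 then have ln: "smooth_at A p (\<lambda>q. ln (f q))" by (intro smooth_atI[OF N] Cinf_ln[OF N(1)]) auto
 obtain w where x: "v = coord_field U \<phi> w p" using tangent_expand_chart[OF c' c(2) v] by blast
 have "((\<lambda>x. ln (f (inv_into U \<phi> x))) has_derivative
   (\<lambda>e. coord_field U \<phi> e p f * inverse (f (inv_into U \<phi> (\<phi> p))))) (at (\<phi> p))"
  by (rule DERIV_compose_FDERIV[OF DERIV_ln_nonzero chart_has_derivative[OF c' c(2) f(1)]])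
   (use chartD(3)[OF c' c(2)] f(2) in simp)
 from coord_field_eqI[OF c' c(2) ln this] show ?thesis
  unfolding x using chartD(3)[OF c' c(2)] by (simp add: divide_inverse)
qed

lemma lie_bracket_skew: "bracket X Y p = - bracket Y X p"
 by (rule ext) (simp add: lie_bracket_def)

lemma lie_bracket_sum:
 assumes X: "X \<in> \<XX> U" and Y: "\<And>i. i \<in> I \<Longrightarrow> Y i \<in> \<XX> U"
  and c: "\<And>i. i \<in> I \<Longrightarrow> c i \<in> Cinf A U" and U: "open U" "p \<in> U"
 shows "bracket X (\<lambda>q. \<Sum>i\<in>I. c i q *\<^sub>R Y i q) p
  = (\<Sum>i\<in>I. c i p *\<^sub>R bracket X (Y i) p + X p (c i) *\<^sub>R Y i p)"
proof
 fix f
 show "bracket X (\<lambda>q. \<Sum>i\<in>I. c i q *\<^sub>R Y i q) p f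
  = (\<Sum>i\<in>I. c i p *\<^sub>R bracket X (Y i) p + X p (c i) *\<^sub>R Y i p) f"
 proof (cases "smooth_at A p f")
  case False
  then show ?thesis using tangent_nonsmooth[OF vector_field_tangent[OF Y U(2)]]
   by (simp add: lie_bracket_def sum_fun_apply)
 next
  case True
  note Xp = vector_field_tangent[OF X U(2)]
  have sc: "smooth_at A p (c i)" if "i \<in> I" for i using smooth_atI[OF U c[OF that]] .
  have sY: "smooth_at A p (\<lambda>q. Y i q f)" if "i \<in> I" for i by (rule smooth_at_vector_field[OF Y[OF that] U True])
  have "X p (\<lambda>q. (\<Sum>i\<in>I. c i q *\<^sub>R Y i q) f) = X p (\<lambda>q. \<Sum>i\<in>I. c i q * Y i q f)"
   by (simp add: sum_fun_apply)
  also have "\<dots> = (\<Sum>i\<in>I. X p (\<lambda>q. c i q * Y i q f))"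
   by (rule tangent_sum[OF Xp]) (intro smooth_at_mult sc sY)
  also have "\<dots> = (\<Sum>i\<in>I. c i p * X p (\<lambda>q. Y i q f) + Y i p f * X p (c i))"
   by (rule sum.cong[OF refl]) (rule tangent_mult[OF Xp sc sY])
  finally show ?thesis
   using True by (simp add: lie_bracket_apply sum_fun_apply sum_subtractf[symmetric] algebra_simps)
 qed
qed

lemma lie_bracket_add:
 assumes "X \<in> \<XX> U" "Y \<in> \<XX> U" "Z \<in> \<XX> U" "open U" "p \<in> U"
 shows "bracket X (\<lambda>q. Y q + Z q) p = bracket X Y p + bracket X Z p"
proof -
 have [simp]: "X p (\<lambda>q. 1) = 0" using tangent_const[OF vector_field_tangent[OF assms(1,5)]] .
 \<comment> \<open>Two summands are written as a sum over the type \<open>bool\<close>, which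
   reduces additivity to \<open>lie_bracket_sum\<close> with constant coefficients.\<close>
 have "bracket X (\<lambda>q. \<Sum>i\<in>UNIV. (\<lambda>_. 1) q *\<^sub>R (if i then Y else Z) q) p
  = (\<Sum>i\<in>UNIV. (\<lambda>_. 1) p *\<^sub>R bracket X (if i then Y else Z) p + X p (\<lambda>_. 1) *\<^sub>R (if i then Y else Z) p)"
  by (rule lie_bracket_sum) (use assms Cinf_const in auto)
 then show ?thesis by (simp add: UNIV_bool add.commute)
qed

lemma lie_bracket_cong:
 assumes X: "X \<in> \<XX> U" and Y: "Y \<in> \<XX> U"
  and W: "open U" "p \<in> U" "\<And>q. q \<in> U \<Longrightarrow> X q = X' q" "\<And>q. q \<in> U \<Longrightarrow> Y q = Y' q"
 shows "bracket X Y p = bracket X' Y' p"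
proof -
 have "X p (\<lambda>q. Y q f) = X p (\<lambda>q. Y' q f)" for f
  by (rule tangent_cong[OF vector_field_tangent[OF X W(2)] W(1,2)]) (simp add: W(4))
 moreover have "Y p (\<lambda>q. X q f) = Y p (\<lambda>q. X' q f)" for f
  by (rule tangent_cong[OF vector_field_tangent[OF Y W(2)] W(1,2)]) (simp add: W(3))
 ultimately show ?thesis using W(3)[OF W(2)] W(4)[OF W(2)] by (intro ext) (simp add: lie_bracket_def)
qed

end

text \<open>The wedge product of the listed functionals, i.e. a determinant expanded along its first
  row.\<close>

primrec coframe_form :: "('v \<Rightarrow> real) list \<Rightarrow> 'v list \<Rightarrow> real" where
 "coframe_form [] = (\<lambda>l. 1)"
| "coframe_form (\<alpha> # \<alpha>s) = alt_lift (\<lambda>u l. \<alpha> u * coframe_form \<alpha>s l)"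

lemma alternating_coframe_form:
 assumes "subspace S" "\<And>\<alpha>. \<alpha> \<in> set \<alpha>s \<Longrightarrow> linear_functional_on S \<alpha>"
 shows "alternating_on S (length \<alpha>s) (coframe_form \<alpha>s)" using assms(2)
proof (induction \<alpha>s)
 case Nil
 show ?case by (rule alternatingI) auto
next
 case (Cons \<alpha> \<alpha>s)
 have a: "alternating_on S (length \<alpha>s) (coframe_form \<alpha>s)" using Cons by simp
 have "alternating_on S (Suc (length \<alpha>s)) (alt_lift (\<lambda>u l. \<alpha> u * coframe_form \<alpha>s l))"
 proof (rule alternating_alt_lift[OF assms(1)])
  show "alternating_on S (length \<alpha>s) (\<lambda>l. \<alpha> u * coframe_form \<alpha>s l)" for u
   using alternating_lincomb[OF a a, of "\<alpha> u" 0] by simp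
  fix u v a b l
  assume "u \<in> S" "v \<in> S"
  then show "\<alpha> (a *\<^sub>R u + b *\<^sub>R v) * coframe_form \<alpha>s l = a * (\<alpha> u * coframe_form \<alpha>s l) + b * (\<alpha> v * coframe_form \<alpha>s l)"
   using Cons.prems[of \<alpha>] by (simp add: linear_functional_on_def algebra_simps)
 qed
 then show ?case by simp
qed

lemma coframe_form_dual:
 assumes "length us = length \<alpha>s" "\<And>i j. i < length \<alpha>s \<Longrightarrow> j < length \<alpha>s \<Longrightarrow> (\<alpha>s ! i) (us ! j) = (if i = j then 1 else 0)"
 shows "coframe_form \<alpha>s us = 1" using assms
proof (induction \<alpha>s arbitrary: us)
 case (Cons \<alpha> \<alpha>s)
 then obtain u vs where us: "us = u # vs" "length vs = length \<alpha>s" by (cases us) auto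
 have 0: "\<alpha> (us ! i) = (if i = 0 then 1 else 0)" if "i < length us" for i
  using Cons.prems(2)[of 0 i] Cons.prems(1) that by (simp del: nth_Cons_Suc)
 have "coframe_form (\<alpha> # \<alpha>s) us = (\<Sum>i\<in>{0}. (- 1) ^ i * (\<alpha> (us ! i) * coframe_form \<alpha>s (remove_nth i us)))"
  unfolding coframe_form.simps alt_lift_def by (rule sum.mono_neutral_right) (use 0 Cons.prems(1) in auto)
 moreover have "coframe_form \<alpha>s vs = 1"
 proof (rule Cons.IH[OF us(2)])
  fix i j assume "i < length \<alpha>s" "j < length \<alpha>s"
  then show "(\<alpha>s ! i) (vs ! j) = (if i = j then 1 else 0)"
   using Cons.prems(2)[of "Suc i" "Suc j"] us by simp
 qed
 ultimately show ?case using Cons.prems(2)[of 0 0] us by (simp add: remove_nth_Cons_0)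
qed simp

lemma sum_lessThan_add: "(\<Sum>i<m + k. f i) = (\<Sum>i<m. f i) + (\<Sum>i<k. f (m + i :: nat) :: 'a::comm_monoid_add)"
 by (induction k) (auto simp: add.assoc)

lemma independent_Un_complement:
 assumes "finite B" "finite C" "independent B" "independent C" "span B \<inter> span C = {0}"
 shows "independent (B \<union> C)" "B \<inter> C = {}"
proof -
 show disj: "B \<inter> C = {}"
  using assms(3,5) span_base dependent_zero by (metis IntI disjoint_iff singletonD)
 show "independent (B \<union> C)" unfolding dependent_finite[OF finite_UnI[OF assms(1,2)]]
 proof (intro notI, elim exE conjE)
  fix u assume u: "\<exists>v\<in>B \<union> C. u v \<noteq> 0" and s: "(\<Sum>v\<in>B \<union> C. u v *\<^sub>R v) = 0"
  let ?b = "\<Sum>v\<in>B. u v *\<^sub>R v" and ?c = "\<Sum>v\<in>C. u v *\<^sub>R v"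
  have bc: "?b + ?c = 0" using s sum.union_disjoint[OF assms(1,2) disj, of "\<lambda>v. u v *\<^sub>R v"] by simp
  have "?b \<in> span B" "?c \<in> span C" by (intro span_sum span_scale span_base, assumption)+
  moreover have "?b = - ?c" using bc by (simp add: eq_neg_iff_add_eq_0)
  ultimately have "?b \<in> span B \<inter> span C" using span_neg[of ?c C] by auto
  then have "?b = 0" "?c = 0" using assms(5) bc by auto
  then show False using u assms(1-4) unfolding independent_alt dependent_finite[OF assms(1)] dependent_finite[OF assms(2)] by blast
 qed
qed

context manifold
begin

section \<open>Forms on a manifold\<close>

lemma Cinf_transform:
 "f \<in> Cinf A W \<Longrightarrow> open W \<Longrightarrow> (\<And>p. p \<in> W \<Longrightarrow> f p = g p) \<Longrightarrow> g \<in> Cinf A W"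
 using Cinf_cong[of W f g] by simp

lemma kforms_alternating: "\<omega> \<in> kforms A D k \<Longrightarrow> alternating_on (D p) k (\<omega> p)"
 unfolding kforms_def by blast

lemma kforms_smooth:
 "\<omega> \<in> kforms A D k \<Longrightarrow> open W \<Longrightarrow> length Xs = k \<Longrightarrow> set Xs \<subseteq> sections A W D \<Longrightarrow>
  (\<lambda>p. \<omega> p (at_point Xs p)) \<in> Cinf A W" unfolding kforms_def by blast

lemma sections_total: "sections A U TM = \<XX> U"
 by (auto simp: sections_def vector_fields_def)

lemma at_point_update: "at_point (Xs[i := X]) p = (at_point Xs p)[i := X p]"
 by (simp add: at_point_def map_update)

lemma length_at_point [simp]: "length (at_point Xs p) = length Xs"
 by (simp add: at_point_def)

lemma nth_at_point: "i < length Xs \<Longrightarrow> at_point Xs p ! i = (Xs ! i) p"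
 by (simp add: at_point_def)

lemma at_point_sections: "set Xs \<subseteq> sections A U D \<Longrightarrow> p \<in> U \<Longrightarrow> set (at_point Xs p) \<subseteq> D p"
 by (auto simp: at_point_def sections_def)

lemma at_point_vector_fields: "set Xs \<subseteq> \<XX> U \<Longrightarrow> p \<in> U \<Longrightarrow> set (at_point Xs p) \<subseteq> TM p"
 by (auto simp: at_point_def vector_fields_def)

lemma vector_fields_local:
 assumes "open U" "\<And>p. p \<in> U \<Longrightarrow> \<exists>W. open W \<and> p \<in> W \<and> X \<in> \<XX> W"
 shows "X \<in> \<XX> U" unfolding vector_fields_def
proof (intro CollectI conjI ballI allI impI)
 fix p assume "p \<in> U"
 then show "X p \<in> TM p" using assms(2) vector_field_tangent by blast
next
 fix W f assume W: "open W" "W \<subseteq> U" "f \<in> Cinf A W"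
 show "(\<lambda>p. X p f) \<in> Cinf A W"
 proof (rule Cinf_local[OF W(1)])
  fix p assume p: "p \<in> W"
  then obtain V where V: "open V" "p \<in> V" "X \<in> \<XX> V" using assms(2) W(2) by blast
  have "(\<lambda>p. X p f) \<in> Cinf A (W \<inter> V)"
   by (rule vector_field_smooth[OF V(3)]) (use W V Cinf_mono[OF W(3)] in auto)
  then show "\<exists>V. open V \<and> p \<in> V \<and> (\<lambda>p. X p f) \<in> Cinf A V" using p V W by blast
 qed
qed

lemma vector_fields_cong:
 assumes "open U" "X \<in> \<XX> U" "\<And>p. p \<in> U \<Longrightarrow> X p = Y p"
 shows "Y \<in> \<XX> U" unfolding vector_fields_def
proof (intro CollectI conjI ballI allI impI)
 fix p assume "p \<in> U"
 then show "Y p \<in> TM p" using assms vector_field_tangent[of X U p] by auto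
next
 fix W f assume W: "open W" "W \<subseteq> U" "f \<in> Cinf A W"
 have "X p f = Y p f" if "p \<in> W" for p using assms(3) W(2) that by auto
 then show "(\<lambda>p. Y p f) \<in> Cinf A W"
  using vector_field_smooth[OF assms(2) W] Cinf_cong[OF W(1), of "\<lambda>p. X p f" "\<lambda>p. Y p f"] by blast
qed

lemma frame_list_sections:
 "adapted_chart D U \<phi> es fs \<Longrightarrow> set (map (coord_field U \<phi>) es) \<subseteq> sections A U D"
 using frame_section by auto

lemma frame_list_span:
 "adapted_chart D U \<phi> es fs \<Longrightarrow> q \<in> U \<Longrightarrow> D q = span (set (frame_at U \<phi> es q))"
 using leaf_span by (simp add: at_point_def comp_def)

lemma leafwise_volume_form_frame:
 assumes "regular_foliation A D" "leafwise_volume_form A D \<tau>" "adapted_chart D U \<phi> es fs" "q \<in> U"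
 shows "\<tau> q (frame_at U \<phi> es q) \<noteq> 0"
proof -
 have \<tau>: "\<tau> \<in> kforms A D (fol_rank D)" "nowhere_vanishing D (fol_rank D) \<tau>"
  using assms(2) unfolding leafwise_volume_form_def by auto
 obtain vs where "length vs = fol_rank D" "set vs \<subseteq> D q" "\<tau> q vs \<noteq> 0"
  using \<tau>(2) unfolding nowhere_vanishing_def by blast
 moreover have "length es = fol_rank D" using adapted_chart_rank[OF assms(1,3)] assms(4) by auto
 ultimately show ?thesis
  using alternating_top_nonzero[OF kforms_alternating[OF \<tau>(1)] subspace_leaf[OF assms(3,4)]
    frame_list_span[OF assms(3,4)]] by simp
qed

text \<open>Pointwise proportionality is \<open>alternating_top_ratio\<close>. Since \<tau> is
  nowhere zero the factor is unique, so it equals the quotient of the two values on any local frame,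
  and these quotients are smooth.\<close>

lemma form_ratio:
 assumes D: "regular_foliation A D" and \<tau>: "leafwise_volume_form A D \<tau>" and \<omega>: "\<omega> \<in> kforms A D (fol_rank D)"
 obtains a where "a \<in> Cinf A UNIV"
  "\<And>p vs. length vs = fol_rank D \<Longrightarrow> set vs \<subseteq> D p \<Longrightarrow> \<omega> p vs = a p * \<tau> p vs"
proof -
 have \<tau>k: "\<tau> \<in> kforms A D (fol_rank D)" using \<tau> unfolding leafwise_volume_form_def by auto
 have frame: "\<omega> q vs = \<omega> q (frame_at U \<phi> es q) / \<tau> q (frame_at U \<phi> es q) * \<tau> q vs"
  if "adapted_chart D U \<phi> es fs" "q \<in> U" "length vs = fol_rank D" "set vs \<subseteq> D q" for U \<phi> es fs q vs
 proof -
  have "length es = fol_rank D" using adapted_chart_rank[OF D that(1)] that(2) by auto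
  then have "\<omega> q vs * \<tau> q (frame_at U \<phi> es q) = \<omega> q (frame_at U \<phi> es q) * \<tau> q vs"
   by (intro alternating_top_ratio[OF kforms_alternating[OF \<omega>] kforms_alternating[OF \<tau>k] subspace_leaf[OF that(1,2)]
    frame_list_span[OF that(1,2)] _ that(3,4)]) simp
  then show ?thesis using leafwise_volume_form_frame[OF D \<tau> that(1,2)] by (simp add: field_simps)
 qed
 have "\<exists>c. \<forall>vs. length vs = fol_rank D \<longrightarrow> set vs \<subseteq> D p \<longrightarrow> \<omega> p vs = c * \<tau> p vs" for p
 proof -
  obtain U \<phi> es fs where "adapted_chart D U \<phi> es fs" "p \<in> U" using adapted_chart_exists[OF D] .
  from frame[OF this] show ?thesis by blast
 qed
 then obtain a where a: "\<And>p vs. length vs = fol_rank D \<Longrightarrow> set vs \<subseteq> D p \<Longrightarrow> \<omega> p vs = a p * \<tau> p vs" by metis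
 have "a \<in> Cinf A UNIV"
 proof (rule Cinf_local[OF open_UNIV])
  fix p
  obtain U \<phi> es fs where ac: "adapted_chart D U \<phi> es fs" and p: "p \<in> U" using adapted_chart_exists[OF D] .
  let ?E = "map (coord_field U \<phi>) es"
  have l: "length ?E = fol_rank D" using adapted_chart_rank[OF D ac] p by auto
  have U: "open U" by (rule acD(2)[OF ac])
  have nz: "\<tau> q (at_point ?E q) \<noteq> 0" if "q \<in> U" for q by (rule leafwise_volume_form_frame[OF D \<tau> ac that])
  have "(\<lambda>q. \<omega> q (at_point ?E q) / \<tau> q (at_point ?E q)) \<in> Cinf A U"
   by (rule Cinf_divide[OF U kforms_smooth[OF \<omega> U l frame_list_sections[OF ac]]
     kforms_smooth[OF \<tau>k U l frame_list_sections[OF ac]] nz])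
  moreover have "\<omega> q (at_point ?E q) / \<tau> q (at_point ?E q) = a q" if "q \<in> U" for q
   using a[of "at_point ?E q" q] nz[OF that] l at_point_sections[OF frame_list_sections[OF ac] that] by simp
  ultimately have "a \<in> Cinf A U" by (rule Cinf_transform[OF _ U])
  then show "\<exists>V. open V \<and> p \<in> V \<and> a \<in> Cinf A V" using U p by blast
 qed
 then show ?thesis using a by (rule that)
qed

section \<open>Coordinate volume, Cramer's rule and splittings of the tangent bundle\<close>

definition chart_volume :: "('m \<Rightarrow> 'e) \<Rightarrow> 'e list \<Rightarrow> 'm tangent list \<Rightarrow> real" where
 "chart_volume \<phi> bs = coframe_form (map (\<lambda>b v. v (coord \<phi> b)) bs)"

lemma alternating_chart_volume: "alternating_on (TM q) (length bs) (chart_volume \<phi> bs)"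
 unfolding chart_volume_def
proof -
 have "linear_functional_on (TM q) \<alpha>" if "\<alpha> \<in> set (map (\<lambda>b v. v (coord \<phi> b)) bs)" for \<alpha>
  using that by (auto simp: linear_functional_on_def)
 then show "alternating_on (TM q) (length bs) (coframe_form (map (\<lambda>b v. v (coord \<phi> b)) bs))"
  using alternating_coframe_form[OF subspace_tangent_space, of "map (\<lambda>b v. v (coord \<phi> b)) bs" q]
  by (metis length_map)
qed

lemma chart_volume_smooth:
 assumes c: "(U, \<phi>) \<in> maximal_atlas A" and W: "open W" "W \<subseteq> U" and Xs: "set Xs \<subseteq> \<XX> W"
 shows "(\<lambda>q. chart_volume \<phi> bs (at_point Xs q)) \<in> Cinf A W"
 using Xs unfolding chart_volume_def
proof (induction bs arbitrary: Xs)
 case Nil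
 then show ?case by (simp add: Cinf_const)
next
 case (Cons b bs)
 have "(\<lambda>q. \<Sum>i<length Xs. (- 1) ^ i * ((Xs ! i) q (coord \<phi> b) *
   coframe_form (map (\<lambda>b v. v (coord \<phi> b)) bs) (at_point (remove_nth i Xs) q))) \<in> Cinf A W"
 proof (intro Cinf_sum[OF W(1)] Cinf_mult[OF W(1)] Cinf_const)
  fix i assume "i \<in> {..<length Xs}"
  then have "Xs ! i \<in> \<XX> W" using Cons.prems by auto
  then show "(\<lambda>q. (Xs ! i) q (coord \<phi> b)) \<in> Cinf A W"
   by (rule vector_field_smooth[OF _ W(1) order.refl Cinf_mono[OF Cinf_coordinate[OF c] W(2)]])
  show "(\<lambda>q. coframe_form (map (\<lambda>b v. v (coord \<phi> b)) bs) (at_point (remove_nth i Xs) q)) \<in> Cinf A W"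
   by (rule Cons.IH) (use Cons.prems set_remove_nth[of i Xs] in blast)
 qed
 then show ?case by (simp add: alt_lift_def at_point_remove_nth nth_at_point)
qed

lemma chart_volume_frame:
 assumes ac: "adapted_chart TM U \<phi> bs []" and q: "q \<in> U"
 shows "chart_volume \<phi> bs (at_point (map (coord_field U \<phi>) bs) q) = 1" unfolding chart_volume_def
proof (rule coframe_form_dual)
 fix i j assume "i < length (map (\<lambda>b v. v (coord \<phi> b)) bs)" "j < length (map (\<lambda>b v. v (coord \<phi> b)) bs)"
 then have ij: "i < length bs" "j < length bs" by auto
 have "bs ! j \<bullet> bs ! i = (if i = j then 1 else 0)"
  using acD(4)[OF ac, of "bs ! j" "bs ! i"] ij acD(3)[OF ac] nth_eq_iff_index_eq[of bs] by auto
 then show "(map (\<lambda>b v. v (coord \<phi> b)) bs ! i) (at_point (map (coord_field U \<phi>) bs) q ! j) = (if i = j then 1 else 0)"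
  using ij frame_coordinate[OF ac q] by (simp add: nth_at_point)
qed simp

lemma chart_volume_nonzero:
 assumes ac: "adapted_chart TM U \<phi> bs []" and q: "q \<in> U"
  and us: "length us = length bs" "TM q = span (set us)"
 shows "chart_volume \<phi> bs us \<noteq> 0"
 by (rule alternating_top_nonzero[OF alternating_chart_volume subspace_tangent_space us(2,1),
    of "at_point (map (coord_field U \<phi>) bs) q"])
  (use chart_volume_frame[OF ac q] at_point_vector_fields[of "map (coord_field U \<phi>) bs" U q]
   frame_vector_field[OF ac] q in auto)

text \<open>Cramer's rule: replacing the \<open>i\<close>-th frame vector by \<open>X\<close>
  multiplies the coordinate volume of the frame by \<open>c i\<close>, so the coefficient is a
  quotient of smooth functions.\<close>

lemma frame_coefficient_smooth:
 assumes U: "open U" and Es: "set Es \<subseteq> \<XX> U" "length Es = DIM('e)"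
  and span: "\<And>q. q \<in> U \<Longrightarrow> TM q = span (set (at_point Es q))"
  and X: "X \<in> \<XX> U" "\<And>q. q \<in> U \<Longrightarrow> X q = (\<Sum>i<length Es. c i q *\<^sub>R (Es ! i) q)"
  and i: "i < length Es"
 shows "c i \<in> Cinf A U"
proof (rule Cinf_local[OF U])
 fix p assume p: "p \<in> U"
 obtain U' \<phi> bs ff where ac0: "adapted_chart TM U' \<phi> bs ff" and p': "p \<in> U'"
  using adapted_chart_exists[OF regular_foliation_total] .
 define cs where "cs = bs @ ff"
 have ac: "adapted_chart TM U' \<phi> cs []" unfolding cs_def by (rule adapted_chart_total[OF ac0])
 let ?W = "U \<inter> U'" and ?w = "chart_volume \<phi> cs"
 have W: "open ?W" "?W \<subseteq> U'" using U acD(2)[OF ac] by auto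
 have n: "length cs = DIM('e)" using adapted_chart_length[OF ac] by simp
 have EsW: "set Es \<subseteq> \<XX> ?W" "set (Es[i := X]) \<subseteq> \<XX> ?W"
  using vector_fields_mono[of _ U ?W] Es X set_update_subset_insert[of Es i X] by (auto, blast)
 have nz: "?w (at_point Es q) \<noteq> 0" if "q \<in> ?W" for q
  by (rule chart_volume_nonzero[OF ac]) (use that span n Es in auto)
 have "(\<lambda>q. ?w (at_point (Es[i := X]) q) / ?w (at_point Es q)) \<in> Cinf A ?W"
  by (intro Cinf_divide[OF W(1)] chart_volume_smooth[OF acD(1)[OF ac] W] EsW nz)
 moreover have "?w (at_point (Es[i := X]) q) / ?w (at_point Es q) = c i q" if q: "q \<in> ?W" for q
 proof -
  let ?e = "at_point Es q"
  have e: "set ?e \<subseteq> TM q" using at_point_vector_fields[OF EsW(1) q] .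
  have a: "alternating_on (TM q) (length ?e) ?w" using alternating_chart_volume[of q cs] n Es by simp
  have "?w (at_point (Es[i := X]) q) = ?w (?e[i := \<Sum>j<length Es. c j q *\<^sub>R ?e ! j])"
   using X(2)[of q] q by (simp add: at_point_update nth_at_point)
  also have "\<dots> = (\<Sum>j<length Es. c j q * ?w (?e[i := ?e ! j]))"
   by (rule alternating_sum[OF a subspace_tangent_space refl e]) (use e i in \<open>auto simp: subset_iff\<close>)
  also have "\<dots> = (\<Sum>j\<in>{i}. c j q * ?w (?e[i := ?e ! j]))"
  proof (rule sum.mono_neutral_right)
   show "\<forall>j\<in>{..<length Es} - {i}. c j q * ?w (?e[i := ?e ! j]) = 0"
   proof
    fix j assume j: "j \<in> {..<length Es} - {i}"
    then have "?e ! j \<in> TM q" using e by (auto simp: subset_iff)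
    then have "?w (?e[i := ?e ! j]) = 0"
     by (intro alternating_eq[OF a, of _ i j]) (use j i set_update_subset[OF e] in auto)
    then show "c j q * ?w (?e[i := ?e ! j]) = 0" by simp
   qed
  qed (use i in auto)
  finally show ?thesis using nz[OF q] by simp
 qed
 ultimately have "c i \<in> Cinf A ?W" by (rule Cinf_transform[OF _ W(1)])
 then show "\<exists>V. open V \<and> p \<in> V \<and> c i \<in> Cinf A V" using W p p' by blast
qed

lemma splits_tangentE:
 assumes "splits_tangent A F V" "v \<in> TM p"
 obtains u w where "u \<in> F p" "w \<in> V p" "v = u + w"
proof -
 have "TM p = {u + w |u w. u \<in> F p \<and> w \<in> V p}"
  using assms(1) unfolding splits_tangent_def by simp
 then have "v \<in> {u + w |u w. u \<in> F p \<and> w \<in> V p}" using assms(2) by simp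
 then show ?thesis using that by auto
qed

lemma splits_tangent_Int: "splits_tangent A F V \<Longrightarrow> F p \<inter> V p = {0}"
 unfolding splits_tangent_def by simp

lemma splits_tangent_proj:
 assumes "splits_tangent A F V" "v \<in> TM p" "subspace (F p)" "subspace (V p)"
 shows "proj_along F V p v \<in> V p" "v - proj_along F V p v \<in> F p"
  "\<And>w. w \<in> V p \<Longrightarrow> v - w \<in> F p \<Longrightarrow> proj_along F V p v = w"
proof -
 obtain u w where uw: "u \<in> F p" "w \<in> V p" "v = u + w" using splits_tangentE[OF assms(1,2)] .
 have uniq: "w' = w" if "w' \<in> V p" "v - w' \<in> F p" for w'
 proof -
  have "v - w' - u \<in> F p" "w - w' \<in> V p" 
   using subspace_diff[OF assms(3) that(2) uw(1)] subspace_diff[OF assms(4) uw(2) that(1)] .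
  moreover have "v - w' - u = w - w'" using uw(3) by simp
  ultimately have "w - w' \<in> F p \<inter> V p" by simp
  then show ?thesis using splits_tangent_Int[OF assms(1)] by auto
 qed
 have e: "proj_along F V p v = w" unfolding proj_along_def
 proof (rule the_equality)
  show "w \<in> V p \<and> v - w \<in> F p" using uw by simp
 qed (elim conjE, rule uniq)
 show "proj_along F V p v \<in> V p" "v - proj_along F V p v \<in> F p" unfolding e using uw by simp_all
 show "proj_along F V p v = w'" if "w' \<in> V p" "v - w' \<in> F p" for w'
  unfolding e using uniq[OF that] by simp
qed

lemma splitting_frame:
 assumes sp: "splits_tangent A F V" and V: "adapted_chart V U \<phi> es fs" and F: "adapted_chart F U' \<psi> es' fs'"
  and q: "q \<in> U \<inter> U'"
 shows "TM q = span (set (at_point (map (coord_field U \<phi>) es @ map (coord_field U' \<psi>) es') q))"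
  and "length es + length es' = DIM('e)"
proof -
 let ?B = "set (frame_at U \<phi> es q)" and ?C = "set (at_point (map (coord_field U' \<psi>) es') q)"
 have BC: "V q = span ?B" "F q = span ?C" using frame_list_span V F q by auto
 have "span (?B \<union> ?C) = TM q"
 proof (intro equalityI subsetI)
  fix v assume v: "v \<in> TM q"
  obtain u w where uw: "u \<in> F q" "w \<in> V q" "v = u + w" using splits_tangentE[OF sp v] .
  then show "v \<in> span (?B \<union> ?C)"
   using BC span_mono[of ?B "?B \<union> ?C"] span_mono[of ?C "?B \<union> ?C"] by (auto intro!: span_add)
 next
  have "?B \<union> ?C \<subseteq> TM q"
   using frame_tangent[OF V] frame_tangent[OF F] q by (auto simp: at_point_def)
  then show "v \<in> TM q" if "v \<in> span (?B \<union> ?C)" for v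
   using that span_minimal[OF _ subspace_tangent_space] by blast
 qed
 then show *: "TM q = span (set (at_point (map (coord_field U \<phi>) es @ map (coord_field U' \<psi>) es') q))"
  by (simp add: at_point_def image_Un)
 have im: "?B = (\<lambda>e. coord_field U \<phi> e q) ` set es" "?C = (\<lambda>e. coord_field U' \<psi> e q) ` set es'"
  by (auto simp: at_point_def)
 have "independent ?B" "independent ?C"
  using independent_mono[OF frame_independent[OF V]] independent_mono[OF frame_independent[OF F]] q im
  by (auto simp: image_Un)
 moreover have "span ?B \<inter> span ?C = {0}" using splits_tangent_Int[OF sp, of q] BC by (metis inf_commute)
 ultimately have i: "independent (?B \<union> ?C)" and d: "?B \<inter> ?C = {}"
  using independent_Un_complement[of ?B ?C] by auto
 have "card ?B = length es" "card ?C = length es'"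
  using q card_image[OF inj_on_subset[OF frame_injective[OF V]]] card_image[OF inj_on_subset[OF frame_injective[OF F]]]
   distinct_card[of es] distinct_card[of es'] acD(3)[OF V] acD(3)[OF F] unfolding im by auto
 then have "card (?B \<union> ?C) = length es + length es'" using d by (simp add: card_Un_disjoint)
 moreover have "dim (TM q) = card (?B \<union> ?C)"
  using i * dim_eq_card_independent[OF i] dim_span[of "?B \<union> ?C"] by (simp add: at_point_def image_Un)
 ultimately show "length es + length es' = DIM('e)"
  using fol_rank_eq[OF regular_foliation_total] fol_rank_total by metis
qed

lemma fol_rank_complement:
 assumes "splits_tangent A F V" "regular_foliation A F" "regular_foliation A V"
 shows "DIM('e) - fol_rank F = fol_rank V"
proof -
 obtain U \<phi> es fs where V: "adapted_chart V U \<phi> es fs" "undefined \<in> U" using adapted_chart_exists[OF assms(3)] .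
 obtain U' \<psi> es' fs' where F: "adapted_chart F U' \<psi> es' fs'" "undefined \<in> U'" using adapted_chart_exists[OF assms(2)] .
 have "length es + length es' = DIM('e)" by (rule splitting_frame(2)[OF assms(1) V(1) F(1)]) (use V F in auto)
 moreover have "length es = fol_rank V" "length es' = fol_rank F"
  using adapted_chart_rank[OF assms(3) V(1)] adapted_chart_rank[OF assms(2) F(1)] V(2) F(2) by auto
 ultimately show ?thesis by simp
qed

text \<open>Leafwise frames of \<open>V\<close> and \<open>F\<close> together form a frame of the
  tangent bundle. By Cramer's rule the coefficients of \<open>X\<close> in it are smooth, and the
  projection keeps those that belong to \<open>V\<close>.\<close>

lemma projection_smooth:
 assumes sp: "splits_tangent A F V" and F: "regular_foliation A F" and V: "regular_foliation A V"
  and U: "open U" and X: "X \<in> \<XX> U"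
 shows "(\<lambda>p. proj_along F V p (X p)) \<in> sections A U V"
proof -
 let ?g = "\<lambda>p. proj_along F V p (X p)"
 have sub: "subspace (F q)" "subspace (V q)" for q using regular_foliation_subspace F V by auto
 have g: "?g q \<in> V q" "X q - ?g q \<in> F q" if "q \<in> U" for q
  using splits_tangent_proj(1,2)[OF sp vector_field_tangent[OF X that] sub] .
 have "?g \<in> \<XX> U"
 proof (rule vector_fields_local[OF U])
  fix p assume p: "p \<in> U"
  obtain U1 \<phi> es fs where V1: "adapted_chart V U1 \<phi> es fs" "p \<in> U1" using adapted_chart_exists[OF V] .
  obtain U2 \<psi> es' fs' where F1: "adapted_chart F U2 \<psi> es' fs'" "p \<in> U2" using adapted_chart_exists[OF F] .
  let ?W = "U \<inter> U1 \<inter> U2"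
  let ?Es = "map (coord_field U1 \<phi>) es @ map (coord_field U2 \<psi>) es'"
  \<comment> \<open>One numbering for both groups of coefficients, in the order of
    \<open>?Es\<close>: first the leafwise coordinates of the projection, then those of the
    remainder in the chart adapted to \<open>F\<close>.\<close>
  define c where "c i q = (if i < length es then ?g q (\<lambda>p. \<phi> p \<bullet> es ! i)
   else (X q - ?g q) (\<lambda>p. \<psi> p \<bullet> es' ! (i - length es)))" for i q
  have W: "open ?W" using U acD(2)[OF V1(1)] acD(2)[OF F1(1)] by auto
  have gq: "?g q = (\<Sum>i<length es. c i q *\<^sub>R coord_field U1 \<phi> (es ! i) q)" if "q \<in> ?W" for q
  proof -
   have "?g q = (\<Sum>e\<in>set es. ?g q (coord \<phi> e) *\<^sub>R coord_field U1 \<phi> e q)"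
    by (rule leaf_expand[OF V1(1)]) (use that g in auto)
   also have "\<dots> = (\<Sum>i<length es. ?g q (\<lambda>p. \<phi> p \<bullet> es ! i) *\<^sub>R coord_field U1 \<phi> (es ! i) q)"
    by (rule sum.reindex_bij_betw[symmetric], rule bij_betw_nth) (use acD(3)[OF V1(1)] in auto)
   finally show ?thesis by (simp add: c_def)
  qed
  have fq: "X q - ?g q = (\<Sum>i<length es'. c (length es + i) q *\<^sub>R coord_field U2 \<psi> (es' ! i) q)" if "q \<in> ?W" for q
  proof -
   have "X q - ?g q = (\<Sum>e\<in>set es'. (X q - ?g q) (\<lambda>p. \<psi> p \<bullet> e) *\<^sub>R coord_field U2 \<psi> e q)"
    by (rule leaf_expand[OF F1(1)]) (use that g in auto)
   also have "\<dots> = (\<Sum>i<length es'. (X q - ?g q) (\<lambda>p. \<psi> p \<bullet> es' ! i) *\<^sub>R coord_field U2 \<psi> (es' ! i) q)"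
    by (rule sum.reindex_bij_betw[symmetric], rule bij_betw_nth) (use acD(3)[OF F1(1)] in auto)
   finally have eq: "X q - ?g q = (\<Sum>i<length es'. (X q - ?g q) (\<lambda>p. \<psi> p \<bullet> es' ! i) *\<^sub>R coord_field U2 \<psi> (es' ! i) q)" .
   have "c (length es + i) q = (X q - ?g q) (\<lambda>p. \<psi> p \<bullet> es' ! i)" for i by (simp add: c_def)
   then show ?thesis using eq by (simp only:)
  qed
  have n: "length es + length es' = DIM('e)" by (rule splitting_frame(2)[OF sp V1(1) F1(1)]) (use V1 F1 in auto)
  have Es: "set ?Es \<subseteq> \<XX> ?W"
   using vector_fields_mono[OF frame_vector_field[OF V1(1)], of ?W] vector_fields_mono[OF frame_vector_field[OF F1(1)], of ?W]
   by auto
  have "c i \<in> Cinf A ?W" if "i < length ?Es" for i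
  proof (rule frame_coefficient_smooth[OF W Es _ _ _ _ that])
   show "TM q = span (set (at_point ?Es q))" if "q \<in> ?W" for q
    by (rule splitting_frame(1)[OF sp V1(1) F1(1)]) (use that in auto)
   show "X \<in> \<XX> ?W" by (rule vector_fields_mono[OF X]) auto
   fix q assume q: "q \<in> ?W"
   have "X q = ?g q + (X q - ?g q)" by simp
   also have "\<dots> = (\<Sum>i<length es. c i q *\<^sub>R coord_field U1 \<phi> (es ! i) q)
     + (\<Sum>i<length es'. c (length es + i) q *\<^sub>R coord_field U2 \<psi> (es' ! i) q)"
    by (rule arg_cong2[of _ _ _ _ "(+)", OF gq[OF q] fq[OF q]])
   also have "\<dots> = (\<Sum>i<length es + length es'. c i q *\<^sub>R (?Es ! i) q)"
    unfolding sum_lessThan_add by (intro arg_cong2[of _ _ _ _ "(+)"] sum.cong) (auto simp: nth_append)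
   finally show "X q = (\<Sum>i<length ?Es. c i q *\<^sub>R (?Es ! i) q)" by simp
  qed (use n in auto)
  then have "(\<lambda>q. \<Sum>i<length es. c i q *\<^sub>R coord_field U1 \<phi> (es ! i) q) \<in> \<XX> ?W"
   by (intro vector_fields_sum[OF W] vector_fields_mono[OF frame_vector_field[OF V1(1)]]) auto
  then have "?g \<in> \<XX> ?W" by (rule vector_fields_cong[OF W]) (use gq in simp)
  then show "\<exists>W. open W \<and> p \<in> W \<and> ?g \<in> \<XX> W" using W p V1 F1 by blast
 qed
 then show ?thesis using g by (simp add: sections_def)
qed

end

context manifold
begin

subsection \<open>The Lie derivative of a form is a tensor\<close>

lemma form_slot_sum:
 assumes \<omega>: "\<omega> \<in> kforms A TM k" and xs: "length xs = k" "set xs \<subseteq> TM p" "i < k"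
  and u: "\<And>j. j \<in> J \<Longrightarrow> u j \<in> TM p"
 shows "\<omega> p (xs[i := \<Sum>j\<in>J. c j *\<^sub>R u j]) = (\<Sum>j\<in>J. c j * \<omega> p (xs[i := u j]))"
 by (rule alternating_sum[OF kforms_alternating[OF \<omega>] subspace_tangent_space xs u])

text \<open>Derivatives of the coefficients arise once from the product rule for \<open>X\<close>
  and once, with opposite sign, from the bracket in slot \<open>i\<close>. Their cancellation is the
  reason why the Lie derivative of a form is a tensor.\<close>

lemma lie_form_sum:
 assumes \<omega>: "\<omega> \<in> kforms A TM k" and U: "open U" "p \<in> U"
  and X: "X \<in> \<XX> U" and Ys: "set Ys \<subseteq> \<XX> U" "length Ys = k" "i < k"
  and Z: "\<And>j. j \<in> J \<Longrightarrow> Z j \<in> \<XX> U" and c: "\<And>j. j \<in> J \<Longrightarrow> c j \<in> Cinf A U" and J: "finite J"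
 shows "lie_form A X \<omega> (Ys[i := (\<lambda>q. \<Sum>j\<in>J. c j q *\<^sub>R Z j q)]) p = (\<Sum>j\<in>J. c j p * lie_form A X \<omega> (Ys[i := Z j]) p)"
proof -
 let ?S = "\<lambda>q. \<Sum>j\<in>J. c j q *\<^sub>R Z j q"
 note Xp = vector_field_tangent[OF X U(2)]
 have Yt: "set (at_point Ys q) \<subseteq> TM q" if "q \<in> U" for q by (rule at_point_vector_fields[OF Ys(1) that])
 have Zt: "Z j q \<in> TM q" if "q \<in> U" "j \<in> J" for q j using vector_field_tangent[OF Z] that by blast
 have YZ: "set (Ys[i := Z j]) \<subseteq> \<XX> U" if "j \<in> J" for j
  using set_update_subset[OF Ys(1) Z[OF that]] .
 have sg: "smooth_at A p (\<lambda>q. \<omega> q (at_point (Ys[i := Z j]) q))" if "j \<in> J" for j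
  by (rule smooth_atI[OF U kforms_smooth[OF \<omega> U(1)]]) (use YZ[OF that] Ys in \<open>auto simp: sections_total\<close>)
 have sc: "smooth_at A p (c j)" if "j \<in> J" for j by (rule smooth_atI[OF U c[OF that]])
 have e: "\<omega> q (at_point (Ys[i := ?S]) q) = (\<Sum>j\<in>J. c j q * \<omega> q (at_point (Ys[i := Z j]) q))" if "q \<in> U" for q
  unfolding at_point_update
  using form_slot_sum[OF \<omega> _ Yt[OF that] Ys(3), of J "\<lambda>j. Z j q" "\<lambda>j. c j q"] Ys Zt that by simp
 have "X p (\<lambda>q. \<omega> q (at_point (Ys[i := ?S]) q)) = X p (\<lambda>q. \<Sum>j\<in>J. c j q * \<omega> q (at_point (Ys[i := Z j]) q))"
  by (rule tangent_cong[OF Xp U e])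
 also have "\<dots> = (\<Sum>j\<in>J. X p (\<lambda>q. c j q * \<omega> q (at_point (Ys[i := Z j]) q)))"
  by (rule tangent_sum[OF Xp]) (intro smooth_at_mult sc sg)
 also have "\<dots> = (\<Sum>j\<in>J. c j p * X p (\<lambda>q. \<omega> q (at_point (Ys[i := Z j]) q)) + \<omega> p (at_point (Ys[i := Z j]) p) * X p (c j))"
  by (rule sum.cong[OF refl]) (rule tangent_mult[OF Xp sc sg])
 finally have 1: "X p (\<lambda>q. \<omega> q (at_point (Ys[i := ?S]) q))
  = (\<Sum>j\<in>J. c j p * X p (\<lambda>q. \<omega> q (at_point (Ys[i := Z j]) q)) + \<omega> p (at_point (Ys[i := Z j]) p) * X p (c j))" .
 let ?t = "\<lambda>W l. \<omega> p ((at_point (Ys[i := W]) p)[l := bracket X (Ys[i := W] ! l) p])"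
 have br: "bracket X Y p \<in> TM p" if "Y \<in> \<XX> U" for Y by (rule lie_bracket_tangent[OF X that U])
 have 2: "?t ?S l = (\<Sum>j\<in>J. c j p * ?t (Z j) l)" if l: "l < k" "l \<noteq> i" for l
 proof -
  have "?t ?S l = \<omega> p ((at_point Ys p)[l := bracket X (Ys ! l) p, i := ?S p])"
   using l by (simp add: at_point_update list_update_swap)
  also have "\<dots> = (\<Sum>j\<in>J. c j p * \<omega> p ((at_point Ys p)[l := bracket X (Ys ! l) p, i := Z j p]))"
   by (rule form_slot_sum[OF \<omega> _ set_update_subset[OF Yt[OF U(2)] br] Ys(3)]) (use Ys l Zt U in auto)
  finally show ?thesis using l by (simp add: at_point_update list_update_swap[of i l])
 qed
 have 3: "?t ?S i = (\<Sum>j\<in>J. c j p * ?t (Z j) i + X p (c j) * \<omega> p (at_point (Ys[i := Z j]) p))"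
 proof -
  have "?t ?S i = \<omega> p ((at_point Ys p)[i := (\<Sum>j\<in>J. c j p *\<^sub>R bracket X (Z j) p) + (\<Sum>j\<in>J. X p (c j) *\<^sub>R Z j p)])"
   using Ys lie_bracket_sum[where I = J and Y = Z and c = c, OF X Z c U]
   by (simp add: at_point_update sum.distrib)
  also have "\<dots> = \<omega> p ((at_point Ys p)[i := \<Sum>j\<in>J. c j p *\<^sub>R bracket X (Z j) p])
    + \<omega> p ((at_point Ys p)[i := \<Sum>j\<in>J. X p (c j) *\<^sub>R Z j p])"
   using alternating_linear[OF kforms_alternating[OF \<omega>] _ Yt[OF U(2)] Ys(3), of "\<Sum>j\<in>J. c j p *\<^sub>R bracket X (Z j) p" "\<Sum>j\<in>J. X p (c j) *\<^sub>R Z j p" 1 1]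
    Ys Zt[OF U(2)] br[OF Z] by (simp add: subspace_sum subspace_scale subspace_tangent_space)
  also have "\<dots> = (\<Sum>j\<in>J. c j p * \<omega> p ((at_point Ys p)[i := bracket X (Z j) p]))
    + (\<Sum>j\<in>J. X p (c j) * \<omega> p ((at_point Ys p)[i := Z j p]))"
   using form_slot_sum[OF \<omega> _ Yt[OF U(2)] Ys(3), of J "\<lambda>j. bracket X (Z j) p"]
    form_slot_sum[OF \<omega> _ Yt[OF U(2)] Ys(3), of J "\<lambda>j. Z j p"] Ys Zt[OF U(2)] br[OF Z] by simp
  finally show ?thesis using Ys by (simp add: at_point_update sum.distrib)
 qed
 have 4: "(\<Sum>l<k. ?t W l) = ?t W i + (\<Sum>l\<in>{..<k} - {i}. ?t W l)" for W
  using Ys(3) by (simp add: sum.remove[of "{..<k}" i])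
 have "(\<Sum>l<k. ?t ?S l) = (\<Sum>j\<in>J. c j p * (\<Sum>l<k. ?t (Z j) l)) + (\<Sum>j\<in>J. X p (c j) * \<omega> p (at_point (Ys[i := Z j]) p))"
 proof -
  have "(\<Sum>l\<in>{..<k} - {i}. ?t ?S l) = (\<Sum>l\<in>{..<k} - {i}. \<Sum>j\<in>J. c j p * ?t (Z j) l)"
   by (rule sum.cong[OF refl]) (use 2 in auto)
  also have "\<dots> = (\<Sum>j\<in>J. c j p * (\<Sum>l\<in>{..<k} - {i}. ?t (Z j) l))"
   by (subst sum.swap) (simp only: sum_distrib_left)
  finally show ?thesis unfolding 4 3 by (simp add: sum.distrib distrib_left)
 qed
 then show ?thesis unfolding lie_form_def 1 using Ys(2)
  by (simp add: sum.distrib sum_subtractf right_diff_distrib mult.commute)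
qed

lemma lie_form_cong:
 assumes \<omega>: "\<omega> \<in> kforms A TM k" and U: "open U" "p \<in> U"
  and X: "X \<in> \<XX> U" and Ys: "set Ys \<subseteq> \<XX> U" "length Ys = length Zs"
  and eq: "\<And>i q. i < length Ys \<Longrightarrow> q \<in> U \<Longrightarrow> (Ys ! i) q = (Zs ! i) q"
 shows "lie_form A X \<omega> Ys p = lie_form A X \<omega> Zs p"
proof -
 have at: "at_point Ys q = at_point Zs q" if "q \<in> U" for q
  by (rule nth_equalityI) (use Ys eq that in \<open>auto simp: nth_at_point\<close>)
 have "X p (\<lambda>q. \<omega> q (at_point Ys q)) = X p (\<lambda>q. \<omega> q (at_point Zs q))"
  by (rule tangent_cong[OF vector_field_tangent[OF X U(2)] U]) (simp add: at)
 moreover have "bracket X (Ys ! i) p = bracket X (Zs ! i) p" if "i < length Ys" for i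
  by (rule lie_bracket_cong[OF X _ U]) (use Ys eq that in auto)
 ultimately show ?thesis using Ys(2) at[OF U(2)] by (simp add: lie_form_def)
qed

text \<open>A standard extension of a tangent vector to a neighbourhood, with constant
  coordinates.\<close>

definition constant_field :: "'m set \<Rightarrow> ('m \<Rightarrow> 'e) \<Rightarrow> 'e list \<Rightarrow> 'm tangent \<Rightarrow> 'm vfield" where
 "constant_field U \<phi> bs v = (\<lambda>q. \<Sum>b\<in>set bs. v (coord \<phi> b) *\<^sub>R coord_field U \<phi> b q)"

lemma constant_field_vector_field:
 assumes "adapted_chart TM U \<phi> bs []"
 shows "constant_field U \<phi> bs v \<in> \<XX> U" unfolding constant_field_def
 by (rule vector_fields_sum[where c = "\<lambda>b q. v (coord \<phi> b)", OF acD(2)[OF assms] frame_vector_field[OF assms] Cinf_const])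

lemma lie_form_slot:
 assumes \<omega>: "\<omega> \<in> kforms A TM k"
  and ac: "adapted_chart TM U \<phi> bs []" and W: "open W" "W \<subseteq> U" "p \<in> W"
  and X: "X \<in> \<XX> W" and Ys: "set Ys \<subseteq> \<XX> W" "length Ys = k" "i < k"
  and Y: "Y \<in> \<XX> W"
 shows "lie_form A X \<omega> (Ys[i := Y]) p
  = (\<Sum>b\<in>set bs. Y p (coord \<phi> b) * lie_form A X \<omega> (Ys[i := coord_field U \<phi> b]) p)"
proof -
 let ?Z = "\<lambda>q. \<Sum>b\<in>set bs. Y q (coord \<phi> b) *\<^sub>R coord_field U \<phi> b q"
 have "lie_form A X \<omega> (Ys[i := Y]) p = lie_form A X \<omega> (Ys[i := ?Z]) p"
 proof (rule lie_form_cong[OF \<omega> W(1,3) X set_update_subset[OF Ys(1) Y]])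
  fix l q assume l: "l < length (Ys[i := Y])" and q: "q \<in> W"
  have e: "Y q = ?Z q" using tangent_expand[OF ac _ vector_field_tangent[OF Y q]] q W(2) by auto
  show "(Ys[i := Y] ! l) q = (Ys[i := ?Z] ! l) q"
  proof (cases "l = i")
   case True
   then have "Ys[i := Y] ! l = Y" "Ys[i := ?Z] ! l = ?Z" using l by auto
   then show ?thesis using e by (simp only:)
  qed simp
 qed simp
 also have "\<dots> = (\<Sum>b\<in>set bs. Y p (coord \<phi> b) * lie_form A X \<omega> (Ys[i := coord_field U \<phi> b]) p)"
 proof (rule lie_form_sum[OF \<omega> W(1,3) X Ys])
  show "coord_field U \<phi> b \<in> \<XX> W" for b by (rule vector_fields_mono[OF frame_vector_field[OF ac] W(2)])
  show "(\<lambda>q. Y q (coord \<phi> b)) \<in> Cinf A W" for b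
   by (rule vector_field_smooth[OF Y W(1) order.refl Cinf_mono[OF coordinate_smooth[OF ac] W(2)]])
 qed simp
 finally show ?thesis .
qed

text \<open>\<open>L\<close> is computed on constant extensions of tangent vectors. By
  \<open>lie_form_slot\<close> a field enters only through its coordinates at \<open>p\<close>, so
  arbitrary fields can be exchanged for these extensions slot by slot.\<close>

lemma lie_form_tensor:
 assumes \<omega>: "\<omega> \<in> kforms A TM k" and U0: "open U0" "p \<in> U0" and X: "X \<in> \<XX> U0"
 obtains L where "alternating_on (TM p) k L"
  "\<And>U Ys. open U \<Longrightarrow> p \<in> U \<Longrightarrow> length Ys = k \<Longrightarrow> set Ys \<subseteq> \<XX> U \<Longrightarrow>
   lie_form A X \<omega> Ys p = L (at_point Ys p)"
proof -
 obtain U1 \<phi> bs ff where ac0: "adapted_chart TM U1 \<phi> bs ff" and p1: "p \<in> U1"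
  using adapted_chart_exists[OF regular_foliation_total] .
 define cs where "cs = bs @ ff"
 have ac: "adapted_chart TM U1 \<phi> cs []" unfolding cs_def by (rule adapted_chart_total[OF ac0])
 let ?ext = "constant_field U1 \<phi> cs"
 let ?L = "\<lambda>vs. lie_form A X \<omega> (map ?ext vs) p"
 let ?W = "U0 \<inter> U1"
 have W: "open ?W" "?W \<subseteq> U1" "p \<in> ?W" using U0 p1 acD(2)[OF ac] by auto
 have XW: "X \<in> \<XX> ?W" by (rule vector_fields_mono[OF X]) auto
 have ext: "?ext v \<in> \<XX> ?W" for v
  by (rule vector_fields_mono[OF constant_field_vector_field[OF ac] W(2)])
 have extp: "?ext v p = v" if "v \<in> TM p" for v
  using tangent_expand[OF ac p1 that] by (simp add: constant_field_def)
 have mext: "set (map ?ext vs) \<subseteq> \<XX> ?W" for vs using ext by auto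
 note slot = lie_form_slot[OF \<omega> ac W XW]
 have alt: "alternating_on (TM p) k ?L"
 proof (rule alternatingI)
  fix xs i u v and a b :: real
  assume *: "length xs = k" "set xs \<subseteq> TM p" "i < k" "u \<in> TM p" "v \<in> TM p"
  have s: "?L (xs[i := w]) = (\<Sum>b\<in>set cs. w (coord \<phi> b) * lie_form A X \<omega> ((map ?ext xs)[i := coord_field U1 \<phi> b]) p)"
   if "w \<in> TM p" for w
   using slot[OF mext _ *(3) ext, of xs w] *(1) extp[OF that] by (simp add: map_update)
  have "a *\<^sub>R u + b *\<^sub>R v \<in> TM p"
   using * subspace_tangent_space by (simp add: subspace_add subspace_scale)
  from s[OF this] show "?L (xs[i := a *\<^sub>R u + b *\<^sub>R v]) = a * ?L (xs[i := u]) + b * ?L (xs[i := v])"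
   unfolding s[OF *(4)] s[OF *(5)] by (simp add: sum_distrib_left sum.distrib algebra_simps)
 next
  fix xs i j
  assume *: "length xs = k" "set xs \<subseteq> TM p" "i < j" "j < k" "xs ! i = xs ! j"
  let ?Ys = "map ?ext xs"
  have l: "length ?Ys = k" using * by simp
  have at: "set (at_point ?Ys q) \<subseteq> TM q" if "q \<in> ?W" for q
   by (rule at_point_vector_fields[OF mext that])
  have Yij: "?Ys ! i = ?Ys ! j" using * by simp
  have 0: "\<omega> q (at_point ?Ys q) = 0" if "q \<in> ?W" for q
   by (rule alternating_eq[OF kforms_alternating[OF \<omega>] _ at[OF that], of i j])
    (use * in \<open>auto simp: nth_at_point\<close>)
  have 1: "X p (\<lambda>q. \<omega> q (at_point ?Ys q)) = 0"
   using tangent_cong[OF vector_field_tangent[OF XW W(3)] W(1,3) 0] tangent_const[OF vector_field_tangent[OF XW W(3)]]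
   by simp
  let ?t = "\<lambda>l. \<omega> p ((at_point ?Ys p)[l := bracket X (?Ys ! l) p])"
  have br: "bracket X (?Ys ! l) p \<in> TM p" if "l < k" for l
   using lie_bracket_tangent[OF XW ext W(1,3)] that * by simp
  have 2: "?t l = 0" if "l < k" "l \<noteq> i" "l \<noteq> j" for l
  proof -
   have s: "set ((at_point ?Ys p)[l := bracket X (?Ys ! l) p]) \<subseteq> TM p"
    by (rule set_update_subset[OF at[OF W(3)] br[OF that(1)]])
   show ?thesis by (rule alternating_eq[OF kforms_alternating[OF \<omega>] _ s, of i j])
     (use * that in \<open>auto simp: nth_at_point\<close>)
  qed
  \<comment> \<open>As the fields in slots \<open>i\<close> and \<open>j\<close> are equal, a
    transposition carries one bracket term into the other.\<close>
  have 3: "?t i + ?t j = 0"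
  proof -
   let ?y = "(?Ys ! i) p" and ?z = "bracket X (?Ys ! i) p" and ?e = "at_point ?Ys p"
   have y: "?y \<in> TM p" using vector_field_tangent[OF ext W(3)] * by simp
   have e: "?e ! i = ?y" "?e ! j = ?y" using * Yij by (auto simp: nth_at_point)
   have "?e[i := ?z] ! j = ?y" using *(3) e(2) by simp
   then have "?e[i := ?z, j := ?y] = ?e[i := ?z]" using list_update_id[of "?e[i := ?z]" j] by (simp only:)
   moreover have "?e[i := ?y] = ?e" using list_update_id[of ?e i] unfolding e(1) .
   ultimately show ?thesis
    using alternating_swap[OF kforms_alternating[OF \<omega>] subspace_tangent_space _ at[OF W(3)], of i j ?y ?z] * br[of i] y Yij by simp
  qed
  have "(\<Sum>l<k. ?t l) = (\<Sum>l\<in>{i, j}. ?t l)" by (rule sum.mono_neutral_right) (use * 2 in auto)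
  then have "(\<Sum>l<k. ?t l) = 0" using 3 *(3) by simp
  then show "?L xs = 0" unfolding lie_form_def 1 l by simp
 qed
 have "lie_form A X \<omega> Ys p = ?L (at_point Ys p)"
  if Ys: "open U" "p \<in> U" "length Ys = k" "set Ys \<subseteq> \<XX> U" for U Ys
 proof -
  let ?V = "?W \<inter> U"
  have V: "open ?V" "?V \<subseteq> U1" "p \<in> ?V" using W Ys by auto
  have XV: "X \<in> \<XX> ?V" by (rule vector_fields_mono[OF XW]) auto
  have YV: "set Ys \<subseteq> \<XX> ?V" using Ys(4) vector_fields_mono[of _ U ?V] by blast
  have extV: "?ext v \<in> \<XX> ?V" for v by (rule vector_fields_mono[OF ext]) auto
  let ?E = "map ?ext (at_point Ys p)"
  have "lie_form A X \<omega> (take m ?E @ drop m Ys) p = lie_form A X \<omega> Ys p" if "m \<le> k" for m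
   using that
  proof (induction m)
   case (Suc m)
   let ?Zs = "take m ?E @ drop m Ys"
   have Zs: "set ?Zs \<subseteq> \<XX> ?V" "length ?Zs = k"
    using YV extV Ys(3) Suc.prems by (auto dest!: in_set_takeD in_set_dropD)
   have d: "drop m Ys = Ys ! m # drop (Suc m) Ys" using Suc.prems Ys by (simp add: Cons_nth_drop_Suc)
   have z: "take (Suc m) ?E @ drop (Suc m) Ys = ?Zs[m := ?ext ((Ys ! m) p)]" "?Zs = ?Zs[m := Ys ! m]"
    using Suc.prems Ys(3) by (auto simp: take_Suc_conv_app_nth list_update_append d nth_at_point)
   have Ym: "Ys ! m \<in> \<XX> ?V" using YV Suc.prems Ys(3) by auto
   have "?ext ((Ys ! m) p) p = (Ys ! m) p" by (rule extp[OF vector_field_tangent[OF Ym V(3)]])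
   then have "lie_form A X \<omega> (?Zs[m := ?ext ((Ys ! m) p)]) p = lie_form A X \<omega> (?Zs[m := Ys ! m]) p"
    using lie_form_slot[OF \<omega> ac V XV Zs _ extV, of m] lie_form_slot[OF \<omega> ac V XV Zs _ Ym, of m] Suc.prems by simp
   then show ?case using Suc z by simp
  qed simp
  from this[of k] show ?thesis using Ys(3) by simp
 qed
 then show ?thesis using alt by (rule that[rotated])
qed

lemma volume_form_leafwise: "volume_form A \<Omega> \<longleftrightarrow> leafwise_volume_form A TM \<Omega>"
 by (simp add: volume_form_def leafwise_volume_form_def fol_rank_total)

text \<open>Turns the definite description into a usable equation: at \<open>p\<close> the Lie
  derivative is a top form, hence a unique multiple of \<open>\<Omega> p\<close>.\<close>

lemma divergence_eq:
 assumes \<Omega>: "volume_form A \<Omega>" and U0: "open U0" "p \<in> U0" and X: "X \<in> \<XX> U0"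
  and Ys: "open U" "p \<in> U" "length Ys = DIM('e)" "set Ys \<subseteq> \<XX> U"
 shows "lie_form A X \<Omega> Ys p = divergence A \<Omega> X p * \<Omega> p (at_point Ys p)"
proof -
 have \<Omega>k: "\<Omega> \<in> kforms A TM DIM('e)" using \<Omega> by (simp add: volume_form_def)
 obtain L where L: "alternating_on (TM p) DIM('e) L"
  "\<And>U Ys. open U \<Longrightarrow> p \<in> U \<Longrightarrow> length Ys = DIM('e) \<Longrightarrow> set Ys \<subseteq> \<XX> U \<Longrightarrow>
   lie_form A X \<Omega> Ys p = L (at_point Ys p)" by (rule lie_form_tensor[OF \<Omega>k U0 X]) blast
 obtain U1 \<phi> bs ff where ac0: "adapted_chart TM U1 \<phi> bs ff" and p1: "p \<in> U1"
  using adapted_chart_exists[OF regular_foliation_total] .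
 define cs where "cs = bs @ ff"
 have ac: "adapted_chart TM U1 \<phi> cs []" unfolding cs_def by (rule adapted_chart_total[OF ac0])
 let ?E = "map (coord_field U1 \<phi>) cs"
 have n: "length ?E = DIM('e)" using adapted_chart_length[OF ac] by simp
 have EV: "set ?E \<subseteq> \<XX> U1" using frame_vector_field[OF ac] by auto
 have nz: "\<Omega> p (at_point ?E p) \<noteq> 0"
  by (rule leafwise_volume_form_frame[OF regular_foliation_total _ ac p1]) (use \<Omega> volume_form_leafwise in blast)
 let ?c = "L (at_point ?E p) / \<Omega> p (at_point ?E p)"
 have c: "L vs = ?c * \<Omega> p vs" if "length vs = DIM('e)" "set vs \<subseteq> TM p" for vs
  using alternating_top_ratio[OF L(1) kforms_alternating[OF \<Omega>k] subspace_tangent_space frame_list_span[OF ac p1] _ that] n nz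
  by (simp add: field_simps)
 have "divergence A \<Omega> X p = ?c" unfolding divergence_def
 proof (rule the_equality)
  show "\<forall>U Ys. open U \<longrightarrow> p \<in> U \<longrightarrow> length Ys = DIM('e) \<longrightarrow> set Ys \<subseteq> \<XX> U \<longrightarrow>
    lie_form A X \<Omega> Ys p = ?c * \<Omega> p (at_point Ys p)"
   using L(2) c at_point_vector_fields by simp
  fix d assume "\<forall>U Ys. open U \<longrightarrow> p \<in> U \<longrightarrow> length Ys = DIM('e) \<longrightarrow> set Ys \<subseteq> \<XX> U \<longrightarrow>
    lie_form A X \<Omega> Ys p = d * \<Omega> p (at_point Ys p)"
  then have "lie_form A X \<Omega> ?E p = d * \<Omega> p (at_point ?E p)" using acD(2)[OF ac] p1 n EV by blast
  then show "d = ?c" using L(2)[OF acD(2)[OF ac] p1 n EV] nz by (simp add: field_simps)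
 qed
 then show ?thesis using L(2)[OF Ys] c[OF _ at_point_vector_fields[OF Ys(4,2)]] Ys(3) by simp
qed

text \<open>The function is exp(-1/s), where s is the squared radius minus the squared coordinate
  distance. The preimage of the closed ball is compact, hence closed in a Hausdorff space, which
  allows the extension by zero. Only \<open>b p \<noteq> 0\<close> is arranged, enough to divide
  by.\<close>

lemma bump_function:
 assumes "open U" "p \<in> U"
 obtains b K where "b \<in> Cinf A UNIV" "b p \<noteq> 0" "closed K" "K \<subseteq> U" "\<And>q. q \<notin> K \<Longrightarrow> b q = 0"
proof -
 obtain D \<psi> where d: "(D, \<psi>) \<in> A" "p \<in> D" by (rule chart_exists)
 then have c: "(D, \<psi>) \<in> maximal_atlas A" using atlas_subset by auto
 let ?W = "D \<inter> U" and ?i = "inv_into D \<psi>"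
 have W: "open ?W" "p \<in> ?W" using chartD(1)[OF c] d assms by auto
 then have "open (\<psi> ` ?W)" using chartD(4)[OF c] by auto
 then obtain r where r: "r > 0" "cball (\<psi> p) r \<subseteq> \<psi> ` ?W" using W(2) by (meson imageI open_contains_cball)
 define K where "K = ?i ` cball (\<psi> p) r"
 have sub: "cball (\<psi> p) r \<subseteq> \<psi> ` D" using r(2) by auto
 have "homeomorphism D (\<psi> ` D) \<psi> ?i" using c by (auto simp: maximal_atlas_def is_chart_def)
 then have "continuous_on (\<psi> ` D) ?i" by (auto simp: homeomorphism_def)
 then have "compact K" unfolding K_def
  using compact_continuous_image[OF continuous_on_subset[OF _ sub]] by simp
 then have K: "closed K" by (rule compact_imp_closed)
 have KU: "K \<subseteq> ?W"
 proof
  fix q assume "q \<in> K"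
  then obtain x where x: "x \<in> cball (\<psi> p) r" "q = ?i x" unfolding K_def by auto
  then obtain q' where "q' \<in> ?W" "x = \<psi> q'" using r(2) by blast
  then show "q \<in> ?W" using x chartD(3)[OF c] by auto
 qed
 \<comment> \<open>The squared distance is spelled out as a sum of products so that smoothness
   follows from the rules for sums and products.\<close>
 define s where "s x = r\<^sup>2 - (\<Sum>b\<in>Basis. ((x - \<psi> p) \<bullet> b) * ((x - \<psi> p) \<bullet> b))" for x
 have s_dist: "s x = r\<^sup>2 - (dist (\<psi> p) x)\<^sup>2" for x
  unfolding s_def dist_norm power2_norm_eq_inner euclidean_inner[of "\<psi> p - x" "\<psi> p - x"]
  by (simp add: inner_diff_left algebra_simps)
 define b where "b q = (if q \<in> D then flat 1 (s (\<psi> q)) else 0)" for q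
 have bK: "b q = 0" if "q \<notin> K" for q
 proof (cases "q \<in> D")
  case True
  have "\<psi> q \<notin> cball (\<psi> p) r"
  proof
   assume "\<psi> q \<in> cball (\<psi> p) r"
   then have "?i (\<psi> q) \<in> K" unfolding K_def by blast
   then show False using that chartD(3)[OF c True] by simp
  qed
  then have "r\<^sup>2 \<le> (dist (\<psi> p) (\<psi> q))\<^sup>2" using r(1) by (intro power_mono) auto
  then show ?thesis using True by (simp add: b_def flat_def s_dist)
 qed (simp add: b_def)
 have bD: "b \<in> Cinf A D"
 proof -
  have oD: "open (\<psi> ` D)" using chartD(1,4)[OF c] by blast
  have lin: "smooth_on (\<psi> ` D) (\<lambda>x. (x - \<psi> p) \<bullet> b)" for b
  proof -
   have "smooth_on (\<psi> ` D) (\<lambda>x. x \<bullet> b + (- (\<psi> p \<bullet> b)))"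
    by (intro smooth_on_add oD smooth_on_const
      smooth_on_bounded_linear[OF bounded_linear_inner_left oD smooth_on_id[OF oD]])
   then show ?thesis by (simp add: inner_diff_left)
  qed
  have "smooth_on (\<psi> ` D) (\<lambda>x. (\<Sum>b\<in>Basis. ((x - \<psi> p) \<bullet> b) * ((x - \<psi> p) \<bullet> b)))"
   unfolding smooth_on_def
   by (intro allI Ck_on_sum[OF oD] Ck_on_mult[OF oD]) (use lin in \<open>auto simp: smooth_on_def\<close>)
  from smooth_on_add[OF oD smooth_on_const smooth_on_mult[OF oD smooth_on_const this], of "r\<^sup>2" "- 1"]
  have "smooth_on (\<psi> ` D) s" by (simp add: s_def[abs_def])
  then have "smooth_on (\<psi> ` D) (\<lambda>x. flat 1 (s x))"
   using smooth_on_compose[OF oD open_UNIV _ _ smooth_on_flat, of s 1] by simp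
  then have "smooth_on (\<psi> ` D) (\<lambda>x. b (?i x))"
   by (rule smooth_on_transform[OF _ oD]) (use chartD(3)[OF c] in \<open>auto simp: b_def\<close>)
  then show ?thesis using Cinf_chart[OF c chartD(1)[OF c] order.refl] by simp
 qed
 have "b \<in> Cinf A UNIV"
 proof (rule Cinf_local[OF open_UNIV])
  fix q
  show "\<exists>V. open V \<and> q \<in> V \<and> b \<in> Cinf A V"
  proof (cases "q \<in> D")
   case True
   then show ?thesis using bD chartD(1)[OF c] by blast
  next
   case False
   have "b \<in> Cinf A (- K)" by (rule Cinf_transform[OF Cinf_const[of 0]]) (use K bK in auto)
   moreover have "q \<in> - K" using False KU by auto
   ultimately show ?thesis using K by (meson open_Compl)
  qed
 qed
 note 1 = this
 have 2: "b p \<noteq> 0" using r(1) d by (simp add: b_def flat_def s_dist)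
 show ?thesis by (rule that[OF 1 2 K _ bK]) (use KU in auto)
qed

text \<open>Projectability over an open set quantifies over sections defined on all of it. A section
  known only near \<open>p\<close> is multiplied by a bump function before it can be used as a
  test.\<close>

lemma extend_section:
 assumes "open U" "p \<in> U" "Y \<in> sections A U D" "\<And>q. 0 \<in> D q" "\<And>q v c. v \<in> D q \<Longrightarrow> c *\<^sub>R v \<in> D q"
 obtains b where "b \<in> Cinf A UNIV" "b p \<noteq> 0" "(\<lambda>q. if q \<in> U then b q *\<^sub>R Y q else 0) \<in> sections A UNIV D"
proof -
 obtain b K where b: "b \<in> Cinf A UNIV" "b p \<noteq> 0" "closed K" "K \<subseteq> U" "\<And>q. q \<notin> K \<Longrightarrow> b q = 0"
  by (rule bump_function[OF assms(1,2)]) blast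
 let ?Z = "\<lambda>q. if q \<in> U then b q *\<^sub>R Y q else 0"
 have Y: "Y \<in> \<XX> U" "\<And>q. q \<in> U \<Longrightarrow> Y q \<in> D q" using assms(3) by (auto simp: sections_def)
 have "(\<lambda>q. b q *\<^sub>R Y q) \<in> \<XX> U"
  by (rule vector_fields_scale[OF assms(1) Y(1) Cinf_mono[OF b(1)]]) auto
 then have 1: "?Z \<in> \<XX> U" by (rule vector_fields_cong[OF assms(1)]) simp
 have "(\<lambda>q. 0) \<in> \<XX> (- K)"
  using vector_fields_sum[of "- K" "{}" "\<lambda>_ _. 0" "\<lambda>_ _. 0"] b(3) by (simp add: open_Compl)
 then have 2: "?Z \<in> \<XX> (- K)" by (rule vector_fields_cong[rotated]) (use b(3,5) in auto)
 have "?Z \<in> \<XX> UNIV"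
 proof (rule vector_fields_local[OF open_UNIV])
  fix q
  show "\<exists>W. open W \<and> q \<in> W \<and> ?Z \<in> \<XX> W"
  proof (cases "q \<in> U")
   case True
   then show ?thesis using 1 assms(1) by blast
  next
   case False
   then have "q \<in> - K" using b(4) by auto
   then show ?thesis using 2 b(3) open_Compl by blast
  qed
 qed
 then have "?Z \<in> sections A UNIV D" using Y assms(4,5) by (auto simp: sections_def)
 then show ?thesis using b by (intro that)
qed

end

section \<open>Bivector fields\<close>

lemma wedge_sum_Nil [simp]: "wedge_sum [] \<alpha> \<beta> = 0"
 and wedge_sum_Cons: "wedge_sum ((v, w) # ps) \<alpha> \<beta> = \<alpha> v * \<beta> w - \<alpha> w * \<beta> v + wedge_sum ps \<alpha> \<beta>"
 and wedge_sum_append: "wedge_sum (ps @ qs) \<alpha> \<beta> = wedge_sum ps \<alpha> \<beta> + wedge_sum qs \<alpha> \<beta>"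
 by (simp_all add: wedge_sum_def)

lemma wedge_sum_skew: "wedge_sum ps \<alpha> \<beta> = - wedge_sum ps \<beta> \<alpha>"
 by (induction ps) (auto simp: wedge_sum_Cons)

lemma linear_functional_onD:
 assumes "linear_functional_on S \<alpha>" "subspace S"
 shows "u \<in> S \<Longrightarrow> v \<in> S \<Longrightarrow> \<alpha> (u + v) = \<alpha> u + \<alpha> v"
  and "u \<in> S \<Longrightarrow> \<alpha> (c *\<^sub>R u) = c * \<alpha> u"
  and "u \<in> S \<Longrightarrow> v \<in> S \<Longrightarrow> \<alpha> (u - v) = \<alpha> u - \<alpha> v"
  and "\<alpha> 0 = 0"
proof -
 have l: "\<alpha> (a *\<^sub>R u + b *\<^sub>R v) = a * \<alpha> u + b * \<alpha> v" if "u \<in> S" "v \<in> S" for a b u v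
  using assms(1) that by (simp add: linear_functional_on_def)
 show "\<alpha> (u + v) = \<alpha> u + \<alpha> v" if "u \<in> S" "v \<in> S" using l[OF that, of 1 1] by simp
 show "\<alpha> (c *\<^sub>R u) = c * \<alpha> u" if "u \<in> S" using l[OF that that, of c 0] by simp
 show "\<alpha> (u - v) = \<alpha> u - \<alpha> v" if "u \<in> S" "v \<in> S" using l[OF that, of 1 "-1"] by simp
 show "\<alpha> 0 = 0" using l[OF subspace_0[OF assms(2)] subspace_0[OF assms(2)], of 0 0] by simp
qed

text \<open>
 The key to the rank of a bivector: if \<open>v = v\<^sub>0 + a x + b y\<close>, then
 \<open>v \<and> w + x \<and> y = v\<^sub>0 \<and> w + (x - b w) \<and> (y + a w)\<close>, so a redundant pair can be absorbed.
\<close>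

lemma wedge_sum_absorb:
 assumes S: "subspace S" and lin: "\<And>\<alpha>. \<alpha> \<in> C \<Longrightarrow> linear_functional_on S \<alpha>"
  and vw: "v \<in> S" "w \<in> S" and qs: "set qs \<subseteq> S \<times> S" and v: "v \<in> span (insert w (set (flatten_pairs qs)))"
 obtains qs' where "length qs' = length qs" "set qs' \<subseteq> S \<times> S"
  "\<And>\<alpha> \<beta>. \<alpha> \<in> C \<Longrightarrow> \<beta> \<in> C \<Longrightarrow> wedge_sum ((v, w) # qs) \<alpha> \<beta> = wedge_sum qs' \<alpha> \<beta>"
proof -
 have "\<exists>qs'. length qs' = length qs \<and> set qs' \<subseteq> S \<times> S \<and>
  (\<forall>\<alpha>\<in>C. \<forall>\<beta>\<in>C. wedge_sum ((v, w) # qs) \<alpha> \<beta> = wedge_sum qs' \<alpha> \<beta>)"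
  using vw qs v
 proof (induction qs arbitrary: v)
  case Nil
  then obtain c where c: "v = c *\<^sub>R w" using span_singleton[of w] by auto
  have e: "\<gamma> v = c * \<gamma> w" if "\<gamma> \<in> C" for \<gamma>
   unfolding c by (rule linear_functional_onD(2)[OF lin[OF that] S Nil.prems(2)])
  have "wedge_sum [(v, w)] \<alpha> \<beta> = 0" if "\<alpha> \<in> C" "\<beta> \<in> C" for \<alpha> \<beta>
   by (simp add: wedge_sum_Cons e[OF that(1)] e[OF that(2)])
  then show ?case by auto
 next
  case (Cons p qs)
  obtain x y where p: "p = (x, y)" by fastforce
  then have xy: "x \<in> S" "y \<in> S" using Cons.prems by auto
  have "v \<in> span (insert x (insert y (insert w (set (flatten_pairs qs)))))"
   using Cons.prems(4) p by (simp add: insert_commute)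
  then obtain a where "v - a *\<^sub>R x \<in> span (insert y (insert w (set (flatten_pairs qs))))"
   using span_breakdown_eq by blast
  then obtain b where 1: "v - a *\<^sub>R x - b *\<^sub>R y \<in> span (insert w (set (flatten_pairs qs)))"
   using span_breakdown_eq by blast
  define v0 where "v0 = v - a *\<^sub>R x - b *\<^sub>R y"
  have v0: "v0 \<in> S" unfolding v0_def using S xy Cons.prems(1) by (intro subspace_diff subspace_scale)
  have qs_S: "set qs \<subseteq> S \<times> S" using Cons.prems(3) by auto
  obtain qs' where qs': "length qs' = length qs" "set qs' \<subseteq> S \<times> S"
   "\<And>\<alpha> \<beta>. \<alpha> \<in> C \<Longrightarrow> \<beta> \<in> C \<Longrightarrow> wedge_sum ((v0, w) # qs) \<alpha> \<beta> = wedge_sum qs' \<alpha> \<beta>"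
   using Cons.IH[OF v0 Cons.prems(2) qs_S 1[folded v0_def]] by blast
  have veq: "v = v0 + (a *\<^sub>R x + b *\<^sub>R y)" by (simp add: v0_def)
  have "wedge_sum ((v, w) # p # qs) \<alpha> \<beta> = wedge_sum ((x - b *\<^sub>R w, y + a *\<^sub>R w) # qs') \<alpha> \<beta>"
   if ab: "\<alpha> \<in> C" "\<beta> \<in> C" for \<alpha> \<beta>
  proof -
   have "\<gamma> v = \<gamma> v0 + a * \<gamma> x + b * \<gamma> y" "\<gamma> (x - b *\<^sub>R w) = \<gamma> x - b * \<gamma> w" "\<gamma> (y + a *\<^sub>R w) = \<gamma> y + a * \<gamma> w"
    if "\<gamma> \<in> C" for \<gamma>
    unfolding veq using linear_functional_onD[OF lin[OF that] S] xy v0 Cons.prems(2)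
     subspace_scale[OF S] subspace_add[OF S] by simp_all
   note e = this[OF ab(1)] this[OF ab(2)]
   show ?thesis using qs'(3)[OF ab] unfolding p wedge_sum_Cons e by (simp add: algebra_simps)
  qed
  moreover have "x - b *\<^sub>R w \<in> S" "y + a *\<^sub>R w \<in> S"
   using S xy Cons.prems(2) by (auto intro: subspace_diff subspace_add subspace_scale)
  ultimately show ?case using qs'(1,2)
   by (intro exI[of _ "(x - b *\<^sub>R w, y + a *\<^sub>R w) # qs'"]) auto
 qed
 then show ?thesis using that by blast
qed

text \<open>If the first vector of a pair were in the span of its partner and of the later pairs,
  \<open>wedge_sum_absorb\<close> would shorten the decomposition. The induction runs over suffixes
  of \<open>ps\<close> and carries the prefix along, so that minimality of the whole list can be
  applied.\<close>

lemma minimal_wedge_sum_independent: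
 assumes S: "subspace S" and lin: "\<And>\<alpha>. \<alpha> \<in> C \<Longrightarrow> linear_functional_on S \<alpha>" and ps: "set ps \<subseteq> S \<times> S"
  and min: "\<And>qs. set qs \<subseteq> S \<times> S \<Longrightarrow> \<forall>\<alpha>\<in>C. \<forall>\<beta>\<in>C. wedge_sum qs \<alpha> \<beta> = wedge_sum ps \<alpha> \<beta> \<Longrightarrow> length ps \<le> length qs"
 shows "independent (set (flatten_pairs ps))" "distinct (flatten_pairs ps)"
proof -
 have no: "v \<notin> span (insert w (set (flatten_pairs qs2)))"
  if eq: "\<forall>\<alpha>\<in>C. \<forall>\<beta>\<in>C. wedge_sum (qs1 @ (v, w) # qs2) \<alpha> \<beta> = wedge_sum ps \<alpha> \<beta>"
   and l: "length (qs1 @ (v, w) # qs2) = length ps" and s: "set (qs1 @ (v, w) # qs2) \<subseteq> S \<times> S" for qs1 v w qs2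
 proof
  assume v: "v \<in> span (insert w (set (flatten_pairs qs2)))"
  obtain qs' where qs': "length qs' = length qs2" "set qs' \<subseteq> S \<times> S"
   "\<And>\<alpha> \<beta>. \<alpha> \<in> C \<Longrightarrow> \<beta> \<in> C \<Longrightarrow> wedge_sum ((v, w) # qs2) \<alpha> \<beta> = wedge_sum qs' \<alpha> \<beta>"
   by (rule wedge_sum_absorb[OF S lin _ _ _ v]) (use s in auto)
  have "length ps \<le> length (qs1 @ qs')"
   by (rule min) (use s qs' eq in \<open>auto simp: wedge_sum_append\<close>)
  then show False using l qs'(1) by simp
 qed
 have "independent (set (flatten_pairs qs2)) \<and> distinct (flatten_pairs qs2)" if "ps = qs1 @ qs2" for qs1 qs2
  using that
 proof (induction qs2 arbitrary: qs1)
  case (Cons p qs2)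
  obtain v w where p: "p = (v, w)" by fastforce
  have i: "independent (set (flatten_pairs qs2))" "distinct (flatten_pairs qs2)"
   using Cons.IH[of "qs1 @ [p]"] Cons.prems by auto
  have v: "v \<notin> span (insert w (set (flatten_pairs qs2)))"
   by (rule no[of qs1 v w qs2]) (use Cons.prems p ps in auto)
  \<comment> \<open>The second vector of the pair is treated like the first by means of v wedge w =
    w wedge (-v).\<close>
  have "w \<notin> span (insert (- v) (set (flatten_pairs qs2)))"
  proof (rule no[of qs1 w "- v" qs2])
   have vS: "v \<in> S" using Cons.prems p ps by auto
   have e: "\<gamma> (- v) = - \<gamma> v" if "\<gamma> \<in> C" for \<gamma>
    using linear_functional_onD(2)[OF lin[OF that] S vS, of "- 1"] by simp
   have "wedge_sum (qs1 @ (w, - v) # qs2) \<alpha> \<beta> = wedge_sum ps \<alpha> \<beta>" if "\<alpha> \<in> C" "\<beta> \<in> C" for \<alpha> \<beta>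
    using Cons.prems p by (simp add: wedge_sum_append wedge_sum_Cons e[OF that(1)] e[OF that(2)])
   then show "\<forall>\<alpha>\<in>C. \<forall>\<beta>\<in>C. wedge_sum (qs1 @ (w, - v) # qs2) \<alpha> \<beta> = wedge_sum ps \<alpha> \<beta>" by blast
   show "set (qs1 @ (w, - v) # qs2) \<subseteq> S \<times> S" using Cons.prems p ps vS subspace_neg[OF S] by auto
  qed (use Cons.prems p in simp)
  then have w: "w \<notin> span (set (flatten_pairs qs2))" using span_mono[of "set (flatten_pairs qs2)" "insert (- v) (set (flatten_pairs qs2))"] by auto
  have "independent (insert w (set (flatten_pairs qs2)))" using independent_insertI[OF w i(1)] .
  then have "independent (insert v (insert w (set (flatten_pairs qs2))))" by (rule independent_insertI[OF v])
  moreover have "v \<noteq> w" "v \<notin> set (flatten_pairs qs2)" "w \<notin> set (flatten_pairs qs2)"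
   using v w span_base by blast+
  ultimately show ?case using i p by (simp add: insert_commute)
 qed (simp add: independent_empty)
 from this[of "[]" ps] show "independent (set (flatten_pairs ps))" "distinct (flatten_pairs ps)" by auto
qed

lemma sum_list_fun_apply: "(\<Sum>x\<leftarrow>l. f x) y = (\<Sum>x\<leftarrow>l. f x y)"
 by (induction l) auto

context manifold
begin

lemma differential_cotangent: "differential f \<in> cotangent_space A p"
 by (auto simp: cotangent_space_def linear_functional_on_def differential_def)

lemma cotangentD: "\<alpha> \<in> cotangent_space A p \<Longrightarrow> linear_functional_on (TM p) \<alpha>"
 by (simp add: cotangent_space_def)

lemma decomposesD:
 assumes "decomposes A p S B ps"
 shows "set ps \<subseteq> S \<times> S" "\<alpha> \<in> cotangent_space A p \<Longrightarrow> \<beta> \<in> cotangent_space A p \<Longrightarrow> B \<alpha> \<beta> = wedge_sum ps \<alpha> \<beta>"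
 using assms by (auto simp: decomposes_def)

lemma sharp_decomposes:
 assumes d: "decomposes A p S (B p) ps" and S: "S \<subseteq> TM p" and \<alpha>: "\<alpha> \<in> cotangent_space A p"
 shows "sharp A B p \<alpha> = (\<Sum>(v, w)\<leftarrow>ps. \<alpha> v *\<^sub>R w - \<alpha> w *\<^sub>R v)"
proof
 fix f
 have ps: "set ps \<subseteq> TM p \<times> TM p" using decomposesD(1)[OF d] S by auto
 have "(\<Sum>(v, w)\<leftarrow>ps. \<alpha> v *\<^sub>R w - \<alpha> w *\<^sub>R v) f = (\<Sum>(v, w)\<leftarrow>ps. \<alpha> v * w f - \<alpha> w * v f)"
  by (simp add: sum_list_fun_apply split_def)
 moreover have "(\<Sum>(v, w)\<leftarrow>ps. \<alpha> v * w f - \<alpha> w * v f) = 0" if "\<not> smooth_at A p f"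
  using ps by (induction ps) (auto simp: tangent_nonsmooth[OF _ that])
 ultimately show "sharp A B p \<alpha> f = (\<Sum>(v, w)\<leftarrow>ps. \<alpha> v *\<^sub>R w - \<alpha> w *\<^sub>R v) f"
  using decomposesD(2)[OF d \<alpha> differential_cotangent, of f] by (simp add: sharp_def wedge_sum_def differential_def)
qed

lemma sharp_mem:
 assumes d: "decomposes A p S (B p) ps" and S: "S \<subseteq> TM p" "subspace S" and \<alpha>: "\<alpha> \<in> cotangent_space A p"
 shows "sharp A B p \<alpha> \<in> S"
proof -
 have "(\<Sum>(v, w)\<leftarrow>ps. \<alpha> v *\<^sub>R w - \<alpha> w *\<^sub>R v) \<in> S" if "set ps \<subseteq> S \<times> S"
  using that by (induction ps) (auto simp: subspace_0[OF S(2)] intro!: subspace_add[OF S(2)] subspace_diff[OF S(2)] subspace_scale[OF S(2)])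
 then show ?thesis using sharp_decomposes[where B = B and p = p, OF d S(1) \<alpha>] decomposesD(1)[OF d] by simp
qed

text \<open>\<open>sharp\<close> is defined by its pairing with differentials; a decomposition into
  tangent vectors carries the identity over to every covector.\<close>

lemma sharp_pairing:
 assumes d: "decomposes A p S (B p) ps" and S: "S \<subseteq> TM p"
  and \<alpha>: "\<alpha> \<in> cotangent_space A p" and \<beta>: "\<beta> \<in> cotangent_space A p"
 shows "\<beta> (sharp A B p \<alpha>) = B p \<alpha> \<beta>"
proof -
 let ?T = "TM p"
 note l = linear_functional_onD[OF cotangentD[OF \<beta>] subspace_tangent_space]
 have *: "\<beta> (\<Sum>(v, w)\<leftarrow>ps. \<alpha> v *\<^sub>R w - \<alpha> w *\<^sub>R v) = wedge_sum ps \<alpha> \<beta> \<and> (\<Sum>(v, w)\<leftarrow>ps. \<alpha> v *\<^sub>R w - \<alpha> w *\<^sub>R v) \<in> ?T"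
  if "set ps \<subseteq> ?T \<times> ?T" for ps using that
 proof (induction ps)
  case Nil
  then show ?case using l(4) subspace_0[OF subspace_tangent_space[of p]] by (simp add: zero_fun_def)
 next
  case (Cons p ps)
  obtain v w where p: "p = (v, w)" by fastforce
  then have vw: "v \<in> ?T" "w \<in> ?T" using Cons.prems by auto
  let ?x = "\<alpha> v *\<^sub>R w - \<alpha> w *\<^sub>R v" and ?y = "\<Sum>(v, w)\<leftarrow>ps. \<alpha> v *\<^sub>R w - \<alpha> w *\<^sub>R v"
  have x: "?x \<in> ?T"
   by (intro subspace_diff[OF subspace_tangent_space] subspace_scale[OF subspace_tangent_space] vw)
  have \<beta>x: "\<beta> ?x = \<alpha> v * \<beta> w - \<alpha> w * \<beta> v"
   unfolding l(3)[OF subspace_scale[OF subspace_tangent_space vw(2)] subspace_scale[OF subspace_tangent_space vw(1)]]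
    l(2)[OF vw(1)] l(2)[OF vw(2)] ..
  have "set ps \<subseteq> ?T \<times> ?T" using Cons.prems by auto
  note y = conjunct1[OF Cons.IH[OF this]] conjunct2[OF Cons.IH[OF this]]
  show ?case unfolding p wedge_sum_Cons list.map sum_list.Cons split_conv l(1)[OF x y(2)] \<beta>x y(1)
   using subspace_add[OF subspace_tangent_space x y(2)] by blast
 qed
 have "set ps \<subseteq> ?T \<times> ?T" using decomposesD(1)[OF d] S by auto
 from *[OF this] show ?thesis
  using sharp_decomposes[where B = B and p = p, OF d S \<alpha>] decomposesD(2)[OF d \<alpha> \<beta>] by simp
qed

lemma bivector_decomposes:
 assumes "B \<in> bivector_fields A D"
 obtains ps where "decomposes A p (D p) (B p) ps"
 using assms unfolding bivector_fields_def wedge2_def by blast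

lemma bivector_skew:
 assumes "B \<in> bivector_fields A D" "\<alpha> \<in> cotangent_space A p" "\<beta> \<in> cotangent_space A p"
 shows "B p \<alpha> \<beta> = - B p \<beta> \<alpha>"
proof -
 obtain ps where "decomposes A p (D p) (B p) ps" by (rule bivector_decomposes[OF assms(1)])
 then show ?thesis using decomposesD(2) assms(2,3) wedge_sum_skew by metis
qed

lemma pbracket_skew: "B \<in> bivector_fields A D \<Longrightarrow> pbracket B f g p = - pbracket B g f p"
 unfolding pbracket_def by (rule bivector_skew[OF _ differential_cotangent differential_cotangent])

lemma ham_field_apply: "smooth_at A p g \<Longrightarrow> ham B f p g = pbracket B f g p"
 by (simp add: ham_field_def sharp_def pbracket_def)

lemma ham_field_mem:
 assumes "B \<in> bivector_fields A D" "subspace (D p)" "D p \<subseteq> TM p"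
 shows "ham B f p \<in> D p"
proof -
 obtain ps where "decomposes A p (D p) (B p) ps" by (rule bivector_decomposes[OF assms(1)])
 then show ?thesis unfolding ham_field_def using sharp_mem assms(2,3) differential_cotangent by blast
qed

lemma ham_field_tangent:
 "B \<in> bivector_fields A TM \<Longrightarrow> ham B f p \<in> TM p"
 by (rule ham_field_mem[OF _ subspace_tangent_space order.refl])

lemma pbracket_smooth:
 "B \<in> bivector_fields A D \<Longrightarrow> open W \<Longrightarrow> f \<in> Cinf A W \<Longrightarrow> g \<in> Cinf A W \<Longrightarrow> pbracket B f g \<in> Cinf A W"
 unfolding bivector_fields_def by blast

lemma ham_field_vector_field:
 assumes B: "B \<in> bivector_fields A TM" and U: "open U" and f: "f \<in> Cinf A U"
 shows "ham B f \<in> \<XX> U" unfolding vector_fields_def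
proof (intro CollectI conjI ballI allI impI)
 fix W g assume W: "open W" "W \<subseteq> U" "g \<in> Cinf A W"
 have "pbracket B f g \<in> Cinf A W" by (rule pbracket_smooth[OF B W(1) Cinf_mono[OF f W(2)] W(3)])
 then show "(\<lambda>p. ham B f p g) \<in> Cinf A W"
  by (rule Cinf_transform[OF _ W(1)]) (simp add: ham_field_apply[OF smooth_atI[OF W(1) _ W(3)]])
qed (rule ham_field_tangent[OF B])

lemma ham_field_skew:
 assumes "B \<in> bivector_fields A D" "smooth_at A p f" "smooth_at A p g"
 shows "ham B f p g = - ham B g p f"
 using pbracket_skew[OF assms(1), of f g p] assms(2,3) by (simp add: ham_field_apply)

lemma poisson_bivectorD: "poisson_bivector A B \<Longrightarrow> B \<in> bivector_fields A TM"
 by (simp add: poisson_bivector_def)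

text \<open>The Jacobi identity, read as invariance of the bivector under its own Hamiltonian
  fields.\<close>

lemma poisson_derivation:
 assumes B: "poisson_bivector A B" and W: "open W" "p \<in> W" and f: "f \<in> Cinf A W" "g \<in> Cinf A W" "h \<in> Cinf A W"
 shows "ham B f p (pbracket B g h) = pbracket B (pbracket B f g) h p + pbracket B g (pbracket B f h) p"
proof -
 note Bb = poisson_bivectorD[OF B]
 have s: "smooth_at A p (pbracket B g h)" using smooth_atI[OF W] pbracket_smooth[OF Bb W(1) f(2,3)] .
 have "pbracket B f (pbracket B g h) p + pbracket B g (pbracket B h f) p + pbracket B h (pbracket B f g) p = 0"
  using B W f unfolding poisson_bivector_def by blast
 moreover have "pbracket B g (pbracket B h f) p = - pbracket B g (pbracket B f h) p"
 proof -
  have sm: "smooth_at A p (pbracket B h f)" "smooth_at A p (pbracket B f h)"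
   using smooth_atI[OF W] pbracket_smooth[OF Bb W(1)] f by blast+
  have "pbracket B h f = (\<lambda>q. - pbracket B f h q)" using pbracket_skew[OF Bb] by blast
  then have "ham B g p (pbracket B h f) = - ham B g p (pbracket B f h)"
   using tangent_minus[OF ham_field_tangent[OF Bb] sm(2)] by simp
  then show ?thesis using sm by (simp add: ham_field_apply)
 qed
 moreover have "pbracket B h (pbracket B f g) p = - pbracket B (pbracket B f g) h p" by (rule pbracket_skew[OF Bb])
 ultimately show ?thesis using s by (simp add: ham_field_apply)
qed

section \<open>Contraction of forms with bivector fields\<close>

lemma interior_bivector_contract:
 "interior_bivector A D B \<Phi> p = contract (SOME ps. decomposes A p (D p) (B p) ps) (\<Phi> p)"
 by (rule ext) (simp add: interior_bivector_def contract_def)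

lemma interior_bivector_pow:
 "(interior_bivector A D B ^^ j) \<Phi> p = (contract (SOME ps. decomposes A p (D p) (B p) ps) ^^ j) (\<Phi> p)"
 by (induction j) (auto simp: interior_bivector_contract)

text \<open>The right-hand side depends on the bivector and not on \<open>ps\<close>, which makes
  contractions independent of the decomposition and of the choice by \<open>SOME\<close>. Each pair
  of frame vectors is counted in both orders, hence the factor 1/2.\<close>

lemma contract_frame:
 assumes ac: "adapted_chart D U \<phi> es fs" and p: "p \<in> U" and d: "decomposes A p (D p) b ps"
  and \<Phi>: "alternating_on (D p) (Suc (Suc k)) \<Phi>" and l: "length l = k" "set l \<subseteq> D p"
 shows "contract ps \<Phi> l = (\<Sum>a\<in>set es. \<Sum>c\<in>set es. b (differential (coord \<phi> a)) (differential (coord \<phi> c)) *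
  \<Phi> (coord_field U \<phi> c p # coord_field U \<phi> a p # l)) / 2"
proof -
 let ?z = "\<lambda>a q. \<phi> q \<bullet> a" and ?e = "\<lambda>a. coord_field U \<phi> a p"
 note sub = subspace_leaf[OF ac p]
 have e: "?e a \<in> D p" if "a \<in> set es" for a by (rule frame_in_leaf[OF ac p that])
 have bil: "\<Phi> (w # v # l) = (\<Sum>a\<in>set es. \<Sum>c\<in>set es. v (?z a) * w (?z c) * \<Phi> (?e c # ?e a # l))"
  if "v \<in> D p" "w \<in> D p" for v w
 proof -
  have "\<Phi> (w # v # l) = \<Phi> ((w # v # l)[1 := \<Sum>a\<in>set es. v (?z a) *\<^sub>R ?e a])"
   by (simp add: leaf_expand[OF ac p that(1), symmetric])
  also have "\<dots> = (\<Sum>a\<in>set es. v (?z a) * \<Phi> ((w # v # l)[1 := ?e a]))"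
   by (rule alternating_sum[OF \<Phi> sub]) (use l that e in auto)
  also have "\<dots> = (\<Sum>a\<in>set es. \<Sum>c\<in>set es. v (?z a) * w (?z c) * \<Phi> (?e c # ?e a # l))"
  proof (rule sum.cong[OF refl])
   fix a assume a: "a \<in> set es"
   have "\<Phi> ((w # v # l)[1 := ?e a]) = \<Phi> ((w # ?e a # l)[0 := \<Sum>c\<in>set es. w (?z c) *\<^sub>R ?e c])"
    by (simp add: leaf_expand[OF ac p that(2), symmetric])
   also have "\<dots> = (\<Sum>c\<in>set es. w (?z c) * \<Phi> ((w # ?e a # l)[0 := ?e c]))"
    by (rule alternating_sum[OF \<Phi> sub]) (use l that e a in auto)
   finally show "v (?z a) * \<Phi> ((w # v # l)[1 := ?e a]) = (\<Sum>c\<in>set es. v (?z a) * w (?z c) * \<Phi> (?e c # ?e a # l))"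
    by (simp add: sum_distrib_left mult.assoc)
  qed
  finally show ?thesis .
 qed
 have skew: "\<Phi> (v # w # l) = - \<Phi> (w # v # l)" if "v \<in> D p" "w \<in> D p" for v w
  using alternating_swap[OF \<Phi> sub, of "v # w # l" 0 1 v w] l that by simp
 have "(\<Sum>a\<in>set es. \<Sum>c\<in>set es. wedge_sum ps (differential (?z a)) (differential (?z c)) * \<Phi> (?e c # ?e a # l))
   = 2 * contract ps \<Phi> l" if "set ps \<subseteq> D p \<times> D p" for ps using that
 proof (induction ps)
  case (Cons q ps)
  obtain v w where q: "q = (v, w)" by fastforce
  have vw: "v \<in> D p" "w \<in> D p" using Cons.prems q by auto
  have "(\<Sum>a\<in>set es. \<Sum>c\<in>set es. wedge_sum (q # ps) (differential (?z a)) (differential (?z c)) * \<Phi> (?e c # ?e a # l))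
   = \<Phi> (w # v # l) - \<Phi> (v # w # l)
    + (\<Sum>a\<in>set es. \<Sum>c\<in>set es. wedge_sum ps (differential (?z a)) (differential (?z c)) * \<Phi> (?e c # ?e a # l))"
   unfolding bil[OF vw] bil[OF vw(2,1)] q
   by (simp add: wedge_sum_Cons differential_def sum.distrib[symmetric] sum_subtractf[symmetric] algebra_simps)
  then show ?case using Cons skew[OF vw] q by (simp add: contract_Cons)
 qed simp
 from this[OF decomposesD(1)[OF d]] show ?thesis
  using decomposesD(2)[OF d differential_cotangent differential_cotangent] by simp
qed

lemma interior_bivector_frame:
 assumes B: "B \<in> bivector_fields A D" and ac: "adapted_chart D U \<phi> es fs" and p: "p \<in> U"
  and \<Phi>: "alternating_on (D p) (Suc (Suc k)) (\<Phi> p)" and l: "length l = k" "set l \<subseteq> D p"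
 shows "interior_bivector A D B \<Phi> p l = (\<Sum>a\<in>set es. \<Sum>c\<in>set es. pbracket B (coord \<phi> a) (coord \<phi> c) p *
  \<Phi> p (coord_field U \<phi> c p # coord_field U \<phi> a p # l)) / 2"
proof -
 obtain ps where "decomposes A p (D p) (B p) ps" by (rule bivector_decomposes[OF B])
 then have "decomposes A p (D p) (B p) (SOME ps. decomposes A p (D p) (B p) ps)" by (rule someI)
 from contract_frame[OF ac p this \<Phi> l] show ?thesis unfolding interior_bivector_contract pbracket_def .
qed

text \<open>Allows the decomposition chosen by \<open>SOME\<close> to be traded for one that is
  sorted into horizontal and vertical pairs.\<close>

lemma contract_pow_independent:
 assumes ac: "adapted_chart D U \<phi> es fs" and p: "p \<in> U"
  and ps: "decomposes A p (D p) b ps" and qs: "decomposes A p (D p) b qs"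
  and \<Phi>: "alternating_on (D p) (k + 2 * j) \<Phi>" and l: "length l = k" "set l \<subseteq> D p"
 shows "(contract ps ^^ j) \<Phi> l = (contract qs ^^ j) \<Phi> l" using \<Phi> l
proof (induction j arbitrary: k l)
 case (Suc j)
 have \<Phi>': "alternating_on (D p) (Suc (Suc k) + 2 * j) \<Phi>" using Suc.prems by simp
 have "contract ps ((contract ps ^^ j) \<Phi>) l = contract ps ((contract qs ^^ j) \<Phi>) l"
  using decomposesD(1)[OF ps] Suc.prems by (intro contract_cong Suc.IH[OF \<Phi>']) auto
 also have "\<dots> = contract qs ((contract qs ^^ j) \<Phi>) l"
  using alternating_contract_pow[OF \<Phi>' decomposesD(1)[OF qs]]
  by (simp add: contract_frame[OF ac p ps _ Suc.prems(2,3)] contract_frame[OF ac p qs _ Suc.prems(2,3)])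
 finally show ?case by simp
qed simp

lemma at_point_Cons: "at_point (X # Xs) p = X p # at_point Xs p"
 by (simp add: at_point_def)

lemma interior_bivector_alternating:
 assumes "B \<in> bivector_fields A D" "alternating_on (D p) (Suc (Suc k)) (\<Phi> p)"
 shows "alternating_on (D p) k (interior_bivector A D B \<Phi> p)"
proof -
 obtain ps where "decomposes A p (D p) (B p) ps" by (rule bivector_decomposes[OF assms(1)])
 then have "decomposes A p (D p) (B p) (SOME ps. decomposes A p (D p) (B p) ps)" by (rule someI)
 from alternating_contract[OF assms(2) decomposesD(1)[OF this]] show ?thesis
  unfolding interior_bivector_contract .
qed

lemma coordinate_bracket_smooth:
 assumes "B \<in> bivector_fields A D'" "adapted_chart D U \<phi> es fs"
 shows "pbracket B (coord \<phi> a) (coord \<phi> c) \<in> Cinf A U"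
 by (rule pbracket_smooth[OF assms(1) acD(2)[OF assms(2)] coordinate_smooth[OF assms(2)] coordinate_smooth[OF assms(2)]])

text \<open>The decompositions chosen at different points need not vary smoothly, so smoothness is
  read off the frame formula.\<close>

lemma interior_bivector_kforms:
 assumes B: "B \<in> bivector_fields A D" and D: "regular_foliation A D" and \<Phi>: "\<Phi> \<in> kforms A D (Suc (Suc k))"
 shows "interior_bivector A D B \<Phi> \<in> kforms A D k" unfolding kforms_def
proof (intro CollectI conjI allI impI)
 show "alternating_on (D p) k (interior_bivector A D B \<Phi> p)" for p
  by (rule interior_bivector_alternating[OF B kforms_alternating[OF \<Phi>]])
 fix W Xs assume W: "open W" "length Xs = k" "set Xs \<subseteq> sections A W D"
 show "(\<lambda>p. interior_bivector A D B \<Phi> p (at_point Xs p)) \<in> Cinf A W"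
 proof (rule Cinf_local[OF W(1)])
  fix p assume p: "p \<in> W"
  obtain U \<phi> es fs where ac: "adapted_chart D U \<phi> es fs" and pU: "p \<in> U" using adapted_chart_exists[OF D] .
  let ?V = "W \<inter> U"
  have V: "open ?V" "?V \<subseteq> U" "?V \<subseteq> W" using W(1) acD(2)[OF ac] by auto
  have "(\<lambda>p. (\<Sum>a\<in>set es. \<Sum>c\<in>set es. pbracket B (coord \<phi> a) (coord \<phi> c) p *
    \<Phi> p (at_point (coord_field U \<phi> c # coord_field U \<phi> a # Xs) p)) / 2) \<in> Cinf A ?V"
  proof (rule Cinf_divide[OF V(1) _ Cinf_const], intro Cinf_sum[OF V(1)] Cinf_mult[OF V(1)])
   fix a c assume "a \<in> set es" "c \<in> set es"
   then show "(\<lambda>p. \<Phi> p (at_point (coord_field U \<phi> c # coord_field U \<phi> a # Xs) p)) \<in> Cinf A ?V"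
    by (intro kforms_smooth[OF \<Phi> V(1)])
     (use W sections_mono[OF frame_section[OF ac] V(2)] sections_mono[OF _ V(3), of _ D] in auto)
   show "pbracket B (coord \<phi> a) (coord \<phi> c) \<in> Cinf A ?V"
    by (rule Cinf_mono[OF coordinate_bracket_smooth[OF B ac] V(2)])
  qed simp
  then have "(\<lambda>p. interior_bivector A D B \<Phi> p (at_point Xs p)) \<in> Cinf A ?V"
  proof (rule Cinf_transform[OF _ V(1)])
   fix q assume "q \<in> ?V"
   then have q: "q \<in> U" "set (at_point Xs q) \<subseteq> D q" using at_point_sections[OF W(3)] by auto
   show "(\<Sum>a\<in>set es. \<Sum>c\<in>set es. pbracket B (coord \<phi> a) (coord \<phi> c) q *
    \<Phi> q (at_point (coord_field U \<phi> c # coord_field U \<phi> a # Xs) q)) / 2 = interior_bivector A D B \<Phi> q (at_point Xs q)"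
    using interior_bivector_frame[where \<Phi> = \<Phi> and p = q, OF B ac q(1) kforms_alternating[OF \<Phi>] _ q(2)] W(2) by (simp add: at_point_Cons)
  qed
  then show "\<exists>V. open V \<and> p \<in> V \<and> (\<lambda>p. interior_bivector A D B \<Phi> p (at_point Xs p)) \<in> Cinf A V"
   using V p pU by blast
 qed
qed

text \<open>\<open>M\<close> stands for the Jacobian of a field and \<open>b\<close> for the
  components of a bivector that it preserves. The derivatives of the components on the left balance
  the brackets with the frame on the right; only summation indices are renamed.\<close>

lemma triple_sum_cancel:
 fixes M b \<Phi> :: "'i \<Rightarrow> 'i \<Rightarrow> real"
 shows "(\<Sum>a\<in>J. \<Sum>d\<in>J. (\<Sum>c\<in>J. M c a * b c d + M c d * b a c) * \<Phi> d a)
  = (\<Sum>a\<in>J. \<Sum>d\<in>J. b a d * (\<Sum>c\<in>J. M d c * \<Phi> c a) + b a d * (\<Sum>c\<in>J. M a c * \<Phi> d c))"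
proof -
 have 1: "(\<Sum>a\<in>J. \<Sum>d\<in>J. \<Sum>c\<in>J. M c a * b c d * \<Phi> d a) = (\<Sum>a\<in>J. \<Sum>d\<in>J. \<Sum>c\<in>J. b a d * (M a c * \<Phi> d c))"
 proof -
  have "(\<Sum>a\<in>J. \<Sum>d\<in>J. \<Sum>c\<in>J. M c a * b c d * \<Phi> d a) = (\<Sum>a\<in>J. \<Sum>c\<in>J. \<Sum>d\<in>J. M c a * b c d * \<Phi> d a)"
   by (rule sum.cong[OF refl], rule sum.swap)
  also have "\<dots> = (\<Sum>c\<in>J. \<Sum>a\<in>J. \<Sum>d\<in>J. M c a * b c d * \<Phi> d a)" by (rule sum.swap)
  also have "\<dots> = (\<Sum>c\<in>J. \<Sum>d\<in>J. \<Sum>a\<in>J. M c a * b c d * \<Phi> d a)"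
   by (rule sum.cong[OF refl], rule sum.swap)
  finally show ?thesis by (simp add: mult_ac)
 qed
 have 2: "(\<Sum>a\<in>J. \<Sum>d\<in>J. \<Sum>c\<in>J. M c d * b a c * \<Phi> d a) = (\<Sum>a\<in>J. \<Sum>d\<in>J. \<Sum>c\<in>J. b a d * (M d c * \<Phi> c a))"
 proof (rule sum.cong[OF refl])
  fix a
  have "(\<Sum>d\<in>J. \<Sum>c\<in>J. M c d * b a c * \<Phi> d a) = (\<Sum>c\<in>J. \<Sum>d\<in>J. M c d * b a c * \<Phi> d a)" by (rule sum.swap)
  then show "(\<Sum>d\<in>J. \<Sum>c\<in>J. M c d * b a c * \<Phi> d a) = (\<Sum>d\<in>J. \<Sum>c\<in>J. b a d * (M d c * \<Phi> c a))" by (simp add: mult_ac)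
 qed
 show ?thesis using 1 2 by (simp add: sum_distrib_left sum_distrib_right sum.distrib distrib_right)
qed

lemma bracket_coordinate:
 assumes ac: "adapted_chart D U \<phi> es fs" and W: "open W" "W \<subseteq> U" "p \<in> W" and X: "X \<in> \<XX> W"
 shows "bracket X (coord_field U \<phi> a) p (coord \<phi> c) = - coord_field U \<phi> a p (\<lambda>q. X q (coord \<phi> c))"
proof -
 have pU: "p \<in> U" using W by auto
 have "X p (\<lambda>q. coord_field U \<phi> a q (coord \<phi> c)) = X p (\<lambda>q. a \<bullet> c)"
  by (rule tangent_cong[OF vector_field_tangent[OF X W(3)] W(1,3)]) (use W(2) frame_coordinate[OF ac] in auto)
 then show ?thesis
  using tangent_const[OF vector_field_tangent[OF X W(3)]] by (simp add: lie_bracket_apply[OF coordinate_smooth_at[OF ac pU]])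
qed

text \<open>Product rule for the frame formula. The Lie derivative of the contracted form does not
  act on the two inserted frame vectors, so their brackets are added back; the factor 2 clears the
  1/2. The distribution is general because the formula is needed both on \<open>TM\<close> and on
  the leaves.\<close>

lemma lie_form_interior_frame:
 assumes B: "B \<in> bivector_fields A D" and ac: "adapted_chart D U \<phi> es fs" and \<Phi>: "\<Phi> \<in> kforms A D (Suc (Suc k))"
  and W: "open W" "W \<subseteq> U" "p \<in> W" and X: "X \<in> \<XX> W" and Zs: "length Zs = k" "set Zs \<subseteq> sections A W D"
  and br: "\<And>i. i < k \<Longrightarrow> bracket X (Zs ! i) p \<in> D p"
 shows "2 * lie_form A X (interior_bivector A D B \<Phi>) Zs p = (\<Sum>a\<in>set es. \<Sum>d\<in>set es.
  X p (pbracket B (coord \<phi> a) (coord \<phi> d)) * \<Phi> p (coord_field U \<phi> d p # coord_field U \<phi> a p # at_point Zs p) +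
  pbracket B (coord \<phi> a) (coord \<phi> d) p * (lie_form A X \<Phi> (coord_field U \<phi> d # coord_field U \<phi> a # Zs) p +
   \<Phi> p (bracket X (coord_field U \<phi> d) p # coord_field U \<phi> a p # at_point Zs p) +
   \<Phi> p (coord_field U \<phi> d p # bracket X (coord_field U \<phi> a) p # at_point Zs p)))"
proof -
 let ?E = "coord_field U \<phi>" and ?\<beta> = "interior_bivector A D B \<Phi>" and ?l = "\<lambda>i. (at_point Zs p)[i := bracket X (Zs ! i) p]"
 let ?b = "\<lambda>a d. pbracket B (coord \<phi> a) (coord \<phi> d)" and ?T = "\<lambda>a d q. \<Phi> q (?E d q # ?E a q # at_point Zs q)"
 let ?T' = "\<lambda>a d i. \<Phi> p (?E d p # ?E a p # ?l i)"
 note Xp = vector_field_tangent[OF X W(3)]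
 have ZD: "set (at_point Zs q) \<subseteq> D q" if "q \<in> W" for q by (rule at_point_sections[OF Zs(2) that])
 have formula: "?\<beta> q l = (\<Sum>a\<in>set es. \<Sum>d\<in>set es. ?b a d q * \<Phi> q (?E d q # ?E a q # l)) / 2"
  if "q \<in> W" "length l = k" "set l \<subseteq> D q" for q l
  by (rule interior_bivector_frame[where \<Phi> = \<Phi> and p = q, OF B ac _ kforms_alternating[OF \<Phi>] that(2,3)]) (use that(1) W(2) in auto)
 have s: "smooth_at A p (?b a d)" "smooth_at A p (?T a d)" if "a \<in> set es" "d \<in> set es" for a d
 proof -
  have "set (?E d # ?E a # Zs) \<subseteq> sections A W D" using Zs(2) sections_mono[OF frame_section[OF ac] W(2)] that by auto
  from kforms_smooth[OF \<Phi> W(1) _ this] Zs(1) show "smooth_at A p (?T a d)"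
   by (intro smooth_atI[OF W(1,3)]) (simp add: at_point_Cons)
  show "smooth_at A p (?b a d)"
   by (rule smooth_atI[OF W(1,3) Cinf_mono[OF coordinate_bracket_smooth[OF B ac] W(2)]])
 qed
 have "X p (\<lambda>q. ?\<beta> q (at_point Zs q)) = X p (\<lambda>q. (1 / 2) * (\<Sum>a\<in>set es. \<Sum>d\<in>set es. ?b a d q * ?T a d q))"
  by (rule tangent_cong[OF Xp W(1,3)]) (simp add: formula Zs(1) ZD)
 also have "\<dots> = 1 / 2 * X p (\<lambda>q. \<Sum>a\<in>set es. \<Sum>d\<in>set es. ?b a d q * ?T a d q)"
  by (rule tangent_cmult[OF Xp]) (intro smooth_at_sum smooth_at_mult s)
 also have "X p (\<lambda>q. \<Sum>a\<in>set es. \<Sum>d\<in>set es. ?b a d q * ?T a d q) = (\<Sum>a\<in>set es. X p (\<lambda>q. \<Sum>d\<in>set es. ?b a d q * ?T a d q))"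
  by (rule tangent_sum[OF Xp]) (intro smooth_at_sum smooth_at_mult s)
 also have "\<dots> = (\<Sum>a\<in>set es. \<Sum>d\<in>set es. X p (\<lambda>q. ?b a d q * ?T a d q))"
  by (intro sum.cong refl tangent_sum[OF Xp] smooth_at_mult s)
 also have "\<dots> = (\<Sum>a\<in>set es. \<Sum>d\<in>set es. ?b a d p * X p (?T a d) + ?T a d p * X p (?b a d))"
  by (intro sum.cong refl tangent_mult[OF Xp s])
 finally have 1: "X p (\<lambda>q. ?\<beta> q (at_point Zs q)) = (\<Sum>a\<in>set es. \<Sum>d\<in>set es. ?b a d p * X p (?T a d) + ?T a d p * X p (?b a d)) / 2"
  by simp
 have "(\<Sum>i<k. ?\<beta> p (?l i)) = (\<Sum>i<k. (\<Sum>a\<in>set es. \<Sum>d\<in>set es. ?b a d p * ?T' a d i) / 2)"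
  by (intro sum.cong refl formula W(3) set_update_subset ZD br) (auto simp: Zs(1))
 also have "\<dots> = (\<Sum>a\<in>set es. \<Sum>d\<in>set es. ?b a d p * (\<Sum>i<k. ?T' a d i)) / 2"
  unfolding sum_divide_distrib[symmetric] sum_distrib_left
  by (subst sum.swap) (intro arg_cong2[of _ _ _ _ "(/)"] sum.cong refl sum.swap)
 finally have 2: "(\<Sum>i<k. ?\<beta> p (?l i)) = (\<Sum>a\<in>set es. \<Sum>d\<in>set es. ?b a d p * (\<Sum>i<k. ?T' a d i)) / 2" .
 have "X p (?T a d) - (\<Sum>i<k. ?T' a d i) = lie_form A X \<Phi> (?E d # ?E a # Zs) p
   + \<Phi> p (bracket X (?E d) p # ?E a p # at_point Zs p) + \<Phi> p (?E d p # bracket X (?E a) p # at_point Zs p)" for a d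
  unfolding lie_form_def length_Cons sum.lessThan_Suc_shift by (simp add: at_point_Cons Zs(1))
 note 3 = this[symmetric]
 have "2 * lie_form A X ?\<beta> Zs p = (\<Sum>a\<in>set es. \<Sum>d\<in>set es. ?b a d p * X p (?T a d) + ?T a d p * X p (?b a d))
   - (\<Sum>a\<in>set es. \<Sum>d\<in>set es. ?b a d p * (\<Sum>i<k. ?T' a d i))"
  using 1 2 by (simp add: lie_form_def Zs(1))
 also have "\<dots> = (\<Sum>a\<in>set es. \<Sum>d\<in>set es. X p (?b a d) * ?T a d p + ?b a d p * (X p (?T a d) - (\<Sum>i<k. ?T' a d i)))"
  unfolding sum_subtractf[symmetric] by (intro sum.cong refl) (simp add: algebra_simps)
 finally show ?thesis unfolding 3 .
qed

text \<open>Since \<open>L\<^sub>X B = 0\<close> for a Hamiltonian field \<open>X\<close> of \<open>B\<close>, contraction with \<open>B\<close> commutes with \<open>L\<^sub>X\<close>.\<close>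

lemma lie_form_interior_bivector:
 assumes B: "poisson_bivector A B" and \<Phi>: "\<Phi> \<in> kforms A TM (Suc (Suc k))"
  and W: "open W" "p \<in> W" and f: "f \<in> Cinf A W"
  and eig: "\<And>U Ys. open U \<Longrightarrow> p \<in> U \<Longrightarrow> length Ys = Suc (Suc k) \<Longrightarrow> set Ys \<subseteq> \<XX> U \<Longrightarrow>
   lie_form A (ham B f) \<Phi> Ys p = c * \<Phi> p (at_point Ys p)"
  and Ys: "open U0" "p \<in> U0" "length Ys = k" "set Ys \<subseteq> \<XX> U0"
 shows "lie_form A (ham B f) (interior_bivector A TM B \<Phi>) Ys p
  = c * interior_bivector A TM B \<Phi> p (at_point Ys p)"
proof -
 note Bb = poisson_bivectorD[OF B]
 let ?X = "ham B f"
 obtain U \<phi> bs ff where ac0: "adapted_chart TM U \<phi> bs ff" and pU: "p \<in> U"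
  using adapted_chart_exists[OF regular_foliation_total] .
 define cs where "cs = bs @ ff"
 have ac: "adapted_chart TM U \<phi> cs []" unfolding cs_def by (rule adapted_chart_total[OF ac0])
 let ?N = "W \<inter> U \<inter> U0"
 have N: "open ?N" "p \<in> ?N" "?N \<subseteq> U" "?N \<subseteq> U0" using W Ys pU acD(2)[OF ac] by auto
 have X: "?X \<in> \<XX> ?N" by (rule ham_field_vector_field[OF Bb N(1) Cinf_mono[OF f]]) auto
 note Xp = vector_field_tangent[OF X N(2)]
 let ?z = "\<lambda>a q. \<phi> q \<bullet> a" and ?E = "coord_field U \<phi>"
 let ?l = "at_point Ys p"
 have E: "?E a \<in> \<XX> ?N" for a by (rule vector_fields_mono[OF frame_vector_field[OF ac] N(3)])
 have YN: "set Ys \<subseteq> \<XX> ?N" using Ys(4) vector_fields_mono[OF _ N(4)] by blast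
 have z: "?z a \<in> Cinf A ?N" for a by (rule Cinf_mono[OF coordinate_smooth[OF ac] N(3)])
 have Yt: "set (at_point Ys q) \<subseteq> TM q" if "q \<in> ?N" for q by (rule at_point_vector_fields[OF YN that])
 have Et: "?E a q \<in> TM q" if "q \<in> ?N" for a q using vector_field_tangent[OF E that] .
 define b where "b a d = pbracket B (?z a) (?z d)" for a d
 define M where "M a d = ?E a p (\<lambda>q. ?X q (?z d))" for a d
 have \<Phi>alt: "alternating_on (TM p) (Suc (Suc k)) (\<Phi> p)" by (rule kforms_alternating[OF \<Phi>])
 \<comment> \<open>Invariance of \<open>B\<close> under \<open>?X\<close> in components;
   \<open>M a d\<close> is the derivative of the \<open>d\<close>-component of \<open>?X\<close>
   along the \<open>a\<close>-th frame field.\<close>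
 have Xb: "?X p (b a d) = (\<Sum>c\<in>set cs. M c a * b c d p + M c d * b a c p)" for a d
 proof -
  have sm: "smooth_at A p (?z e)" "smooth_at A p (pbracket B f (?z e))" "smooth_at A p (\<lambda>q. ?X q (?z e))" for e
   using smooth_atI[OF N(1,2) z] smooth_atI[OF N(1,2) pbracket_smooth[OF Bb N(1) Cinf_mono[OF f] z]]
    smooth_at_vector_field[OF X N(1,2) smooth_atI[OF N(1,2) z]] by auto
  have h: "ham B (?z e) p u = (\<Sum>c\<in>set cs. b e c p * ?E c p u)" for e u
  proof -
   have "ham B (?z e) p = (\<Sum>c\<in>set cs. ham B (?z e) p (?z c) *\<^sub>R ?E c p)"
    using tangent_expand[OF ac pU ham_field_tangent[OF Bb]] by simp
   then have "ham B (?z e) p u = (\<Sum>c\<in>set cs. ham B (?z e) p (?z c) *\<^sub>R ?E c p) u"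
    by (rule fun_cong)
   also have "\<dots> = (\<Sum>c\<in>set cs. b e c p * ?E c p u)"
    by (simp add: sum_fun_apply b_def ham_field_apply[OF sm(1)])
   finally show ?thesis .
  qed
  have e: "pbracket B f (?z e) q = ?X q (?z e)" if "q \<in> ?N" for q e
   using ham_field_apply[OF smooth_atI[OF N(1) that z]] by simp
  have Ee: "?E c p (pbracket B f (?z e)) = M c e" for c e
   unfolding M_def by (rule tangent_cong[OF Et[OF N(2)] N(1,2) e])
  have "?X p (b a d) = pbracket B (pbracket B f (?z a)) (?z d) p + pbracket B (?z a) (pbracket B f (?z d)) p"
   unfolding b_def by (rule poisson_derivation[OF B N(1,2) Cinf_mono[OF f] z z]) auto
  also have "pbracket B (pbracket B f (?z a)) (?z d) p = - ham B (?z d) p (pbracket B f (?z a))"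
   using pbracket_skew[OF Bb, of "pbracket B f (?z a)" "?z d" p] sm by (simp add: ham_field_apply)
  also have "\<dots> = (\<Sum>c\<in>set cs. M c a * b c d p)"
  proof -
   have "b d c p = - b c d p" for c unfolding b_def by (rule pbracket_skew[OF Bb])
   then show ?thesis by (simp add: h Ee sum_negf[symmetric] mult.commute)
  qed
  also have "pbracket B (?z a) (pbracket B f (?z d)) p = (\<Sum>c\<in>set cs. M c d * b a c p)"
   using h[of a "pbracket B f (?z d)"] sm by (simp add: ham_field_apply Ee mult.commute)
  finally show ?thesis by (simp add: sum.distrib)
 qed
 have XE: "bracket ?X (?E a) p = (\<Sum>c\<in>set cs. (- M a c) *\<^sub>R ?E c p)" for a
  using tangent_expand[OF ac pU lie_bracket_tangent[OF X E N(1,2)], of a] bracket_coordinate[OF ac N(1,3,2) X, of a]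
  by (simp add: M_def)
 let ?P = "\<lambda>d a. \<Phi> p (?E d p # ?E a p # ?l)" and ?\<beta> = "interior_bivector A TM B \<Phi>"
 have L: "set (?E d p # ?E a p # ?l) \<subseteq> TM p" "length (?E d p # ?E a p # ?l) = Suc (Suc k)" for a d
  using Et[OF N(2)] Yt[OF N(2)] Ys(3) by auto
 have P1: "\<Phi> p (bracket ?X (?E d) p # ?E a p # ?l) = - (\<Sum>e\<in>set cs. M d e * ?P e a)" for a d
  using alternating_sum[OF \<Phi>alt subspace_tangent_space L(2)[of d a] L(1)[of d a], of 0 "set cs" "\<lambda>e. ?E e p" "\<lambda>e. - M d e"] Et[OF N(2)]
  by (simp add: XE sum_negf)
 have P2: "\<Phi> p (?E d p # bracket ?X (?E a) p # ?l) = - (\<Sum>e\<in>set cs. M a e * ?P d e)" for a d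
  using alternating_sum[OF \<Phi>alt subspace_tangent_space L(2)[of d a] L(1)[of d a], of 1 "set cs" "\<lambda>e. ?E e p" "\<lambda>e. - M a e"] Et[OF N(2)]
  by (simp add: XE sum_negf)
 have e: "lie_form A ?X \<Phi> (?E d # ?E a # Ys) p = c * ?P d a" for a d
  using eig[OF N(1,2), of "?E d # ?E a # Ys"] YN E Ys(3) by (simp add: at_point_Cons)
 have "2 * lie_form A ?X ?\<beta> Ys p = (\<Sum>a\<in>set cs. \<Sum>d\<in>set cs. ?X p (b a d) * ?P d a
   + b a d p * (c * ?P d a + - (\<Sum>e\<in>set cs. M d e * ?P e a) + - (\<Sum>e\<in>set cs. M a e * ?P d e)))"
  unfolding P1[symmetric] P2[symmetric] e[symmetric] b_def
 proof (rule lie_form_interior_frame[OF Bb ac \<Phi> N(1,3,2) X Ys(3)])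
  show "set Ys \<subseteq> sections A ?N TM" using YN by (simp add: sections_total)
  show "bracket ?X (Ys ! i) p \<in> TM p" if "i < k" for i
   by (rule lie_bracket_tangent[OF X _ N(1,2)]) (use YN that Ys(3) nth_mem in blast)
 qed
 also have "\<dots> = (\<Sum>a\<in>set cs. \<Sum>d\<in>set cs. b a d p * (c * ?P d a))"
  using triple_sum_cancel[where J = "set cs" and M = M and b = "\<lambda>a d. b a d p" and \<Phi> = ?P]
  by (simp add: Xb sum.distrib sum_subtractf algebra_simps)
 also have "\<dots> = c * (2 * ?\<beta> p ?l)"
 proof -
  have "2 * ?\<beta> p ?l = (\<Sum>a\<in>set cs. \<Sum>d\<in>set cs. b a d p * ?P d a)"
   using interior_bivector_frame[where \<Phi> = \<Phi> and p = p, OF Bb ac pU \<Phi>alt _ Yt[OF N(2)]] Ys(3) by (simp add: b_def)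
  then show ?thesis by (simp only: sum_distrib_left mult.left_commute)
 qed
 finally show ?thesis by simp
qed

end

lemma wedge_sum_linear: "wedge_sum ps (\<lambda>v. a * \<alpha> v + b * \<beta> v) \<gamma> = a * wedge_sum ps \<alpha> \<gamma> + b * wedge_sum ps \<beta> \<gamma>"
 by (induction ps) (auto simp: wedge_sum_Cons algebra_simps)

lemma contract_scale: "contract ps (\<lambda>l. c * \<Phi> l) l = c * contract ps \<Phi> l"
 by (induction ps) (auto simp: contract_Cons algebra_simps)

lemma contract_pow_scale: "(contract ps ^^ j) (\<lambda>l. c * \<Phi> l) l = c * (contract ps ^^ j) \<Phi> l"
proof (induction j arbitrary: l)
 case (Suc j)
 have "(contract ps ^^ j) (\<lambda>l. c * \<Phi> l) = (\<lambda>l. c * (contract ps ^^ j) \<Phi> l)" using Suc by blast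
 then show ?case by (simp add: contract_scale)
qed simp

context manifold
begin

lemma Cinf_continuous:
 assumes "f \<in> Cinf A W" "open W"
 shows "continuous_on W f"
proof (rule continuous_at_imp_continuous_on, intro ballI)
 fix p assume p: "p \<in> W"
 obtain U \<phi> where c: "(U, \<phi>) \<in> A" "p \<in> U" by (rule chart_exists)
 then have c': "(U, \<phi>) \<in> maximal_atlas A" using atlas_subset by auto
 let ?N = "W \<inter> U"
 have N: "open ?N" "?N \<subseteq> U" "p \<in> ?N" using assms(2) chartD(1)[OF c'] p c by auto
 have "f \<in> Cinf A ?N" using assms(1) by (rule Cinf_mono) auto
 then have cN: "continuous_on (\<phi> ` ?N) (\<lambda>x. f (inv_into U \<phi> x))"
  using Cinf_chart[OF c' N(1,2)] by (simp add: smooth_on_def Ck_on_imp_continuous_on)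
 have "continuous_on ?N f"
 proof (rule continuous_on_eq)
  show "continuous_on ?N (\<lambda>q. f (inv_into U \<phi> (\<phi> q)))"
   by (rule continuous_on_compose2[OF cN continuous_on_subset[OF chartD(6)[OF c'] N(2)]]) auto
 qed (use chartD(3)[OF c'] in auto)
 then show "isCont f p" using N continuous_on_eq_continuous_at by blast
qed

lemma open_nonzero:
 assumes "f \<in> Cinf A W" "open W"
 shows "open {q \<in> W. f q \<noteq> (0::real)}"
proof -
 have "open (W \<inter> f -` (- {0}))"
  using Cinf_continuous[OF assms] assms(2) by (intro continuous_open_preimage) auto
 moreover have "W \<inter> f -` (- {0}) = {q \<in> W. f q \<noteq> 0}" by auto
 ultimately show ?thesis by simp
qed

lemma kforms_restrict:
 assumes "\<omega> \<in> kforms A TM k" "\<And>p. D p \<subseteq> TM p"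
 shows "\<omega> \<in> kforms A D k" unfolding kforms_def
proof (intro CollectI conjI allI impI)
 show "alternating_on (D p) k (\<omega> p)" for p
  by (rule alternating_subset[OF kforms_alternating[OF assms(1)] assms(2)])
 fix W Xs assume *: "open W" "length Xs = k" "set Xs \<subseteq> sections A W D"
 then have "set Xs \<subseteq> \<XX> W" by (auto simp: sections_def)
 then show "(\<lambda>p. \<omega> p (at_point Xs p)) \<in> Cinf A W"
  by (intro kforms_smooth[OF assms(1) *(1,2)]) (simp only: sections_total)
qed

text \<open>A chart volume cut off by a bump function is a global top form.\<close>

lemma local_volume_exists:
 obtains \<omega> vs where "\<omega> \<in> kforms A TM DIM('e)" "length vs = DIM('e)"
  "set vs \<subseteq> TM p" "\<omega> p vs \<noteq> 0"
proof -
 obtain U \<phi> bs ff where ac0: "adapted_chart TM U \<phi> bs ff" and pU: "p \<in> U"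
  using adapted_chart_exists[OF regular_foliation_total] .
 define cs where "cs = bs @ ff"
 have ac: "adapted_chart TM U \<phi> cs []" unfolding cs_def by (rule adapted_chart_total[OF ac0])
 have n: "length cs = DIM('e)" using adapted_chart_length[OF ac] by simp
 have U: "open U" by (rule acD(2)[OF ac])
 obtain b K where b: "b \<in> Cinf A UNIV" "b p \<noteq> 0" "closed K" "K \<subseteq> U" "\<And>q. q \<notin> K \<Longrightarrow> b q = 0"
  by (rule bump_function[OF U pU]) blast
 define \<omega> where "\<omega> q vs = (if q \<in> U then b q * chart_volume \<phi> cs vs else 0)" for q vs
 have "\<omega> \<in> kforms A TM DIM('e)" unfolding kforms_def
 proof (intro CollectI conjI allI impI)
  fix q
  have "alternating_on (TM q) DIM('e) (\<lambda>vs. (if q \<in> U then b q else 0) * chart_volume \<phi> cs vs + 0 * chart_volume \<phi> cs vs)"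
   using alternating_lincomb[OF alternating_chart_volume alternating_chart_volume] n by metis
  then show "alternating_on (TM q) DIM('e) (\<omega> q)"
   by (rule alternating_cong[OF _ subspace_tangent_space]) (simp add: \<omega>_def)
 next
  fix W Xs assume W: "open W" "length Xs = DIM('e)" "set Xs \<subseteq> sections A W TM"
  show "(\<lambda>q. \<omega> q (at_point Xs q)) \<in> Cinf A W"
  proof (rule Cinf_local[OF W(1)])
   fix q assume q: "q \<in> W"
   show "\<exists>V. open V \<and> q \<in> V \<and> (\<lambda>q. \<omega> q (at_point Xs q)) \<in> Cinf A V"
   proof (cases "q \<in> U")
    case True
    let ?N = "W \<inter> U"
    have N: "open ?N" "?N \<subseteq> U" using W U by auto
    have "set Xs \<subseteq> \<XX> ?N"
     using W(3) vector_fields_mono[of _ W ?N] by (auto simp: sections_total)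
    then have "(\<lambda>q. b q * chart_volume \<phi> cs (at_point Xs q)) \<in> Cinf A ?N"
     by (intro Cinf_mult[OF N(1)] chart_volume_smooth[OF acD(1)[OF ac] N] Cinf_mono[OF b(1)]) auto
    then have "(\<lambda>q. \<omega> q (at_point Xs q)) \<in> Cinf A ?N"
     by (rule Cinf_transform[OF _ N(1)]) (simp add: \<omega>_def)
    then show ?thesis using N q True by blast
   next
    case False
    have "(\<lambda>q. \<omega> q (at_point Xs q)) \<in> Cinf A (- K)"
     by (rule Cinf_transform[OF Cinf_const[of 0]]) (use b(3,5) in \<open>auto simp: \<omega>_def\<close>)
    then show ?thesis using False b(3,4) by (intro exI[of _ "- K"]) auto
   qed
  qed
 qed
 moreover have "\<omega> p (at_point (map (coord_field U \<phi>) cs) p) \<noteq> 0"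
  using pU b(2) chart_volume_frame[OF ac pU] by (simp add: \<omega>_def)
 moreover have "set (at_point (map (coord_field U \<phi>) cs) p) \<subseteq> TM p"
  using frame_tangent[OF ac pU] by (auto simp: at_point_def)
 ultimately show ?thesis using n by (intro that) auto
qed

end

section \<open>Coupling structures\<close>

locale coupling_structure = manifold A for A :: "('m::t2_space, 'e::euclidean_space) chart set" +
 fixes V :: "'m distribution" and P B :: "'m bivector"
 assumes V: "regular_foliation A V" and P: "P \<in> bivector_fields A V" and B: "poisson_bivector A B"
  and coupling: "coupling A V B" and vertical: "vertical_part A V B P"
begin

lemmas Bb = poisson_bivectorD[OF B]

abbreviation H :: "'m distribution" where "H \<equiv> horizontal A V B"

abbreviation r :: nat where "r \<equiv> fol_rank V"

text \<open>Half the rank of \<open>H\<close>. This rank is even because \<open>H\<close> has a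
  basis made of pairs, see \<open>horizontal_basis\<close>.\<close>

definition half_codim :: nat where "half_codim = (DIM('e) - r) div 2"

lemma subspace_V: "subspace (V p)"
 by (rule regular_foliation_subspace[OF V])

lemma V_tangent: "V p \<subseteq> TM p"
 using regular_foliation_tangent[OF V] by auto

lemma splits: "splits_tangent A H V"
 using coupling by (simp add: coupling_def)

lemma H_tangent: "H p \<subseteq> TM p"
proof
 fix h assume "h \<in> H p"
 then obtain \<alpha> where \<alpha>: "h = sharp A B p \<alpha>" "\<alpha> \<in> cotangent_space A p" unfolding horizontal_def by auto
 obtain ps where "decomposes A p (TM p) (B p) ps" by (rule bivector_decomposes[OF Bb])
 from sharp_mem[where B = B and p = p, OF this order.refl subspace_tangent_space \<alpha>(2)] \<alpha>(1)
 show "h \<in> TM p" by simp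
qed

lemma subspace_H: "subspace (H p)"
proof -
 obtain ps where d: "decomposes A p (TM p) (B p) ps" by (rule bivector_decomposes[OF Bb])
 have lin: "sharp A B p (\<lambda>v. a * \<alpha> v + b * \<beta> v) = a *\<^sub>R sharp A B p \<alpha> + b *\<^sub>R sharp A B p \<beta> \<and>
   (\<lambda>v. a * \<alpha> v + b * \<beta> v) \<in> cotangent_space A p"
  if "\<alpha> \<in> cotangent_space A p" "\<beta> \<in> cotangent_space A p" for \<alpha> \<beta> a b
 proof -
  have c: "(\<lambda>v. a * \<alpha> v + b * \<beta> v) \<in> cotangent_space A p"
   using that by (simp add: cotangent_space_def linear_functional_on_def algebra_simps)
  have "B p (\<lambda>v. a * \<alpha> v + b * \<beta> v) (differential f) = a * B p \<alpha> (differential f) + b * B p \<beta> (differential f)" for f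
   unfolding decomposesD(2)[OF d c differential_cotangent] decomposesD(2)[OF d that(1) differential_cotangent]
    decomposesD(2)[OF d that(2) differential_cotangent] by (rule wedge_sum_linear)
  then show ?thesis using c by (auto simp: sharp_def fun_eq_iff)
 qed
 have mem: "a *\<^sub>R h + b *\<^sub>R h' \<in> H p" if hh: "h \<in> H p" "h' \<in> H p" for a b h h'
 proof -
  obtain \<alpha> where a: "h = sharp A B p \<alpha>" "\<alpha> \<in> cotangent_space A p" "\<forall>v\<in>V p. \<alpha> v = 0"
   using hh(1) unfolding horizontal_def by blast
  obtain \<beta> where b: "h' = sharp A B p \<beta>" "\<beta> \<in> cotangent_space A p" "\<forall>v\<in>V p. \<beta> v = 0"
   using hh(2) unfolding horizontal_def by blast
  note * = a b
  show ?thesis unfolding horizontal_def using lin[OF *(2,5), of a b] *(3,6)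
   by (intro CollectI exI[of _ "\<lambda>v. a * \<alpha> v + b * \<beta> v"]) (simp add: *(1,4))
 qed
 have z: "0 \<in> H p" using splits_tangent_Int[OF splits, of p] by auto
 show ?thesis
 proof (rule subspaceI[OF z])
  show "x + y \<in> H p" if "x \<in> H p" "y \<in> H p" for x y using mem[OF that, of 1 1] by simp
  show "c *\<^sub>R x \<in> H p" if "x \<in> H p" for c x using mem[OF that that, of c 0] by simp
 qed
qed

text \<open>A shortest decomposition of \<open>B - P\<close> consists of independent vectors. They
  span \<open>H\<close>, since an element of \<open>H\<close> is the image of a covector that kills
  \<open>V\<close> and with it all pairs of \<open>qs\<close>. The splitting then ties their number
  to the codimension of \<open>V\<close>.\<close>

lemma horizontal_basis:
 obtains ps qs where "decomposes A p (TM p) (B p) (ps @ qs)" "set ps \<subseteq> H p \<times> H p"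
  "decomposes A p (V p) (P p) qs"
  "decomposes A p (H p) (\<lambda>\<alpha> \<beta>. B p \<alpha> \<beta> - P p \<alpha> \<beta>) ps"
  "H p = span (set (flatten_pairs ps))" "2 * length ps + r = DIM('e)"
proof -
 let ?C = "cotangent_space A p" and ?T = "TM p"
 let ?D = "\<lambda>\<alpha> \<beta>. B p \<alpha> \<beta> - P p \<alpha> \<beta>"
 obtain ps0 where "decomposes A p (H p) ?D ps0" using vertical unfolding vertical_part_def wedge2_def by blast
 from ex_has_least_nat[of "decomposes A p (H p) ?D" ps0 length, OF this]
 obtain ps where ps: "decomposes A p (H p) ?D ps" "\<And>qs. decomposes A p (H p) ?D qs \<Longrightarrow> length ps \<le> length qs" by blast
 obtain qs where qs: "decomposes A p (V p) (P p) qs" by (rule bivector_decomposes[OF P])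
 have psH: "set ps \<subseteq> H p \<times> H p" and qsV: "set qs \<subseteq> V p \<times> V p" using decomposesD(1) ps(1) qs by auto
 have lin: "linear_functional_on (H p) \<alpha>" if "\<alpha> \<in> ?C" for \<alpha>
  using cotangentD[OF that] H_tangent[of p] by (auto simp: linear_functional_on_def)
 have ind: "independent (set (flatten_pairs ps))" "distinct (flatten_pairs ps)"
 proof -
  have "length ps \<le> length qs" if "set qs \<subseteq> H p \<times> H p" "\<forall>\<alpha>\<in>?C. \<forall>\<beta>\<in>?C. wedge_sum qs \<alpha> \<beta> = wedge_sum ps \<alpha> \<beta>" for qs
   by (rule ps(2)) (use that decomposesD(2)[OF ps(1)] in \<open>auto simp: decomposes_def\<close>)
  from minimal_wedge_sum_independent[OF subspace_H lin psH this]
  show "independent (set (flatten_pairs ps))" "distinct (flatten_pairs ps)" by auto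
 qed
 have d: "decomposes A p ?T (B p) (ps @ qs)" unfolding decomposes_def
 proof (intro conjI ballI)
  show "set (ps @ qs) \<subseteq> ?T \<times> ?T" using psH qsV H_tangent[of p] V_tangent[of p] by auto
  fix \<alpha> \<beta> assume "\<alpha> \<in> ?C" "\<beta> \<in> ?C"
  then show "B p \<alpha> \<beta> = wedge_sum (ps @ qs) \<alpha> \<beta>"
   using decomposesD(2)[OF ps(1), of \<alpha> \<beta>] decomposesD(2)[OF qs, of \<alpha> \<beta>] by (simp add: wedge_sum_append)
 qed
 have fH: "set (flatten_pairs ps) \<subseteq> H p" using psH by (auto simp: set_flatten_pairs)
 have sp: "H p = span (set (flatten_pairs ps))"
 proof (intro equalityI subsetI)
  fix h assume "h \<in> H p"
  then obtain \<alpha> where \<alpha>: "h = sharp A B p \<alpha>" "\<alpha> \<in> ?C" "\<forall>v\<in>V p. \<alpha> v = 0" unfolding horizontal_def by auto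
  let ?s = "\<lambda>ps. \<Sum>(v, w)\<leftarrow>ps. \<alpha> v *\<^sub>R w - \<alpha> w *\<^sub>R v"
  have 1: "?s ps \<in> span (set (flatten_pairs ps))" for ps :: "('m tangent \<times> 'm tangent) list"
  proof (induction ps)
   case Nil
   show ?case unfolding list.map sum_list.Nil by (rule span_0)
  next
   case (Cons q ps)
   obtain v w where q: "q = (v, w)" by fastforce
   let ?S = "span (set (flatten_pairs (q # ps)))"
   have "v \<in> ?S" "w \<in> ?S" unfolding q by (rule span_base, simp)+
   moreover have "?s ps \<in> ?S" by (rule subsetD[OF span_mono Cons.IH]) (auto simp: q)
   ultimately show ?case unfolding q list.map sum_list.Cons split_conv by (intro span_add span_diff span_scale)
  qed
  have 2: "?s qs = 0" using qsV
  proof (induction qs)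
   case Nil
   show ?case unfolding list.map sum_list.Nil ..
  next
   case (Cons q qs)
   obtain v w where q: "q = (v, w)" by fastforce
   have "set qs \<subseteq> V p \<times> V p" and vw: "\<alpha> v = 0" "\<alpha> w = 0" using Cons.prems q \<alpha>(3) by auto
   note IH = Cons.IH[OF this(1)]
   show ?case unfolding q list.map sum_list.Cons split_conv vw IH scale_zero_left
    by (simp only: diff_self add_0_left)
  qed
  have "h = ?s (ps @ qs)" unfolding \<alpha>(1) by (rule sharp_decomposes[where B = B and p = p, OF d order.refl \<alpha>(2)])
  also have "\<dots> = ?s ps" unfolding map_append sum_list_append 2 by simp
  finally show "h \<in> span (set (flatten_pairs ps))" using 1 by simp
 next
  show "h \<in> H p" if "h \<in> span (set (flatten_pairs ps))" for h
   using span_minimal[OF fH subspace_H] that by blast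
 qed
 obtain U \<phi> es fs where ac: "adapted_chart V U \<phi> es fs" and pU: "p \<in> U" using adapted_chart_exists[OF V] .
 let ?E = "(\<lambda>e. coord_field U \<phi> e p) ` set es"
 have VE: "V p = span ?E" using leaf_span[OF ac pU] by simp
 have "independent ?E" using independent_mono[OF frame_independent[OF ac pU]] by (auto simp: image_Un)
 moreover have "span (set (flatten_pairs ps)) \<inter> span ?E = {0}"
  using splits_tangent_Int[OF splits, of p] sp VE by simp
 ultimately have i: "independent (set (flatten_pairs ps) \<union> ?E)" "set (flatten_pairs ps) \<inter> ?E = {}"
  using independent_Un_complement[of "set (flatten_pairs ps)" ?E] ind(1) by auto
 have "card ?E = r"
  using card_image[OF inj_on_subset[OF frame_injective[OF ac pU]], of "set es"] distinct_card[of es] acD(3)[OF ac]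
   adapted_chart_rank[OF V ac] pU by auto
 then have c: "card (set (flatten_pairs ps) \<union> ?E) = 2 * length ps + r"
  using i(2) distinct_card[OF ind(2)] by (simp add: card_Un_disjoint)
 have "?T = span (set (flatten_pairs ps) \<union> ?E)"
 proof (intro equalityI subsetI)
  fix v assume v: "v \<in> ?T"
  obtain u w where uw: "u \<in> H p" "w \<in> V p" "v = u + w" using splits_tangentE[OF splits v] .
  have "u \<in> span (set (flatten_pairs ps) \<union> ?E)" "w \<in> span (set (flatten_pairs ps) \<union> ?E)"
   using uw(1,2) sp VE span_mono[of "set (flatten_pairs ps)" "set (flatten_pairs ps) \<union> ?E"]
    span_mono[of ?E "set (flatten_pairs ps) \<union> ?E"] by auto
  then show "v \<in> span (set (flatten_pairs ps) \<union> ?E)" unfolding uw(3) by (rule span_add)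
 next
  have "set (flatten_pairs ps) \<union> ?E \<subseteq> ?T" using fH H_tangent[of p] frame_tangent[OF ac pU] by auto
  then show "v \<in> ?T" if "v \<in> span (set (flatten_pairs ps) \<union> ?E)" for v
   using span_minimal[OF _ subspace_tangent_space] that by blast
 qed
 then have "dim ?T = 2 * length ps + r" using dim_eq_card_independent[OF i(1)] c by (simp add: dim_span)
 then have "2 * length ps + r = DIM('e)"
  using fol_rank_eq[OF regular_foliation_total] fol_rank_total by metis
 with d psH qs ps(1) sp show ?thesis by (rule that)
qed

lemma half_codim: "2 * half_codim + r = DIM('e)"
proof -
 obtain ps :: "('m tangent \<times> 'm tangent) list" where "2 * length ps + r = DIM('e)"
  by (rule horizontal_basis[of undefined])
 then have "DIM('e) - r = 2 * length ps" "r \<le> DIM('e)" by simp_all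
 then show ?thesis unfolding half_codim_def by simp
qed

text \<open>The contractions use all of \<open>B\<close>, since it is \<open>B\<close> that its
  Hamiltonian fields preserve; \<open>K_flatten\<close> shows that the vertical pairs drop out on
  the lists that matter.\<close>

definition K :: "'m kform \<Rightarrow> 'm kform" where
 "K \<Omega> = (interior_bivector A TM B ^^ half_codim) \<Omega>"

lemma interior_pow_kforms:
 "\<Omega> \<in> kforms A TM (k + 2 * j) \<Longrightarrow>
  (interior_bivector A TM B ^^ j) \<Omega> \<in> kforms A TM k"
proof (induction j arbitrary: k)
 case (Suc j)
 have "(interior_bivector A TM B ^^ j) \<Omega> \<in> kforms A TM (Suc (Suc k))"
  by (rule Suc.IH) (use Suc.prems in simp)
 from interior_bivector_kforms[OF Bb regular_foliation_total this] show ?case by simp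
qed simp

lemma K_kforms: "\<Omega> \<in> kforms A TM DIM('e) \<Longrightarrow> K \<Omega> \<in> kforms A TM r"
 unfolding K_def by (rule interior_pow_kforms) (use half_codim in \<open>simp add: add.commute\<close>)

lemma K_eq:
 assumes alt: "alternating_on (TM p) DIM('e) (\<Omega> p)"
  and d: "decomposes A p (TM p) (B p) ps" and l: "length l = r" "set l \<subseteq> TM p"
 shows "K \<Omega> p l = (contract ps ^^ half_codim) (\<Omega> p) l"
proof -
 obtain U \<phi> es fs where ac: "adapted_chart TM U \<phi> es fs" and pU: "p \<in> U"
  using adapted_chart_exists[OF regular_foliation_total] .
 have "decomposes A p (TM p) (B p) (SOME ps. decomposes A p (TM p) (B p) ps)" using d by (rule someI)
 from contract_pow_independent[OF ac pU this d _ l] show ?thesis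
  unfolding K_def interior_bivector_pow using alt half_codim by (simp add: add.commute)
qed

lemma K_flatten:
 assumes alt: "alternating_on (TM p) DIM('e) (\<Omega> p)"
  and ps: "decomposes A p (TM p) (B p) (ps @ qs)" "set ps \<subseteq> H p \<times> H p" "decomposes A p (V p) (P p) qs"
   "2 * length ps + r = DIM('e)"
  and l: "length l = r" "set l \<subseteq> TM p" and many: "r \<le> Suc (length (filter (\<lambda>v. v \<in> V p) l))"
 shows "K \<Omega> p l = fact half_codim * \<Omega> p (flatten_pairs ps @ l)"
proof -
 let ?T = "TM p" and ?cnt = "\<lambda>l. length (filter (\<lambda>v. v \<in> V p) l)"
 have k: "half_codim = length ps" using half_codim ps(4) by simp
 have n: "r + 2 * half_codim = DIM('e)" using half_codim by simp
 have psT: "set ps \<subseteq> ?T \<times> ?T" using ps(2) H_tangent[of p] by auto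
 have qsV: "set qs \<subseteq> V p \<times> V p" using decomposesD(1)[OF ps(3)] .
 then have qsT: "set qs \<subseteq> ?T \<times> ?T" using V_tangent[of p] by auto
 obtain U \<phi> es fs where ac: "adapted_chart V U \<phi> es fs" and pU: "p \<in> U" using adapted_chart_exists[OF V] .
 let ?E = "set (map (\<lambda>e. coord_field U \<phi> e p) es)"
 have "card ?E \<le> length es" using card_length[of "map (\<lambda>e. coord_field U \<phi> e p) es"] by simp
 moreover have "length es = r" by (rule adapted_chart_rank[OF V ac]) (use pU in auto)
 ultimately have E: "card ?E \<le> r" "V p = span ?E" using leaf_span[OF ac pU] by auto
 have bad0: "\<Omega> p l = 0" if "length l = r + 2 * half_codim" "set l \<subseteq> ?T" "?cnt l > r" for l
  by (rule alternating_dependent_zero[of ?T l "\<Omega> p" ?E "\<lambda>v. v \<in> V p"])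
   (use alt that E n in \<open>auto simp: subspace_tangent_space\<close>)
 have "K \<Omega> p l = (contract (ps @ qs) ^^ half_codim) (\<Omega> p) l" by (rule K_eq[where \<Omega> = \<Omega> and p = p, OF alt ps(1) l])
 also have "\<dots> = (contract ps ^^ half_codim) (\<Omega> p) l"
 proof (rule contract_pow_append_bad[where bad = "\<lambda>l. ?cnt l > r" and Q = "\<lambda>l. r \<le> Suc (?cnt l)" and S = ?T and k = r])
  fix v w l assume "r \<le> Suc (?cnt l)" "(v, w) \<in> set qs"
  then show "?cnt (w # v # l) > r" using qsV by auto
 qed (use bad0 psT qsT l many in auto)
 also have "\<dots> = fact half_codim * \<Omega> p (flatten_pairs ps @ l)"
  unfolding k by (rule contract_pow_length[OF subspace_tangent_space psT _ l]) (use alt n k in simp)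
 finally show ?thesis .
qed

text \<open>The horizontal pairs together with \<open>l\<close> span the tangent space, and a
  nonzero top form does not vanish on a spanning list of full length.\<close>

lemma K_nonzero:
 assumes alt: "alternating_on (TM p) DIM('e) (\<Omega> p)"
  and vs: "length vs = DIM('e)" "set vs \<subseteq> TM p" "\<Omega> p vs \<noteq> 0"
  and l: "length l = r" "V p = span (set l)"
 shows "K \<Omega> p l \<noteq> 0"
proof -
 obtain ps qs where ps: "decomposes A p (TM p) (B p) (ps @ qs)" "set ps \<subseteq> H p \<times> H p"
  "decomposes A p (V p) (P p) qs" "decomposes A p (H p) (\<lambda>\<alpha> \<beta>. B p \<alpha> \<beta> - P p \<alpha> \<beta>) ps"
  "H p = span (set (flatten_pairs ps))" "2 * length ps + r = DIM('e)" by (rule horizontal_basis)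
 have lV: "set l \<subseteq> V p" unfolding l(2) by (auto intro: span_base)
 then have lT: "set l \<subseteq> TM p" using V_tangent[of p] by blast
 have "filter (\<lambda>v. v \<in> V p) l = l" using lV by (auto simp: filter_id_conv)
 then have *: "K \<Omega> p l = fact half_codim * \<Omega> p (flatten_pairs ps @ l)"
  by (intro K_flatten[where \<Omega> = \<Omega> and p = p, OF alt ps(1-3,6) l(1) lT]) (simp add: l(1))
 have "TM p = span (set (flatten_pairs ps @ l))"
 proof (intro equalityI subsetI)
  fix v assume v: "v \<in> TM p"
  obtain u w where uw: "u \<in> H p" "w \<in> V p" "v = u + w" using splits_tangentE[OF splits v] .
  have "u \<in> span (set (flatten_pairs ps @ l))" "w \<in> span (set (flatten_pairs ps @ l))"
   using uw(1,2) ps(5) l(2) span_mono[of "set (flatten_pairs ps)" "set (flatten_pairs ps @ l)"]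
    span_mono[of "set l" "set (flatten_pairs ps @ l)"] by auto
  then show "v \<in> span (set (flatten_pairs ps @ l))" unfolding uw(3) by (rule span_add)
 next
  have "set (flatten_pairs ps @ l) \<subseteq> TM p"
   using lT ps(2) H_tangent[of p] by (auto simp: set_flatten_pairs)
  then show "v \<in> TM p" if "v \<in> span (set (flatten_pairs ps @ l))" for v
   using span_minimal[OF _ subspace_tangent_space] that by blast
 qed
 then have "\<Omega> p (flatten_pairs ps @ l) \<noteq> 0"
  by (rule alternating_top_nonzero[OF alt subspace_tangent_space _ _ vs]) (use ps(6) l(1) in simp)
 then show ?thesis using * by simp
qed

text \<open>Together with \<open>h\<close> more than \<open>2 * length ps\<close> entries lie in
  \<open>H\<close>, which is spanned by that many vectors.\<close>

lemma K_horizontal_zero: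
 assumes alt: "alternating_on (TM p) DIM('e) (\<Omega> p)"
  and l: "length l = r" "set l \<subseteq> V p" "i < r" "h \<in> H p"
 shows "K \<Omega> p (l[i := h]) = 0"
proof -
 obtain ps qs where ps: "decomposes A p (TM p) (B p) (ps @ qs)" "set ps \<subseteq> H p \<times> H p"
  "decomposes A p (V p) (P p) qs" "decomposes A p (H p) (\<lambda>\<alpha> \<beta>. B p \<alpha> \<beta> - P p \<alpha> \<beta>) ps"
  "H p = span (set (flatten_pairs ps))" "2 * length ps + r = DIM('e)" by (rule horizontal_basis)
 let ?l = "l[i := h]"
 have lT: "set ?l \<subseteq> TM p"
  using l(2,4) V_tangent[of p] H_tangent[of p] by (intro set_update_subset) auto
 have "{..<r} - {i} \<subseteq> {j. j < length ?l \<and> ?l ! j \<in> V p}" using l by (auto simp: subset_iff)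
 then have "card ({..<r} - {i}) \<le> length (filter (\<lambda>v. v \<in> V p) ?l)"
  unfolding length_filter_conv_card by (intro card_mono) auto
 then have "r \<le> Suc (length (filter (\<lambda>v. v \<in> V p) ?l))" using l(3) by simp
 then have *: "K \<Omega> p ?l = fact half_codim * \<Omega> p (flatten_pairs ps @ ?l)"
  using l(1) lT by (intro K_flatten[where \<Omega> = \<Omega> and p = p, OF alt ps(1-3,6)]) auto
 have fH: "\<forall>x\<in>set (flatten_pairs ps). x \<in> H p" using ps(2) by (auto simp: set_flatten_pairs)
 have "h \<in> set ?l" using l(1,3) by (intro set_update_memI) simp
 then have "filter (\<lambda>v. v \<in> H p) ?l \<noteq> []" using l(4) by (auto simp: filter_empty_conv)
 then have cnt: "2 * length ps < length (filter (\<lambda>v. v \<in> H p) (flatten_pairs ps @ ?l))"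
  using fH by (simp add: filter_True)
 have "\<Omega> p (flatten_pairs ps @ ?l) = 0"
 proof (rule alternating_dependent_zero[of "TM p" _ _ "set (flatten_pairs ps)" "\<lambda>v. v \<in> H p"])
  show "alternating_on (TM p) (length (flatten_pairs ps @ ?l)) (\<Omega> p)" using alt ps(6) l(1) by simp
  show "card (set (flatten_pairs ps)) < length (filter (\<lambda>v. v \<in> H p) (flatten_pairs ps @ ?l))"
   using card_length[of "flatten_pairs ps"] cnt by simp
  show "set (flatten_pairs ps @ ?l) \<subseteq> TM p" using lT fH H_tangent[of p] by auto
 qed (use ps(5) in \<open>auto simp: subspace_tangent_space\<close>)
 then show ?thesis using * by simp
qed

lemma K_scale:
 assumes "alternating_on (TM p) DIM('e) (\<Omega> p)" "alternating_on (TM p) DIM('e) (\<Omega>' p)"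
  and "\<And>vs. length vs = DIM('e) \<Longrightarrow> set vs \<subseteq> TM p \<Longrightarrow> \<Omega> p vs = c * \<Omega>' p vs"
  and l: "length l = r" "set l \<subseteq> TM p"
 shows "K \<Omega> p l = c * K \<Omega>' p l"
proof -
 obtain ps where d: "decomposes A p (TM p) (B p) ps" by (rule bivector_decomposes[OF Bb])
 have "K \<Omega> p l = (contract ps ^^ half_codim) (\<Omega> p) l" by (rule K_eq[where \<Omega> = \<Omega> and p = p, OF assms(1) d l])
 also have "\<dots> = (contract ps ^^ half_codim) (\<lambda>l. c * \<Omega>' p l) l"
  by (rule contract_pow_cong[OF decomposesD(1)[OF d] _ l]) (use half_codim assms(3) in \<open>simp add: add.commute\<close>)
 also have "\<dots> = c * K \<Omega>' p l"
  unfolding contract_pow_scale K_eq[where \<Omega> = \<Omega>' and p = p, OF assms(2) d l] ..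
 finally show ?thesis .
qed

text \<open>The form sought is the one whose contraction \<open>K\<close> equals \<tau> on the
  leaves. Since \<open>K\<close> scales with the form and is nonzero for nonzero top forms, this
  normalisation is unique, so local volumes divided by their factors \<open>a p\<close> fit
  together.\<close>

lemma volume_form_exists:
 assumes \<tau>: "leafwise_volume_form A V \<tau>"
 shows "\<exists>\<Omega>. volume_form A \<Omega>"
proof -
 let ?T = "TM" and ?n = "DIM('e)"
 have "\<exists>\<omega>. \<omega> \<in> kforms A ?T ?n \<and> (\<exists>vs. length vs = ?n \<and> set vs \<subseteq> ?T p \<and> \<omega> p vs \<noteq> 0)" for p
  using local_volume_exists[of p] by metis
 then obtain w where w: "\<And>p. w p \<in> kforms A ?T ?n" "\<And>p. \<exists>vs. length vs = ?n \<and> set vs \<subseteq> ?T p \<and> w p p vs \<noteq> 0" by metis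
 have "\<exists>a. a \<in> Cinf A UNIV \<and> (\<forall>q vs. length vs = r \<longrightarrow> set vs \<subseteq> V q \<longrightarrow> K (w p) q vs = a q * \<tau> q vs)" for p
  using form_ratio[OF V \<tau> kforms_restrict[OF K_kforms[OF w(1)] V_tangent]] by metis
 then obtain a where a: "\<And>p. a p \<in> Cinf A UNIV"
  "\<And>p q vs. length vs = r \<Longrightarrow> set vs \<subseteq> V q \<Longrightarrow> K (w p) q vs = a p q * \<tau> q vs" by metis
 have walt: "alternating_on (?T q) ?n (w p q)" for p q by (rule kforms_alternating[OF w(1)])
 have leaf: "\<exists>l. length l = r \<and> set l \<subseteq> V q \<and> V q = span (set l) \<and> \<tau> q l \<noteq> 0" for q
 proof -
  obtain U \<phi> es fs where ac: "adapted_chart V U \<phi> es fs" and q: "q \<in> U" using adapted_chart_exists[OF V] .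
  let ?l = "frame_at U \<phi> es q"
  have "length ?l = r" using adapted_chart_rank[OF V ac] q by auto
  then show ?thesis
   using at_point_sections[OF frame_list_sections[OF ac] q] frame_list_span[OF ac q] leafwise_volume_form_frame[OF V \<tau> ac q] by blast
 qed
 have anz: "a p p \<noteq> 0" for p
 proof -
  obtain vs where vs: "length vs = ?n" "set vs \<subseteq> ?T p" "w p p vs \<noteq> 0" using w(2) by blast
  obtain l where l: "length l = r" "set l \<subseteq> V p" "V p = span (set l)" using leaf by blast
  show ?thesis using K_nonzero[where \<Omega> = "w p" and p = p, OF walt vs l(1,3)] a(2)[OF l(1,2)] by auto
 qed
 define \<Omega> where "\<Omega> q vs = w q q vs / a q q" for q vs
 \<comment> \<open>Every local form \<open>w p\<close> is a multiple of the one normalised form with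
   the smooth factor \<open>a p\<close>; where \<open>a p\<close> is nonzero this exhibits \<Omega>
   as smooth.\<close>
 have rel: "w p q vs = a p q * \<Omega> q vs" if vs: "length vs = ?n" "set vs \<subseteq> ?T q" for p q vs
 proof -
  obtain us where us: "length us = ?n" "set us \<subseteq> ?T q" "w q q us \<noteq> 0" using w(2) by blast
  obtain U \<phi> bs ff where ac0: "adapted_chart ?T U \<phi> bs ff" and q: "q \<in> U"
   using adapted_chart_exists[OF regular_foliation_total] .
  let ?e = "at_point (map (coord_field U \<phi>) (bs @ ff)) q"
  note ac = adapted_chart_total[OF ac0]
  have e: "?T q = span (set ?e)" "length ?e = ?n"
   using frame_list_span[OF ac q] adapted_chart_length[OF ac] by auto
  have enz: "w q q ?e \<noteq> 0" by (rule alternating_top_nonzero[OF walt subspace_tangent_space e us])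
  define c where "c = w p q ?e / w q q ?e"
  have c: "w p q us = c * w q q us" if "length us = ?n" "set us \<subseteq> ?T q" for us
   using alternating_top_ratio[OF walt[of q p] walt[of q q] subspace_tangent_space e that] enz by (simp add: c_def field_simps)
  obtain l where l: "length l = r" "set l \<subseteq> V q" "\<tau> q l \<noteq> 0" using leaf by blast
  have "K (w p) q l = c * K (w q) q l"
   by (rule K_scale[where \<Omega> = "w p" and \<Omega>' = "w q" and p = q, OF walt walt c l(1)]) (use l(2) V_tangent[of q] in auto)
  then have "a p q = c * a q q" using a(2)[OF l(1,2)] l(3) by simp
  then show ?thesis using c[OF vs] anz[of q] by (simp add: \<Omega>_def)
 qed
 have "\<Omega> \<in> kforms A ?T ?n" unfolding kforms_def
 proof (intro CollectI conjI allI impI)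
  fix q
  have "alternating_on (?T q) ?n (\<lambda>vs. (1 / a q q) * w q q vs + 0 * w q q vs)"
   by (rule alternating_lincomb[OF walt walt])
  then show "alternating_on (?T q) ?n (\<Omega> q)"
   by (rule alternating_cong[OF _ subspace_tangent_space]) (simp add: \<Omega>_def)
 next
  fix W Xs assume W: "open W" "length Xs = ?n" "set Xs \<subseteq> sections A W ?T"
  show "(\<lambda>q. \<Omega> q (at_point Xs q)) \<in> Cinf A W"
  proof (rule Cinf_local[OF W(1)])
   fix p assume p: "p \<in> W"
   let ?N = "{q \<in> W. a p q \<noteq> 0}"
   have N: "open ?N" by (rule open_nonzero[OF Cinf_mono[OF a(1)] W(1)]) auto
   have "(\<lambda>q. w p q (at_point Xs q) / a p q) \<in> Cinf A ?N"
    by (rule Cinf_divide[OF N Cinf_mono[OF kforms_smooth[OF w(1) W]] Cinf_mono[OF a(1)]]) auto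
   then have "(\<lambda>q. \<Omega> q (at_point Xs q)) \<in> Cinf A ?N"
   proof (rule Cinf_transform[OF _ N])
    fix q assume "q \<in> ?N"
    then show "w p q (at_point Xs q) / a p q = \<Omega> q (at_point Xs q)"
     using rel[of "at_point Xs q" q p] W(2) at_point_sections[OF W(3), of q] by simp
   qed
   then show "\<exists>V. open V \<and> p \<in> V \<and> (\<lambda>q. \<Omega> q (at_point Xs q)) \<in> Cinf A V" using N p anz by blast
  qed
 qed
 moreover have "nowhere_vanishing ?T ?n \<Omega>"
  unfolding nowhere_vanishing_def \<Omega>_def using w(2) anz by simp
 ultimately show ?thesis unfolding volume_form_def by blast
qed

text \<open>At the start the eigenvalue is the divergence, and each contraction with
  \<open>B\<close> preserves it by \<open>lie_form_interior_bivector\<close>.\<close>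

lemma lie_form_K:
 assumes \<Omega>: "volume_form A \<Omega>" and W: "open W" "p \<in> W" and f: "f \<in> Cinf A W"
  and Ys: "open U" "p \<in> U" "length Ys = r" "set Ys \<subseteq> \<XX> U"
 shows "lie_form A (ham B f) (K \<Omega>) Ys p = divergence A \<Omega> (ham B f) p * K \<Omega> p (at_point Ys p)"
proof -
 let ?X = "ham B f" and ?I = "interior_bivector A TM B"
 have \<Omega>k: "\<Omega> \<in> kforms A TM DIM('e)" using \<Omega> by (simp add: volume_form_def)
 have "lie_form A ?X ((?I ^^ j) \<Omega>) Ys p = divergence A \<Omega> ?X p * (?I ^^ j) \<Omega> p (at_point Ys p)"
  if "open U" "p \<in> U" "length Ys + 2 * j = DIM('e)" "set Ys \<subseteq> \<XX> U" for j U Ys using that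
 proof (induction j arbitrary: U Ys)
  case 0
  then show ?case using divergence_eq[OF \<Omega> W ham_field_vector_field[OF Bb W(1) f], of U Ys] by simp
 next
  case (Suc j)
  let ?k = "length Ys"
  have \<Phi>: "(?I ^^ j) \<Omega> \<in> kforms A TM (Suc (Suc ?k))"
   by (rule interior_pow_kforms) (use Suc.prems(3) \<Omega>k in simp)
  have "lie_form A ?X (?I ((?I ^^ j) \<Omega>)) Ys p = divergence A \<Omega> ?X p * ?I ((?I ^^ j) \<Omega>) p (at_point Ys p)"
   by (rule lie_form_interior_bivector[OF B \<Phi> W f Suc.IH Suc.prems(1,2) refl Suc.prems(4)])
    (use Suc.prems(3) in auto)
  then show ?case by simp
 qed
 from this[OF Ys(1,2) _ Ys(4), of half_codim] show ?thesis unfolding K_def using Ys(3) half_codim by simp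
qed

end

section \<open>Projection of leafwise forms and the leafwise divergence\<close>

context manifold
begin

lemma proj_along_linear:
 assumes "splits_tangent A F V" "subspace (F p)" "subspace (V p)" "u \<in> TM p" "v \<in> TM p"
 shows "proj_along F V p (a *\<^sub>R u + b *\<^sub>R v) = a *\<^sub>R proj_along F V p u + b *\<^sub>R proj_along F V p v"
proof -
 note pr = splits_tangent_proj[OF assms(1) _ assms(2,3)]
 have t: "a *\<^sub>R u + b *\<^sub>R v \<in> TM p"
  by (intro subspace_add[OF subspace_tangent_space] subspace_scale[OF subspace_tangent_space] assms)
 have m: "a *\<^sub>R proj_along F V p u + b *\<^sub>R proj_along F V p v \<in> V p"
  by (intro subspace_add[OF assms(3)] subspace_scale[OF assms(3)] pr(1) assms)
 have "a *\<^sub>R (u - proj_along F V p u) + b *\<^sub>R (v - proj_along F V p v) \<in> F p"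
  by (intro subspace_add[OF assms(2)] subspace_scale[OF assms(2)] pr(2) assms)
 moreover have "a *\<^sub>R (u - proj_along F V p u) + b *\<^sub>R (v - proj_along F V p v)
  = a *\<^sub>R u + b *\<^sub>R v - (a *\<^sub>R proj_along F V p u + b *\<^sub>R proj_along F V p v)"
  unfolding scaleR_diff_right by (simp only: add_diff_add)
 ultimately show ?thesis using pr(3)[OF t m] by simp
qed

text \<open>Precomposition with the projection along \<open>F\<close> extends a leafwise form to all
  tangent vectors; results about forms on the whole manifold, such as
  \<open>lie_form_tensor\<close>, become available for it.\<close>

lemma projected_form_kforms:
 assumes sp: "splits_tangent A F V" and F: "regular_foliation A F" and V: "regular_foliation A V"
  and \<omega>: "\<omega> \<in> kforms A V k"
 shows "(\<lambda>p vs. \<omega> p (map (proj_along F V p) vs)) \<in> kforms A TM k" unfolding kforms_def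
proof (intro CollectI conjI allI impI)
 fix p
 let ?\<gamma> = "proj_along F V p" and ?T = "TM p"
 note sub = regular_foliation_subspace[OF F, of p] regular_foliation_subspace[OF V, of p]
 note alt = kforms_alternating[OF \<omega>, of p]
 have mem: "?\<gamma> v \<in> V p" if "v \<in> ?T" for v by (rule splits_tangent_proj(1)[OF sp that sub])
 show "alternating_on ?T k (\<lambda>vs. \<omega> p (map ?\<gamma> vs))"
 proof (rule alternatingI)
  fix xs i u v a b assume *: "length xs = k" "set xs \<subseteq> ?T" "i < k" "u \<in> ?T" "v \<in> ?T"
  have "set (map ?\<gamma> xs) \<subseteq> V p" using mem *(2) by auto
  from alternating_linear[OF alt _ this *(3) mem[OF *(4)] mem[OF *(5)], of a b]
  show "\<omega> p (map ?\<gamma> (xs[i := a *\<^sub>R u + b *\<^sub>R v])) = a * \<omega> p (map ?\<gamma> (xs[i := u])) + b * \<omega> p (map ?\<gamma> (xs[i := v]))"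
   unfolding map_update proj_along_linear[OF sp sub *(4,5)] using *(1) by simp
 next
  fix xs i j assume *: "length xs = k" "set xs \<subseteq> ?T" "i < j" "j < k" "xs ! i = xs ! j"
  have "set (map ?\<gamma> xs) \<subseteq> V p" using mem *(2) by auto
  from alternating_eq[OF alt _ this, of i j] show "\<omega> p (map ?\<gamma> xs) = 0" using * by simp
 qed
next
 fix W Xs assume W: "open W" "length Xs = k" "set Xs \<subseteq> sections A W TM"
 let ?Y = "map (\<lambda>X q. proj_along F V q (X q)) Xs"
 have "set ?Y \<subseteq> sections A W V"
  using W(3) projection_smooth[OF sp F V W(1)] by (auto simp: sections_total)
 from kforms_smooth[OF \<omega> W(1) _ this] W(2) have "(\<lambda>q. \<omega> q (at_point ?Y q)) \<in> Cinf A W" by simp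
 then show "(\<lambda>q. \<omega> q (map (proj_along F V q) (at_point Xs q))) \<in> Cinf A W"
  by (simp add: at_point_def comp_def)
qed

lemma proj_along_leaf:
 assumes "splits_tangent A F V" "subspace (F p)" "subspace (V p)" "v \<in> TM p" "v \<in> V p"
 shows "proj_along F V p v = v"
 by (rule splits_tangent_proj(3)[OF assms(1,4,2,3,5)]) (simp only: diff_self subspace_0[OF assms(2)])

lemma proj_along_complement:
 assumes "splits_tangent A F V" "subspace (F p)" "subspace (V p)" "v \<in> TM p" "v \<in> F p"
 shows "proj_along F V p v = 0"
 by (rule splits_tangent_proj(3)[OF assms(1,4,2,3) subspace_0[OF assms(3)]]) (simp only: diff_0_right assms(5))

text \<open>For \<open>X\<close> preserving the foliation this is the function \<open>c\<close> with \<open>L\<^sub>X \<omega> = c \<omega>\<close> along the leaves.\<close>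

definition leaf_div :: "'m set \<Rightarrow> ('m \<Rightarrow> 'e) \<Rightarrow> 'e list \<Rightarrow> 'm kform \<Rightarrow> 'm vfield \<Rightarrow> 'm \<Rightarrow> real" where
 "leaf_div U \<phi> es \<omega> X q = X q (\<lambda>q. ln (\<omega> q (frame_at U \<phi> es q)))
  + (\<Sum>e\<in>set es. coord_field U \<phi> e q (\<lambda>q. X q (coord \<phi> e)))"

context
 fixes D U \<phi> es fs
 assumes ac: "adapted_chart D U \<phi> es fs"
begin

lemma frame_list_mem: "q \<in> U \<Longrightarrow> set (frame_at U \<phi> es q) \<subseteq> D q"
 using frame_in_leaf[OF ac] by (auto simp: at_point_def)

lemma frame_slot:
 assumes q: "q \<in> U" and w: "alternating_on (D q) (length es) w" and Y: "Y \<in> D q" and i: "i < length es"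
 shows "w ((frame_at U \<phi> es q)[i := Y])
  = Y (coord \<phi> (es ! i)) * w (frame_at U \<phi> es q)"
proof -
 let ?E = "frame_at U \<phi> es q"
 have E: "length ?E = length es" "set ?E \<subseteq> D q" using frame_list_mem[OF q] by auto
 have "w (?E[i := Y]) = w (?E[i := \<Sum>e\<in>set es. Y (coord \<phi> e) *\<^sub>R coord_field U \<phi> e q])"
  using leaf_expand[OF ac q Y] by (rule arg_cong)
 also have "\<dots> = (\<Sum>e\<in>set es. Y (coord \<phi> e) * w (?E[i := coord_field U \<phi> e q]))"
  by (rule alternating_sum[OF w subspace_leaf[OF ac q] E i]) (rule frame_in_leaf[OF ac q])
 also have "\<dots> = (\<Sum>e\<in>set es. if e = es ! i then Y (coord \<phi> e) * w ?E else 0)"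
 proof (rule sum.cong[OF refl])
  fix e assume "e \<in> set es"
  then obtain j where j: "j < length es" "e = es ! j" by (auto simp: in_set_conv_nth)
  have Ej: "?E ! j = coord_field U \<phi> e q" using j by (simp add: nth_at_point)
  show "Y (coord \<phi> e) * w (?E[i := coord_field U \<phi> e q]) = (if e = es ! i then Y (coord \<phi> e) * w ?E else 0)"
  proof (cases "j = i")
   case True
   have "?E[i := coord_field U \<phi> e q] = ?E" using Ej True by (metis list_update_id)
   then show ?thesis using True j by simp
  next
   case False
   then have "e \<noteq> es ! i" using j i acD(3)[OF ac] by (auto simp: nth_eq_iff_index_eq)
   moreover have "w (?E[i := coord_field U \<phi> e q]) = 0"
   proof (rule alternating_eq[OF w _ _ i j(1)])
    show "set (?E[i := coord_field U \<phi> e q]) \<subseteq> D q"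
     by (rule set_update_subset[OF E(2) frame_in_leaf[OF ac q \<open>e \<in> set es\<close>]])
    show "?E[i := coord_field U \<phi> e q] ! i = ?E[i := coord_field U \<phi> e q] ! j"
     using False Ej i by simp
   qed (use False in auto)
   ultimately show ?thesis by simp
  qed
 qed
 also have "\<dots> = Y (coord \<phi> (es ! i)) * w ?E" using i by simp
 finally show ?thesis .
qed

lemma leaf_bracket_coordinates:
 assumes W: "open W" "W \<subseteq> U" "q \<in> W" and X: "X \<in> \<XX> W"
  and e: "bracket X (coord_field U \<phi> a) q \<in> D q"
 shows "bracket X (coord_field U \<phi> a) q
  = (\<Sum>c\<in>set es. (- coord_field U \<phi> a q (\<lambda>q. X q (coord \<phi> c))) *\<^sub>R coord_field U \<phi> c q)"
proof -
 have "q \<in> U" using W by auto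
 from leaf_expand[OF ac this e] show ?thesis unfolding bracket_coordinate[OF ac W X] .
qed

text \<open>A bracket with the \<open>i\<close>-th frame field contributes only its
  \<open>i\<close>-th coefficient, because the others repeat a frame vector, so the brackets add up
  to a trace. The remaining term of \<open>leaf_div\<close> is the logarithmic derivative of the
  density.\<close>

lemma lie_form_frame:
 assumes W: "open W" "W \<subseteq> U" "q \<in> W" and X: "X \<in> \<XX> W"
  and \<omega>: "alternating_on (D q) (length es) (\<omega> q)"
  and br: "\<And>e. e \<in> set es \<Longrightarrow> bracket X (coord_field U \<phi> e) q \<in> D q"
  and t: "smooth_at A q (\<lambda>q. \<omega> q (frame_at U \<phi> es q))" "\<omega> q (frame_at U \<phi> es q) \<noteq> 0"
 shows "lie_form A X \<omega> (map (coord_field U \<phi>) es) q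
  = leaf_div U \<phi> es \<omega> X q * \<omega> q (frame_at U \<phi> es q)"
proof -
 let ?E = "map (coord_field U \<phi>) es"
 let ?t = "\<lambda>q. \<omega> q (at_point ?E q)"
 have q: "q \<in> U" using W by auto
 have 1: "\<omega> q ((at_point ?E q)[i := bracket X (?E ! i) q]) = - coord_field U \<phi> (es ! i) q (\<lambda>q. X q (coord \<phi> (es ! i))) * ?t q"
  if i: "i < length es" for i
  using frame_slot[OF q \<omega> br[OF nth_mem[OF i]] i] bracket_coordinate[OF ac W X] i by simp
 have "(\<Sum>i<length ?E. \<omega> q ((at_point ?E q)[i := bracket X (?E ! i) q]))
  = (\<Sum>i<length es. - coord_field U \<phi> (es ! i) q (\<lambda>q. X q (coord \<phi> (es ! i))) * ?t q)"
  using 1 by (intro sum.cong) auto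
 also have "\<dots> = (\<Sum>e\<in>set es. - coord_field U \<phi> e q (\<lambda>q. X q (coord \<phi> e)) * ?t q)"
 proof -
  have "distinct es" using acD(3)[OF ac] by simp
  then have "bij_betw ((!) es) {..<length es} (set es)" by (rule bij_betw_nth) auto
  then show ?thesis by (rule sum.reindex_bij_betw[of "(!) es" "{..<length es}" "set es"
     "\<lambda>e. - coord_field U \<phi> e q (\<lambda>q. X q (coord \<phi> e)) * ?t q"])
 qed
 finally show ?thesis using tangent_apply_ln[OF vector_field_tangent[OF X W(3)] t] t(2)
  by (simp add: lie_form_def leaf_div_def sum_negf sum_distrib_right distrib_right)
qed

text \<open>The bracket term of the first sum and that of the second cancel by symmetry.\<close>

lemma leaf_div_bracket:
 assumes W: "open W" "W \<subseteq> U" "q \<in> W" and X: "X \<in> \<XX> W" and Y: "Y \<in> \<XX> W"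
  and brX: "\<And>e. e \<in> set es \<Longrightarrow> bracket X (coord_field U \<phi> e) q \<in> D q"
  and brY: "\<And>e. e \<in> set es \<Longrightarrow> bracket Y (coord_field U \<phi> e) q \<in> D q"
  and t: "(\<lambda>q. ln (\<omega> q (frame_at U \<phi> es q))) \<in> Cinf A W"
 shows "leaf_div U \<phi> es \<omega> (bracket X Y) q = X q (leaf_div U \<phi> es \<omega> Y) - Y q (leaf_div U \<phi> es \<omega> X)"
proof -
 let ?L = "\<lambda>q. ln (\<omega> q (frame_at U \<phi> es q))"
 let ?E = "\<lambda>e. coord_field U \<phi> e" and ?y = "\<lambda>e q. \<phi> q \<bullet> e"
 have q: "q \<in> U" using W by auto
 have sm: "smooth_at A q f" if "f \<in> Cinf A W" for f by (rule smooth_atI[OF W(1,3) that])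
 have y: "?y e \<in> Cinf A W" for e by (rule Cinf_mono[OF coordinate_smooth[OF ac] W(2)])
 have EW: "?E e \<in> \<XX> W" for e by (rule vector_fields_mono[OF frame_vector_field[OF ac] W(2)])
 have Cf: "(\<lambda>q. Z q f) \<in> Cinf A W" if "Z \<in> \<XX> W" "f \<in> Cinf A W" for Z f
  by (rule vector_field_smooth[OF that(1) W(1) order.refl that(2)])
 have T: "Z q \<in> TM q" if "Z \<in> \<XX> W" for Z by (rule vector_field_tangent[OF that W(3)])
 have app: "Z q (leaf_div U \<phi> es \<omega> Z') = Z q (\<lambda>q. Z' q ?L) + (\<Sum>e\<in>set es. Z q (\<lambda>q. ?E e q (\<lambda>q. Z' q (?y e))))"
  if Z: "Z \<in> \<XX> W" "Z' \<in> \<XX> W" for Z Z'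
 proof -
  have c1: "(\<lambda>q. Z' q ?L) \<in> Cinf A W" by (rule Cf[OF Z(2) t])
  have c2: "(\<lambda>q. ?E e q (\<lambda>q. Z' q (?y e))) \<in> Cinf A W" for e by (rule Cf[OF EW Cf[OF Z(2) y]])
  have "leaf_div U \<phi> es \<omega> Z' = (\<lambda>q. Z' q ?L + (\<Sum>e\<in>set es. ?E e q (\<lambda>q. Z' q (?y e))))"
   by (rule ext) (rule leaf_div_def)
  then have "Z q (leaf_div U \<phi> es \<omega> Z') = Z q (\<lambda>q. Z' q ?L + (\<Sum>e\<in>set es. ?E e q (\<lambda>q. Z' q (?y e))))"
   by (rule arg_cong)
  also have "\<dots> = Z q (\<lambda>q. Z' q ?L) + Z q (\<lambda>q. \<Sum>e\<in>set es. ?E e q (\<lambda>q. Z' q (?y e)))"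
   by (rule tangent_add[OF T[OF Z(1)] sm[OF c1] sm[OF Cinf_sum[OF W(1) c2]]])
  also have "Z q (\<lambda>q. \<Sum>e\<in>set es. ?E e q (\<lambda>q. Z' q (?y e))) = (\<Sum>e\<in>set es. Z q (\<lambda>q. ?E e q (\<lambda>q. Z' q (?y e))))"
   by (rule tangent_sum[OF T[OF Z(1)] sm[OF c2]])
  finally show ?thesis .
 qed
 \<comment> \<open>Moves \<open>Z\<close> past the frame field. The commutator is expanded in the
   leafwise frame and produces the quadratic sum that \<open>sym\<close> cancels in the end.\<close>
 have swap: "Z q (\<lambda>q. ?E e q (\<lambda>q. Z' q (?y e))) = ?E e q (\<lambda>q. Z q (\<lambda>q. Z' q (?y e)))
   - (\<Sum>c\<in>set es. ?E e q (\<lambda>q. Z q (?y c)) * ?E c q (\<lambda>q. Z' q (?y e)))"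
  if Z: "Z \<in> \<XX> W" "Z' \<in> \<XX> W" and br: "bracket Z (?E e) q \<in> D q" for Z Z' e
 proof -
  have "bracket Z (?E e) q (\<lambda>q. Z' q (?y e)) = Z q (\<lambda>q. ?E e q (\<lambda>q. Z' q (?y e))) - ?E e q (\<lambda>q. Z q (\<lambda>q. Z' q (?y e)))"
   by (rule lie_bracket_apply[OF sm[OF Cf[OF Z(2) y]]])
  moreover have "bracket Z (?E e) q (\<lambda>q. Z' q (?y e)) = (\<Sum>c\<in>set es. - ?E e q (\<lambda>q. Z q (?y c)) * ?E c q (\<lambda>q. Z' q (?y e)))"
   using fun_cong[OF leaf_bracket_coordinates[OF W Z(1) br], of "\<lambda>q. Z' q (?y e)"] unfolding sum_fun_apply by simp
  ultimately show ?thesis by (simp add: sum_negf)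
 qed
 have sym: "(\<Sum>e\<in>set es. \<Sum>c\<in>set es. ?E e q (\<lambda>q. X q (?y c)) * ?E c q (\<lambda>q. Y q (?y e)))
   = (\<Sum>e\<in>set es. \<Sum>c\<in>set es. ?E e q (\<lambda>q. Y q (?y c)) * ?E c q (\<lambda>q. X q (?y e)))"
  by (subst sum.swap) (simp add: mult.commute)
 have "X q (\<lambda>q. ?E e q (\<lambda>q. Y q (?y e))) = ?E e q (\<lambda>q. X q (\<lambda>q. Y q (?y e)))
   - (\<Sum>c\<in>set es. ?E e q (\<lambda>q. X q (?y c)) * ?E c q (\<lambda>q. Y q (?y e)))" if "e \<in> set es" for e
  by (rule swap[OF X Y brX[OF that]])
 moreover have "Y q (\<lambda>q. ?E e q (\<lambda>q. X q (?y e))) = ?E e q (\<lambda>q. Y q (\<lambda>q. X q (?y e)))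
   - (\<Sum>c\<in>set es. ?E e q (\<lambda>q. Y q (?y c)) * ?E c q (\<lambda>q. X q (?y e)))" if "e \<in> set es" for e
  by (rule swap[OF Y X brY[OF that]])
 moreover have "?E e q (\<lambda>q. bracket X Y q (?y e)) = ?E e q (\<lambda>q. X q (\<lambda>q. Y q (?y e))) - ?E e q (\<lambda>q. Y q (\<lambda>q. X q (?y e)))" for e
 proof -
  have "?E e q (\<lambda>q. bracket X Y q (?y e)) = ?E e q (\<lambda>q. X q (\<lambda>q. Y q (?y e)) - Y q (\<lambda>q. X q (?y e)))"
   by (rule tangent_cong[OF T[OF EW] W(1,3)])
    (rule lie_bracket_apply[OF smooth_atI[OF W(1) _ y]])
  also have "\<dots> = ?E e q (\<lambda>q. X q (\<lambda>q. Y q (?y e))) - ?E e q (\<lambda>q. Y q (\<lambda>q. X q (?y e)))"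
   by (rule tangent_diff[OF T[OF EW] sm[OF Cf[OF X Cf[OF Y y]]] sm[OF Cf[OF Y Cf[OF X y]]]])
  finally show ?thesis .
 qed
 moreover have "bracket X Y q ?L = X q (\<lambda>q. Y q ?L) - Y q (\<lambda>q. X q ?L)"
  by (rule lie_bracket_apply[OF sm[OF t]])
 ultimately show ?thesis unfolding app[OF X Y] app[OF Y X] using sym
  by (simp add: leaf_div_def sum_subtractf)
qed

lemma leaf_div_add:
 assumes W: "open W" "W \<subseteq> U" "q \<in> W" and X: "X \<in> \<XX> W" and Y: "Y \<in> \<XX> W"
 shows "leaf_div U \<phi> es \<omega> (\<lambda>q. X q + Y q) q = leaf_div U \<phi> es \<omega> X q + leaf_div U \<phi> es \<omega> Y q"
proof -
 have "coord_field U \<phi> e q (\<lambda>q. X q (coord \<phi> e) + Y q (coord \<phi> e)) =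
  coord_field U \<phi> e q (\<lambda>q. X q (coord \<phi> e)) + coord_field U \<phi> e q (\<lambda>q. Y q (coord \<phi> e))" for e
 proof (rule tangent_add[OF frame_tangent[OF ac]])
  show "q \<in> U" using W by auto
  have y: "(coord \<phi> e) \<in> Cinf A W" by (rule Cinf_mono[OF coordinate_smooth[OF ac] W(2)])
  show "smooth_at A q (\<lambda>q. X q (coord \<phi> e))" by (rule smooth_atI[OF W(1,3) vector_field_smooth[OF X W(1) order.refl y]])
  show "smooth_at A q (\<lambda>q. Y q (coord \<phi> e))" by (rule smooth_atI[OF W(1,3) vector_field_smooth[OF Y W(1) order.refl y]])
 qed
 then show ?thesis by (simp add: leaf_div_def sum.distrib)
qed

end

end

section \<open>The foliated exterior derivative in a coordinate frame\<close>

text \<open>\<open>m\<close> is thought of as a position in a list from which entry \<open>i\<close>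
  was removed. Positions below \<open>i\<close> keep their index and the others move down by one,
  hence \<open>j - 1\<close> when the pairs are regrouped by larger and smaller index.\<close>

lemma sum_off_diagonal:
 "(\<Sum>i<Suc k. \<Sum>m<k. f i m) = (\<Sum>j<Suc k. \<Sum>i<j. f j i + f i (j - 1 :: nat) :: real)"
proof (induction k)
 case (Suc k)
 have "(\<Sum>i<Suc (Suc k). \<Sum>m<Suc k. f i m) = (\<Sum>i<Suc k. \<Sum>m<k. f i m) + (\<Sum>i<Suc k. f i k) + (\<Sum>m<Suc k. f (Suc k) m)"
  by (simp add: sum.distrib)
 then show ?case using Suc by (simp add: sum.distrib)
qed simp

lemma alt_lift_Cons_Cons:
 "alt_lift (\<lambda>u l. \<alpha> u * w l) (u # v # l)
  = \<alpha> u * w (v # l) - \<alpha> v * w (u # l) + (\<Sum>i<length l. (- 1) ^ i * (\<alpha> (l ! i) * w (u # v # remove_nth i l)))"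
 unfolding alt_lift_def length_Cons sum.lessThan_Suc_shift
 by (simp add: remove_nth_Cons_0 remove_nth_Cons_Suc)

context manifold
begin

context
 fixes D U \<phi> es fs
 assumes ac: "adapted_chart D U \<phi> es fs"
begin

text \<open>A bracket is tangent to the leaves if its transverse coordinates vanish. Those of
  \<open>Y\<close> are zero throughout, so only the derivatives of those of \<open>X\<close> along
  \<open>Y\<close> remain.\<close>

lemma leaf_bracket:
 assumes W: "open W" "W \<subseteq> U" "q \<in> W" and X: "X \<in> \<XX> W" and Y: "Y \<in> sections A W D"
  and X': "\<And>f. f \<in> set fs \<Longrightarrow> Y q (\<lambda>q. X q (coord \<phi> f)) = 0"
 shows "bracket X Y q \<in> D q"
proof -
 have q: "q \<in> U" using W by auto
 have Yv: "Y \<in> \<XX> W" using Y by (simp add: sections_def)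
 have "bracket X Y q (coord \<phi> f) = 0" if f: "f \<in> set fs" for f
 proof -
  have "X q (\<lambda>q. Y q (coord \<phi> f)) = X q (\<lambda>q. 0)"
  proof (rule tangent_cong[OF vector_field_tangent[OF X W(3)] W(1,3)])
   fix q' assume "q' \<in> W"
   then have "Y q' \<in> D q'" "q' \<in> U" using Y W(2) by (auto simp: sections_def)
   then show "Y q' (coord \<phi> f) = 0" using acD(6)[OF ac] f by blast
  qed
  then show ?thesis using X'[OF f] tangent_const[OF vector_field_tangent[OF X W(3)], of 0]
   by (simp add: lie_bracket_apply[OF coordinate_smooth_at[OF ac q]])
 qed
 then show ?thesis using acD(6)[OF ac q] lie_bracket_tangent[OF X Yv W(1,3)] by blast
qed

lemma frame_bracket_leaf:
 assumes W: "open W" "W \<subseteq> U" "q \<in> W" and Y: "Y \<in> sections A W D"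
 shows "bracket (coord_field U \<phi> a) Y q \<in> D q"
proof (rule leaf_bracket[OF W _ Y])
 show "coord_field U \<phi> a \<in> \<XX> W" by (rule vector_fields_mono[OF frame_vector_field[OF ac] W(2)])
 have Yt: "Y q \<in> TM q" using Y W(3) by (auto simp: sections_def vector_fields_def)
 show "Y q (\<lambda>q. coord_field U \<phi> a q (coord \<phi> f)) = 0" for f
 proof -
  have "Y q (\<lambda>q. coord_field U \<phi> a q (coord \<phi> f)) = Y q (\<lambda>q. a \<bullet> f)"
   by (rule tangent_cong[OF Yt W(1,3)]) (use W(2) frame_coordinate[OF ac] in auto)
  then show ?thesis using tangent_const[OF Yt] by simp
 qed
qed

lemma leaf_expand_apply: "q \<in> U \<Longrightarrow> v \<in> D q \<Longrightarrow> v g = (\<Sum>a\<in>set es. v (coord \<phi> a) * coord_field U \<phi> a q g)"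
 using fun_cong[OF leaf_expand[OF ac], of q v g] unfolding sum_fun_apply by simp

text \<open>The coordinate frame is flat and torsion free.\<close>

lemma bracket_frame_expand:
 assumes W: "open W" "W \<subseteq> U" "q \<in> W" and X: "X \<in> sections A W D" and Y: "Y \<in> sections A W D"
 shows "bracket X Y q = (\<Sum>a\<in>set es. X q (coord \<phi> a) *\<^sub>R bracket (coord_field U \<phi> a) Y q)
  - (\<Sum>a\<in>set es. Y q (coord \<phi> a) *\<^sub>R bracket (coord_field U \<phi> a) X q)"
proof -
 let ?E = "coord_field U \<phi>" and ?T = "TM q"
 have q: "q \<in> U" using W by auto
 have v: "X \<in> \<XX> W" "Y \<in> \<XX> W" using X Y by (auto simp: sections_def)
 have XYq: "X q \<in> D q" "Y q \<in> D q" using X Y W by (auto simp: sections_def)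
 have E: "?E a \<in> \<XX> W" for a by (rule vector_fields_mono[OF frame_vector_field[OF ac] W(2)])
 have tan: "(\<Sum>a\<in>set es. c a *\<^sub>R bracket (?E a) Z q) \<in> ?T" if "Z \<in> \<XX> W" for Z c
  by (intro subspace_sum[OF subspace_tangent_space] subspace_scale[OF subspace_tangent_space]
    lie_bracket_tangent[OF E that W(1,3)])
 have co: "(\<Sum>a\<in>set es. Z' q (coord \<phi> a) *\<^sub>R bracket (?E a) Z q) (coord \<phi> b) = Z' q (\<lambda>q. Z q (coord \<phi> b))"
  if Z: "Z \<in> \<XX> W" "Z' q \<in> D q" for Z Z' b
 proof -
  have "bracket (?E a) Z q (coord \<phi> b) = ?E a q (\<lambda>q. Z q (coord \<phi> b))" for a
   using fun_cong[OF lie_bracket_skew[of "?E a" Z q], of "coord \<phi> b"] bracket_coordinate[OF ac W Z(1), of a b] by simp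
  then show ?thesis unfolding sum_fun_apply leaf_expand_apply[OF q Z(2), of "\<lambda>q. Z q (coord \<phi> b)"] by simp
 qed
 show ?thesis
 proof (rule tangent_eqI[OF ac q lie_bracket_tangent[OF v W(1,3)] subspace_diff[OF subspace_tangent_space tan[OF v(2)] tan[OF v(1)]]])
  fix b
  show "bracket X Y q (coord \<phi> b) = ((\<Sum>a\<in>set es. X q (coord \<phi> a) *\<^sub>R bracket (?E a) Y q)
    - (\<Sum>a\<in>set es. Y q (coord \<phi> a) *\<^sub>R bracket (?E a) X q)) (coord \<phi> b)"
   unfolding minus_apply co[where Z' = X, OF v(2) XYq(1)] co[where Z' = Y, OF v(1) XYq(2)]
   by (rule lie_bracket_apply[OF coordinate_smooth_at[OF ac q]])
 qed
qed

text \<open>This is d \<beta> as the sum over \<open>a\<close> of dy_a wedge the Lie derivative of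
  \<beta> along the \<open>a\<close>-th coordinate field. The Koszul bracket terms can be
  distributed over these Lie derivatives by \<open>bracket_frame_expand\<close>.\<close>

lemma ext_deriv_frame:
 assumes \<beta>: "\<beta> \<in> kforms A D k" and W: "open W" "W \<subseteq> U" "q \<in> W"
  and Xs: "length Xs = Suc k" "set Xs \<subseteq> sections A W D"
 shows "ext_deriv A \<beta> Xs q = (\<Sum>i<Suc k. (- 1) ^ i *
  (\<Sum>a\<in>set es. (Xs ! i) q (coord \<phi> a) * lie_form A (coord_field U \<phi> a) \<beta> (remove_nth i Xs) q))"
proof -
 let ?E = "coord_field U \<phi>" and ?xs = "at_point Xs q"
 have q: "q \<in> U" using W by auto
 note alt = kforms_alternating[OF \<beta>, of q] and sub = subspace_leaf[OF ac q]
 define Y where "Y i j = (\<Sum>a\<in>set es. (Xs ! i) q (coord \<phi> a) *\<^sub>R bracket (?E a) (Xs ! j) q)" for i j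
 have X: "Xs ! i \<in> sections A W D" if "i < Suc k" for i using Xs nth_mem[of i Xs] that by auto
 have Xq: "(Xs ! i) q \<in> D q" if "i < Suc k" for i using X[OF that] W(3) by (simp add: sections_def)
 have br: "bracket (?E a) (Xs ! j) q \<in> D q" if "j < Suc k" for a j
  by (rule frame_bracket_leaf[OF W X[OF that]])
 have YD: "Y i j \<in> D q" if "j < Suc k" for i j
  unfolding Y_def by (intro subspace_sum[OF sub] subspace_scale[OF sub] br that)
 have len: "length (remove_nth i Xs) = k" if "i < Suc k" for i using length_remove_nth[of i Xs] Xs that by simp
 have rD: "set (at_point (remove_nth i Xs) q) \<subseteq> D q" if "i < Suc k" for i
  using at_point_sections[OF Xs(2) W(3)] set_remove_nth[of i ?xs] unfolding at_point_remove_nth by blast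
 have rn: "remove_nth i Xs ! m = Xs ! (if m < i then m else Suc m)" if "i < Suc k" "m < k" for i m
  using nth_remove_nth[of i Xs m] that Xs by simp
 \<comment> \<open>\<open>m\<close> counts positions in the list without entry \<open>i\<close>;
   from \<open>i\<close> on it therefore refers to the field with index
   \<open>Suc m\<close>.\<close>
 define g where "g i m = \<beta> q (Y i (if m < i then m else Suc m) # remove_nth m (remove_nth i ?xs))" for i m
 have lie: "(\<Sum>a\<in>set es. (Xs ! i) q (coord \<phi> a) * lie_form A (?E a) \<beta> (remove_nth i Xs) q)
   = (Xs ! i) q (\<lambda>q. \<beta> q (at_point (remove_nth i Xs) q)) - (\<Sum>m<k. (- 1) ^ m * g i m)" if i: "i < Suc k" for i
 proof -
  let ?R = "at_point (remove_nth i Xs) q" and ?x = "\<lambda>a. (Xs ! i) q (coord \<phi> a)"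
  have m: "(\<Sum>a\<in>set es. ?x a * \<beta> q (?R[m := bracket (?E a) (remove_nth i Xs ! m) q])) = (- 1) ^ m * g i m" if m: "m < k" for m
  proof -
   let ?j = "if m < i then m else Suc m"
   have j: "?j < Suc k" using m by simp
   have nm: "?R[m := Y i ?j] ! m = Y i ?j" using m len[OF i] by (intro nth_list_update_eq) simp
   have "(\<Sum>a\<in>set es. ?x a * \<beta> q (?R[m := bracket (?E a) (remove_nth i Xs ! m) q])) = \<beta> q (?R[m := Y i ?j])"
    unfolding Y_def rn[OF i m]
    by (rule alternating_sum[OF alt sub _ rD[OF i] m br[OF j], symmetric]) (simp add: len[OF i])
   also have "\<dots> = (- 1) ^ m * \<beta> q (?R[m := Y i ?j] ! m # remove_nth m (?R[m := Y i ?j]))"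
    by (rule alternating_remove_nth[OF alt sub _ set_update_subset[OF rD[OF i] YD[OF j]] m]) (simp add: len[OF i])
   also have "\<dots> = (- 1) ^ m * g i m"
    unfolding nm remove_nth_update_eq unfolding g_def at_point_remove_nth ..
   finally show ?thesis .
  qed
  have "(\<Sum>a\<in>set es. ?x a * lie_form A (?E a) \<beta> (remove_nth i Xs) q) =
   (\<Sum>a\<in>set es. ?x a * ?E a q (\<lambda>q. \<beta> q (at_point (remove_nth i Xs) q)))
   - (\<Sum>m<k. \<Sum>a\<in>set es. ?x a * \<beta> q (?R[m := bracket (?E a) (remove_nth i Xs ! m) q]))"
   by (subst sum.swap) (simp add: lie_form_def len[OF i] right_diff_distrib sum_subtractf sum_distrib_left)
  then show ?thesis
   using m leaf_expand_apply[OF q Xq[OF i], of "\<lambda>q. \<beta> q (at_point (remove_nth i Xs) q)"] by simp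
 qed
 have brk: "\<beta> q (bracket (Xs ! i) (Xs ! j) q # at_point (remove_nth i (remove_nth j Xs)) q)
   = g i (j - 1) - g j i" if ij: "i < j" "j < Suc k" for i j
 proof -
  let ?R = "remove_nth i (remove_nth j ?xs)"
  have i: "i < Suc k" using ij by simp
  have k: "k > 0" using ij by simp
  have R: "length (0 # ?R) = k" "set (0 # ?R) \<subseteq> D q"
   using length_remove_nth[of j ?xs] length_remove_nth[of i "remove_nth j ?xs"] ij Xs(1)
    set_remove_nth[of i "remove_nth j ?xs"] rD[OF ij(2)] subspace_0[OF sub] by (auto simp: at_point_remove_nth)
  have "bracket (Xs ! i) (Xs ! j) q = 1 *\<^sub>R Y i j + (- 1) *\<^sub>R Y j i"
   using bracket_frame_expand[OF W X[OF i] X[OF ij(2)]] by (simp add: Y_def)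
  then have "\<beta> q (bracket (Xs ! i) (Xs ! j) q # ?R) = \<beta> q ((0 # ?R)[0 := 1 *\<^sub>R Y i j + (- 1) *\<^sub>R Y j i])" by simp
  also have "\<dots> = 1 * \<beta> q ((0 # ?R)[0 := Y i j]) + (- 1) * \<beta> q ((0 # ?R)[0 := Y j i])"
   by (rule alternating_linear[OF alt R k YD[OF ij(2)] YD[OF i]])
  also have "\<dots> = g i (j - 1) - g j i"
  proof -
   have "\<not> j - 1 < i" "Suc (j - 1) = j" using ij(1) by auto
   then show ?thesis using ij remove_nth_remove_nth[OF ij(1), of ?xs] Xs(1) by (simp add: g_def)
  qed
  finally show ?thesis by (simp add: at_point_remove_nth)
 qed
 have "(\<Sum>j<Suc k. \<Sum>i<j. (- 1) ^ (i + j) * \<beta> q (bracket (Xs ! i) (Xs ! j) q # at_point (remove_nth i (remove_nth j Xs)) q))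
  = (\<Sum>j<Suc k. \<Sum>i<j. - ((- 1) ^ (j + i) * g j i + (- 1) ^ (i + (j - 1)) * g i (j - 1)))"
 proof (intro sum.cong refl)
  fix i j assume *: "j \<in> {..<Suc k}" "i \<in> {..<j}"
  then have "(- 1 :: real) ^ (i + j) = - ((- 1) ^ (i + (j - 1)))" by (cases j) auto
  then show "(- 1) ^ (i + j) * \<beta> q (bracket (Xs ! i) (Xs ! j) q # at_point (remove_nth i (remove_nth j Xs)) q)
   = - ((- 1) ^ (j + i) * g j i + (- 1) ^ (i + (j - 1)) * g i (j - 1))"
   using brk[of i j] * by (simp add: add.commute right_diff_distrib)
 qed
 also have "\<dots> = - (\<Sum>i<Suc k. \<Sum>m<k. (- 1) ^ (i + m) * g i m)"
  unfolding sum_negf sum_off_diagonal[of "\<lambda>i m. (- 1) ^ (i + m) * g i m"] ..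
 finally have b: "(\<Sum>j<Suc k. \<Sum>i<j. (- 1) ^ (i + j) * \<beta> q (bracket (Xs ! i) (Xs ! j) q # at_point (remove_nth i (remove_nth j Xs)) q))
  = - (\<Sum>i<Suc k. (- 1) ^ i * (\<Sum>m<k. (- 1) ^ m * g i m))"
  by (simp only: sum_distrib_left power_add mult.assoc)
 have "(\<Sum>i<Suc k. (- 1) ^ i * (\<Sum>a\<in>set es. (Xs ! i) q (coord \<phi> a) * lie_form A (?E a) \<beta> (remove_nth i Xs) q))
  = (\<Sum>i<Suc k. (- 1) ^ i * (Xs ! i) q (\<lambda>q. \<beta> q (at_point (remove_nth i Xs) q)) - (- 1) ^ i * (\<Sum>m<k. (- 1) ^ m * g i m))"
  by (rule sum.cong[OF refl]) (simp add: lie right_diff_distrib)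
 also have "\<dots> = (\<Sum>i<Suc k. (- 1) ^ i * (Xs ! i) q (\<lambda>q. \<beta> q (at_point (remove_nth i Xs) q)))
  + - (\<Sum>i<Suc k. (- 1) ^ i * (\<Sum>m<k. (- 1) ^ m * g i m))"
  unfolding sum_subtractf by (rule diff_conv_add_uminus)
 finally show ?thesis unfolding ext_deriv_def Xs(1) b ..
qed

text \<open>On the leaves \<open>dy\<^sub>a \<and> \<tau> = 0\<close> for degree reasons.\<close>

lemma coordinate_wedge_top:
 assumes q: "q \<in> U" and w: "alternating_on (D q) (length es) w" and abc: "a \<in> set es" "b \<in> set es" "c \<in> set es"
  and l: "Suc (length l) = length es" "set l \<subseteq> D q"
 shows "(\<Sum>i<length l. (- 1) ^ i * ((l ! i) (coord \<phi> a) * w (coord_field U \<phi> c q # coord_field U \<phi> b q # remove_nth i l)))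
  = (if a = b then w (coord_field U \<phi> c q # l) else 0) - (if a = c then w (coord_field U \<phi> b q # l) else 0)"
proof -
 let ?y = "\<lambda>v. v (coord \<phi> a)" and ?E = "\<lambda>e. coord_field U \<phi> e q"
 let ?w = "alt_lift (\<lambda>u l. ?y u * w l)"
 have co: "?y (?E e) = (if a = e then 1 else 0)" if "e \<in> set es" for e
  using frame_coordinate[OF ac q, of e a] acD(4)[OF ac, of e a] abc that by auto
 have "alternating_on (D q) (Suc (length es)) ?w"
 proof (rule alternating_alt_lift[OF subspace_leaf[OF ac q]])
  show "alternating_on (D q) (length es) (\<lambda>l. ?y u * w l)" for u
   using alternating_lincomb[OF w w, of "?y u" 0] by simp
 qed (simp add: algebra_simps)
 then have alt: "alternating_on (D q) (length (?E c # ?E b # l)) ?w" using l(1) by simp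
 have "?w (?E c # ?E b # l) = 0"
 proof (rule alternating_dependent_zero[OF alt subspace_leaf[OF ac q]])
  show "set (?E c # ?E b # l) \<subseteq> D q" using l(2) abc frame_in_leaf[OF ac q] by auto
  show "x \<in> span (set (map ?E es))" if "x \<in> set (?E c # ?E b # l)" for x
   using leaf_span[OF ac q] that l(2) abc frame_in_leaf[OF ac q] by auto
  show "card (set (map ?E es)) < length (filter (\<lambda>_. True) (?E c # ?E b # l))"
   using card_length[of "map ?E es"] l(1) by simp
 qed auto
 then show ?thesis unfolding alt_lift_Cons_Cons co[OF abc(2)] co[OF abc(3)] by (auto split: if_splits)
qed

end

end

section \<open>The modular field of an oriented Poisson foliation\<close>

text \<open>\<tau> is a parameter because the Reeb class is defined by a transverse form of its own:
  the locale is instantiated a second time with that form.\<close>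

locale poisson_foliation = manifold A for A :: "('m::t2_space, 'e::euclidean_space) chart set" +
 fixes V F :: "'m distribution" and P :: "'m bivector" and \<tau> :: "'m kform"
 assumes fol_V: "regular_foliation A V" and fol_F: "regular_foliation A F" and split_FV: "splits_tangent A F V"
  and leaf_P: "P \<in> bivector_fields A V" and poisson_P: "poisson_bivector A P"
  and vol: "leafwise_volume_form A V \<tau>"
begin

lemmas Pb = poisson_bivectorD[OF poisson_P]

lemma sub_V: "subspace (V p)" and sub_F: "subspace (F p)"
 by (rule regular_foliation_subspace[OF fol_V]) (rule regular_foliation_subspace[OF fol_F])

lemma V_sub_tangent: "V p \<subseteq> TM p" and F_sub_tangent: "F p \<subseteq> TM p"
 using regular_foliation_tangent[OF fol_V] regular_foliation_tangent[OF fol_F] by auto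

lemma vol_kforms: "\<tau> \<in> kforms A V (fol_rank V)"
 using vol by (simp add: leafwise_volume_form_def)

abbreviation ext_vol :: "'m kform" where
 "ext_vol \<equiv> \<lambda>p vs. \<tau> p (map (proj_along F V p) vs)"

lemma ext_vol_kforms: "ext_vol \<in> kforms A TM (fol_rank V)"
 by (rule projected_form_kforms[OF split_FV fol_F fol_V vol_kforms])

lemma ext_vol_leaf:
 assumes "set vs \<subseteq> V p"
 shows "ext_vol p vs = \<tau> p vs"
proof -
 have "map (proj_along F V p) vs = vs"
  using assms V_sub_tangent[of p] by (intro map_idI proj_along_leaf[OF split_FV sub_F sub_V]) auto
 then show ?thesis by simp
qed

text \<open>With \<open>y\<^sub>c\<close> the leafwise coordinates of the chart and \<open>\<tau> = t dy\<^sub>1 \<and> \<dots> \<and> dy\<^sub>r\<close>, the coefficients of the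
 modular field are \<open>t\<inverse> \<Sum>\<^sub>b \<partial>\<^sub>b (t {y\<^sub>c, y\<^sub>b})\<close>.\<close>

definition modular_coeff :: "'m set \<Rightarrow> ('m \<Rightarrow> 'e) \<Rightarrow> 'e list \<Rightarrow> 'e \<Rightarrow> 'm \<Rightarrow> real" where
 "modular_coeff U \<phi> es c q = (\<Sum>b\<in>set es.
   coord_field U \<phi> b q (pbracket P (coord \<phi> c) (coord \<phi> b)) +
   pbracket P (coord \<phi> c) (coord \<phi> b) q * coord_field U \<phi> b q (\<lambda>q. ln (\<tau> q (frame_at U \<phi> es q))))"

definition local_modular :: "'m set \<Rightarrow> ('m \<Rightarrow> 'e) \<Rightarrow> 'e list \<Rightarrow> 'm vfield" where
 "local_modular U \<phi> es q = (\<Sum>c\<in>set es. modular_coeff U \<phi> es c q *\<^sub>R coord_field U \<phi> c q)"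

context
 fixes U \<phi> es fs
 assumes ac: "adapted_chart V U \<phi> es fs"
begin

lemma chart_rank: "q \<in> U \<Longrightarrow> length es = fol_rank V"
 by (rule adapted_chart_rank[OF fol_V ac]) auto

lemma frame_vol_nonzero: "q \<in> U \<Longrightarrow> \<tau> q (frame_at U \<phi> es q) \<noteq> 0"
 by (rule leafwise_volume_form_frame[OF fol_V vol ac])

lemma frame_vol_smooth: "(\<lambda>q. \<tau> q (frame_at U \<phi> es q)) \<in> Cinf A U"
proof (cases "U = {}")
 case True
 then show ?thesis by (intro Cinf_transform[OF Cinf_const[of 0] acD(2)[OF ac]]) auto
next
 case False
 then have "length es = fol_rank V" using chart_rank by auto
 then show ?thesis by (intro kforms_smooth[OF vol_kforms acD(2)[OF ac] _ frame_list_sections[OF ac]]) simp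
qed

lemma ln_vol_smooth: "(\<lambda>q. ln (\<tau> q (frame_at U \<phi> es q))) \<in> Cinf A U"
 by (rule Cinf_ln[OF acD(2)[OF ac] frame_vol_smooth frame_vol_nonzero])

lemma alt_vol: "q \<in> U \<Longrightarrow> alternating_on (V q) (length es) (\<tau> q)"
 using kforms_alternating[OF vol_kforms, of q] chart_rank by simp

text \<open>On the leaves the Lie derivative of \<tau> is again a top form, so it is enough to
  evaluate it on the frame, where all brackets vanish. Tensoriality is borrowed from
  \<open>ext_vol\<close>, which agrees with \<tau> on vertical vectors.\<close>

lemma lie_form_vol:
 assumes W: "open W" "W \<subseteq> U" "q \<in> W" and Zs: "set Zs \<subseteq> sections A W V" "length Zs = length es"
 shows "lie_form A (coord_field U \<phi> a) \<tau> Zs q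
  = coord_field U \<phi> a q (\<lambda>q. ln (\<tau> q (frame_at U \<phi> es q))) * \<tau> q (at_point Zs q)"
proof -
 let ?E = "coord_field U \<phi>" and ?Es = "map (coord_field U \<phi>) es"
 have q: "q \<in> U" using W by auto
 note r = chart_rank[OF q]
 have Ea: "?E b \<in> \<XX> W" for b by (rule vector_fields_mono[OF frame_vector_field[OF ac] W(2)])
 note Eat = vector_field_tangent[OF Ea W(3), of a]
 obtain L where L: "alternating_on (TM q) (fol_rank V) L"
  "\<And>U Ys. open U \<Longrightarrow> q \<in> U \<Longrightarrow> length Ys = fol_rank V \<Longrightarrow> set Ys \<subseteq> \<XX> U \<Longrightarrow>
   lie_form A (?E a) ext_vol Ys q = L (at_point Ys q)"
  by (rule lie_form_tensor[OF ext_vol_kforms W(1,3) Ea[of a]]) blast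
 have eq: "lie_form A (?E a) \<tau> Ys q = L (at_point Ys q)" if Ys: "set Ys \<subseteq> sections A W V" "length Ys = length es" for Ys
 proof -
  have Yv: "set Ys \<subseteq> \<XX> W" using Ys(1) by (auto simp: sections_def)
  have 1: "?E a q (\<lambda>q. \<tau> q (at_point Ys q)) = ?E a q (\<lambda>q. ext_vol q (at_point Ys q))"
   by (rule tangent_cong[OF Eat W(1,3)]) (rule ext_vol_leaf[symmetric, OF at_point_sections[OF Ys(1)]])
  have 2: "\<tau> q ((at_point Ys q)[i := bracket (?E a) (Ys ! i) q]) = ext_vol q ((at_point Ys q)[i := bracket (?E a) (Ys ! i) q])"
   if i: "i < length Ys" for i
  proof -
   have "Ys ! i \<in> sections A W V" using Ys i by auto
   then show ?thesis
    by (intro ext_vol_leaf[symmetric] set_update_subset at_point_sections[OF Ys(1) W(3)] frame_bracket_leaf[OF ac W])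
  qed
  have "lie_form A (?E a) \<tau> Ys q = lie_form A (?E a) ext_vol Ys q"
   unfolding lie_form_def 1 using 2 by simp
  then show ?thesis using L(2)[OF W(1,3) _ Yv] Ys(2) r by simp
 qed
 have Es: "set ?Es \<subseteq> sections A W V" using frame_list_sections[OF ac] sections_mono[OF _ W(2)] by blast
 have "leaf_div U \<phi> es \<tau> (?E a) q = ?E a q (\<lambda>q. ln (\<tau> q (at_point ?Es q)))"
 proof -
  have "?E e q (\<lambda>q. ?E a q (coord \<phi> e)) = 0" for e
  proof -
   note Ee = vector_field_tangent[OF Ea W(3), of e]
   have "?E e q (\<lambda>q. ?E a q (coord \<phi> e)) = ?E e q (\<lambda>q. a \<bullet> e)"
    by (rule tangent_cong[OF Ee W(1,3)]) (use W(2) frame_coordinate[OF ac] in auto)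
   then show ?thesis using tangent_const[OF Ee] by simp
  qed
  then show ?thesis by (simp add: leaf_div_def)
 qed
 moreover have "lie_form A (?E a) \<tau> ?Es q = leaf_div U \<phi> es \<tau> (?E a) q * \<tau> q (at_point ?Es q)"
 proof (rule lie_form_frame[where D = V and \<omega> = \<tau> and q = q, OF ac W Ea alt_vol[OF q]])
  show "bracket (?E a) (?E e) q \<in> V q" if "e \<in> set es" for e
   using bracket_frame_zero[OF ac q] subspace_0[OF sub_V] by simp
  show "smooth_at A q (\<lambda>q. \<tau> q (at_point ?Es q))" by (rule smooth_atI[OF acD(2)[OF ac] q frame_vol_smooth])
 qed (rule frame_vol_nonzero[OF q])
 ultimately have LE: "L (at_point ?Es q) = ?E a q (\<lambda>q. ln (\<tau> q (at_point ?Es q))) * \<tau> q (at_point ?Es q)"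
  using eq[OF Es] by simp
 have "L (at_point Zs q) * \<tau> q (at_point ?Es q) = L (at_point ?Es q) * \<tau> q (at_point Zs q)"
  by (rule alternating_top_ratio[OF alternating_subset[OF L(1) V_sub_tangent] kforms_alternating[OF vol_kforms] sub_V frame_list_span[OF ac q]])
   (use Zs r at_point_sections[OF Zs(1) W(3)] in auto)
 then show ?thesis using LE eq[OF Zs] frame_vol_nonzero[OF q] by simp
qed

lemma lie_form_interior:
 assumes W: "open W" "W \<subseteq> U" "q \<in> W" and Zs: "set Zs \<subseteq> sections A W V" "Suc (Suc (length Zs)) = length es"
 shows "2 * lie_form A (coord_field U \<phi> a) (interior_bivector A V P \<tau>) Zs q = (\<Sum>b\<in>set es. \<Sum>c\<in>set es.
  (coord_field U \<phi> a q (pbracket P (coord \<phi> b) (coord \<phi> c)) + pbracket P (coord \<phi> b) (coord \<phi> c) q *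
   coord_field U \<phi> a q (\<lambda>q. ln (\<tau> q (frame_at U \<phi> es q)))) *
  \<tau> q (coord_field U \<phi> c q # coord_field U \<phi> b q # at_point Zs q))"
proof -
 let ?E = "coord_field U \<phi>" and ?p = "\<lambda>b c. pbracket P (coord \<phi> b) (coord \<phi> c)"
 let ?T = "\<lambda>b c. \<tau> q (?E c q # ?E b q # at_point Zs q)" and ?L = "\<lambda>q. ln (\<tau> q (frame_at U \<phi> es q))"
 have q: "q \<in> U" using W by auto
 have vk: "\<tau> \<in> kforms A V (Suc (Suc (length Zs)))" using vol_kforms chart_rank[OF q] Zs(2) by simp
 have Es: "?E b \<in> sections A W V" if "b \<in> set es" for b by (rule sections_mono[OF frame_section[OF ac that] W(2)])
 have z: "\<tau> q (0 # ?E b q # at_point Zs q) = 0" "\<tau> q (?E b q # 0 # at_point Zs q) = 0" if "b \<in> set es" for b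
 proof -
  have l: "length (?E b q # ?E b q # at_point Zs q) = Suc (Suc (length Zs))" "set (?E b q # ?E b q # at_point Zs q) \<subseteq> V q"
   using at_point_sections[OF Zs(1) W(3)] frame_in_leaf[OF ac q that] by auto
  note * = alternating_sum[OF kforms_alternating[OF vk] sub_V l, of _ "{}"]
  show "\<tau> q (0 # ?E b q # at_point Zs q) = 0" using *[of 0] by simp
  show "\<tau> q (?E b q # 0 # at_point Zs q) = 0" using *[of 1] by simp
 qed
 have "2 * lie_form A (?E a) (interior_bivector A V P \<tau>) Zs q = (\<Sum>b\<in>set es. \<Sum>c\<in>set es. ?E a q (?p b c) * ?T b c
   + ?p b c q * (lie_form A (?E a) \<tau> (?E c # ?E b # Zs) q + \<tau> q (bracket (?E a) (?E c) q # ?E b q # at_point Zs q)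
    + \<tau> q (?E c q # bracket (?E a) (?E b) q # at_point Zs q)))"
 proof (rule lie_form_interior_frame[where \<Phi> = \<tau>, OF leaf_P ac vk W vector_fields_mono[OF frame_vector_field[OF ac] W(2)] refl Zs(1)])
  show "bracket (?E a) (Zs ! i) q \<in> V q" if "i < length Zs" for i
   using Zs(1) that by (intro frame_bracket_leaf[OF ac W]) auto
 qed
 also have "\<dots> = (\<Sum>b\<in>set es. \<Sum>c\<in>set es. (?E a q (?p b c) + ?p b c q * ?E a q ?L) * ?T b c)"
 proof (intro sum.cong refl)
  fix b c assume bc: "b \<in> set es" "c \<in> set es"
  have "set (?E c # ?E b # Zs) \<subseteq> sections A W V" using Zs(1) Es bc by auto
  from lie_form_vol[OF W this] Zs(2) have "lie_form A (?E a) \<tau> (?E c # ?E b # Zs) q = ?E a q ?L * ?T b c"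
   by (simp add: at_point_Cons)
  then show "?E a q (?p b c) * ?T b c + ?p b c q * (lie_form A (?E a) \<tau> (?E c # ?E b # Zs) q
    + \<tau> q (bracket (?E a) (?E c) q # ?E b q # at_point Zs q) + \<tau> q (?E c q # bracket (?E a) (?E b) q # at_point Zs q))
   = (?E a q (?p b c) + ?p b c q * ?E a q ?L) * ?T b c"
   unfolding bracket_frame_zero[OF ac q] z[OF bc(1)] z[OF bc(2)] by (simp add: algebra_simps)
 qed
 finally show ?thesis .
qed

text \<open>After \<open>ext_deriv_frame\<close>, the degree argument of
  \<open>coordinate_wedge_top\<close> keeps only the terms with \<open>a = b\<close> or
  \<open>a = c\<close>. By skewness of the bracket the two groups agree, which cancels the factor
  1/2 of the frame formula and leaves the coefficients of \<open>local_modular\<close>.\<close>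

lemma modular_contraction:
 assumes W: "open W" "W \<subseteq> U" "q \<in> W" and Xs: "set Xs \<subseteq> sections A W V" "Suc (length Xs) = length es"
 shows "\<tau> q (local_modular U \<phi> es q # at_point Xs q) = - ext_deriv A (interior_bivector A V P \<tau>) Xs q"
proof -
 let ?E = "coord_field U \<phi>" and ?\<beta> = "interior_bivector A V P \<tau>" and ?l = "at_point Xs q"
 let ?p = "\<lambda>b c. pbracket P (coord \<phi> b) (coord \<phi> c)"
 let ?x = "\<lambda>i a. (Xs ! i) q (coord \<phi> a)"
 let ?I = "\<lambda>i b c. \<tau> q (?E c q # ?E b q # remove_nth i ?l)"
 have q: "q \<in> U" using W by auto
 have lV: "set ?l \<subseteq> V q" by (rule at_point_sections[OF Xs(1) W(3)])
 define d where "d a b c = ?E a q (?p b c) + ?p b c q * ?E a q (\<lambda>q. ln (\<tau> q (at_point (map ?E es) q)))" for a b c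
 have d_skew: "d a c b = - d a b c" for a b c
 proof -
  have pp: "?p c b = (\<lambda>q. - ?p b c q)" by (rule ext) (rule pbracket_skew[OF leaf_P])
  have "?E a q (?p c b) = - ?E a q (?p b c)"
   unfolding pp by (rule tangent_minus[OF frame_tangent[OF ac q] smooth_atI[OF acD(2)[OF ac] q coordinate_bracket_smooth[OF leaf_P ac]]])
  then show ?thesis unfolding d_def using fun_cong[OF pp, of q] by simp
 qed
 have ed: "ext_deriv A ?\<beta> Xs q = (\<Sum>i<length Xs. (- 1) ^ i * (\<Sum>a\<in>set es. ?x i a * ((\<Sum>b\<in>set es. \<Sum>c\<in>set es. d a b c * ?I i b c) / 2)))"
 proof (cases "length Xs")
  \<comment> \<open>Leaves of dimension one: the contracted form has negative degree, and
    \<open>ext_deriv\<close> on the empty list is 0 by convention.\<close>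
  case 0
  then show ?thesis by (simp add: ext_deriv_def)
 next
  case (Suc k)
  have "\<tau> \<in> kforms A V (Suc (Suc k))" using vol_kforms chart_rank[OF q] Xs(2) Suc by simp
  from interior_bivector_kforms[OF leaf_P fol_V this] have \<beta>: "?\<beta> \<in> kforms A V k" .
  show ?thesis unfolding ext_deriv_frame[OF ac \<beta> W Suc Xs(1)] Suc
  proof (intro sum.cong refl arg_cong2[of _ _ _ _ "(*)"])
   fix i a assume i: "i \<in> {..<Suc k}"
   have "set (remove_nth i Xs) \<subseteq> sections A W V" using Xs(1) set_remove_nth[of i Xs] by auto
   from lie_form_interior[OF W this, of a] length_remove_nth[of i Xs] i Suc Xs(2)
   show "lie_form A (?E a) ?\<beta> (remove_nth i Xs) q = (\<Sum>b\<in>set es. \<Sum>c\<in>set es. d a b c * ?I i b c) / 2"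
    by (simp add: d_def at_point_remove_nth)
  qed
 qed
 also have "\<dots> = (\<Sum>a\<in>set es. \<Sum>b\<in>set es. \<Sum>c\<in>set es. d a b c / 2 * (\<Sum>i<length Xs. (- 1) ^ i * (?x i a * ?I i b c)))"
  (is "?L = ?R")
 proof -
  have "?L = (\<Sum>i<length Xs. \<Sum>a\<in>set es. \<Sum>b\<in>set es. \<Sum>c\<in>set es. d a b c / 2 * ((- 1) ^ i * (?x i a * ?I i b c)))"
   by (simp add: sum_distrib_left sum_divide_distrib mult_ac)
  also have "\<dots> = (\<Sum>a\<in>set es. \<Sum>i<length Xs. \<Sum>b\<in>set es. \<Sum>c\<in>set es. d a b c / 2 * ((- 1) ^ i * (?x i a * ?I i b c)))"
   by (rule sum.swap)
  also have "\<dots> = (\<Sum>a\<in>set es. \<Sum>b\<in>set es. \<Sum>i<length Xs. \<Sum>c\<in>set es. d a b c / 2 * ((- 1) ^ i * (?x i a * ?I i b c)))"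
   by (intro sum.cong refl sum.swap)
  also have "\<dots> = (\<Sum>a\<in>set es. \<Sum>b\<in>set es. \<Sum>c\<in>set es. \<Sum>i<length Xs. d a b c / 2 * ((- 1) ^ i * (?x i a * ?I i b c)))"
   by (intro sum.cong refl sum.swap)
  finally show ?thesis by (simp only: sum_distrib_left)
 qed
 also have "\<dots> = (\<Sum>a\<in>set es. \<Sum>b\<in>set es. \<Sum>c\<in>set es. d a b c / 2 *
   ((if a = b then \<tau> q (?E c q # ?l) else 0) - (if a = c then \<tau> q (?E b q # ?l) else 0)))"
 proof (intro sum.cong refl arg_cong2[of _ _ _ _ "(*)"])
  fix a b c assume abc: "a \<in> set es" "b \<in> set es" "c \<in> set es"
  show "(\<Sum>i<length Xs. (- 1) ^ i * (?x i a * ?I i b c)) = (if a = b then \<tau> q (?E c q # ?l) else 0) - (if a = c then \<tau> q (?E b q # ?l) else 0)"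
   using coordinate_wedge_top[OF ac q alt_vol[OF q] abc _ lV] Xs(2) by (simp add: nth_at_point)
 qed
 also have "\<dots> = (\<Sum>b\<in>set es. \<Sum>c\<in>set es. d b b c / 2 * \<tau> q (?E c q # ?l)) - (\<Sum>b\<in>set es. \<Sum>c\<in>set es. d c b c / 2 * \<tau> q (?E b q # ?l))"
 proof -
  have sel: "(\<Sum>a\<in>set es. g a * (if a = b then x else 0)) = g b * x" if "b \<in> set es" for g :: "'e \<Rightarrow> real" and b x
  proof -
   have "(\<Sum>a\<in>set es. g a * (if a = b then x else 0)) = (\<Sum>a\<in>set es. if a = b then g a * x else 0)"
    by (rule sum.cong) auto
   then show ?thesis using that by simp
  qed
  have swap: "(\<Sum>a\<in>set es. \<Sum>b\<in>set es. \<Sum>c\<in>set es. f a b c) = (\<Sum>b\<in>set es. \<Sum>c\<in>set es. \<Sum>a\<in>set es. f a b c)"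
   for f :: "'e \<Rightarrow> 'e \<Rightarrow> 'e \<Rightarrow> real"
  proof -
   have "(\<Sum>a\<in>set es. \<Sum>b\<in>set es. \<Sum>c\<in>set es. f a b c) = (\<Sum>b\<in>set es. \<Sum>a\<in>set es. \<Sum>c\<in>set es. f a b c)"
    by (rule sum.swap)
   also have "\<dots> = (\<Sum>b\<in>set es. \<Sum>c\<in>set es. \<Sum>a\<in>set es. f a b c)"
    by (intro sum.cong refl sum.swap)
   finally show ?thesis .
  qed
  have "(\<Sum>a\<in>set es. \<Sum>b\<in>set es. \<Sum>c\<in>set es. d a b c / 2 * (if a = b then \<tau> q (?E c q # ?l) else 0))
   = (\<Sum>b\<in>set es. \<Sum>c\<in>set es. d b b c / 2 * \<tau> q (?E c q # ?l))"
   by (rule trans[OF swap]) (intro sum.cong refl sel)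
  moreover have "(\<Sum>a\<in>set es. \<Sum>b\<in>set es. \<Sum>c\<in>set es. d a b c / 2 * (if a = c then \<tau> q (?E b q # ?l) else 0))
   = (\<Sum>b\<in>set es. \<Sum>c\<in>set es. d c b c / 2 * \<tau> q (?E b q # ?l))"
   by (rule trans[OF swap]) (intro sum.cong refl sel)
  ultimately show ?thesis by (simp only: right_diff_distrib sum_subtractf)
 qed
 also have "\<dots> = - (\<Sum>c\<in>set es. \<Sum>b\<in>set es. d b c b * \<tau> q (?E c q # ?l))"
 proof -
  have "(\<Sum>b\<in>set es. \<Sum>c\<in>set es. d b b c / 2 * \<tau> q (?E c q # ?l)) = (\<Sum>c\<in>set es. \<Sum>b\<in>set es. - (d b c b / 2 * \<tau> q (?E c q # ?l)))"
  proof (subst sum.swap, intro sum.cong refl)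
   fix b c show "d b b c / 2 * \<tau> q (?E c q # ?l) = - (d b c b / 2 * \<tau> q (?E c q # ?l))"
    using d_skew[where a = b and b = b and c = c] by simp
  qed
  moreover have "(\<Sum>c\<in>set es. \<Sum>b\<in>set es. d b c b / 2 * \<tau> q (?E c q # ?l)) = (\<Sum>c\<in>set es. \<Sum>b\<in>set es. d b c b * \<tau> q (?E c q # ?l)) / 2"
   by (simp add: sum_divide_distrib)
  ultimately show ?thesis by (simp only: sum_negf)
 qed
 also have "(\<Sum>c\<in>set es. \<Sum>b\<in>set es. d b c b * \<tau> q (?E c q # ?l)) = \<tau> q (local_modular U \<phi> es q # ?l)"
 proof -
  have "\<tau> q ((0 # ?l)[0 := \<Sum>c\<in>set es. modular_coeff U \<phi> es c q *\<^sub>R ?E c q]) = (\<Sum>c\<in>set es. modular_coeff U \<phi> es c q * \<tau> q ((0 # ?l)[0 := ?E c q]))"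
   by (rule alternating_sum[OF alt_vol[OF q] sub_V _ _ _ frame_in_leaf[OF ac q]])
    (use Xs(2) lV subspace_0[OF sub_V] in auto)
  then show ?thesis by (simp add: local_modular_def modular_coeff_def d_def sum_distrib_right)
 qed
 finally show ?thesis by simp
qed

lemma local_modular_section: "local_modular U \<phi> es \<in> sections A U V"
proof -
 note U = acD(2)[OF ac]
 have E: "coord_field U \<phi> e \<in> \<XX> U" for e by (rule frame_vector_field[OF ac])
 have c: "modular_coeff U \<phi> es c \<in> Cinf A U" for c
 proof -
  have "(\<lambda>q. \<Sum>b\<in>set es. coord_field U \<phi> b q (pbracket P (coord \<phi> c) (coord \<phi> b)) +
   pbracket P (coord \<phi> c) (coord \<phi> b) q * coord_field U \<phi> b q (\<lambda>q. ln (\<tau> q (frame_at U \<phi> es q)))) \<in> Cinf A U"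
   by (intro Cinf_sum[OF U] Cinf_add[OF U] Cinf_mult[OF U] coordinate_bracket_smooth[OF leaf_P ac]
    vector_field_smooth[OF E U order.refl coordinate_bracket_smooth[OF leaf_P ac]]
    vector_field_smooth[OF E U order.refl ln_vol_smooth])
  then show ?thesis by (rule Cinf_transform[OF _ U]) (simp add: modular_coeff_def)
 qed
 have "(\<lambda>q. \<Sum>e\<in>set es. modular_coeff U \<phi> es e q *\<^sub>R coord_field U \<phi> e q) \<in> \<XX> U"
  by (rule vector_fields_sum[OF U E c])
 then have "local_modular U \<phi> es \<in> \<XX> U"
  by (rule vector_fields_cong[OF U]) (rule local_modular_def[symmetric])
 moreover have "local_modular U \<phi> es q \<in> V q" if "q \<in> U" for q
  unfolding local_modular_def by (intro subspace_sum[OF sub_V] subspace_scale[OF sub_V] frame_in_leaf[OF ac that])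
 ultimately show ?thesis by (simp add: sections_def)
qed

text \<open>The second derivatives of \<open>f\<close> are paired with the skew matrix of brackets
  of coordinates and drop out; the first derivatives match term by term. This makes the modular
  field the leafwise divergence of Hamiltonian fields.\<close>

lemma local_modular_apply:
 assumes q: "q \<in> U" and f: "smooth_at A q f"
 shows "local_modular U \<phi> es q f = leaf_div U \<phi> es \<tau> (ham P f) q"
proof -
 let ?E = "coord_field U \<phi>" and ?y = "\<lambda>c q. \<phi> q \<bullet> c" and ?L = "\<lambda>q. ln (\<tau> q (frame_at U \<phi> es q))"
 let ?p = "\<lambda>b c. pbracket P (?y b) (?y c)"
 obtain W where W: "open W" "q \<in> W" "W \<subseteq> U" "f \<in> Cinf A W" using smooth_atE[OF f acD(2)[OF ac] q] .
 have smy: "smooth_at A q' (?y c)" if "q' \<in> W" for c q' using coordinate_smooth_at[OF ac] that W(3) by auto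
 have smf: "smooth_at A q' f" if "q' \<in> W" for q' by (rule smooth_atI[OF W(1) that W(4)])
 have sm: "smooth_at A q g" if "g \<in> Cinf A W" for g by (rule smooth_atI[OF W(1,2) that])
 have p: "?p b c \<in> Cinf A W" for b c by (rule Cinf_mono[OF coordinate_bracket_smooth[OF leaf_P ac] W(3)])
 have Ev: "?E b \<in> \<XX> W" for b by (rule vector_fields_mono[OF frame_vector_field[OF ac] W(3)])
 have Ef: "(\<lambda>q. ?E b q f) \<in> Cinf A W" for b by (rule vector_field_smooth[OF Ev W(1) order.refl W(4)])
 note Et = vector_field_tangent[OF Ev W(2)]
 have pskew: "?p b c q' = - ?p c b q'" for b c q' by (rule pbracket_skew[OF leaf_P])
 have ham: "ham P g q' \<in> V q'" for g q' by (rule ham_field_mem[OF leaf_P sub_V V_sub_tangent])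
 have hamy: "ham P f q' (?y c) = - (\<Sum>b\<in>set es. ?p c b q' * ?E b q' f)" if q': "q' \<in> W" for q' c
 proof -
  have "ham P f q' (?y c) = - ham P (?y c) q' f" by (rule ham_field_skew[OF leaf_P smf[OF q'] smy[OF q']])
  also have "ham P (?y c) q' f = (\<Sum>b\<in>set es. ham P (?y c) q' (?y b) * ?E b q' f)"
   by (rule leaf_expand_apply[OF ac _ ham]) (use q' W(3) in auto)
  finally show ?thesis using ham_field_apply[OF smy[OF q']] by simp
 qed
 have d: "?E c q (\<lambda>q. ham P f q (?y c)) = - (\<Sum>b\<in>set es. ?p c b q * ?E c q (\<lambda>q. ?E b q f) + ?E b q f * ?E c q (?p c b))" for c
 proof -
  have s: "(\<lambda>q. ?p c b q * ?E b q f) \<in> Cinf A W" for b by (rule Cinf_mult[OF W(1) p Ef])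
  have "?E c q (\<lambda>q. ham P f q (?y c)) = ?E c q (\<lambda>q. - (\<Sum>b\<in>set es. ?p c b q * ?E b q f))"
   by (rule tangent_cong[OF Et W(1,2) hamy])
  also have "\<dots> = - ?E c q (\<lambda>q. \<Sum>b\<in>set es. ?p c b q * ?E b q f)"
   by (rule tangent_minus[OF Et sm[OF Cinf_sum[OF W(1) s]]])
  also have "?E c q (\<lambda>q. \<Sum>b\<in>set es. ?p c b q * ?E b q f) = (\<Sum>b\<in>set es. ?E c q (\<lambda>q. ?p c b q * ?E b q f))"
   by (rule tangent_sum[OF Et sm[OF s]])
  also have "\<dots> = (\<Sum>b\<in>set es. ?p c b q * ?E c q (\<lambda>q. ?E b q f) + ?E b q f * ?E c q (?p c b))"
   by (intro sum.cong refl tangent_mult[OF Et sm[OF p] sm[OF Ef]])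
  finally show ?thesis .
 qed
 have comm: "?E c q (\<lambda>q. ?E b q f) = ?E b q (\<lambda>q. ?E c q f)" for b c
  using lie_bracket_apply[OF f, of "?E c" "?E b"] fun_cong[OF bracket_frame_zero[OF ac q, of c b], of f] by simp
 have "(\<Sum>c\<in>set es. \<Sum>b\<in>set es. ?p c b q * ?E c q (\<lambda>q. ?E b q f)) = - (\<Sum>c\<in>set es. \<Sum>b\<in>set es. ?p b c q * ?E b q (\<lambda>q. ?E c q f))"
  unfolding sum_negf[symmetric]
 proof (intro sum.cong refl)
  fix b c show "?p c b q * ?E c q (\<lambda>q. ?E b q f) = - (?p b c q * ?E b q (\<lambda>q. ?E c q f))"
   using pskew[of c b q] comm[of c b] by simp
 qed
 also have "(\<Sum>c\<in>set es. \<Sum>b\<in>set es. ?p b c q * ?E b q (\<lambda>q. ?E c q f)) = (\<Sum>c\<in>set es. \<Sum>b\<in>set es. ?p c b q * ?E c q (\<lambda>q. ?E b q f))"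
  by (rule sum.swap)
 finally have 0: "(\<Sum>c\<in>set es. \<Sum>b\<in>set es. ?p c b q * ?E c q (\<lambda>q. ?E b q f)) = 0" by simp
 have pd: "?E c q (?p c b) = - ?E c q (?p b c)" for b c
 proof -
  have "?p c b = (\<lambda>q. - ?p b c q)" by (rule ext) (rule pskew)
  then have "?E c q (?p c b) = ?E c q (\<lambda>q. - ?p b c q)" by (rule arg_cong)
  then show ?thesis using tangent_minus[OF Et sm[OF p]] by simp
 qed
 have "leaf_div U \<phi> es \<tau> (ham P f) q = (\<Sum>c\<in>set es. ham P f q (?y c) * ?E c q ?L)
   - (\<Sum>c\<in>set es. \<Sum>b\<in>set es. ?p c b q * ?E c q (\<lambda>q. ?E b q f)) - (\<Sum>c\<in>set es. \<Sum>b\<in>set es. ?E b q f * ?E c q (?p c b))"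
  unfolding leaf_div_def d leaf_expand_apply[OF ac q ham, of f ?L]
  by (simp add: sum_negf sum.distrib sum_subtractf)
 also have "\<dots> = (\<Sum>c\<in>set es. \<Sum>b\<in>set es. (?E c q (?p b c) + ?p b c q * ?E c q ?L) * ?E b q f)"
 proof -
  have s: "- (?p c b q * ?E b q f) * ?E c q ?L - ?E b q f * ?E c q (?p c b) = (?E c q (?p b c) + ?p b c q * ?E c q ?L) * ?E b q f" for b c
   unfolding pd[of c b] using pskew[of c b q] by (simp add: algebra_simps)
  show ?thesis
   unfolding 0 hamy[OF W(2)] sum_negf[symmetric] sum_distrib_right diff_0_right sum_subtractf[symmetric] s ..
 qed
 also have "\<dots> = (\<Sum>b\<in>set es. \<Sum>c\<in>set es. (?E c q (?p b c) + ?p b c q * ?E c q ?L) * ?E b q f)" by (rule sum.swap)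
 also have "\<dots> = local_modular U \<phi> es q f"
  unfolding local_modular_def modular_coeff_def sum_fun_apply by (simp add: sum_distrib_right)
 finally show ?thesis by simp
qed

text \<open>Contracting \<tau> with all frame vectors but the \<open>i\<close>-th recovers the
  \<open>i\<close>-th coordinate up to a sign and a nonzero factor.\<close>

lemma leaf_vector_unique:
 assumes q: "q \<in> U" and Y: "Y \<in> V q" "Y' \<in> V q"
  and eq: "\<And>i. i < length es \<Longrightarrow> \<tau> q (Y # remove_nth i (frame_at U \<phi> es q))
   = \<tau> q (Y' # remove_nth i (frame_at U \<phi> es q))"
 shows "Y = Y'"
proof -
 let ?E = "frame_at U \<phi> es q"
 have E: "length ?E = length es" "set ?E \<subseteq> V q" using frame_list_mem[OF ac q] by auto
 have *: "Z (coord \<phi> (es ! i)) * \<tau> q ?E = (- 1) ^ i * \<tau> q (Z # remove_nth i ?E)"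
  if i: "i < length es" and Z: "Z \<in> V q" for i Z
 proof -
  have n: "?E[i := Z] ! i = Z" using i by simp
  show ?thesis unfolding frame_slot[OF ac q alt_vol[OF q] Z i, symmetric]
   using alternating_remove_nth[OF alt_vol[OF q] sub_V _ set_update_subset[OF E(2) Z] i, of i]
   unfolding n remove_nth_update_eq by simp
 qed
 have co: "Y (coord \<phi> e) = Y' (coord \<phi> e)" if e: "e \<in> set es" for e
 proof -
  obtain i where i: "i < length es" "es ! i = e" using e unfolding in_set_conv_nth by blast
  have "Y (coord \<phi> e) * \<tau> q ?E = Y' (coord \<phi> e) * \<tau> q ?E"
   using *[OF i(1) Y(1)] *[OF i(1) Y(2)] eq[OF i(1)] i(2) by simp
  then show ?thesis using frame_vol_nonzero[OF q] by (simp only: mult_cancel_right) simp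
 qed
 show ?thesis by (rule tangent_eqI[OF ac q]) (use Y co acD(6)[OF ac q] in auto)
qed

end

end

context poisson_foliation
begin

text \<open>The contraction identity has at most one vertical solution at each point. Hence the
  local formulas of overlapping charts agree, and they glue to the field described by
  \<open>THE\<close>.\<close>

lemma foliated_modular_field:
 shows foliated_modular_section: "foliated_modular_field A V P \<tau> \<in> sections A UNIV V"
  and foliated_modular_local: "adapted_chart V U \<phi> es fs \<Longrightarrow> q \<in> U \<Longrightarrow>
   foliated_modular_field A V P \<tau> q = local_modular U \<phi> es q"
proof -
 let ?\<beta> = "interior_bivector A V P \<tau>"
 let ?prop = "\<lambda>Z. Z \<in> sections A UNIV V \<and>
   (\<forall>U Xs. open U \<longrightarrow> length Xs + 1 = fol_rank V \<longrightarrow> set Xs \<subseteq> sections A U V \<longrightarrow>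
    (\<forall>p\<in>U. \<tau> p (Z p # at_point Xs p) = - ext_deriv A ?\<beta> Xs p))"
 have "\<exists>U \<phi> es fs. adapted_chart V U \<phi> es fs \<and> p \<in> U" for p using adapted_chart_exists[OF fol_V] by metis
 then obtain cU c\<phi> ce cf where c: "\<And>p. adapted_chart V (cU p) (c\<phi> p) (ce p) (cf p)" "\<And>p. p \<in> cU p" by metis
 define Z where "Z p = local_modular (cU p) (c\<phi> p) (ce p) p" for p
 have ZV: "Z p \<in> V p" for p using local_modular_section[OF c(1)] c(2) by (auto simp: Z_def sections_def)
 have con: "\<tau> p (Z p # at_point Xs p) = - ext_deriv A ?\<beta> Xs p"
  if "open U" "p \<in> U" "length Xs + 1 = fol_rank V" "set Xs \<subseteq> sections A U V" for U p Xs
  unfolding Z_def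
 proof (rule modular_contraction[OF c(1), of "U \<inter> cU p"])
  show "open (U \<inter> cU p)" using that(1) acD(2)[OF c(1)] by blast
  show "p \<in> U \<inter> cU p" using that(2) c(2) by blast
  show "set Xs \<subseteq> sections A (U \<inter> cU p) V" using that(4) sections_mono[OF _ Int_lower1] by blast
  show "Suc (length Xs) = length (ce p)" using that(3) chart_rank[OF c(1) c(2)] by simp
 qed simp
 have uniq: "Y = Y'" if ac: "adapted_chart V U \<phi> es fs" "p \<in> U" and Y: "Y \<in> V p" "Y' \<in> V p"
  and Y': "\<And>Xs. length Xs + 1 = fol_rank V \<Longrightarrow> set Xs \<subseteq> sections A U V \<Longrightarrow> \<tau> p (Y # at_point Xs p) = \<tau> p (Y' # at_point Xs p)" for U \<phi> es fs p Y Y'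
 proof (rule leaf_vector_unique[OF ac Y])
  fix i assume i: "i < length es"
  let ?Xs = "remove_nth i (map (coord_field U \<phi>) es)"
  have "set ?Xs \<subseteq> sections A U V" by (rule order.trans[OF set_remove_nth frame_list_sections[OF ac(1)]])
  moreover have "length ?Xs + 1 = fol_rank V"
   using length_remove_nth[of i "map (coord_field U \<phi>) es"] i chart_rank[OF ac] by simp
  ultimately have "\<tau> p (Y # at_point ?Xs p) = \<tau> p (Y' # at_point ?Xs p)" by (intro Y')
  then show "\<tau> p (Y # remove_nth i (at_point (map (coord_field U \<phi>) es) p)) = \<tau> p (Y' # remove_nth i (at_point (map (coord_field U \<phi>) es) p))"
   unfolding at_point_remove_nth .
 qed
 have loc: "Z q = local_modular U \<phi> es q" if ac: "adapted_chart V U \<phi> es fs" "q \<in> U" for U \<phi> es fs q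
 proof (rule uniq[OF ac ZV])
  show "local_modular U \<phi> es q \<in> V q" using local_modular_section[OF ac(1)] ac(2) by (auto simp: sections_def)
  fix Xs assume Xs: "length Xs + 1 = fol_rank V" "set Xs \<subseteq> sections A U V"
  show "\<tau> q (Z q # at_point Xs q) = \<tau> q (local_modular U \<phi> es q # at_point Xs q)"
   using con[OF acD(2)[OF ac(1)] ac(2) Xs] modular_contraction[OF ac(1) acD(2)[OF ac(1)] order.refl ac(2) Xs(2)] Xs(1) chart_rank[OF ac] by simp
 qed
 have "Z \<in> \<XX> UNIV"
 proof (rule vector_fields_local[OF open_UNIV])
  fix p
  have "local_modular (cU p) (c\<phi> p) (ce p) \<in> \<XX> (cU p)"
   using local_modular_section[OF c(1)] by (simp add: sections_def)
  then have "Z \<in> \<XX> (cU p)"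
   by (rule vector_fields_cong[OF acD(2)[OF c(1)]]) (rule loc[OF c(1), symmetric])
  then show "\<exists>W. open W \<and> p \<in> W \<and> Z \<in> \<XX> W" using acD(2)[OF c(1)] c(2) by blast
 qed
 then have Zs: "Z \<in> sections A UNIV V" using ZV by (simp add: sections_def)
 have "foliated_modular_field A V P \<tau> = Z" unfolding foliated_modular_field_def
 proof (rule the_equality)
  show "?prop Z" using Zs con by blast
  fix Y assume Y: "?prop Y"
  show "Y = Z"
  proof
   fix p
   show "Y p = Z p"
   proof (rule uniq[OF c(1) c(2) _ ZV])
    show "Y p \<in> V p" using Y by (simp add: sections_def)
    show "\<tau> p (Y p # at_point Xs p) = \<tau> p (Z p # at_point Xs p)"
     if "length Xs + 1 = fol_rank V" "set Xs \<subseteq> sections A (cU p) V" for Xs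
     using con[OF acD(2)[OF c(1)] c(2) that] Y[THEN conjunct2, rule_format, OF acD(2)[OF c(1)] that c(2)] by simp
   qed
  qed
 qed
 then show "foliated_modular_field A V P \<tau> \<in> sections A UNIV V"
  "adapted_chart V U \<phi> es fs \<Longrightarrow> q \<in> U \<Longrightarrow> foliated_modular_field A V P \<tau> q = local_modular U \<phi> es q"
  using Zs loc by auto
qed

section \<open>The Reeb class\<close>

text \<open>For \<open>f\<close> in \<open>fs\<close> this is the field Z_j of the overview.\<close>

definition lift :: "'m set \<Rightarrow> ('m \<Rightarrow> 'e) \<Rightarrow> 'e \<Rightarrow> 'm vfield" where
 "lift U \<phi> f q = coord_field U \<phi> f q - proj_along F V q (coord_field U \<phi> f q)"

context
 fixes U \<phi> es fs
 assumes ac: "adapted_chart V U \<phi> es fs"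
begin

lemma proj_tangent: "v \<in> TM q \<Longrightarrow> proj_along F V q v \<in> V q"
 and proj_complement: "v \<in> TM q \<Longrightarrow> v - proj_along F V q v \<in> F q"
 by (rule splits_tangent_proj[OF split_FV _ sub_F sub_V]; assumption)+

lemma lift_F: "q \<in> U \<Longrightarrow> lift U \<phi> f q \<in> F q"
 unfolding lift_def by (rule proj_complement[OF frame_tangent[OF ac]])

lemma lift_vector_field: "lift U \<phi> f \<in> \<XX> U"
proof -
 have "(\<lambda>q. proj_along F V q (coord_field U \<phi> f q)) \<in> \<XX> U"
  using projection_smooth[OF split_FV fol_F fol_V acD(2)[OF ac] frame_vector_field[OF ac]] by (simp add: sections_def)
 from vector_fields_diff[OF acD(2)[OF ac] frame_vector_field[OF ac] this] show ?thesis
  by (rule vector_fields_cong[OF acD(2)[OF ac]]) (rule lift_def[symmetric])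
qed

lemma lift_section: "lift U \<phi> f \<in> sections A U F"
 using lift_vector_field lift_F by (simp add: sections_def)

lemma leaf_coordinate: "q \<in> U \<Longrightarrow> v \<in> V q \<Longrightarrow> f \<in> set fs \<Longrightarrow> v (coord \<phi> f) = 0"
 using acD(6)[OF ac] by blast

lemma lift_coordinate: "q \<in> U \<Longrightarrow> f' \<in> set fs \<Longrightarrow> lift U \<phi> f q (coord \<phi> f') = f \<bullet> f'"
 using leaf_coordinate[OF _ proj_tangent[OF frame_tangent[OF ac]]]
 by (simp add: lift_def frame_coordinate[OF ac])

lemma fs_inner: "f \<in> set fs \<Longrightarrow> f' \<in> set fs \<Longrightarrow> f \<bullet> f' = (if f = f' then 1 else 0)"
 using acD(4)[OF ac, of f f'] by simp

text \<open>\<open>G\<close> is a complement of the leaf direction, later the fibre of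
  \<open>F\<close> or of \<open>H\<close>. The difference of the two sides lies in \<open>G\<close>
  and has no transverse coordinates, so it lies in \<open>V q\<close> as well and is zero.\<close>

lemma transverse_expand:
 assumes q: "q \<in> U" and v: "v \<in> TM q" and G: "subspace G" "G \<subseteq> TM q" "G \<inter> V q = {0}" "v - w \<in> G" "w \<in> V q"
  and Z: "\<And>f. f \<in> set fs \<Longrightarrow> Z f \<in> G" "\<And>f f'. f \<in> set fs \<Longrightarrow> f' \<in> set fs \<Longrightarrow> Z f (coord \<phi> f') = f \<bullet> f'"
 shows "v - w = (\<Sum>f\<in>set fs. v (coord \<phi> f) *\<^sub>R Z f)"
proof -
 let ?s = "\<Sum>f\<in>set fs. v (coord \<phi> f) *\<^sub>R Z f"
 have s: "?s \<in> G" by (intro subspace_sum[OF G(1)] subspace_scale[OF G(1)] Z(1))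
 then have d: "v - w - ?s \<in> G" by (rule subspace_diff[OF G(1,4)])
 have "(v - w - ?s) (coord \<phi> f) = 0" if f: "f \<in> set fs" for f
 proof -
  have "?s (coord \<phi> f) = (\<Sum>f'\<in>set fs. if f' = f then v (coord \<phi> f') else 0)"
   unfolding sum_fun_apply by (rule sum.cong[OF refl]) (simp add: Z(2)[OF _ f] fs_inner[OF _ f])
  then show ?thesis using f leaf_coordinate[OF q G(5) f] by simp
 qed
 then have "v - w - ?s \<in> V q" using d G(2) acD(6)[OF ac q] by blast
 then have "v - w - ?s = 0" using d G(3) by blast
 then show ?thesis by (rule eq_iff_diff_eq_0[THEN iffD2])
qed

lemma complement_expand:
 assumes "q \<in> U" "v \<in> TM q"
 shows "v - proj_along F V q v = (\<Sum>f\<in>set fs. v (coord \<phi> f) *\<^sub>R lift U \<phi> f q)"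
 by (rule transverse_expand[OF assms sub_F F_sub_tangent splits_tangent_Int[OF split_FV]
   proj_complement[OF assms(2)] proj_tangent[OF assms(2)] lift_F[OF assms(1)] lift_coordinate[OF assms(1)]])

lemma F_expand:
 assumes "q \<in> U" "v \<in> F q"
 shows "v = (\<Sum>f\<in>set fs. v (coord \<phi> f) *\<^sub>R lift U \<phi> f q)"
proof -
 have "v \<in> TM q" using assms(2) F_sub_tangent by blast
 from transverse_expand[OF assms(1) this sub_F F_sub_tangent splits_tangent_Int[OF split_FV] _ subspace_0[OF sub_V]
   lift_F[OF assms(1)] lift_coordinate[OF assms(1)]] assms(2)
 show ?thesis by (simp only: diff_0_right)
qed

text \<open>Fields with constant transverse coordinates are infinitesimal symmetries of the
  foliation. This covers coordinate fields, the lifts to \<open>F\<close> and to \<open>H\<close>,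
  and vertical fields.\<close>

lemma constant_coordinate_bracket:
 assumes W: "open W" "W \<subseteq> U" "q \<in> W" and X: "X \<in> \<XX> W" and Y: "Y \<in> sections A W V"
  and c: "\<And>q f. q \<in> W \<Longrightarrow> f \<in> set fs \<Longrightarrow> X q (coord \<phi> f) = c f"
 shows "bracket X Y q \<in> V q"
proof (rule leaf_bracket[OF ac W X Y])
 fix f assume f: "f \<in> set fs"
 have Yq: "Y q \<in> TM q" using Y W(3) by (auto simp: sections_def vector_fields_def)
 have "Y q (\<lambda>q. X q (coord \<phi> f)) = Y q (\<lambda>q. c f)" by (rule tangent_cong[OF Yq W(1,3) c[OF _ f]])
 then show "Y q (\<lambda>q. X q (coord \<phi> f)) = 0" using tangent_const[OF Yq] by simp
qed

lemma lift_bracket: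
 assumes "open W" "W \<subseteq> U" "q \<in> W" "Y \<in> sections A W V"
 shows "bracket (lift U \<phi> f) Y q \<in> V q"
 by (rule constant_coordinate_bracket[OF assms(1-3) vector_fields_mono[OF lift_vector_field assms(2)] assms(4) lift_coordinate])
  (use assms(2) in auto)

lemma lift_bracket_frame: "q \<in> U \<Longrightarrow> e \<in> set es \<Longrightarrow> bracket (lift U \<phi> f) (coord_field U \<phi> e) q \<in> V q"
 by (rule lift_bracket[OF acD(2)[OF ac] order.refl _ frame_section[OF ac]])

lemma leaf_div_smooth:
 assumes W: "open W" "W \<subseteq> U" and X: "X \<in> \<XX> W"
 shows "leaf_div U \<phi> es \<tau> X \<in> Cinf A W"
proof -
 have E: "coord_field U \<phi> e \<in> \<XX> W" for e by (rule vector_fields_mono[OF frame_vector_field[OF ac] W(2)])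
 have y: "(coord \<phi> e) \<in> Cinf A W" for e by (rule Cinf_mono[OF coordinate_smooth[OF ac] W(2)])
 have "(\<lambda>q. X q (\<lambda>q. ln (\<tau> q (frame_at U \<phi> es q)))
  + (\<Sum>e\<in>set es. coord_field U \<phi> e q (\<lambda>q. X q (coord \<phi> e)))) \<in> Cinf A W"
  by (intro Cinf_add[OF W(1)] Cinf_sum[OF W(1)] vector_field_smooth[OF X W(1) order.refl Cinf_mono[OF ln_vol_smooth[OF ac] W(2)]]
    vector_field_smooth[OF E W(1) order.refl vector_field_smooth[OF X W(1) order.refl y]])
 then show ?thesis by (rule Cinf_transform[OF _ W(1)]) (rule leaf_div_def[symmetric])
qed

lemma lie_form_lift:
 assumes "q \<in> U"
 shows "lie_form A (lift U \<phi> f) \<tau> (map (coord_field U \<phi>) es) q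
  = leaf_div U \<phi> es \<tau> (lift U \<phi> f) q * \<tau> q (frame_at U \<phi> es q)"
 by (rule lie_form_frame[where D = V and \<omega> = \<tau> and q = q, OF ac acD(2)[OF ac] order.refl assms lift_vector_field alt_vol[OF ac assms]
   lift_bracket_frame[OF assms] smooth_atI[OF acD(2)[OF ac] assms frame_vol_smooth[OF ac]] frame_vol_nonzero[OF ac assms]])

end

end

context poisson_foliation
begin

text \<open>In a chart adapted to \<open>F\<close> the transverse coordinates of \<open>X\<close>
  vanish identically, so \<open>leaf_bracket\<close> applies.\<close>

lemma F_bracket:
 assumes W: "open W" "q \<in> W" and X: "X \<in> sections A W F" and Y: "Y \<in> sections A W F"
 shows "bracket X Y q \<in> F q"
proof -
 obtain U \<phi> es fs where ac: "adapted_chart F U \<phi> es fs" and q: "q \<in> U" using adapted_chart_exists[OF fol_F] .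
 let ?N = "W \<inter> U"
 have N: "open ?N" "?N \<subseteq> U" "q \<in> ?N" using W q acD(2)[OF ac] by auto
 have XN: "X \<in> sections A ?N F" and YN: "Y \<in> sections A ?N F" using sections_mono[OF _ Int_lower1] X Y by blast+
 have Yq: "Y q \<in> TM q" using Y W(2) by (auto simp: sections_def vector_fields_def)
 show ?thesis
 proof (rule leaf_bracket[OF ac N _ YN])
  show "X \<in> \<XX> ?N" using XN by (simp add: sections_def)
  fix f assume f: "f \<in> set fs"
  have "Y q (\<lambda>q. X q (coord \<phi> f)) = Y q (\<lambda>q. 0)"
  proof (rule tangent_cong[OF Yq N(1,3)])
   fix q' assume "q' \<in> ?N"
   then have "X q' \<in> F q'" "q' \<in> U" using XN by (auto simp: sections_def)
   then show "X q' (coord \<phi> f) = 0" using acD(6)[OF ac] f by blast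
  qed
  then show "Y q (\<lambda>q. X q (coord \<phi> f)) = 0" using tangent_const[OF Yq, of 0] by simp
 qed
qed

context
 fixes U \<phi> es fs
 assumes ac: "adapted_chart V U \<phi> es fs"
begin

text \<open>For a transverse volume form \<open>L\<^sub>X \<tau>\<close> again vanishes on \<open>F\<close>, as \<open>F\<close> is involutive; it is therefore
 determined by its value on the leafwise frame.\<close>

lemma lie_form_transverse:
 assumes kf: "\<tau> \<in> kforms A TM (fol_rank V)"
  and kill: "\<And>p vs. length vs = fol_rank V \<Longrightarrow> set vs \<subseteq> TM p \<Longrightarrow> set vs \<inter> F p \<noteq> {} \<Longrightarrow> \<tau> p vs = 0"
  and W0: "open W0" "p \<in> W0" "p \<in> U" and X: "X \<in> sections A W0 F"
  and Ys: "open U0" "p \<in> U0" "length Ys = fol_rank V" "set Ys \<subseteq> \<XX> U0"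
 shows "lie_form A X \<tau> Ys p = (\<Sum>f\<in>set fs. X p (coord \<phi> f) * leaf_div U \<phi> es \<tau> (lift U \<phi> f) p) * \<tau> p (at_point Ys p)"
proof -
 let ?r = "fol_rank V" and ?T = "TM p" and ?E = "coord_field U \<phi>" and ?Es = "map (coord_field U \<phi>) es"
 let ?x = "\<lambda>f q. X q (coord \<phi> f)" and ?t = "\<lambda>q. \<tau> q (frame_at U \<phi> es q)"
 define W where "W = W0 \<inter> U"
 have W: "open W" "W \<subseteq> U" "p \<in> W" and WW0: "W \<subseteq> W0" using W0 acD(2)[OF ac] by (auto simp: W_def)
 have XW: "X \<in> sections A W F" by (rule sections_mono[OF X WW0])
 then have Xv: "X \<in> \<XX> W" by (simp add: sections_def)
 have Xt: "X p \<in> ?T" by (rule vector_field_tangent[OF Xv W(3)])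
 note alt = kforms_alternating[OF kf, of p]
 note r = chart_rank[OF ac W0(3)]
 note acT = adapted_chart_total[OF ac]
 obtain L where L: "alternating_on ?T ?r L"
  "\<And>U Ys. open U \<Longrightarrow> p \<in> U \<Longrightarrow> length Ys = ?r \<Longrightarrow> set Ys \<subseteq> \<XX> U \<Longrightarrow> lie_form A X \<tau> Ys p = L (at_point Ys p)"
  by (rule lie_form_tensor[OF kf W(1,3) Xv]) blast
 \<comment> \<open>Vectors are extended to fields in such a way that elements of \<open>F p\<close>
   stay in \<open>F\<close>: for these, constant combinations of the lifts are used in place of
   constant coordinates.\<close>
 have cs: "\<exists>Y. Y \<in> \<XX> W \<and> Y p = v \<and> (v \<in> F p \<longrightarrow> Y \<in> sections A W F)" if v: "v \<in> ?T" for v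
 proof (cases "v \<in> F p")
  case True
  let ?Y = "\<lambda>q. \<Sum>f\<in>set fs. v (coord \<phi> f) *\<^sub>R lift U \<phi> f q"
  have "?Y \<in> \<XX> W"
   by (rule vector_fields_sum[OF W(1) vector_fields_mono[OF lift_vector_field[OF ac] W(2)] Cinf_const])
  moreover have "?Y q \<in> F q" if "q \<in> W" for q
   using that W(2) by (intro subspace_sum[OF sub_F] subspace_scale[OF sub_F] lift_F[OF ac]) auto
  moreover have "?Y p = v" by (rule F_expand[OF ac W0(3) True, symmetric])
  ultimately show ?thesis unfolding sections_def by blast
 next
  case False
  let ?Y = "constant_field U \<phi> (es @ fs) v"
  have "?Y \<in> \<XX> W" by (rule vector_fields_mono[OF constant_field_vector_field[OF acT] W(2)])
  moreover have "?Y p = v" unfolding constant_field_def by (rule tangent_expand[OF ac W0(3) v, symmetric])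
  ultimately show ?thesis using False by blast
 qed
 then obtain Y where Y: "\<And>v. v \<in> ?T \<Longrightarrow> Y v \<in> \<XX> W" "\<And>v. v \<in> ?T \<Longrightarrow> Y v p = v"
  "\<And>v. v \<in> ?T \<Longrightarrow> v \<in> F p \<Longrightarrow> Y v \<in> sections A W F" by metis
 \<comment> \<open>The extension of an entry in \<open>F\<close> stays in \<open>F\<close>, and so
   does its bracket with \<open>X\<close>; hence every term of the Lie derivative has an entry in
   \<open>F\<close>.\<close>
 have Lkill: "L vs = 0" if vs: "length vs = ?r" "set vs \<subseteq> ?T" "set vs \<inter> F p \<noteq> {}" for vs
 proof -
  let ?Ys = "map Y vs"
  have Ysv: "set ?Ys \<subseteq> \<XX> W" using Y(1) vs(2) by auto
  have Ysp: "at_point ?Ys p = vs" using Y(2) vs(2) by (auto simp: at_point_def intro!: map_idI)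
  obtain v where v: "v \<in> set vs" "v \<in> F p" using vs(3) by blast
  then obtain i where i: "i < length vs" "vs ! i = v" unfolding in_set_conv_nth by blast
  have Yi: "Y v \<in> sections A W F" using Y(3) v vs(2) by blast
  have z: "\<tau> q (at_point ?Ys q) = 0" if q: "q \<in> W" for q
  proof (rule kill)
   show "set (at_point ?Ys q) \<subseteq> TM q" by (rule at_point_vector_fields[OF Ysv q])
   have "Y v q \<in> set (at_point ?Ys q)" using v(1) by (auto simp: at_point_def)
   moreover have "Y v q \<in> F q" using Yi q by (simp add: sections_def)
   ultimately show "set (at_point ?Ys q) \<inter> F q \<noteq> {}" by blast
  qed (simp add: vs(1))
  have "X p (\<lambda>q. \<tau> q (at_point ?Ys q)) = 0"
   using tangent_cong[OF Xt W(1,3) z] tangent_const[OF Xt, of 0] by simp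
  moreover have "\<tau> p ((at_point ?Ys p)[j := bracket X (?Ys ! j) p]) = 0" if j: "j < ?r" for j
  proof (rule kill)
   let ?b = "bracket X (?Ys ! j) p"
   have Yj: "?Ys ! j \<in> \<XX> W" using Ysv j vs(1) by (metis length_map nth_mem subsetD)
   show "set ((at_point ?Ys p)[j := ?b]) \<subseteq> ?T"
    unfolding Ysp by (rule set_update_subset[OF vs(2) lie_bracket_tangent[OF Xv Yj W(1,3)]])
   show "set ((at_point ?Ys p)[j := ?b]) \<inter> F p \<noteq> {}"
   proof (cases "j = i")
    case True
    then have "?Ys ! j = Y v" using i by simp
    then have "?b \<in> F p" using F_bracket[OF W(1,3) XW Yi] by simp
    moreover have "?b \<in> set ((at_point ?Ys p)[j := ?b])" using j vs(1) by (intro set_update_memI) simp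
    ultimately show ?thesis by blast
   next
    case False
    have "(vs[j := ?b]) ! i \<in> set (vs[j := ?b])" using i(1) by (intro nth_mem) simp
    then have "v \<in> set (vs[j := ?b])" using False i(2) by simp
    then show ?thesis unfolding Ysp using v(2) by blast
   qed
  qed (simp add: vs(1))
  ultimately have "lie_form A X \<tau> ?Ys p = 0" by (simp add: lie_form_def vs(1))
  then show ?thesis using L(2)[OF W(1,3) _ Ysv] Ysp vs(1) by simp
 qed
 have Esv: "set ?Es \<subseteq> \<XX> W" using vector_fields_mono[OF frame_vector_field[OF ac] W(2)] by auto
 have EsV: "set (at_point ?Es p) \<subseteq> V p" by (rule frame_list_mem[OF ac W0(3)])
 have LE: "L (at_point ?Es p) = (\<Sum>f\<in>set fs. ?x f p * leaf_div U \<phi> es \<tau> (lift U \<phi> f) p) * ?t p"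
 proof -
  have Lv: "lift U \<phi> f \<in> \<XX> W" for f by (rule vector_fields_mono[OF lift_vector_field[OF ac] W(2)])
  have y: "?x f \<in> Cinf A W" for f
   by (rule vector_field_smooth[OF Xv W(1) order.refl Cinf_mono[OF coordinate_smooth[OF ac] W(2)]])
  have br: "\<tau> p ((at_point ?Es p)[i := bracket X (?Es ! i) p])
    = (\<Sum>f\<in>set fs. ?x f p * \<tau> p ((at_point ?Es p)[i := bracket (lift U \<phi> f) (?Es ! i) p]))" if i: "i < length es" for i
  proof -
   let ?e = "?E (es ! i)"
   have ev: "?e \<in> \<XX> W" by (rule vector_fields_mono[OF frame_vector_field[OF ac] W(2)])
   have et: "?e p \<in> ?T" by (rule vector_field_tangent[OF ev W(3)])
   have "bracket X ?e p = - bracket ?e X p" by (rule lie_bracket_skew)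
   also have "bracket ?e X p = bracket ?e (\<lambda>q. \<Sum>f\<in>set fs. ?x f q *\<^sub>R lift U \<phi> f q) p"
   proof (rule lie_bracket_cong[OF ev Xv W(1,3)])
    fix q assume "q \<in> W"
    then show "X q = (\<Sum>f\<in>set fs. ?x f q *\<^sub>R lift U \<phi> f q)"
     using XW W(2) by (intro F_expand[OF ac]) (auto simp: sections_def)
   qed simp
   also have "\<dots> = (\<Sum>f\<in>set fs. ?x f p *\<^sub>R bracket ?e (lift U \<phi> f) p + ?e p (?x f) *\<^sub>R lift U \<phi> f p)"
    by (rule lie_bracket_sum[OF ev Lv y W(1,3)])
   finally have b: "bracket X ?e p = - (\<Sum>f\<in>set fs. ?x f p *\<^sub>R bracket ?e (lift U \<phi> f) p + ?e p (?x f) *\<^sub>R lift U \<phi> f p)" .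
   \<comment> \<open>Derivatives of the coefficients of \<open>X\<close> yield only multiples of the
     lifts, which lie in \<open>F\<close>, so \<tau> does not notice them.\<close>
   have diff: "bracket X ?e p - (\<Sum>f\<in>set fs. ?x f p *\<^sub>R bracket (lift U \<phi> f) ?e p) \<in> F p"
   proof -
    have "(\<Sum>f\<in>set fs. ?x f p *\<^sub>R bracket (lift U \<phi> f) ?e p) = - (\<Sum>f\<in>set fs. ?x f p *\<^sub>R bracket ?e (lift U \<phi> f) p)"
     unfolding lie_bracket_skew[of "lift U \<phi> _" ?e] scaleR_minus_right sum_negf ..
    then have "bracket X ?e p - (\<Sum>f\<in>set fs. ?x f p *\<^sub>R bracket (lift U \<phi> f) ?e p) = - (\<Sum>f\<in>set fs. ?e p (?x f) *\<^sub>R lift U \<phi> f p)"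
     unfolding b sum.distrib by (simp only: minus_add_distrib diff_minus_eq_add add.commute add.left_commute) (simp only: add_minus_cancel add.commute)
    moreover have "- (\<Sum>f\<in>set fs. ?e p (?x f) *\<^sub>R lift U \<phi> f p) \<in> F p"
     by (intro subspace_neg[OF sub_F] subspace_sum[OF sub_F] subspace_scale[OF sub_F] lift_F[OF ac W0(3)])
    ultimately show ?thesis by simp
   qed
   have bt: "bracket (lift U \<phi> f) ?e p \<in> ?T" for f by (rule lie_bracket_tangent[OF Lv ev W(1,3)])
   have st: "(\<Sum>f\<in>set fs. ?x f p *\<^sub>R bracket (lift U \<phi> f) ?e p) \<in> ?T"
    by (intro subspace_sum[OF subspace_tangent_space] subspace_scale[OF subspace_tangent_space] bt)
   have EsT: "set (at_point ?Es p) \<subseteq> ?T" by (rule at_point_vector_fields[OF Esv W(3)])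
   have "\<tau> p ((at_point ?Es p)[i := bracket X ?e p]) = \<tau> p ((at_point ?Es p)[i := \<Sum>f\<in>set fs. ?x f p *\<^sub>R bracket (lift U \<phi> f) ?e p])"
   proof (rule alternating_replace[OF alt subspace_tangent_space _ set_update_subset[OF EsT lie_bracket_tangent[OF Xv ev W(1,3)]] _ set_update_subset[OF EsT st] kill])
    show "(at_point ?Es p)[i := bracket X ?e p] ! j - (at_point ?Es p)[i := \<Sum>f\<in>set fs. ?x f p *\<^sub>R bracket (lift U \<phi> f) ?e p] ! j \<in> F p"
     if "j < ?r" for j
    proof (cases "j = i")
     case True
     show ?thesis unfolding True using diff i by (simp only: nth_list_update_eq length_at_point length_map)
    next
     case False
     then have ij: "i \<noteq> j" by simp
     show ?thesis unfolding nth_list_update_neq[OF ij] diff_self by (rule subspace_0[OF sub_F])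
    qed
   qed (simp_all add: r)
   also have "\<dots> = (\<Sum>f\<in>set fs. ?x f p * \<tau> p ((at_point ?Es p)[i := bracket (lift U \<phi> f) ?e p]))"
    by (rule alternating_sum[OF alt subspace_tangent_space _ EsT _ bt]) (use r i in auto)
   finally show ?thesis using i by simp
  qed
  have ts: "smooth_at A p ?t" by (rule smooth_atI[OF acD(2)[OF ac] W0(3) frame_vol_smooth[OF ac]])
  have "X p ?t = (\<Sum>f\<in>set fs. ?x f p * lift U \<phi> f p ?t)"
  proof -
   have "X p \<in> F p" using XW W(3) by (simp add: sections_def)
   from fun_cong[OF F_expand[OF ac W0(3) this], of ?t] show ?thesis unfolding sum_fun_apply by simp
  qed
  then have "lie_form A X \<tau> ?Es p = (\<Sum>f\<in>set fs. ?x f p * lie_form A (lift U \<phi> f) \<tau> ?Es p)"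
   using br by (simp add: lie_form_def right_diff_distrib sum_subtractf sum_distrib_left sum.swap[of _ "{..<length es}"])
  then show ?thesis
   using L(2)[OF W(1,3) _ Esv] r by (simp add: lie_form_lift[OF ac W0(3)] sum_distrib_right mult.assoc)
 qed
 let ?vs = "at_point Ys p" and ?ws = "map (proj_along F V p) (at_point Ys p)"
 have vs: "length ?vs = ?r" "set ?vs \<subseteq> ?T" using Ys at_point_vector_fields by auto
 have wsV: "set ?ws \<subseteq> V p" using proj_tangent[OF ac] vs(2) by auto
 then have ws: "length ?ws = ?r" "set ?ws \<subseteq> ?T" using vs(1) V_sub_tangent[of p] by auto
 have d: "?vs ! i - ?ws ! i \<in> F p" if "i < ?r" for i
 proof -
  have i: "i < length ?vs" using that vs(1) by simp
  then have "?vs ! i \<in> ?T" using vs(2) nth_mem by blast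
  then show ?thesis using proj_complement[OF ac] by (simp only: nth_map[OF i])
 qed
 have "L ?vs = L ?ws" by (rule alternating_replace[OF L(1) subspace_tangent_space vs ws Lkill d])
 moreover have "\<tau> p ?vs = \<tau> p ?ws" by (rule alternating_replace[OF alt subspace_tangent_space vs ws kill d])
 moreover have "L ?ws * ?t p = L (at_point ?Es p) * \<tau> p ?ws"
  by (rule alternating_top_ratio[OF alternating_subset[OF L(1) V_sub_tangent] kforms_alternating[OF vol_kforms] sub_V frame_list_span[OF ac W0(3)] _ ws(1) wsV])
   (simp add: r)
 ultimately have "L ?vs * ?t p = (\<Sum>f\<in>set fs. ?x f p * leaf_div U \<phi> es \<tau> (lift U \<phi> f) p) * \<tau> p ?vs * ?t p"
  using LE by simp
 then have "L ?vs = (\<Sum>f\<in>set fs. ?x f p * leaf_div U \<phi> es \<tau> (lift U \<phi> f) p) * \<tau> p ?vs"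
  using frame_vol_nonzero[OF ac W0(3)] by (simp only: mult_cancel_right) simp
 then show ?thesis using L(2)[OF Ys] by simp
qed

end

end

context manifold
begin

lemma oneformsD:
 assumes "\<eta> \<in> oneforms A D"
 shows "linear_functional_on (D p) (\<eta> p)" "v \<notin> D p \<Longrightarrow> \<eta> p v = 0"
  "open W \<Longrightarrow> X \<in> sections A W D \<Longrightarrow> (\<lambda>p. \<eta> p (X p)) \<in> Cinf A W"
 using assms by (auto simp: oneforms_def)

lemma transverse_volume_formD:
 assumes "splits_tangent A F V" "regular_foliation A F" "regular_foliation A V" "transverse_volume_form A F \<sigma>"
 shows "\<sigma> \<in> kforms A TM (fol_rank V)"
  "length vs = fol_rank V \<Longrightarrow> set vs \<subseteq> TM p \<Longrightarrow> set vs \<inter> F p \<noteq> {} \<Longrightarrow> \<sigma> p vs = 0"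
  "nowhere_vanishing TM (fol_rank V) \<sigma>"
 using assms(4) fol_rank_complement[OF assms(1-3)] by (simp_all add: transverse_volume_form_def Let_def)

text \<open>A transverse form does not see components along \<open>F\<close>; projecting the
  arguments of a nonzero value makes them vertical without changing it.\<close>

lemma transverse_volume_form_leafwise:
 assumes sp: "splits_tangent A F V" "regular_foliation A F" "regular_foliation A V" and \<sigma>: "transverse_volume_form A F \<sigma>"
 shows "leafwise_volume_form A V \<sigma>" unfolding leafwise_volume_form_def nowhere_vanishing_def
proof (intro conjI allI)
 note T = transverse_volume_formD[OF sp \<sigma>]
 note pr = splits_tangent_proj[OF sp(1) _ regular_foliation_subspace[OF sp(2)] regular_foliation_subspace[OF sp(3)]]
 have VT: "V p \<subseteq> TM p" for p using regular_foliation_tangent[OF sp(3)] by auto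
 show "\<sigma> \<in> kforms A V (fol_rank V)" by (rule kforms_restrict[OF T(1) VT])
 fix p
 obtain vs where vs: "length vs = fol_rank V" "set vs \<subseteq> TM p" "\<sigma> p vs \<noteq> 0"
  using T(3) unfolding nowhere_vanishing_def by blast
 let ?ws = "map (proj_along F V p) vs"
 have wsV: "set ?ws \<subseteq> V p" using pr(1) vs(2) by auto
 have "\<sigma> p vs = \<sigma> p ?ws"
 proof (rule alternating_replace[OF kforms_alternating[OF T(1)] subspace_tangent_space vs(1,2) _ _ T(2)])
  show "vs ! i - ?ws ! i \<in> F p" if "i < fol_rank V" for i
  proof -
   have i: "i < length vs" using that vs(1) by simp
   then have "vs ! i \<in> TM p" using vs(2) nth_mem by blast
   from pr(2)[OF this] show ?thesis by (simp only: nth_map[OF i])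
  qed
 qed (use vs(1) wsV VT[of p] in auto)
 then show "\<exists>vs. length vs = fol_rank V \<and> set vs \<subseteq> V p \<and> \<sigma> p vs \<noteq> 0" using vs wsV by (intro exI[of _ ?ws]) auto
qed

end

context poisson_foliation
begin

lemma transverse_volume_form_exists: "transverse_volume_form A F ext_vol"
 unfolding transverse_volume_form_def Let_def fol_rank_complement[OF split_FV fol_F fol_V]
proof (intro conjI allI impI)
 show "ext_vol \<in> kforms A TM (fol_rank V)" by (rule ext_vol_kforms)
 fix p and vs :: "'m tangent list"
 assume vs: "length vs = fol_rank V" "set vs \<subseteq> TM p" "set vs \<inter> F p \<noteq> {}"
 obtain v where v: "v \<in> set vs" "v \<in> F p" using vs(3) by blast
 then obtain i where i: "i < length vs" "vs ! i = v" unfolding in_set_conv_nth by blast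
 let ?ws = "map (proj_along F V p) vs"
 have "v \<in> TM p" using v(1) vs(2) by blast
 then have "proj_along F V p v = 0" by (rule proj_along_complement[OF split_FV sub_F sub_V _ v(2)])
 then have "?ws ! i = 0" using i by simp
 then have "?ws = ?ws[i := 0]" by (metis list_update_id)
 moreover have "set ?ws \<subseteq> V p" using splits_tangent_proj(1)[OF split_FV _ sub_F sub_V] vs(2) by auto
 moreover have "i < fol_rank V" using i(1) vs(1) by simp
 ultimately have "\<tau> p ?ws = 0"
  using alternating_sum[OF kforms_alternating[OF vol_kforms] sub_V, of ?ws p i "{}"] vs(1) by simp
 then show "\<tau> p ?ws = 0" .
next
 show "nowhere_vanishing TM (fol_rank V) ext_vol" unfolding nowhere_vanishing_def
 proof
  fix p
  obtain vs where vs: "length vs = fol_rank V" "set vs \<subseteq> V p" "\<tau> p vs \<noteq> 0"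
   using vol unfolding leafwise_volume_form_def nowhere_vanishing_def by blast
  then show "\<exists>vs. length vs = fol_rank V \<and> set vs \<subseteq> TM p \<and> ext_vol p vs \<noteq> 0"
   using ext_vol_leaf[OF vs(2)] V_sub_tangent[of p] by (intro exI[of _ vs]) auto
 qed
qed

lemma constant_F_section:
 assumes ac: "adapted_chart V U \<phi> es fs" "q \<in> U" and v: "v \<in> F q"
 obtains X where "X \<in> sections A U F" "X q = v"
proof
 let ?X = "\<lambda>q. \<Sum>f\<in>set fs. v (coord \<phi> f) *\<^sub>R lift U \<phi> f q"
 have "?X \<in> \<XX> U"
  by (rule vector_fields_sum[OF acD(2)[OF ac(1)] lift_vector_field[OF ac(1)] Cinf_const])
 moreover have "?X q \<in> F q" if "q \<in> U" for q
  using that by (intro subspace_sum[OF sub_F] subspace_scale[OF sub_F] lift_F[OF ac(1)]) auto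
 ultimately show "?X \<in> sections A U F" unfolding sections_def by blast
 show "?X q = v" by (rule F_expand[OF ac v, symmetric])
qed

text \<open>In any chart the value on a vector of \<open>F\<close> is forced by
  \<open>lie_form_transverse\<close> evaluated on a leafwise frame. This gives uniqueness for
  \<open>THE\<close> and, at the same time, independence of the charts \<open>cU p\<close> picked to
  define \<eta>.\<close>

lemma reeb_form_transverse:
 assumes tr: "transverse_volume_form A F \<tau>"
 shows reeb_form_oneform: "reeb_form A F \<tau> \<in> oneforms A F"
  and reeb_form_apply: "adapted_chart V U \<phi> es fs \<Longrightarrow> q \<in> U \<Longrightarrow> v \<in> F q \<Longrightarrow>
   reeb_form A F \<tau> q v = (\<Sum>f\<in>set fs. v (coord \<phi> f) * leaf_div U \<phi> es \<tau> (lift U \<phi> f) q)"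
proof -
 note T = transverse_volume_formD[OF split_FV fol_F fol_V tr]
 note rk = fol_rank_complement[OF split_FV fol_F fol_V]
 let ?s = "\<lambda>U \<phi> es fs q v. \<Sum>f\<in>set fs. v (coord \<phi> f) * leaf_div U \<phi> es \<tau> (lift U \<phi> f) q"
 let ?prop = "\<lambda>\<eta>. \<eta> \<in> oneforms A F \<and>
   (\<forall>U X Ys. open U \<longrightarrow> X \<in> sections A U F \<longrightarrow> length Ys = DIM('e) - fol_rank F \<longrightarrow> set Ys \<subseteq> \<XX> U \<longrightarrow>
    (\<forall>p\<in>U. lie_form A X \<tau> Ys p = \<eta> p (X p) * \<tau> p (at_point Ys p)))"
 have "\<exists>U \<phi> es fs. adapted_chart V U \<phi> es fs \<and> p \<in> U" for p using adapted_chart_exists[OF fol_V] by metis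
 then obtain cU c\<phi> ce cf where c: "\<And>p. adapted_chart V (cU p) (c\<phi> p) (ce p) (cf p)" "\<And>p. p \<in> cU p" by metis
 define \<eta> where "\<eta> p v = (if v \<in> F p then ?s (cU p) (c\<phi> p) (ce p) (cf p) p v else 0)" for p v
 have lie: "lie_form A X \<tau> Ys p = \<eta> p (X p) * \<tau> p (at_point Ys p)"
  if "open U" "p \<in> U" "X \<in> sections A U F" "length Ys = fol_rank V" "set Ys \<subseteq> \<XX> U" for U X Ys p
 proof -
  have "X p \<in> F p" using that(2,3) by (simp add: sections_def)
  then show ?thesis
   unfolding \<eta>_def using lie_form_transverse[OF c(1) T(1,2) that(1,2) c(2) that(3) that(1,2,4,5)] by simp
 qed
 have chart: "\<eta>' q v = ?s U \<phi> es fs q v"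
  if ac: "adapted_chart V U \<phi> es fs" "q \<in> U" and v: "v \<in> F q"
   and p: "\<And>U X Ys. open U \<Longrightarrow> q \<in> U \<Longrightarrow> X \<in> sections A U F \<Longrightarrow> length Ys = fol_rank V \<Longrightarrow> set Ys \<subseteq> \<XX> U \<Longrightarrow>
    lie_form A X \<tau> Ys q = \<eta>' q (X q) * \<tau> q (at_point Ys q)" for U \<phi> es fs q v \<eta>'
 proof -
  obtain X where X: "X \<in> sections A U F" "X q = v" by (rule constant_F_section[OF ac v])
  let ?Es = "map (coord_field U \<phi>) es"
  have Es: "length ?Es = fol_rank V" "set ?Es \<subseteq> \<XX> U"
   using chart_rank[OF ac] frame_vector_field[OF ac(1)] by auto
  note U = acD(2)[OF ac(1)]
  have "\<eta>' q v * \<tau> q (at_point ?Es q) = ?s U \<phi> es fs q v * \<tau> q (at_point ?Es q)"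
   using trans[OF p[OF U ac(2) X(1) Es, symmetric] lie_form_transverse[OF ac(1) T(1,2) U ac(2) ac(2) X(1) U ac(2) Es]]
   unfolding X(2) .
  then show ?thesis using frame_vol_nonzero[OF ac] by (simp only: mult_cancel_right) simp
 qed
 have "\<eta> \<in> oneforms A F" unfolding oneforms_def
 proof (intro CollectI conjI allI impI)
  fix p
  show "linear_functional_on (F p) (\<eta> p)" unfolding linear_functional_on_def
  proof (intro ballI allI)
   fix u v and a b :: real assume uv: "u \<in> F p" "v \<in> F p"
   have "a *\<^sub>R u + b *\<^sub>R v \<in> F p" using uv by (intro subspace_add[OF sub_F] subspace_scale[OF sub_F])
   then show "\<eta> p (a *\<^sub>R u + b *\<^sub>R v) = a * \<eta> p u + b * \<eta> p v"
    unfolding \<eta>_def using uv by (simp add: sum.distrib sum_distrib_left distrib_right mult.assoc)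
  qed
 next
  fix p v assume "v \<notin> F p" then show "\<eta> p v = 0" by (simp add: \<eta>_def)
 next
  fix W X assume W: "open W" "X \<in> sections A W F"
  show "(\<lambda>p. \<eta> p (X p)) \<in> Cinf A W"
  proof (rule Cinf_local[OF W(1)])
   fix p assume p: "p \<in> W"
   note ac = c(1)[of p] and U = acD(2)[OF c(1), of p]
   let ?N = "W \<inter> cU p"
   have N: "open ?N" "p \<in> ?N" "?N \<subseteq> cU p" using W(1) U p c(2) by auto
   have Xv: "X \<in> \<XX> ?N" using W(2) vector_fields_mono[of X W ?N] by (simp add: sections_def)
   have "(\<lambda>q. ?s (cU p) (c\<phi> p) (ce p) (cf p) q (X q)) \<in> Cinf A ?N"
    by (intro Cinf_sum[OF N(1)] Cinf_mult[OF N(1)] Cinf_mono[OF leaf_div_smooth[OF ac U order.refl lift_vector_field[OF ac]] N(3)]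
      vector_field_smooth[OF Xv N(1) order.refl Cinf_mono[OF coordinate_smooth[OF ac] N(3)]])
   then have "(\<lambda>q. \<eta> q (X q)) \<in> Cinf A ?N"
   proof (rule Cinf_transform[OF _ N(1)])
    fix q assume q: "q \<in> ?N"
    then have "X q \<in> F q" "q \<in> cU p" using W(2) by (auto simp: sections_def)
    from chart[where \<eta>' = \<eta>, OF ac this(2,1) lie] show "?s (cU p) (c\<phi> p) (ce p) (cf p) q (X q) = \<eta> q (X q)" by simp
   qed
   then show "\<exists>V. open V \<and> p \<in> V \<and> (\<lambda>p. \<eta> p (X p)) \<in> Cinf A V" using N by blast
  qed
 qed
 then have \<eta>: "?prop \<eta>" unfolding rk using lie by blast
 have "reeb_form A F \<tau> = \<eta>" unfolding reeb_form_def
 proof (rule the_equality)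
  show "?prop \<eta>" by (rule \<eta>)
  fix \<eta>' assume \<eta>': "?prop \<eta>'"
  show "\<eta>' = \<eta>"
  proof (intro ext)
   fix p v
   show "\<eta>' p v = \<eta> p v"
   proof (cases "v \<in> F p")
    case True
    show ?thesis using chart[OF c(1) c(2) True, of \<eta>'] \<eta>' True unfolding rk \<eta>_def by simp
   next
    case False
    then show ?thesis using oneformsD(2)[OF conjunct1[OF \<eta>'] False] by (simp add: \<eta>_def)
   qed
  qed
 qed
 then show "reeb_form A F \<tau> \<in> oneforms A F" using \<eta> by simp
 show "reeb_form A F \<tau> q v = ?s U \<phi> es fs q v" if "adapted_chart V U \<phi> es fs" "q \<in> U" "v \<in> F q"
  using chart[where \<eta>' = \<eta>, OF that lie] \<open>reeb_form A F \<tau> = \<eta>\<close> by simp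
qed

text \<open>The form enters \<open>leaf_div\<close> only through the logarithm of its density, which
  is shifted by ln a.\<close>

lemma leaf_div_rescale:
 assumes ac: "adapted_chart V U \<phi> es fs" and q: "q \<in> U" and X: "X q \<in> TM q"
  and a: "a \<in> Cinf A UNIV" "a q \<noteq> 0"
  and \<sigma>: "\<And>p vs. length vs = fol_rank V \<Longrightarrow> set vs \<subseteq> V p \<Longrightarrow> \<sigma> p vs = a p * \<tau> p vs"
 shows "leaf_div U \<phi> es \<sigma> X q = leaf_div U \<phi> es \<tau> X q + X q (\<lambda>q. ln (a q))"
proof -
 let ?Es = "map (coord_field U \<phi>) es"
 let ?t = "\<lambda>q. \<tau> q (at_point ?Es q)"
 have eq: "\<sigma> q (at_point ?Es q) = a q * ?t q" if "q \<in> U" for q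
  by (rule \<sigma>[OF _ frame_list_mem[OF ac that]]) (simp add: chart_rank[OF ac that])
 have t: "smooth_at A q ?t" "?t q \<noteq> 0"
  using smooth_atI[OF acD(2)[OF ac] q frame_vol_smooth[OF ac]] frame_vol_nonzero[OF ac q] by auto
 have as: "smooth_at A q a" by (rule smooth_atI[OF open_UNIV UNIV_I a(1)])
 have at: "smooth_at A q (\<lambda>q. a q * ?t q)" by (rule smooth_at_mult[OF as t(1)])
 have "smooth_at A q (\<lambda>q. \<sigma> q (at_point ?Es q))"
  by (rule smooth_at_cong[OF at acD(2)[OF ac] q]) (simp add: eq)
 from tangent_apply_ln[OF X this] have "X q (\<lambda>q. ln (\<sigma> q (at_point ?Es q))) = X q (\<lambda>q. \<sigma> q (at_point ?Es q)) / (a q * ?t q)"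
  using eq[OF q] a(2) t(2) by simp
 also have "X q (\<lambda>q. \<sigma> q (at_point ?Es q)) = X q (\<lambda>q. a q * ?t q)" by (rule tangent_cong[OF X acD(2)[OF ac] q eq])
 also have "\<dots> = a q * X q ?t + ?t q * X q a" by (rule tangent_mult[OF X as t(1)])
 finally have "X q (\<lambda>q. ln (\<sigma> q (at_point ?Es q))) = X q (\<lambda>q. ln (?t q)) + X q (\<lambda>q. ln (a q))"
  unfolding tangent_apply_ln[OF X t] tangent_apply_ln[OF X as a(2)] using a(2) t(2) by (simp add: field_simps)
 then show ?thesis by (simp add: leaf_div_def)
qed

end

context manifold
begin

lemma leaf_div_cong:
 assumes ac: "adapted_chart D U \<phi> es fs" and W: "open W" "W \<subseteq> U" "q \<in> W" and eq: "\<And>q. q \<in> W \<Longrightarrow> X q = Y q"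
 shows "leaf_div U \<phi> es \<omega> X q = leaf_div U \<phi> es \<omega> Y q"
proof -
 have q: "q \<in> U" using W by auto
 have "coord_field U \<phi> e q (\<lambda>q. X q (coord \<phi> e)) = coord_field U \<phi> e q (\<lambda>q. Y q (coord \<phi> e))" for e
  by (rule tangent_cong[OF frame_tangent[OF ac q] W(1,3)]) (simp add: eq)
 then show ?thesis by (simp add: leaf_div_def eq[OF W(3)])
qed

end

section \<open>Strongly compatible coupling structures\<close>

locale flat_coupling = coupling_structure A V P B + poisson_foliation A V F P \<tau>
 for A :: "('m::t2_space, 'e::euclidean_space) chart set" and V P B F \<tau> +
 fixes \<mu> :: "'m oneform"
 assumes flat: "\<And>U Z. open U \<Longrightarrow> Z \<in> sections A U F \<Longrightarrow> Z \<in> projectable_fields A U V \<Longrightarrow> preserves_bivector A U Z P"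
  and \<mu>: "\<mu> \<in> annihilating_oneforms A V"
  and compatible: "\<And>U X p. open U \<Longrightarrow> X \<in> projectable_fields A U V \<Longrightarrow> p \<in> U \<Longrightarrow>
   proj_along F V p (X p) - proj_along H V p (X p) = sharp A P p (differential (\<lambda>q. \<mu> q (X q)))"
begin

lemma ham_P_leaf: "ham P g q \<in> V q"
 by (rule ham_field_mem[OF leaf_P sub_V V_sub_tangent])

lemma ham_P_tangent: "ham P g q \<in> TM q"
 using ham_P_leaf V_sub_tangent by blast

lemma ham_horizontal: "ham B g q - ham P g q \<in> H q"
proof -
 let ?D = "\<lambda>p \<alpha> \<beta>. B p \<alpha> \<beta> - P p \<alpha> \<beta>"
 have "?D q \<in> wedge2 A q (H q)" using vertical by (simp add: vertical_part_def)
 then obtain ps where "decomposes A q (H q) (?D q) ps" unfolding wedge2_def by blast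
 from sharp_mem[where B = ?D and p = q, OF this H_tangent subspace_H differential_cotangent]
 have "sharp A ?D q (differential g) \<in> H q" .
 moreover have "sharp A ?D q (differential g) = ham B g q - ham P g q"
  by (rule ext) (simp add: sharp_def ham_field_def)
 ultimately show ?thesis by simp
qed

context
 fixes U \<phi> es fs
 assumes ac: "adapted_chart V U \<phi> es fs"
begin

lemma projectable_constant:
 assumes "X \<in> \<XX> U" "\<And>q f. q \<in> U \<Longrightarrow> f \<in> set fs \<Longrightarrow> X q (coord \<phi> f) = c f"
 shows "X \<in> projectable_fields A U V" unfolding projectable_fields_def
proof (intro CollectI conjI ballI)
 fix Y assume Y: "Y \<in> sections A U V"
 then have "Y \<in> \<XX> U" by (simp add: sections_def)
 from lie_bracket_vector_field[OF assms(1) this acD(2)[OF ac]]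
 show "bracket X Y \<in> sections A U V"
  using constant_coordinate_bracket[OF ac acD(2)[OF ac] order.refl _ assms(1) Y assms(2)] by (simp add: sections_def)
qed (rule assms(1))

lemma frame_projectable: "coord_field U \<phi> f \<in> projectable_fields A U V"
 by (rule projectable_constant[OF frame_vector_field[OF ac] frame_coordinate[OF ac]])

lemma lift_projectable: "lift U \<phi> f \<in> projectable_fields A U V"
 by (rule projectable_constant[OF lift_vector_field[OF ac] lift_coordinate[OF ac]])

text \<open>Here the invariance of \<open>P\<close> under projectable sections of \<open>F\<close>
  enters the argument.\<close>

lemma lift_pbracket:
 assumes W: "open W" "W \<subseteq> U" "q \<in> W" and g: "g \<in> Cinf A W" and h: "h \<in> Cinf A W"
 shows "lift U \<phi> f q (pbracket P g h) = pbracket P (\<lambda>q. lift U \<phi> f q g) h q + pbracket P g (\<lambda>q. lift U \<phi> f q h) q"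
proof -
 have "lie_bivector (lift U \<phi> f) P g h q = 0"
  using flat[OF acD(2)[OF ac] lift_section[OF ac] lift_projectable] W g h unfolding preserves_bivector_def by blast
 then show ?thesis by (simp add: lie_bivector_def)
qed

lemma lift_ham:
 assumes W: "open W" "W \<subseteq> U" "q \<in> W" and g: "g \<in> Cinf A W"
 shows "bracket (lift U \<phi> f) (ham P g) q = ham P (\<lambda>q. lift U \<phi> f q g) q"
proof
 fix h
 show "bracket (lift U \<phi> f) (ham P g) q h = ham P (\<lambda>q. lift U \<phi> f q g) q h"
 proof (cases "smooth_at A q h")
  case False
  then show ?thesis by (simp add: lie_bracket_def ham_field_def sharp_def)
 next
  case True
  obtain N where N: "open N" "q \<in> N" "N \<subseteq> W" "h \<in> Cinf A N" using smooth_atE[OF True W(1,3)] .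
  have NU: "N \<subseteq> U" using N(3) W(2) by blast
  have Lv: "lift U \<phi> f \<in> \<XX> N" by (rule vector_fields_mono[OF lift_vector_field[OF ac] NU])
  have "lift U \<phi> f q (\<lambda>q. ham P g q h) = lift U \<phi> f q (pbracket P g h)"
   by (rule tangent_cong[OF vector_field_tangent[OF Lv N(2)] N(1,2)])
    (rule ham_field_apply[OF smooth_atI[OF N(1) _ N(4)]])
  also have "\<dots> = pbracket P (\<lambda>q. lift U \<phi> f q g) h q + pbracket P g (\<lambda>q. lift U \<phi> f q h) q"
   by (rule lift_pbracket[OF N(1) NU N(2) Cinf_mono[OF g N(3)] N(4)])
  finally show ?thesis unfolding lie_bracket_apply[OF True] ham_field_apply[OF True]
    ham_field_apply[OF smooth_at_vector_field[OF Lv N(1,2) True]] by simp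
 qed
qed

definition hlift :: "'e \<Rightarrow> 'm vfield" where
 "hlift f q = lift U \<phi> f q + ham P (\<lambda>q. \<mu> q (coord_field U \<phi> f q)) q"

lemma \<mu>_smooth: "(\<lambda>q. \<mu> q (coord_field U \<phi> f q)) \<in> Cinf A U"
proof -
 have "\<mu> \<in> oneforms A TM" using \<mu> by (simp add: annihilating_oneforms_def)
 from oneformsD(3)[OF this acD(2)[OF ac], of "coord_field U \<phi> f"] frame_vector_field[OF ac] show ?thesis
  by (simp add: sections_total)
qed

text \<open>Strong compatibility, applied to the coordinate field, exchanges the projection along
  \<open>F\<close> for the one along \<open>H\<close>. The lift is thus smooth by its formula and
  horizontal by this lemma.\<close>

lemma hlift_H:
 assumes q: "q \<in> U"
 shows "hlift f q \<in> H q"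
proof -
 let ?e = "coord_field U \<phi> f q"
 have "proj_along F V q ?e - proj_along H V q ?e = ham P (\<lambda>q. \<mu> q (coord_field U \<phi> f q)) q"
  unfolding ham_field_def by (rule compatible[OF acD(2)[OF ac] frame_projectable q])
 then have "hlift f q = (?e - proj_along F V q ?e) + (proj_along F V q ?e - proj_along H V q ?e)"
  by (simp only: hlift_def lift_def)
 also have "\<dots> = ?e - proj_along H V q ?e" by (rule ext) simp
 finally have "hlift f q = ?e - proj_along H V q ?e" .
 then show ?thesis
  using splits_tangent_proj(2)[OF splits frame_tangent[OF ac q] subspace_H subspace_V] by simp
qed

lemma hlift_coordinate: "q \<in> U \<Longrightarrow> f' \<in> set fs \<Longrightarrow> hlift f q (coord \<phi> f') = f \<bullet> f'"
 using lift_coordinate[OF ac] leaf_coordinate[OF ac _ ham_P_leaf] by (simp add: hlift_def)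

lemma hlift_vector_field: "hlift f \<in> \<XX> U"
proof (rule vector_fields_cong[OF acD(2)[OF ac] vector_fields_add[OF acD(2)[OF ac] lift_vector_field[OF ac]]])
 show "ham P (\<lambda>q. \<mu> q (coord_field U \<phi> f q)) \<in> \<XX> U"
  by (rule ham_field_vector_field[OF Pb acD(2)[OF ac] \<mu>_smooth])
qed (rule hlift_def[symmetric])

text \<open>\<open>B - P\<close> is horizontal, so \<open>ham P g\<close> is the vertical part of
  \<open>ham B g\<close>; the rest lies in \<open>H\<close> and is determined there by its
  transverse coordinates.\<close>

lemma ham_expand:
 assumes q: "q \<in> U"
 shows "ham B g q = (\<Sum>f\<in>set fs. ham B g q (coord \<phi> f) *\<^sub>R hlift f q) + ham P g q"
proof -
 have "ham B g q - ham P g q = (\<Sum>f\<in>set fs. ham B g q (coord \<phi> f) *\<^sub>R hlift f q)"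
  by (rule transverse_expand[OF ac q ham_field_tangent[OF Bb] subspace_H H_tangent splits_tangent_Int[OF splits] ham_horizontal ham_P_leaf
    hlift_H[OF q] hlift_coordinate[OF q]])
 then show ?thesis by (simp only: diff_eq_eq)
qed

lemma ham_expand_apply:
 "q \<in> U \<Longrightarrow> ham B g q h = (\<Sum>f\<in>set fs. ham B g q (coord \<phi> f) * hlift f q h) + ham P g q h"
 using fun_cong[OF ham_expand, of q g h] unfolding plus_fun_apply sum_fun_apply by simp

lemma divergence_ham:
 assumes \<Omega>: "volume_form A \<Omega>" and \<kappa>: "\<kappa> \<in> Cinf A UNIV" "\<And>p. \<kappa> p \<noteq> 0"
  and K: "\<And>p vs. length vs = fol_rank V \<Longrightarrow> set vs \<subseteq> V p \<Longrightarrow> K \<Omega> p vs = \<kappa> p * \<tau> p vs"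
  and q: "q \<in> U" and g0: "smooth_at A q g"
 shows "divergence A \<Omega> (ham B g) q = ham B g q (\<lambda>q. ln (\<kappa> q))
  + (\<Sum>f\<in>set fs. ham B g q (coord \<phi> f) * leaf_div U \<phi> es \<tau> (hlift f) q) + leaf_div U \<phi> es \<tau> (ham P g) q"
proof -
 obtain W where W: "open W" "q \<in> W" "W \<subseteq> U" and g: "g \<in> Cinf A W" using smooth_atE[OF g0 acD(2)[OF ac] q] .
 let ?X = "ham B g" and ?E = "coord_field U \<phi>" and ?Es = "map (coord_field U \<phi>) es"
 let ?Q = "ham P g" and ?t = "\<lambda>q. \<tau> q (frame_at U \<phi> es q)"
 let ?L = "\<lambda>q. ln (\<tau> q (frame_at U \<phi> es q))"
 let ?c = "\<lambda>f q. ham B g q (coord \<phi> f)" and ?y = "\<lambda>e q. \<phi> q \<bullet> e"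
 have Xv: "?X \<in> \<XX> W" by (rule ham_field_vector_field[OF Bb W(1) g])
 have Qv: "?Q \<in> \<XX> W" by (rule ham_field_vector_field[OF Pb W(1) g])
 have hv: "hlift f \<in> \<XX> W" for f by (rule vector_fields_mono[OF hlift_vector_field W(3)])
 have Ev: "?E e \<in> \<XX> W" for e by (rule vector_fields_mono[OF frame_vector_field[OF ac] W(3)])
 have Es: "?E e \<in> sections A W V" if "e \<in> set es" for e by (rule sections_mono[OF frame_section[OF ac that] W(3)])
 have c: "?c f \<in> Cinf A W" for f
  by (rule vector_field_smooth[OF Xv W(1) order.refl Cinf_mono[OF coordinate_smooth[OF ac] W(3)]])
 note Xt = vector_field_tangent[OF Xv W(2)]
 note r = chart_rank[OF ac q]
 have \<Omega>k: "\<Omega> \<in> kforms A TM DIM('e)" using \<Omega> by (simp add: volume_form_def)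
 note altK = kforms_alternating[OF K_kforms[OF \<Omega>k], of q]
 have EsV: "set (at_point ?Es q) \<subseteq> V q" by (rule frame_list_mem[OF ac q])
 then have EsT: "set (at_point ?Es q) \<subseteq> TM q" using V_sub_tangent[of q] by blast
 have KE: "K \<Omega> q (at_point ?Es q) = \<kappa> q * ?t q" if "q \<in> U" for q
  by (rule K[OF _ frame_list_mem[OF ac that]]) (simp add: chart_rank[OF ac that])
 \<comment> \<open>The \<open>e\<close>-th diagonal coefficient of the vertical part of the bracket;
   its sum over \<open>e\<close> will be the trace in \<open>leaf_div\<close>, up to sign.\<close>
 define d where "d e = (\<Sum>f\<in>set fs. ?c f q * - ?E e q (\<lambda>q. hlift f q (?y e))) - ?E e q (\<lambda>q. ?Q q (?y e))" for e
 have slot: "K \<Omega> q ((at_point ?Es q)[i := bracket ?X (?Es ! i) q]) = d (es ! i) * (\<kappa> q * ?t q)" if i: "i < length es" for i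
 proof -
  let ?e = "es ! i"
  have e: "?e \<in> set es" using i by simp
  let ?w = "(\<Sum>f\<in>set fs. ?c f q *\<^sub>R bracket (hlift f) (?E ?e) q) + bracket ?Q (?E ?e) q"
  let ?h = "\<Sum>f\<in>set fs. (- ?E ?e q (?c f)) *\<^sub>R hlift f q"
  have Sv: "(\<lambda>q. \<Sum>f\<in>set fs. ?c f q *\<^sub>R hlift f q) \<in> \<XX> W" by (rule vector_fields_sum[OF W(1) hv c])
  have "bracket (?E ?e) ?X q = bracket (?E ?e) (\<lambda>q. (\<Sum>f\<in>set fs. ?c f q *\<^sub>R hlift f q) + ?Q q) q"
   by (rule lie_bracket_cong[OF Ev Xv W(1,2) refl ham_expand]) (use W(3) in auto)
  also have "\<dots> = bracket (?E ?e) (\<lambda>q. \<Sum>f\<in>set fs. ?c f q *\<^sub>R hlift f q) q + bracket (?E ?e) ?Q q"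
   by (rule lie_bracket_add[OF Ev Sv Qv W(1,2)])
  also have "bracket (?E ?e) (\<lambda>q. \<Sum>f\<in>set fs. ?c f q *\<^sub>R hlift f q) q
    = (\<Sum>f\<in>set fs. ?c f q *\<^sub>R bracket (?E ?e) (hlift f) q + ?E ?e q (?c f) *\<^sub>R hlift f q)"
   by (rule lie_bracket_sum[OF Ev hv c W(1,2)])
  finally have b: "bracket (?E ?e) ?X q = (\<Sum>f\<in>set fs. ?c f q *\<^sub>R bracket (?E ?e) (hlift f) q + ?E ?e q (?c f) *\<^sub>R hlift f q)
   + bracket (?E ?e) ?Q q" .
  \<comment> \<open>Differentiating the coefficients of the horizontal lifts gives multiples of
    these lifts only: they are collected in \<open>?h\<close>, which
    \<open>K_horizontal_zero\<close> removes, while \<open>?w\<close> is vertical.\<close>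
  have br: "bracket ?X (?E ?e) q = 1 *\<^sub>R ?w + 1 *\<^sub>R ?h"
  proof
   fix k
   have "bracket ?X (?E ?e) q k = - bracket (?E ?e) ?X q k"
    using fun_cong[OF lie_bracket_skew[of ?X "?E ?e" q], of k] by simp
   moreover have "bracket (?E ?e) ?X q k = (\<Sum>f\<in>set fs. ?c f q * bracket (?E ?e) (hlift f) q k + ?E ?e q (?c f) * hlift f q k)
    + bracket (?E ?e) ?Q q k" unfolding b plus_fun_apply sum_fun_apply by simp
   moreover have "bracket (hlift f) (?E ?e) q k = - bracket (?E ?e) (hlift f) q k" for f
    using fun_cong[OF lie_bracket_skew[of "hlift f" "?E ?e" q], of k] by simp
   moreover have "bracket ?Q (?E ?e) q k = - bracket (?E ?e) ?Q q k"
    using fun_cong[OF lie_bracket_skew[of ?Q "?E ?e" q], of k] by simp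
   ultimately show "bracket ?X (?E ?e) q k = (1 *\<^sub>R ?w + 1 *\<^sub>R ?h) k"
    unfolding plus_fun_apply scaleR_fun_apply sum_fun_apply by (simp add: sum.distrib sum_negf)
  qed
  have hb: "bracket (hlift f) (?E ?e) q \<in> V q" for f
   by (rule constant_coordinate_bracket[OF ac W(1,3,2) hv Es[OF e] hlift_coordinate]) (use W(3) in auto)
  have Qb: "bracket ?Q (?E ?e) q \<in> V q"
  proof (rule constant_coordinate_bracket[OF ac W(1,3,2) Qv Es[OF e]])
   show "?Q q' (coord \<phi> f) = 0" if "q' \<in> W" "f \<in> set fs" for q' f
    using leaf_coordinate[OF ac _ ham_P_leaf that(2)] that(1) W(3) by auto
  qed
  have wV: "?w \<in> V q" by (intro subspace_add[OF sub_V] subspace_sum[OF sub_V] subspace_scale[OF sub_V] hb Qb)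
  have hH: "?h \<in> H q" by (intro subspace_sum[OF subspace_H] subspace_scale[OF subspace_H] hlift_H[OF q])
  have "K \<Omega> q ((at_point ?Es q)[i := bracket ?X (?E ?e) q])
   = 1 * K \<Omega> q ((at_point ?Es q)[i := ?w]) + 1 * K \<Omega> q ((at_point ?Es q)[i := ?h])"
   unfolding br by (rule alternating_linear[OF altK _ EsT]) (use r i wV hH V_sub_tangent[of q] H_tangent[of q] in auto)
  also have "K \<Omega> q ((at_point ?Es q)[i := ?h]) = 0"
   by (rule K_horizontal_zero[where \<Omega> = \<Omega> and p = q, OF kforms_alternating[OF \<Omega>k] _ EsV _ hH]) (use r i in auto)
  also have "K \<Omega> q ((at_point ?Es q)[i := ?w]) = \<kappa> q * \<tau> q ((at_point ?Es q)[i := ?w])"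
   by (rule K[OF _ set_update_subset[OF EsV wV]]) (simp add: r)
  also have "\<tau> q ((at_point ?Es q)[i := ?w]) = ?w (?y ?e) * ?t q" by (rule frame_slot[OF ac q alt_vol[OF ac q] wV i])
  also have "?w (?y ?e) = d ?e"
  proof -
   have "?w (?y ?e) = (\<Sum>f\<in>set fs. ?c f q * bracket (hlift f) (?E ?e) q (?y ?e)) + bracket ?Q (?E ?e) q (?y ?e)"
    unfolding plus_fun_apply sum_fun_apply by simp
   then show ?thesis
    unfolding d_def bracket_coordinate[OF ac W(1,3,2) hv] bracket_coordinate[OF ac W(1,3,2) Qv] by simp
  qed
  finally show ?thesis using i by simp
 qed
 have nz: "\<kappa> q * ?t q \<noteq> 0" using \<kappa>(2) frame_vol_nonzero[OF ac q] by simp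
 have \<kappa>s: "smooth_at A q \<kappa>" by (rule smooth_atI[OF open_UNIV UNIV_I \<kappa>(1)])
 have ts: "smooth_at A q ?t" by (rule smooth_atI[OF acD(2)[OF ac] q frame_vol_smooth[OF ac]])
 have "?X q (\<lambda>q. K \<Omega> q (at_point ?Es q)) = ?X q (\<lambda>q. \<kappa> q * ?t q)" by (rule tangent_cong[OF Xt acD(2)[OF ac] q KE])
 also have "\<dots> = \<kappa> q * ?X q ?t + ?t q * ?X q \<kappa>" by (rule tangent_mult[OF Xt \<kappa>s ts])
 also have "\<dots> = (?X q (\<lambda>q. ln (\<kappa> q)) + ?X q ?L) * (\<kappa> q * ?t q)"
  unfolding tangent_apply_ln[OF Xt \<kappa>s \<kappa>(2)] tangent_apply_ln[OF Xt ts frame_vol_nonzero[OF ac q]]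
  using \<kappa>(2)[of q] frame_vol_nonzero[OF ac q] by (simp add: field_simps)
 finally have d1: "?X q (\<lambda>q. K \<Omega> q (at_point ?Es q)) = (?X q (\<lambda>q. ln (\<kappa> q)) + ?X q ?L) * (\<kappa> q * ?t q)" .
 have "(\<Sum>i<length es. d (es ! i)) = (\<Sum>e\<in>set es. d e)"
 proof -
  have "distinct es" using acD(3)[OF ac] by simp
  then have "bij_betw ((!) es) {..<length es} (set es)" by (rule bij_betw_nth) auto
  then show ?thesis by (rule sum.reindex_bij_betw)
 qed
 then have d2: "(\<Sum>i<length ?Es. K \<Omega> q ((at_point ?Es q)[i := bracket ?X (?Es ! i) q])) = (\<Sum>e\<in>set es. d e) * (\<kappa> q * ?t q)"
  using slot by (simp add: sum_distrib_right[symmetric])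
 have lf: "lie_form A ?X (K \<Omega>) ?Es q = divergence A \<Omega> ?X q * K \<Omega> q (at_point ?Es q)"
  by (rule lie_form_K[OF \<Omega> W(1,2) g acD(2)[OF ac] q]) (use r frame_vector_field[OF ac] in auto)
 have "divergence A \<Omega> ?X q * (\<kappa> q * ?t q) = (?X q (\<lambda>q. ln (\<kappa> q)) + ?X q ?L - (\<Sum>e\<in>set es. d e)) * (\<kappa> q * ?t q)"
  unfolding KE[OF q, symmetric] lf[symmetric] unfolding lie_form_def d1 d2 KE[OF q] by (simp only: left_diff_distrib)
 then have div: "divergence A \<Omega> ?X q = ?X q (\<lambda>q. ln (\<kappa> q)) + ?X q ?L - (\<Sum>e\<in>set es. d e)"
  using nz by (simp only: mult_cancel_right) simp
 have "(\<Sum>e\<in>set es. d e) = - (\<Sum>f\<in>set fs. ?c f q * (\<Sum>e\<in>set es. ?E e q (\<lambda>q. hlift f q (?y e)))) - (\<Sum>e\<in>set es. ?E e q (\<lambda>q. ?Q q (?y e)))"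
  unfolding d_def sum_subtractf sum_distrib_left sum_negf[symmetric]
  by (subst sum.swap) (simp add: sum_negf)
 then show ?thesis
  unfolding div ham_expand_apply[OF q, of g ?L] by (simp add: leaf_div_def distrib_left sum.distrib)
qed

lemma leaf_div_hlift:
 assumes q: "q \<in> U"
 shows "leaf_div U \<phi> es \<tau> (hlift f) q = leaf_div U \<phi> es \<tau> (lift U \<phi> f) q + local_modular U \<phi> es q (\<lambda>q. \<mu> q (coord_field U \<phi> f q))"
proof -
 note U = acD(2)[OF ac]
 have "leaf_div U \<phi> es \<tau> (hlift f) q
  = leaf_div U \<phi> es \<tau> (\<lambda>q. lift U \<phi> f q + ham P (\<lambda>q. \<mu> q (coord_field U \<phi> f q)) q) q"
  by (rule leaf_div_cong[OF ac U order.refl q hlift_def])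
 also have "\<dots> = leaf_div U \<phi> es \<tau> (lift U \<phi> f) q + leaf_div U \<phi> es \<tau> (ham P (\<lambda>q. \<mu> q (coord_field U \<phi> f q))) q"
  by (rule leaf_div_add[OF ac U order.refl q lift_vector_field[OF ac] ham_field_vector_field[OF Pb U \<mu>_smooth]])
 finally show ?thesis unfolding local_modular_apply[OF ac q smooth_atI[OF U q \<mu>_smooth]] .
qed

text \<open>\<open>B\<^sup>\<sharp>\<close> is injective on the annihilator of \<open>V\<close>.\<close>

lemma transverse_ham_independent:
 assumes q: "q \<in> U" and z: "\<And>g. smooth_at A q g \<Longrightarrow> (\<Sum>f\<in>set fs. d f * ham B g q (coord \<phi> f)) = 0" and f: "f \<in> set fs"
 shows "d f = 0"
proof -
 obtain ps where ps: "decomposes A q (TM q) (B q) ps" by (rule bivector_decomposes[OF Bb])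
 obtain \<alpha> where \<alpha>: "hlift f q = sharp A B q \<alpha>" "\<alpha> \<in> cotangent_space A q"
  using hlift_H[OF q, of f] unfolding horizontal_def by blast
 let ?x = "\<lambda>f q. \<phi> q \<bullet> f"
 have sm: "smooth_at A q (?x f)" for f by (rule coordinate_smooth_at[OF ac q])
 \<comment> \<open>By skewness the hypothesis says that this combination of Hamiltonian fields kills
   every function. Pairing it with the covector that produces \<open>hlift f\<close> isolates
   \<open>d f\<close>.\<close>
 let ?s = "\<Sum>f\<in>set fs. d f *\<^sub>R ham B (?x f) q"
 have "?s = 0"
 proof (rule ext)
  fix g
  show "?s g = 0 g"
  proof (cases "smooth_at A q g")
   case True
   have "?s g = - (\<Sum>f\<in>set fs. d f * ham B g q (?x f))" unfolding sum_fun_apply sum_negf[symmetric]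
    by (rule sum.cong[OF refl]) (simp add: ham_field_skew[OF Bb sm True])
   then show ?thesis using z[OF True] by simp
  next
   case False
   then show ?thesis unfolding sum_fun_apply by (simp add: ham_field_def sharp_def)
  qed
 qed
 moreover have "\<alpha> ?s = - d f"
 proof -
  note lin = linear_functional_onD[OF cotangentD[OF \<alpha>(2)] subspace_tangent_space]
  note ht = ham_field_tangent[OF Bb]
  have \<alpha>s: "\<alpha> (\<Sum>f\<in>I. d f *\<^sub>R ham B (?x f) q) = (\<Sum>f\<in>I. d f * \<alpha> (ham B (?x f) q))" if "finite I" for I
   using that
  proof (induction I)
   case empty
   show ?case unfolding sum.empty by (rule lin(4))
  next
   case (insert i I)
   have "(\<Sum>f\<in>I. d f *\<^sub>R ham B (?x f) q) \<in> TM q"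
    by (intro subspace_sum[OF subspace_tangent_space] subspace_scale[OF subspace_tangent_space] ht)
   then show ?case unfolding sum.insert[OF insert.hyps] insert.IH[symmetric]
    by (subst lin(1)) (simp_all add: lin(2) ht subspace_scale[OF subspace_tangent_space])
  qed
  have "\<alpha> (ham B (?x f') q) = - (f \<bullet> f')" if f': "f' \<in> set fs" for f'
  proof -
   have "\<alpha> (ham B (?x f') q) = B q (differential (?x f')) \<alpha>"
    unfolding ham_field_def by (rule sharp_pairing[where B = B and p = q, OF ps order.refl differential_cotangent \<alpha>(2)])
   also have "\<dots> = - B q \<alpha> (differential (?x f'))" by (rule bivector_skew[where B = B and p = q, OF Bb differential_cotangent \<alpha>(2)])
   also have "B q \<alpha> (differential (?x f')) = hlift f q (?x f')" unfolding \<alpha>(1) by (simp add: sharp_def sm)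
   finally show ?thesis using hlift_coordinate[OF q f'] by simp
  qed
  then have "\<alpha> ?s = (\<Sum>f'\<in>set fs. if f' = f then - d f' else 0)"
   unfolding \<alpha>s[OF finite_set] by (intro sum.cong refl) (auto simp: fs_inner[OF ac f])
  then show ?thesis using f by simp
 qed
 moreover have "\<alpha> 0 = 0" by (rule linear_functional_onD(4)[OF cotangentD[OF \<alpha>(2)] subspace_tangent_space])
 ultimately show ?thesis by simp
qed

lemma divergence_ham_exact_iff:
 assumes \<Omega>: "volume_form A \<Omega>" and \<kappa>: "\<kappa> \<in> Cinf A UNIV" "\<And>p. \<kappa> p \<noteq> 0"
  and K: "\<And>p vs. length vs = fol_rank V \<Longrightarrow> set vs \<subseteq> V p \<Longrightarrow> K \<Omega> p vs = \<kappa> p * \<tau> p vs"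
  and q: "q \<in> U" and h: "smooth_at A q h"
 shows "(\<forall>g. smooth_at A q g \<longrightarrow> divergence A \<Omega> (ham B g) q = ham B g q (\<lambda>q. ln (\<kappa> q)) + ham B g q h) \<longleftrightarrow>
  (\<forall>f\<in>set fs. leaf_div U \<phi> es \<tau> (lift U \<phi> f) q = lift U \<phi> f q h) \<and> local_modular U \<phi> es q = - ham P h q"
  (is "?L \<longleftrightarrow> ?R")
proof -
 let ?x = "\<lambda>f q. \<phi> q \<bullet> f" and ?m = "\<lambda>f q. \<mu> q (coord_field U \<phi> f q)"
 define u where "u = local_modular U \<phi> es q + ham P h q"
 \<comment> \<open>The term \<open>u (?m f)\<close> comes from the Hamiltonian field of
   \<open>?m f\<close> contained in the horizontal lift; it goes away once \<open>u\<close> is known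
   to vanish.\<close>
 define d where "d f = leaf_div U \<phi> es \<tau> (lift U \<phi> f) q - lift U \<phi> f q h + u (?m f)" for f
 have uV: "u \<in> V q"
  unfolding u_def using local_modular_section[OF ac] q by (intro subspace_add[OF sub_V] ham_P_leaf) (simp add: sections_def)
 have sx: "smooth_at A q (?x f)" for f by (rule coordinate_smooth_at[OF ac q])
 have sm: "smooth_at A q (?m f)" for f by (rule smooth_atI[OF acD(2)[OF ac] q \<mu>_smooth])
 have skew: "ham P g q h = - ham P h q g" if "smooth_at A q g" for g by (rule ham_field_skew[OF Pb that h])
 have key: "divergence A \<Omega> (ham B g) q - ham B g q (\<lambda>q. ln (\<kappa> q)) - ham B g q h
   = (\<Sum>f\<in>set fs. d f * ham B g q (?x f)) + u g" if g: "smooth_at A q g" for g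
 proof -
  have "divergence A \<Omega> (ham B g) q = ham B g q (\<lambda>q. ln (\<kappa> q))
   + (\<Sum>f\<in>set fs. ham B g q (?x f) * (leaf_div U \<phi> es \<tau> (lift U \<phi> f) q + local_modular U \<phi> es q (?m f)))
   + local_modular U \<phi> es q g"
   unfolding leaf_div_hlift[OF q, symmetric] local_modular_apply[OF ac q g] by (rule divergence_ham[OF \<Omega> \<kappa> K q g])
  moreover have "ham B g q h
   = (\<Sum>f\<in>set fs. ham B g q (?x f) * (lift U \<phi> f q h - ham P h q (?m f))) - ham P h q g"
   unfolding ham_expand_apply[OF q, of g h] skew[OF g] hlift_def plus_fun_apply skew[OF sm] by simp
  ultimately show ?thesis
   unfolding u_def d_def plus_fun_apply by (simp add: algebra_simps sum.distrib sum_subtractf)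
 qed
 show ?thesis
 proof
  assume L: ?L
  have z: "(\<Sum>f\<in>set fs. d f * ham B g q (?x f)) + u g = 0" if "smooth_at A q g" for g
   using key[OF that] L that by simp
  \<comment> \<open>Transverse coordinates are constant on the leaves, so
    \<open>ham P (?x f)\<close> is zero; subtracting it shows that the sum is horizontal. It also
    equals the vertical vector \<open>u\<close>, hence both vanish, and then so do the
    \<open>d f\<close> by \<open>transverse_ham_independent\<close>.\<close>
  let ?s = "\<Sum>f\<in>set fs. d f *\<^sub>R (ham B (?x f) q - ham P (?x f) q)"
  have Px: "ham P (?x f) q = 0" if f: "f \<in> set fs" for f
  proof
   fix g show "ham P (?x f) q g = 0 g"
   proof (cases "smooth_at A q g")
    case True
    have "ham P (?x f) q g = - ham P g q (?x f)" by (rule ham_field_skew[OF Pb sx True])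
    then show ?thesis using leaf_coordinate[OF ac q ham_P_leaf f] by simp
   next
    case False then show ?thesis by (simp add: ham_field_def sharp_def)
   qed
  qed
  have us: "u = ?s"
  proof
   fix g show "u g = ?s g"
   proof (cases "smooth_at A q g")
    case True
    have "?s g = (\<Sum>f\<in>set fs. - (d f * ham B g q (?x f)))" unfolding sum_fun_apply
    proof (rule sum.cong[OF refl])
     fix f assume f: "f \<in> set fs"
     show "(d f *\<^sub>R (ham B (?x f) q - ham P (?x f) q)) g = - (d f * ham B g q (?x f))"
      unfolding scaleR_fun_apply minus_apply Px[OF f] using ham_field_skew[OF Bb sx True, of f] by simp
    qed
    then show ?thesis using z[OF True] by (simp add: sum_negf)
   next
    case False
    have "u g = 0" using uV V_sub_tangent tangent_nonsmooth[OF _ False] by blast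
    moreover have "?s g = 0" unfolding sum_fun_apply using False by (simp add: ham_field_def sharp_def)
    ultimately show ?thesis by simp
   qed
  qed
  have "?s \<in> H q" by (intro subspace_sum[OF subspace_H] subspace_scale[OF subspace_H] ham_horizontal)
  then have u0: "u = 0" using uV splits_tangent_Int[OF splits, of q] us by blast
  have "d f = 0" if "f \<in> set fs" for f
   by (rule transverse_ham_independent[OF q _ that, of d]) (use z u0 in simp)
  moreover have "local_modular U \<phi> es q = - ham P h q" using u0 unfolding u_def by (rule add_eq_0_iff2[THEN iffD1])
  ultimately show ?R unfolding d_def u0 by simp
 next
  assume R: ?R
  then have u0: "u = 0" unfolding u_def by (simp only: add.left_inverse)
  then have "d f = 0" if "f \<in> set fs" for f using R that unfolding d_def u0 by simp
  then have "divergence A \<Omega> (ham B g) q - ham B g q (\<lambda>q. ln (\<kappa> q)) - ham B g q h = 0" if "smooth_at A q g" for g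
   unfolding key[OF that] u0 by simp
  then show ?L by (simp add: algebra_simps)
 qed
qed

text \<open>Compares both sides of \<open>\<delta>[Z, W] = Z(\<delta> W) - W(\<delta> Z)\<close> for the leafwise divergence \<open>\<delta>\<close>, a lift \<open>Z\<close> and a
 Hamiltonian field \<open>W\<close>.\<close>

lemma lift_potential_casimir:
 assumes q: "q \<in> U" and w0: "smooth_at A q w" and k: "k \<in> Cinf A U" and g: "g \<in> Cinf A U"
  and Zk: "\<And>q. q \<in> U \<Longrightarrow> local_modular U \<phi> es q = ham P k q"
  and \<lambda>: "\<And>q. q \<in> U \<Longrightarrow> leaf_div U \<phi> es \<tau> (lift U \<phi> f) q = lift U \<phi> f q g"
 shows "ham P w q (\<lambda>q. lift U \<phi> f q (\<lambda>q. g q + k q)) = 0"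
proof -
 obtain W where W: "open W" "q \<in> W" "W \<subseteq> U" and w: "w \<in> Cinf A W" using smooth_atE[OF w0 acD(2)[OF ac] q] .
 let ?Z = "lift U \<phi> f" and ?Q = "ham P w" and ?\<delta> = "leaf_div U \<phi> es \<tau>"
 have Zv: "?Z \<in> \<XX> W" by (rule vector_fields_mono[OF lift_vector_field[OF ac] W(3)])
 have Qv: "?Q \<in> \<XX> W" by (rule ham_field_vector_field[OF Pb W(1) w])
 have kW: "k \<in> Cinf A W" and gW: "g \<in> Cinf A W" using Cinf_mono[OF _ W(3)] k g by auto
 have Zf: "(\<lambda>q. ?Z q h) \<in> Cinf A W" if "h \<in> Cinf A W" for h by (rule vector_field_smooth[OF Zv W(1) order.refl that])
 have sm: "smooth_at A q' h" if "h \<in> Cinf A W" "q' \<in> W" for h q' by (rule smooth_atI[OF W(1) that(2,1)])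
 note Zt = vector_field_tangent[OF Zv] and Qt = vector_field_tangent[OF Qv W(2)]
 have \<delta>P: "?\<delta> (ham P h) q' = pbracket P k h q'" if "h \<in> Cinf A W" "q' \<in> W" for h q'
 proof -
  have q': "q' \<in> U" using that(2) W(3) by auto
  show ?thesis
   using local_modular_apply[OF ac q' sm[OF that]] ham_field_apply[OF sm[OF that], of P k] Zk[OF q'] by simp
 qed
 have Qb: "bracket ?Q (coord_field U \<phi> e) q \<in> V q" if "e \<in> set es" for e
 proof (rule constant_coordinate_bracket[OF ac W(1,3,2) Qv sections_mono[OF frame_section[OF ac that] W(3)]])
  show "?Q q' (coord \<phi> f) = 0" if "q' \<in> W" "f \<in> set fs" for q' f
   using leaf_coordinate[OF ac _ ham_P_leaf that(2)] that(1) W(3) by auto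
 qed
 have "?\<delta> (bracket ?Z ?Q) q = ?Z q (?\<delta> ?Q) - ?Q q (?\<delta> ?Z)"
  by (rule leaf_div_bracket[where D = V and q = q and \<omega> = \<tau>, OF ac W(1,3,2) Zv Qv lift_bracket_frame[OF ac q] Qb Cinf_mono[OF ln_vol_smooth[OF ac] W(3)]])
 moreover have "?\<delta> (bracket ?Z ?Q) q = pbracket P k (\<lambda>q. ?Z q w) q"
 proof -
  have "?\<delta> (bracket ?Z ?Q) q = ?\<delta> (ham P (\<lambda>q. ?Z q w)) q"
   by (rule leaf_div_cong[OF ac W(1,3,2)]) (rule lift_ham[OF W(1,3) _ w])
  then show ?thesis using \<delta>P[OF Zf[OF w] W(2)] by simp
 qed
 moreover have "?Z q (?\<delta> ?Q) = pbracket P (\<lambda>q. ?Z q k) w q + pbracket P k (\<lambda>q. ?Z q w) q"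
 proof -
  have "?Z q (?\<delta> ?Q) = ?Z q (pbracket P k w)" by (rule tangent_cong[OF Zt[OF W(2)] W(1,2) \<delta>P[OF w]])
  then show ?thesis using lift_pbracket[OF W(1,3,2) kW w] by simp
 qed
 moreover have "?Q q (?\<delta> ?Z) = ?Q q (\<lambda>q. ?Z q g)" by (rule tangent_cong[OF Qt W(1,2) \<lambda>]) (use W(3) in auto)
 moreover have "?Q q (\<lambda>q. ?Z q k) = - pbracket P (\<lambda>q. ?Z q k) w q"
  using ham_field_apply[OF sm[OF Zf[OF kW] W(2)], of P w] pbracket_skew[OF Pb, of w "\<lambda>q. ?Z q k" q] by simp
 moreover have "?Q q (\<lambda>q. ?Z q (\<lambda>q. g q + k q)) = ?Q q (\<lambda>q. ?Z q g) + ?Q q (\<lambda>q. ?Z q k)"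
 proof -
  have "?Q q (\<lambda>q. ?Z q (\<lambda>q. g q + k q)) = ?Q q (\<lambda>q. ?Z q g + ?Z q k)"
   by (rule tangent_cong[OF Qt W(1,2)]) (rule tangent_add[OF Zt sm[OF gW] sm[OF kW]])
  then show ?thesis using tangent_add[OF Qt sm[OF Zf[OF gW] W(2)] sm[OF Zf[OF kW] W(2)]] by simp
 qed
 ultimately show ?thesis by simp
qed

text \<open>The bracket of \<open>X\<close> with a vertical field is vertical, so its transverse
  coordinates vanish; this forces those of \<open>X\<close> to be constant along the leaves. A bump
  function is involved because projectability over \<open>W\<close> speaks of vertical fields on all
  of \<open>W\<close>, while the frame lives in a chart.\<close>

lemma projectable_coordinate:
 assumes W: "open W" "q \<in> W" "q \<in> U" and X: "X \<in> projectable_fields A W V" and f: "f \<in> set fs" and v: "v \<in> V q"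
 shows "v (\<lambda>q. X q (coord \<phi> f)) = 0"
proof -
 let ?x = "coord \<phi> f"
 define N where "N = W \<inter> U"
 have N: "open N" "q \<in> N" "N \<subseteq> U" "N \<subseteq> W" using W acD(2)[OF ac] by (auto simp: N_def)
 have Xv: "X \<in> \<XX> W" using X by (simp add: projectable_fields_def)
 note Xt = vector_field_tangent[OF Xv W(2)]
 have "coord_field U \<phi> e q (\<lambda>q. X q ?x) = 0" if e: "e \<in> set es" for e
 proof -
  let ?E = "coord_field U \<phi> e"
  have Es: "?E \<in> sections A N V" by (rule sections_mono[OF frame_section[OF ac e] N(3)])
  obtain b where b: "b \<in> Cinf A UNIV" "b q \<noteq> 0" "(\<lambda>q. if q \<in> N then b q *\<^sub>R ?E q else 0) \<in> sections A UNIV V"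
   by (rule extend_section[OF N(1,2) Es]) (auto intro: subspace_0[OF sub_V] subspace_scale[OF sub_V])
  let ?Y = "\<lambda>q. if q \<in> N then b q *\<^sub>R ?E q else 0"
  have "?Y \<in> sections A W V" by (rule sections_mono[OF b(3)]) simp
  then have "bracket X ?Y \<in> sections A W V" using X by (simp add: projectable_fields_def)
  then have "bracket X ?Y q \<in> V q" using W(2) by (simp add: sections_def)
  then have "bracket X ?Y q ?x = 0" by (rule leaf_coordinate[OF ac W(3) _ f])
  then have "X q (\<lambda>q. ?Y q ?x) - ?Y q (\<lambda>q. X q ?x) = 0"
   unfolding lie_bracket_apply[OF coordinate_smooth_at[OF ac W(3)]] .
  moreover have "X q (\<lambda>q. ?Y q ?x) = X q (\<lambda>q. 0)"
  proof (rule tangent_cong[OF Xt N(1,2)])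
   fix q' assume q': "q' \<in> N"
   then have "q' \<in> U" using N(3) by blast
   from leaf_coordinate[OF ac this frame_in_leaf[OF ac this e] f] show "?Y q' ?x = 0" using q' by simp
  qed
  ultimately have "?Y q (\<lambda>q. X q ?x) = 0" using tangent_const[OF Xt, of 0] by simp
  then show ?thesis using b(2) N(2) by simp
 qed
 then show ?thesis using leaf_expand_apply[OF ac W(3) v, of "\<lambda>q. X q ?x"] by simp
qed

end

end

section \<open>Vanishing of the classes as existence of potentials\<close>

text \<open>The element 0 lies in its own class. If the classes agree it lies in that of
  \<open>x\<close> too, which puts \<open>0 - x\<close> and hence \<open>x\<close> into
  \<open>B\<close>.\<close>

lemma quot_class_eq_iff:
 assumes "0 \<in> Z" "0 \<in> B" "\<And>x y. x \<in> B \<Longrightarrow> y \<in> B \<Longrightarrow> x - y \<in> B"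
 shows "quot_class Z B x = quot_class Z B 0 \<longleftrightarrow> x \<in> B"
proof
 assume eq: "quot_class Z B x = quot_class Z B 0"
 have "0 \<in> quot_class Z B 0" unfolding quot_class_def using assms(1,2) by (simp only: mem_Collect_eq diff_self)
 then have "0 - x \<in> B" using eq unfolding quot_class_def by blast
 from assms(3)[OF assms(2) this] show "x \<in> B" by (simp only: diff_diff_eq2 add_0_left diff_0_right)
next
 assume x: "x \<in> B"
 have "y - x \<in> B \<longleftrightarrow> y - 0 \<in> B" for y
 proof
  assume "y - x \<in> B"
  from assms(3)[OF this assms(3)[OF assms(2) x]] show "y - 0 \<in> B"
   by (simp only: diff_diff_eq2 diff_add_cancel diff_0_right)
 next
  assume "y - 0 \<in> B"
  from assms(3)[OF this x] show "y - x \<in> B" by (simp only: diff_0_right)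
 qed
 then show "quot_class Z B x = quot_class Z B 0" unfolding quot_class_def by blast
qed

context manifold
begin

text \<open>By skewness the field of \<open>f\<close> applied to \<open>h\<close> is minus the field
  of \<open>h\<close> applied to \<open>f\<close>, and the latter is a tangent vector, hence linear
  in \<open>f\<close>.\<close>

lemma ham_field_lincomb:
 assumes B: "B \<in> bivector_fields A TM" and f: "smooth_at A p f" and g: "smooth_at A p g"
 shows "ham B (\<lambda>q. a * f q + b * g q) p = a *\<^sub>R ham B f p + b *\<^sub>R ham B g p"
proof
 fix h
 show "ham B (\<lambda>q. a * f q + b * g q) p h = (a *\<^sub>R ham B f p + b *\<^sub>R ham B g p) h"
 proof (cases "smooth_at A p h")
  case True
  note t = ham_field_tangent[OF B, of h p]
  have af: "smooth_at A p (\<lambda>q. a * f q)" "smooth_at A p (\<lambda>q. b * g q)"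
   using smooth_at_mult[OF smooth_at_const f] smooth_at_mult[OF smooth_at_const g] by auto
  show ?thesis
   unfolding plus_fun_apply scaleR_fun_apply ham_field_skew[OF B smooth_at_add[OF af] True] ham_field_skew[OF B f True] ham_field_skew[OF B g True]
    tangent_add[OF t af] tangent_cmult[OF t f] tangent_cmult[OF t g] by simp
 next
  case False
  then show ?thesis by (simp add: ham_field_def sharp_def)
 qed
qed

lemma Cinf_smooth_at: "f \<in> Cinf A UNIV \<Longrightarrow> smooth_at A p f"
 by (rule smooth_atI[OF open_UNIV UNIV_I])

lemma hamiltonian_fields_diff:
 assumes B: "B \<in> bivector_fields A TM" and X: "X \<in> hamiltonian_fields A B" and Y: "Y \<in> hamiltonian_fields A B"
 shows "X - Y \<in> hamiltonian_fields A B"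
proof -
 obtain f g where f: "f \<in> Cinf A UNIV" "X = ham B f" and g: "g \<in> Cinf A UNIV" "Y = ham B g"
  using X Y unfolding hamiltonian_fields_def by blast
 have "X - Y = ham B (\<lambda>q. 1 * f q + (- 1) * g q)"
 proof
  fix p
  show "(X - Y) p = ham B (\<lambda>q. 1 * f q + (- 1) * g q) p"
   unfolding ham_field_lincomb[OF B Cinf_smooth_at[OF f(1)] Cinf_smooth_at[OF g(1)]] f(2) g(2) minus_apply
   by (rule ext) simp
 qed
 moreover have "(\<lambda>q. 1 * f q + (- 1) * g q) \<in> Cinf A UNIV"
  by (intro Cinf_add Cinf_mult Cinf_const f g open_UNIV)
 ultimately show ?thesis unfolding hamiltonian_fields_def by blast
qed

lemma ham_field_zero:
 assumes B: "B \<in> bivector_fields A TM"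
 shows "ham B (\<lambda>q. 0) p = 0"
proof -
 have "ham B (\<lambda>q. 0 * 0 + 0 * 0) p = 0 *\<^sub>R ham B (\<lambda>q. 0) p + 0 *\<^sub>R ham B (\<lambda>q. 0) p"
  by (rule ham_field_lincomb[OF B smooth_at_const smooth_at_const])
 then show ?thesis by simp
qed

lemma zero_hamiltonian: "B \<in> bivector_fields A TM \<Longrightarrow> 0 \<in> hamiltonian_fields A B"
 unfolding hamiltonian_fields_def
proof (rule image_eqI[of _ _ "\<lambda>q. 0"])
 assume B: "B \<in> bivector_fields A TM"
 show "0 = ham B (\<lambda>q. 0)"
 proof
  fix p show "0 p = ham B (\<lambda>q. 0) p" unfolding ham_field_zero[OF B] by (rule zero_fun_apply)
 qed
qed (rule Cinf_const)

lemma zero_vector_field: "0 \<in> \<XX> U"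
proof -
 have "(\<lambda>p. \<Sum>i\<in>{}. undefined i p *\<^sub>R undefined i p) \<in> \<XX> U"
  unfolding vector_fields_def using subspace_0[OF subspace_tangent_space] Cinf_const by simp
 moreover have "(\<lambda>p. \<Sum>i\<in>{}. undefined i p *\<^sub>R undefined i p) = (0 :: 'm vfield)"
  by (rule ext) (simp only: sum.empty zero_fun_apply)
 ultimately show ?thesis by simp
qed

lemma zero_poisson_field:
 assumes B: "B \<in> bivector_fields A TM"
 shows "0 \<in> poisson_fields A B" unfolding poisson_fields_def preserves_bivector_def
proof (intro CollectI conjI allI impI ballI)
 fix W f g p assume W: "open W" "f \<in> Cinf A W" "g \<in> Cinf A W" "p \<in> W"
 have 0: "pbracket B h (\<lambda>q. 0) p = 0" for h
  using tangent_const[OF ham_field_tangent[OF B, of h p], of 0]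
   ham_field_apply[OF smooth_at_const[of p 0], of B h] by simp
 then have "pbracket B (\<lambda>q. 0) g p = 0" using pbracket_skew[OF B, of "\<lambda>q. 0" g p] by simp
 then show "lie_bivector 0 B f g p = 0" using 0 by (simp add: lie_bivector_def)
qed (rule zero_vector_field)

end

context poisson_foliation
begin

lemma zero_closed_oneform: "0 \<in> closed_foliated_oneforms A F"
 unfolding closed_foliated_oneforms_def oneforms_def
proof (intro CollectI conjI allI impI ballI)
 show "linear_functional_on (F p) ((0 :: 'm oneform) p)" for p by (simp add: linear_functional_on_def)
 show "(0 :: 'm oneform) p v = 0" for p v by simp
 show "(\<lambda>p. (0 :: 'm oneform) p (X p)) \<in> Cinf A W" for W X using Cinf_const[of 0] by simp
 fix U X Y p assume "open U" "X \<in> sections A U F" "Y \<in> sections A U F" "p \<in> U"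
 then have "X p \<in> TM p" "Y p \<in> TM p" by (auto simp: sections_def vector_fields_def)
 then have "X p (\<lambda>q. 0) = 0" "Y p (\<lambda>q. 0) = 0" using tangent_const[of _ p 0] by blast+
 then show "ext_deriv A (\<lambda>q vs. (0 :: 'm oneform) q (hd vs)) [X, Y] p = 0"
  by (simp add: ext_deriv_def numeral_2_eq_2)
qed

lemma exact_foliated_oneforms_diff:
 assumes "\<alpha> \<in> exact_foliated_oneforms A F" "\<beta> \<in> exact_foliated_oneforms A F"
 shows "\<alpha> - \<beta> \<in> exact_foliated_oneforms A F"
proof -
 let ?d = "\<lambda>f p v. if v \<in> F p then differential f v else 0"
 obtain f g where f: "f \<in> Cinf A UNIV" "\<alpha> = ?d f" and g: "g \<in> Cinf A UNIV" "\<beta> = ?d g"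
  using assms unfolding exact_foliated_oneforms_def by blast
 have "\<alpha> - \<beta> = ?d (\<lambda>q. f q - g q)"
 proof (intro ext)
  fix p v
  show "(\<alpha> - \<beta>) p v = ?d (\<lambda>q. f q - g q) p v"
  proof (cases "v \<in> F p")
   case True
   then have "v \<in> TM p" using F_sub_tangent by blast
   from tangent_diff[OF this Cinf_smooth_at[OF f(1)] Cinf_smooth_at[OF g(1)]] show ?thesis
    unfolding minus_apply f(2) g(2) differential_def using True by simp
  next
   case False then show ?thesis unfolding minus_apply f(2) g(2) by simp
  qed
 qed
 moreover have "(\<lambda>q. f q - g q) \<in> Cinf A UNIV" by (rule Cinf_diff[OF open_UNIV f(1) g(1)])
 ultimately show ?thesis unfolding exact_foliated_oneforms_def by blast
qed

lemma zero_exact_oneform: "0 \<in> exact_foliated_oneforms A F"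
proof -
 have "(\<lambda>p v. if v \<in> F p then differential (\<lambda>q. 0) v else 0) \<in> exact_foliated_oneforms A F"
  unfolding exact_foliated_oneforms_def using Cinf_const by blast
 from exact_foliated_oneforms_diff[OF this this] show ?thesis by (simp only: diff_self)
qed

text \<open>Exactness of the Reeb form belonging to \<tau>, tested on lifts in all adapted charts;
  in this shape it can be compared with the divergence formula.\<close>

definition leaf_potential :: "('m \<Rightarrow> real) \<Rightarrow> bool" where
 "leaf_potential h \<longleftrightarrow> (\<forall>U \<phi> es fs. adapted_chart V U \<phi> es fs \<longrightarrow>
   (\<forall>q\<in>U. \<forall>f\<in>set fs. leaf_div U \<phi> es \<tau> (lift U \<phi> f) q = lift U \<phi> f q h))"

lemma leaf_potentialD:
 "leaf_potential h \<Longrightarrow> adapted_chart V U \<phi> es fs \<Longrightarrow> q \<in> U \<Longrightarrow> f \<in> set fs \<Longrightarrow> leaf_div U \<phi> es \<tau> (lift U \<phi> f) q = lift U \<phi> f q h"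
 unfolding leaf_potential_def by blast

text \<open>The Reeb class is computed with a transverse form \<sigma> of its own, the divergence
  formula with \<tau>. On the leaves \<sigma> is a nonvanishing multiple \<open>a\<close> of \<tau>,
  so a potential for one form becomes a potential for the other by adding or subtracting ln
  a.\<close>

lemma reeb_exact_iff:
 assumes \<sigma>: "transverse_volume_form A F \<sigma>"
 shows "reeb_form A F \<sigma> \<in> exact_foliated_oneforms A F \<longleftrightarrow> (\<exists>h\<in>Cinf A UNIV. leaf_potential h)"
proof -
 have vol': "leafwise_volume_form A V \<sigma>" by (rule transverse_volume_form_leafwise[OF split_FV fol_F fol_V \<sigma>])
 interpret S: poisson_foliation A V F P \<sigma>
  using fol_V fol_F split_FV leaf_P poisson_P vol' by unfold_locales
 obtain a where a: "a \<in> Cinf A UNIV" and ar: "\<And>p vs. length vs = fol_rank V \<Longrightarrow> set vs \<subseteq> V p \<Longrightarrow> \<sigma> p vs = a p * \<tau> p vs"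
  by (rule form_ratio[OF fol_V vol S.vol_kforms]) blast
 have anz: "a p \<noteq> 0" for p
 proof -
  obtain vs where "length vs = fol_rank V" "set vs \<subseteq> V p" "\<sigma> p vs \<noteq> 0"
   using vol' unfolding leafwise_volume_form_def nowhere_vanishing_def by blast
  then show ?thesis using ar[of vs p] by auto
 qed
 let ?ln = "\<lambda>q. ln (a q)"
 have l: "?ln \<in> Cinf A UNIV" by (rule Cinf_ln[OF open_UNIV a anz])
 have rel: "leaf_div U \<phi> es \<sigma> (lift U \<phi> f) q = leaf_div U \<phi> es \<tau> (lift U \<phi> f) q + lift U \<phi> f q ?ln"
  if "adapted_chart V U \<phi> es fs" "q \<in> U" for U \<phi> es fs f q
  by (rule leaf_div_rescale[where X = "lift U \<phi> f" and \<sigma> = \<sigma> and a = a, OF that vector_field_tangent[OF lift_vector_field[OF that(1)] that(2)] a anz ar])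
 note lt = vector_field_tangent[OF lift_vector_field]
 show ?thesis
 proof
  assume "reeb_form A F \<sigma> \<in> exact_foliated_oneforms A F"
  then obtain g where g: "g \<in> Cinf A UNIV" and eq: "reeb_form A F \<sigma> = (\<lambda>p v. if v \<in> F p then differential g v else 0)"
   unfolding exact_foliated_oneforms_def by blast
  have "leaf_potential (\<lambda>q. g q - ?ln q)" unfolding leaf_potential_def
  proof (intro allI impI ballI)
   fix U \<phi> es fs q f assume ac: "adapted_chart V U \<phi> es fs" and q: "q \<in> U" and f: "f \<in> set fs"
   have "lift U \<phi> f q g = reeb_form A F \<sigma> q (lift U \<phi> f q)"
    unfolding eq using lift_F[OF ac q] by (simp add: differential_def)
   also have "\<dots> = (\<Sum>f'\<in>set fs. lift U \<phi> f q (coord \<phi> f') * leaf_div U \<phi> es \<sigma> (lift U \<phi> f') q)"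
    by (rule S.reeb_form_apply[OF \<sigma> ac q lift_F[OF ac q]])
   also have "\<dots> = (\<Sum>f'\<in>set fs. if f = f' then leaf_div U \<phi> es \<sigma> (lift U \<phi> f') q else 0)"
    by (intro sum.cong refl) (simp add: lift_coordinate[OF ac q] fs_inner[OF ac f])
   also have "\<dots> = leaf_div U \<phi> es \<sigma> (lift U \<phi> f) q" using f by simp
   finally show "leaf_div U \<phi> es \<tau> (lift U \<phi> f) q = lift U \<phi> f q (\<lambda>q. g q - ?ln q)"
    using rel[OF ac q, of f] tangent_diff[OF lt[OF ac q] Cinf_smooth_at[OF g] Cinf_smooth_at[OF l], of f] by simp
  qed
  then show "\<exists>h\<in>Cinf A UNIV. leaf_potential h" using Cinf_diff[OF open_UNIV g l] by blast
 next
  assume "\<exists>h\<in>Cinf A UNIV. leaf_potential h"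
  then obtain h where h: "h \<in> Cinf A UNIV" "leaf_potential h" by blast
  let ?g = "\<lambda>q. h q + ?ln q"
  have "reeb_form A F \<sigma> = (\<lambda>p v. if v \<in> F p then differential ?g v else 0)"
  proof (intro ext)
   fix p v
   obtain U \<phi> es fs where ac: "adapted_chart V U \<phi> es fs" and p: "p \<in> U" using adapted_chart_exists[OF fol_V] .
   show "reeb_form A F \<sigma> p v = (if v \<in> F p then differential ?g v else 0)"
   proof (cases "v \<in> F p")
    case True
    have "leaf_div U \<phi> es \<sigma> (lift U \<phi> f) p = lift U \<phi> f p ?g" if "f \<in> set fs" for f
     using rel[OF ac p, of f] leaf_potentialD[OF h(2) ac p that]
      tangent_add[OF lt[OF ac p] Cinf_smooth_at[OF h(1)] Cinf_smooth_at[OF l], of f] by simp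
    then have "reeb_form A F \<sigma> p v = (\<Sum>f\<in>set fs. v (coord \<phi> f) * lift U \<phi> f p ?g)"
     unfolding S.reeb_form_apply[OF \<sigma> ac p True] by (intro sum.cong) auto
    also have "\<dots> = v ?g" using fun_cong[OF F_expand[OF ac p True], of ?g] unfolding sum_fun_apply by simp
    finally show ?thesis using True by (simp add: differential_def)
   next
    case False
    then show ?thesis using oneformsD(2)[OF S.reeb_form_oneform[OF \<sigma>] False] by simp
   qed
  qed
  then show "reeb_form A F \<sigma> \<in> exact_foliated_oneforms A F"
   unfolding exact_foliated_oneforms_def using Cinf_add[OF open_UNIV h(1) l] by blast
 qed
qed

lemma reeb_class_zero_iff:
 "reeb_class A F = foliated_deRham_class A F 0 \<longleftrightarrow> (\<exists>h\<in>Cinf A UNIV. leaf_potential h)"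
 unfolding reeb_class_def foliated_deRham_class_def
  reeb_exact_iff[OF someI[of "transverse_volume_form A F", OF transverse_volume_form_exists], symmetric]
 by (rule quot_class_eq_iff[OF zero_closed_oneform zero_exact_oneform exact_foliated_oneforms_diff])

lemma foliated_class_zero_iff:
 "foliated_poisson_class A V P X = foliated_poisson_class A V P 0 \<longleftrightarrow> (\<exists>k\<in>Cinf A UNIV. X = ham P k)"
proof -
 have "0 \<in> sections A UNIV V"
  using zero_vector_field[of UNIV] subspace_0[OF sub_V] by (simp add: sections_def)
 then have "0 \<in> sections A UNIV V \<inter> poisson_fields A P" using zero_poisson_field[OF Pb] by blast
 then have "foliated_poisson_class A V P X = foliated_poisson_class A V P 0 \<longleftrightarrow> X \<in> hamiltonian_fields A P"
  unfolding foliated_poisson_class_def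
  by (rule quot_class_eq_iff[OF _ zero_hamiltonian[OF Pb] hamiltonian_fields_diff[OF Pb]])
 then show ?thesis unfolding hamiltonian_fields_def by blast
qed

end

section \<open>Unimodularity in terms of a single potential\<close>

context flat_coupling
begin

lemma modular_hamiltonian_iff:
 assumes \<Omega>: "volume_form A \<Omega>"
 shows "modular_field A B \<Omega> \<in> hamiltonian_fields A B \<longleftrightarrow>
  (\<exists>h\<in>Cinf A UNIV. leaf_potential h \<and> foliated_modular_field A V P \<tau> = - ham P h)"
proof -
 have \<Omega>k: "\<Omega> \<in> kforms A TM DIM('e)" using \<Omega> by (simp add: volume_form_def)
 obtain \<kappa> where \<kappa>: "\<kappa> \<in> Cinf A UNIV" and K: "\<And>p vs. length vs = fol_rank V \<Longrightarrow> set vs \<subseteq> V p \<Longrightarrow> K \<Omega> p vs = \<kappa> p * \<tau> p vs"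
  by (rule form_ratio[OF fol_V vol kforms_restrict[OF K_kforms[OF \<Omega>k] V_sub_tangent]]) blast
 have \<kappa>nz: "\<kappa> p \<noteq> 0" for p
 proof -
  obtain vs where vs: "length vs = DIM('e)" "set vs \<subseteq> TM p" "\<Omega> p vs \<noteq> 0"
   using \<Omega> unfolding volume_form_def nowhere_vanishing_def by blast
  obtain U \<phi> es fs where ac: "adapted_chart V U \<phi> es fs" and p: "p \<in> U" using adapted_chart_exists[OF fol_V] .
  let ?l = "at_point (map (coord_field U \<phi>) es) p"
  have l: "length ?l = fol_rank V" by (simp add: chart_rank[OF ac p])
  show ?thesis
   using K_nonzero[where \<Omega> = \<Omega> and p = p, OF kforms_alternating[OF \<Omega>k] vs l frame_list_span[OF ac p]]
    K[OF l frame_list_mem[OF ac p]] by auto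
 qed
 let ?ln = "\<lambda>q. ln (\<kappa> q)"
 have l: "?ln \<in> Cinf A UNIV" by (rule Cinf_ln[OF open_UNIV \<kappa> \<kappa>nz])
 let ?exact = "\<lambda>h. \<forall>q g. smooth_at A q g \<longrightarrow> divergence A \<Omega> (ham B g) q = ham B g q ?ln + ham B g q h"
 have exact: "?exact h \<longleftrightarrow> leaf_potential h \<and> foliated_modular_field A V P \<tau> = - ham P h" if h: "h \<in> Cinf A UNIV" for h
 proof -
  have iff: "(\<forall>g. smooth_at A q g \<longrightarrow> divergence A \<Omega> (ham B g) q = ham B g q ?ln + ham B g q h) \<longleftrightarrow>
    (\<forall>f\<in>set fs. leaf_div U \<phi> es \<tau> (lift U \<phi> f) q = lift U \<phi> f q h) \<and> local_modular U \<phi> es q = - ham P h q"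
   if "adapted_chart V U \<phi> es fs" "q \<in> U" for U \<phi> es fs q
   by (rule divergence_ham_exact_iff[OF that(1) \<Omega> \<kappa> \<kappa>nz K that(2) Cinf_smooth_at[OF h]])
  show ?thesis
  proof
   assume e: "?exact h"
   have "leaf_potential h" unfolding leaf_potential_def
   proof (intro allI impI ballI)
    fix U \<phi> es fs q f assume "adapted_chart V U \<phi> es fs" "q \<in> U" "f \<in> set fs"
    then show "leaf_div U \<phi> es \<tau> (lift U \<phi> f) q = lift U \<phi> f q h" using iff[of U \<phi> es fs q] e by blast
   qed
   moreover have "foliated_modular_field A V P \<tau> = - ham P h"
   proof
    fix q
    obtain U \<phi> es fs where ac: "adapted_chart V U \<phi> es fs" "q \<in> U" using adapted_chart_exists[OF fol_V] .
    have "local_modular U \<phi> es q = - ham P h q" using iff[OF ac] e by blast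
    then show "foliated_modular_field A V P \<tau> q = (- ham P h) q"
     unfolding foliated_modular_local[OF ac] uminus_apply .
   qed
   ultimately show "leaf_potential h \<and> foliated_modular_field A V P \<tau> = - ham P h" by (rule conjI)
  next
   assume R: "leaf_potential h \<and> foliated_modular_field A V P \<tau> = - ham P h"
   show "?exact h"
   proof
    fix q
    obtain U \<phi> es fs where ac: "adapted_chart V U \<phi> es fs" "q \<in> U" using adapted_chart_exists[OF fol_V] .
    have "local_modular U \<phi> es q = - ham P h q"
     using fun_cong[OF conjunct2[OF R], of q] unfolding foliated_modular_local[OF ac] uminus_apply .
    moreover have "\<forall>f\<in>set fs. leaf_div U \<phi> es \<tau> (lift U \<phi> f) q = lift U \<phi> f q h"
     using leaf_potentialD[OF conjunct1[OF R] ac] by blast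
    ultimately show "\<forall>g. smooth_at A q g \<longrightarrow> divergence A \<Omega> (ham B g) q = ham B g q ?ln + ham B g q h"
     using iff[OF ac] by blast
   qed
  qed
 qed
 \<comment> \<open>Carries a Hamiltonian of the modular field to the common potential. As an
   involution it also leads back, so one chain of equivalences serves both directions.\<close>
 let ?m = "\<lambda>h q. (- 1) * h q + (- 1) * ?ln q"
 have mC: "?m h \<in> Cinf A UNIV" if "h \<in> Cinf A UNIV" for h
  by (intro Cinf_add Cinf_mult Cinf_const that l open_UNIV)
 have mm: "ham B g q (?m h) = - ham B g q h - ham B g q ?ln" if h: "h \<in> Cinf A UNIV" for g q h
 proof -
  note t = ham_field_tangent[OF Bb, of g q]
  note s = smooth_at_mult[OF smooth_at_const Cinf_smooth_at]
  show ?thesis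
   unfolding tangent_add[OF t s[OF h] s[OF l]] tangent_cmult[OF t Cinf_smooth_at[OF h]] tangent_cmult[OF t Cinf_smooth_at[OF l]] by simp
 qed
 have ham: "modular_field A B \<Omega> = ham B h \<longleftrightarrow> ?exact (?m h)" if h: "h \<in> Cinf A UNIV" for h
 proof -
  have "modular_field A B \<Omega> = ham B h \<longleftrightarrow> (\<forall>q g. modular_field A B \<Omega> q g = ham B h q g)"
   unfolding fun_eq_iff ..
  also have "\<dots> \<longleftrightarrow> (\<forall>q g. smooth_at A q g \<longrightarrow> divergence A \<Omega> (ham B g) q = - ham B g q h)"
  proof (intro iff_allI)
   fix q g
   show "(modular_field A B \<Omega> q g = ham B h q g) \<longleftrightarrow> (smooth_at A q g \<longrightarrow> divergence A \<Omega> (ham B g) q = - ham B g q h)"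
   proof (cases "smooth_at A q g")
    case True
    then show ?thesis using ham_field_skew[OF Bb Cinf_smooth_at[OF h] True] by (simp add: modular_field_def)
   next
    case False then show ?thesis by (simp add: modular_field_def ham_field_def sharp_def)
   qed
  qed
  also have "\<dots> \<longleftrightarrow> ?exact (?m h)" unfolding mm[OF h] by simp
  finally show ?thesis .
 qed
 show ?thesis
 proof
  assume "modular_field A B \<Omega> \<in> hamiltonian_fields A B"
  then obtain h where h: "h \<in> Cinf A UNIV" "modular_field A B \<Omega> = ham B h"
   unfolding hamiltonian_fields_def by blast
  then have "?exact (?m h)" using ham[OF h(1)] by blast
  then have "leaf_potential (?m h) \<and> foliated_modular_field A V P \<tau> = - ham P (?m h)" using exact[OF mC[OF h(1)]] by blast
  then show "\<exists>h\<in>Cinf A UNIV. leaf_potential h \<and> foliated_modular_field A V P \<tau> = - ham P h"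
   by (rule bexI[OF _ mC[OF h(1)]])
 next
  assume "\<exists>h\<in>Cinf A UNIV. leaf_potential h \<and> foliated_modular_field A V P \<tau> = - ham P h"
  then obtain h where h: "h \<in> Cinf A UNIV" "?exact h" using exact by blast
  have "?m (?m h) = h" by (rule ext) simp
  then have "?exact (?m (?m h))" using h(2) by simp
  then have "modular_field A B \<Omega> = ham B (?m h)" using ham[OF mC[OF h(1)]] by blast
  then show "modular_field A B \<Omega> \<in> hamiltonian_fields A B"
   unfolding hamiltonian_fields_def using mC[OF h(1)] by blast
 qed
qed

text \<open>The form chosen in \<open>modular_class\<close> is a genuine volume form by
  \<open>volume_form_exists\<close>, so the criterion for an arbitrary volume form applies to
  it.\<close>

lemma unimodular_iff:
 "unimodular A B \<longleftrightarrow> (\<exists>h\<in>Cinf A UNIV. leaf_potential h \<and> foliated_modular_field A V P \<tau> = - ham P h)"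
proof -
 have "volume_form A (SOME \<Omega>. volume_form A \<Omega>)" using volume_form_exists[OF vol] by (rule someI_ex)
 from modular_hamiltonian_iff[OF this, symmetric] show ?thesis
  unfolding unimodular_def modular_class_def poisson_class_def
  by (rule ssubst) (rule quot_class_eq_iff[OF zero_poisson_field[OF Bb] zero_hamiltonian[OF Bb] hamiltonian_fields_diff[OF Bb]])
qed

lemma partial_F_annihilating:
 assumes G: "G \<in> Cinf A UNIV"
 shows "partial_F A V F G \<in> annihilating_oneforms A V" unfolding annihilating_oneforms_def oneforms_def
proof (intro CollectI conjI allI impI ballI)
 fix p
 note s = Cinf_smooth_at[OF G, of p]
 note pr = splits_tangent_proj[OF split_FV _ sub_F sub_V]
 show "linear_functional_on (TM p) (partial_F A V F G p)" unfolding linear_functional_on_def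
 proof (intro ballI allI)
  fix u v and a b :: real assume uv: "u \<in> TM p" "v \<in> TM p"
  have "a *\<^sub>R u + b *\<^sub>R v \<in> TM p"
   using uv by (intro subspace_add[OF subspace_tangent_space] subspace_scale[OF subspace_tangent_space])
  then show "partial_F A V F G p (a *\<^sub>R u + b *\<^sub>R v) = a * partial_F A V F G p u + b * partial_F A V F G p v"
   unfolding partial_F_def differential_def using uv proj_along_linear[OF split_FV sub_F sub_V uv, of a b]
   by (simp add: algebra_simps)
 qed
 show "partial_F A V F G p v = 0" if "v \<notin> TM p" for v using that by (simp add: partial_F_def)
 show "partial_F A V F G p v = 0" if "v \<in> V p" for v
  using that V_sub_tangent proj_along_leaf[OF split_FV sub_F sub_V _ that] by (auto simp: partial_F_def differential_def)
next
 fix W X assume W: "open W" "X \<in> sections A W TM"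
 then have Xv: "X \<in> \<XX> W" by (simp add: sections_total)
 have "(\<lambda>p. proj_along F V p (X p)) \<in> \<XX> W"
  using projection_smooth[OF split_FV fol_F fol_V W(1) Xv] by (simp add: sections_def)
 from vector_fields_diff[OF W(1) Xv this]
 have "(\<lambda>p. (X p - proj_along F V p (X p)) G) \<in> Cinf A W"
  by (rule vector_field_smooth[OF _ W(1) order.refl Cinf_mono[OF G subset_UNIV]])
 then show "(\<lambda>p. partial_F A V F G p (X p)) \<in> Cinf A W"
  by (rule Cinf_transform[OF _ W(1)]) (simp add: partial_F_def differential_def vector_field_tangent[OF Xv])
qed

text \<open>On a projectable \<open>X\<close> the form is a sum of products of transverse
  coordinates of \<open>X\<close> with derivatives of \<open>g + k\<close> along lifts. Hamiltonian
  fields of \<open>P\<close> kill the first factors by \<open>projectable_coordinate\<close>, being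
  tangent to the leaves, and the second by \<open>lift_potential_casimir\<close>.\<close>

lemma partial_F_casimir:
 assumes g: "g \<in> Cinf A UNIV" "leaf_potential g" and k: "k \<in> Cinf A UNIV" "foliated_modular_field A V P \<tau> = ham P k"
 shows "partial_F A V F (\<lambda>q. g q + k q) \<in> casimir_oneforms A V P" unfolding casimir_oneforms_def
proof (intro CollectI conjI allI impI ballI)
 let ?G = "\<lambda>q. g q + k q"
 have G: "?G \<in> Cinf A UNIV" by (rule Cinf_add[OF open_UNIV g(1) k(1)])
 show an: "partial_F A V F ?G \<in> annihilating_oneforms A V" by (rule partial_F_annihilating[OF G])
 fix W X assume W: "open W" and X: "X \<in> projectable_fields A W V"
 have Xv: "X \<in> \<XX> W" using X by (simp add: projectable_fields_def)
 let ?u = "\<lambda>q. partial_F A V F ?G q (X q)"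
 have "partial_F A V F ?G \<in> oneforms A TM" using an by (simp add: annihilating_oneforms_def)
 from oneformsD(3)[OF this W, of X] have u: "?u \<in> Cinf A W" using Xv by (simp add: sections_total)
 have "ham P ?u q = 0" if q: "q \<in> W" for q
 proof
  fix w
  show "ham P ?u q w = 0 w"
  proof (cases "smooth_at A q w")
   case False then show ?thesis by (simp add: ham_field_def sharp_def)
  next
   case True
   obtain U \<phi> es fs where ac: "adapted_chart V U \<phi> es fs" and qU: "q \<in> U" using adapted_chart_exists[OF fol_V] .
   let ?N = "W \<inter> U" and ?x = "\<lambda>f q. \<phi> q \<bullet> f" and ?v = "ham P w q"
   have N: "open ?N" "q \<in> ?N" using W q qU acD(2)[OF ac] by auto
   have vt: "?v \<in> TM q" by (rule ham_P_tangent)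
   have s1: "smooth_at A q (\<lambda>q. X q (?x f))" for f
    by (rule smooth_at_vector_field[OF Xv W q coordinate_smooth_at[OF ac qU]])
   have s2: "smooth_at A q (\<lambda>q. lift U \<phi> f q ?G)" for f
    by (rule smooth_at_vector_field[OF lift_vector_field[OF ac] acD(2)[OF ac] qU Cinf_smooth_at[OF G]])
   have Zk: "local_modular U \<phi> es q = ham P k q" if "q \<in> U" for q
    using foliated_modular_local[OF ac that] k(2) by simp
   have "?v ?u = ?v (\<lambda>q. \<Sum>f\<in>set fs. X q (?x f) * lift U \<phi> f q ?G)"
   proof (rule tangent_cong[OF vt N])
    fix q' assume q': "q' \<in> ?N"
    then have t: "X q' \<in> TM q'" using vector_field_tangent[OF Xv] by blast
    have "q' \<in> U" using q' by blast
    from fun_cong[OF complement_expand[OF ac this t], of ?G]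
    have "(X q' - proj_along F V q' (X q')) ?G = (\<Sum>f\<in>set fs. X q' (?x f) * lift U \<phi> f q' ?G)"
     unfolding sum_fun_apply by simp
    then show "?u q' = (\<Sum>f\<in>set fs. X q' (?x f) * lift U \<phi> f q' ?G)" using t by (simp add: partial_F_def differential_def)
   qed
   also have "\<dots> = (\<Sum>f\<in>set fs. ?v (\<lambda>q. X q (?x f) * lift U \<phi> f q ?G))"
    by (rule tangent_sum[OF vt smooth_at_mult[OF s1 s2]])
   also have "\<dots> = 0"
   proof (rule sum.neutral, intro ballI)
    fix f assume f: "f \<in> set fs"
    have "?v (\<lambda>q. X q (?x f)) = 0" by (rule projectable_coordinate[OF ac W q qU X f ham_P_leaf])
    moreover have "?v (\<lambda>q. lift U \<phi> f q ?G) = 0"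
     by (rule lift_potential_casimir[OF ac qU True Cinf_mono[OF k(1) subset_UNIV] Cinf_mono[OF g(1) subset_UNIV] Zk
       leaf_potentialD[OF g(2) ac _ f]])
    ultimately show "?v (\<lambda>q. X q (?x f) * lift U \<phi> f q ?G) = 0" unfolding tangent_mult[OF vt s1 s2] by simp
   qed
   finally have "ham P w q ?u = 0" .
   then show ?thesis using ham_field_skew[OF Pb smooth_atI[OF W q u] True] by simp
  qed
 qed
 then show "?u \<in> casimirs A W P" using u by (simp add: casimirs_def)
qed

lemma casimir_correction:
 assumes hyp: "partial_F A V F ` casimirs A UNIV P = partial_F A V F ` Cinf A UNIV \<inter> casimir_oneforms A V P"
  and g: "g \<in> Cinf A UNIV" "leaf_potential g" and k: "k \<in> Cinf A UNIV" "foliated_modular_field A V P \<tau> = ham P k"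
 shows "\<exists>h\<in>Cinf A UNIV. leaf_potential h \<and> foliated_modular_field A V P \<tau> = - ham P h"
proof -
 let ?G = "\<lambda>q. g q + k q"
 have G: "?G \<in> Cinf A UNIV" by (rule Cinf_add[OF open_UNIV g(1) k(1)])
 have "partial_F A V F ?G \<in> partial_F A V F ` casimirs A UNIV P"
  unfolding hyp using partial_F_casimir[OF g k] G by blast
 then obtain c where c0: "c \<in> casimirs A UNIV P" and eq: "partial_F A V F ?G = partial_F A V F c" by blast
 have c: "c \<in> Cinf A UNIV" "\<And>q. ham P c q = 0" using c0 by (auto simp: casimirs_def)
 let ?h = "\<lambda>q. 1 * c q + (- 1) * k q"
 have h: "?h \<in> Cinf A UNIV" by (intro Cinf_add Cinf_mult Cinf_const c(1) k(1) open_UNIV)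
 have "leaf_potential ?h" unfolding leaf_potential_def
 proof (intro allI impI ballI)
  fix U \<phi> es fs q f assume ac: "adapted_chart V U \<phi> es fs" and q: "q \<in> U" and f: "f \<in> set fs"
  note t = vector_field_tangent[OF lift_vector_field[OF ac] q, of f]
  note s = smooth_at_mult[OF smooth_at_const Cinf_smooth_at]
  \<comment> \<open>On a coordinate field \<open>partial_F\<close> is the derivative along its lift,
    so equal forms mean equal derivatives along all lifts.\<close>
  have "lift U \<phi> f q ?G = lift U \<phi> f q c"
   using fun_cong[OF fun_cong[OF eq, of q], of "coord_field U \<phi> f q"] frame_tangent[OF ac q]
   by (simp add: partial_F_def differential_def lift_def)
  moreover have "lift U \<phi> f q ?G = lift U \<phi> f q g + lift U \<phi> f q k"
   by (rule tangent_add[OF t Cinf_smooth_at[OF g(1)] Cinf_smooth_at[OF k(1)]])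
  moreover have "lift U \<phi> f q ?h = lift U \<phi> f q c - lift U \<phi> f q k"
   unfolding tangent_add[OF t s[OF c(1)] s[OF k(1)]] tangent_cmult[OF t Cinf_smooth_at[OF c(1)]] tangent_cmult[OF t Cinf_smooth_at[OF k(1)]]
   by simp
  ultimately show "leaf_div U \<phi> es \<tau> (lift U \<phi> f) q = lift U \<phi> f q ?h"
   using leaf_potentialD[OF g(2) ac q f] by simp
 qed
 moreover have "foliated_modular_field A V P \<tau> = - ham P ?h"
 proof
  fix q
  have "ham P ?h q = 1 *\<^sub>R ham P c q + (- 1) *\<^sub>R ham P k q"
   by (rule ham_field_lincomb[OF Pb Cinf_smooth_at[OF c(1)] Cinf_smooth_at[OF k(1)]])
  then show "foliated_modular_field A V P \<tau> q = (- ham P ?h) q"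
   unfolding k(2) uminus_apply c(2) by (simp add: fun_eq_iff)
 qed
 ultimately show ?thesis using h by blast
qed

lemma ham_P_minus: "h \<in> Cinf A UNIV \<Longrightarrow> - ham P h = ham P (\<lambda>q. - h q)"
proof
 fix q assume h: "h \<in> Cinf A UNIV"
 have "ham P (\<lambda>q. (- 1) * h q + 0 * h q) q = (- 1) *\<^sub>R ham P h q + 0 *\<^sub>R ham P h q"
  by (rule ham_field_lincomb[OF Pb Cinf_smooth_at[OF h] Cinf_smooth_at[OF h]])
 then show "(- ham P h) q = ham P (\<lambda>q. - h q) q" by (simp add: fun_eq_iff)
qed

lemma unimodular_imp_foliated:
 assumes "unimodular A B"
 shows "(\<exists>h\<in>Cinf A UNIV. leaf_potential h) \<and> (\<exists>k\<in>Cinf A UNIV. foliated_modular_field A V P \<tau> = ham P k)"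
proof -
 obtain h where h: "h \<in> Cinf A UNIV" "leaf_potential h" "foliated_modular_field A V P \<tau> = - ham P h"
  using assms unimodular_iff by blast
 have "foliated_modular_field A V P \<tau> = ham P (\<lambda>q. - h q)" using h(3) ham_P_minus[OF h(1)] by (rule trans)
 then show ?thesis using h(1,2) Cinf_minus[OF open_UNIV h(1)] by blast
qed

end

theorem theorem7p2:
  fixes A :: "('m::{t2_space, second_countable_topology}, 'e::euclidean_space) chart set"
    and V F :: "'m distribution"
    and P B :: "'m bivector"
  assumes "smooth_atlas A"
    and "flat_poisson_foliation A V P F"
    and "orientable_foliation A V"
    and "poisson_bivector A B"
    and "coupling A V B"
    and "strongly_compatible A V P F B"
  shows "(unimodular A B \<longrightarrow>
            reeb_class A F = foliated_deRham_class A F 0 \<and>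
            foliated_modular_class A V P = foliated_poisson_class A V P 0) \<and>
         (partial_F A V F ` casimirs A UNIV P =
            partial_F A V F ` Cinf A UNIV \<inter> casimir_oneforms A V P \<longrightarrow>
          (unimodular A B \<longleftrightarrow>
            reeb_class A F = foliated_deRham_class A F 0 \<and>
            foliated_modular_class A V P = foliated_poisson_class A V P 0))"
proof -
  \<comment> \<open>The very choice made in \<open>foliated_modular_class\<close>, so that this
    class is by definition that of the modular field of \<tau>. The separate choice inside
    \<open>reeb_class\<close> is absorbed by \<open>reeb_exact_iff\<close>.\<close>
  define \<tau> where "\<tau> = (SOME \<tau>. leafwise_volume_form A V \<tau>)"
  have \<tau>: "leafwise_volume_form A V \<tau>"
    unfolding \<tau>_def using assms(3) unfolding orientable_foliation_def by (rule someI_ex)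
  have fl: "regular_foliation A V" "P \<in> bivector_fields A V" "poisson_bivector A P" "regular_foliation A F" "splits_tangent A F V"
    "\<And>U Z. open U \<Longrightarrow> Z \<in> sections A U F \<Longrightarrow> Z \<in> projectable_fields A U V \<Longrightarrow> preserves_bivector A U Z P"
    using assms(2) unfolding flat_poisson_foliation_def by blast+
  have vert: "vertical_part A V B P" using assms(6) by (simp add: strongly_compatible_def)
  obtain \<mu> where \<mu>: "\<mu> \<in> annihilating_oneforms A V" "\<And>U X p. open U \<Longrightarrow> X \<in> projectable_fields A U V \<Longrightarrow> p \<in> U \<Longrightarrow>
      proj_along F V p (X p) - proj_along (horizontal A V B) V p (X p) = sharp A P p (differential (\<lambda>q. \<mu> q (X q)))"
    using assms(6) unfolding strongly_compatible_def by blast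
  interpret flat_coupling A V P B F \<tau> \<mu>
    using assms(1,4,5) fl vert \<mu> \<tau> by unfold_locales
  have m: "foliated_modular_class A V P = foliated_poisson_class A V P 0 \<longleftrightarrow>
      (\<exists>k\<in>Cinf A UNIV. foliated_modular_field A V P \<tau> = ham_field A P k)"
    unfolding foliated_modular_class_def \<tau>_def[symmetric] by (rule foliated_class_zero_iff)
  show ?thesis
    unfolding m reeb_class_zero_iff
  proof (intro conjI impI)
    assume hyp: "partial_F A V F ` casimirs A UNIV P = partial_F A V F ` Cinf A UNIV \<inter> casimir_oneforms A V P"
    show "unimodular A B \<longleftrightarrow> (\<exists>h\<in>Cinf A UNIV. leaf_potential h) \<and> (\<exists>k\<in>Cinf A UNIV. foliated_modular_field A V P \<tau> = ham_field A P k)"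
      using unimodular_imp_foliated casimir_correction[OF hyp] unimodular_iff by blast
  qed (use unimodular_imp_foliated in blast)+
qed

end
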